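(* Let $\mathcal{G}$ be an $SU(3)$ $\mathcal{ADE}$ graph which is not $\mathcal{E}_4^{(12)}$, with Coxeter number $h$ and permutation $\nu$, let $W$ be a $\nu$-invariant cell system on $\mathcal{G}$, and let $A=A(\mathcal{G},W)$. Let $\mu_0,\mu_1,\mu_2,\mu_3$ be the $A$-$A$ bimodule maps defined in the context. The fourth syzygy $\Omega^4(A)=\mathrm{Ker}(\mu_3)$ of $A$ is isomorphic to ${}_1A_{\beta^{-1}}$ as an $A$-$A$ bimodule, where $\beta$ is the Nakayama automorphism of $A$ (the automorphism defined on $\mathcal{G}$ by $\beta=\nu$). Thus $$0\rightarrow{}_1A_{\beta^{-1}}[h]\stackrel{\mu_4}{\longrightarrow}A\otimes_RA[3]\stackrel{\mu_3}{\longrightarrow}A\otimes_R\widetilde{V}\otimes_RA[1]\stackrel{\mu_2}{\longrightarrow}A\otimes_RV\otimes_RA\stackrel{\mu_1}{\longrightarrow}A\otimes_RA\stackrel{\mu_0}{\longrightarrow}A\rightarrow0$$ is a finite resolution of $A$ as an $A$-$A$ bimodule, where $\mu_4(x)=x\sum_jx_j\otimes x_j^{\ast}$, the $x_j$ are a homogeneous basis for $A$, and $\{x_j^{\ast}\}$ is its dual basis under the non-degenerate form on $A$.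
   Context: Graphs. All graphs are finite directed graphs; $\mathcal{G}_0$, $\mathcal{G}_1$ are the sets of vertices and edges, and $s(a)$, $r(a)$ are the source and range of an edge $a$. Edges listed below are single unless marked double. The $SU(3)$ $\mathcal{ADE}$ graphs other than $\mathcal{E}_4^{(12)}$, with Coxeter number $h$, are: (1) $\mathcal{A}^{(n)}$, $n\ge 4$, $h=n$: vertices $(p,l)$ with integers $p,l\ge0$, $p+l\le n-3$; edges $(p,l)\to(p+1,l)$, $(p,l)\to(p-1,l+1)$, $(p,l)\to(p,l-1)$ whenever the target is a vertex. (2) $\mathcal{D}^{(n)}$, $n\ge5$, $h=n$: the $\mathbb{Z}_3$ orbifold of $\mathcal{A}^{(n)}$ under $\mathbf{r}(p,l)=(n-3-p-l,p)$. The vertices are the $\mathbf{r}$-orbits of size 3, together with, if $n=3k'+3$, three vertices $(k',k')_1,(k',k')_2,(k',k')_3$ replacing the fixed point $(k',k')$. The number of edges from an orbit $[x]$ to an orbit $[y]$ (both of size 3) is the number of edges of $\mathcal{A}^{(n)}$ from $x$ to elements of $[y]$; there is one edge from $[x]$ to each $(k',k')_m$ if some element of $[x]$ has an edge to $(k',k')$, and one edge from each $(k',k')_m$ to $[x]$ if $(k',k')$ has an edge to some element of $[x]$. (3) $\mathcal{A}^{(n)\ast}$, $n\ge5$, $h=n$: vertices $1,\dots,p$ with $p=\lfloor (n-1)/2\rfloor$; edges $a\to a+1$ and $a+1\to a$ for $1\le a\le p-1$; one loop at each vertex if $n$ is even, and one loop at each vertex except $p$ if $n$ is odd. (4) $\mathcal{D}^{(n)\ast}$,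 $n\ge5$, $h=n$: vertices $m_c$ with $m$ a vertex of $\mathcal{A}^{(n)\ast}$ and $c\in\mathbb{Z}/3$; an edge $m_c\to m'_{c+1}$ for each edge $m\to m'$ of $\mathcal{A}^{(n)\ast}$ and each $c$. (5) $\mathcal{E}^{(8)\ast}$, $h=8$: vertices $1,2,3,4$; edges $1\to2$; $2\to2,3,4$; $3\to1,2,3$; $4\to3$. (6) $\mathcal{E}^{(8)}$, $h=8$: vertices $x_c$, $x\in\{1,2,3,4\}$, $c\in\mathbb{Z}/3$; an edge $x_c\to y_{c+1}$ for each edge $x\to y$ of $\mathcal{E}^{(8)\ast}$. (7) $\mathcal{E}_1^{(12)}$, $h=12$: vertices $i_s,j_s,k_s$ ($s=1,2,3$), $p,q,r$; edges $i_s\to j_s$, $j_s\to k_s$, $k_s\to i_s$, $j_s\to r$, $p\to j_s$, $q\to k_s$, $k_s\to p$, $q\to r$, a double edge $r\to p$ and a double edge $p\to q$. (8) $\mathcal{E}_2^{(12)}$, $h=12$: vertices $i,j,k$, $p_s,q_s,r_s$ ($s=1,2,3$); edges $i\to j$, $j\to k$, $k\to i$; $j\to r_s$, $p_s\to j$, $q_s\to k$, $k\to p_s$ for all $s$; $r_1\to p_1,p_3$; $r_2\to p_1,p_2$; $r_3\to p_2,p_3$; $p_1\to q_1,q_3$; $p_2\to q_1,q_2$; $p_3\to q_2,q_3$; $q_1\to r_2$; $q_2\to r_3$; $q_3\to r_1$. (9) $\mathcal{E}_5^{(12)}$, $h=12$: vertices $1,\dots,17$; edges $1\to6,7,8$;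 $2\to6,7,9$; $3\to7,8,11$; $4\to7,10$; $5\to8,9$; $6\to12,13$; $7\to12,13,14,15$; $8\to13,14,17$; $9\to13,16$; $10\to15$; $11\to14$; $12\to1,2$; $13\to1,2,3,5$; $14\to1,3,4$; $15\to2,4$; $16\to5$; $17\to3$. (10) $\mathcal{E}^{(24)}$, $h=24$: vertices $1,\dots,24$; edges $1\to9$; $2\to9,10,11$; $3\to10,12,14$; $4\to11,12,14$; $5\to11,13,14$; $6\to11,13,15$; $7\to14,15,16$; $8\to16$; $9\to17,18$; $10\to17,19$; $11\to18,19,20,22$; $12\to19,21$; $13\to20,22$; $14\to19,21,22,23$; $15\to22,24$; $16\to23,24$; $17\to1,2$; $18\to2,6$; $19\to2,3,4,5$; $20\to5,6$; $21\to3,4$; $22\to4,5,6,7$; $23\to3,7$; $24\to7,8$. The permutation $\nu$. $\nu$ is the graph automorphism of $\mathcal{G}$ which is the identity for $\mathcal{D}^{(n)}$, $\mathcal{A}^{(n)\ast}$, $\mathcal{E}^{(8)\ast}$, $\mathcal{E}_1^{(12)}$, $\mathcal{E}_2^{(12)}$, $\mathcal{E}_5^{(12)}$, $\mathcal{E}^{(24)}$; is given on vertices by $\nu(p,l)=(n-3-p-l,p)$ for $\mathcal{A}^{(n)}$, $\nu(m_c)=m_{c+n}$ for $\mathcal{D}^{(n)\ast}$, $\nu(x_c)=x_{c+2}$ for $\mathcal{E}^{(8)}$; and, in these last three cases (no multiple edges), on edges by $s(\nu(a))=\nu(s(a))$, $r(\nu(a))=\nu(r(a))$. Cell systems. Let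 $[2]=2\cos(\pi/h)$, $[3]=1+2\cos(2\pi/h)$, and let $(\phi_i)_{i\in\mathcal{G}_0}$ be a Perron-Frobenius eigenvector of $\mathcal{G}$ (eigenvalue $[3]$, all $\phi_i>0$). A cell system $W$ on $\mathcal{G}$ assigns a complex number $W_{i,j,k}^{(a,b,c)}$ to each closed path (triangle) $i\stackrel{a}{\to}j\stackrel{b}{\to}k\stackrel{c}{\to}i$ of length 3, invariant under cyclic permutation of $(a,b,c)$, such that: (I) for all edges $a,a'$ from $i$ to $j$, $\sum_{k,b,c}W_{i,j,k}^{(a,b,c)}\overline{W_{i,j,k}^{(a',b,c)}}=\delta_{a,a'}[2]\phi_i\phi_j$; (II) for all vertices $i_1,i_2,i_3,i_4$ and edges $a_1:i_1\to i_2$, $a_2:i_3\to i_2$, $a_3:i_3\to i_4$, $a_4:i_1\to i_4$, $$\sum_{k,b_1,b_2,b_3,b_4}\phi_k^{-1}W_{i_1,i_2,k}^{(a_1,b_2,b_1)}\overline{W_{i_3,i_2,k}^{(a_2,b_2,b_3)}}W_{i_3,i_4,k}^{(a_3,b_4,b_3)}\overline{W_{i_1,i_4,k}^{(a_4,b_4,b_1)}}=\delta_{a_1,a_4}\delta_{a_2,a_3}\phi_{i_1}\phi_{i_2}\phi_{i_3}+\delta_{a_1,a_2}\delta_{a_3,a_4}\phi_{i_1}\phi_{i_2}\phi_{i_4},$$ the sum being over all vertices $k$ and edges $b_2:i_2\to k$, $b_4:i_4\to k$, $b_1:k\to i_1$, $b_3:k\to i_3$. $W$ is $\nu$-invariant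 if $W_{i,j,k}^{(a,b,c)}=W_{\nu(i),\nu(j),\nu(k)}^{(\nu(a),\nu(b),\nu(c))}$ for all triangles. Write $W_{abb'}=W_{s(a),s(b),s(b')}^{(a,b,b')}$ if $abb'$ is a closed path of length 3, and $W_{abb'}=0$ otherwise. The algebra. $\mathbb{C}\mathcal{G}$ is the path algebra graded by path length, with multiplication by concatenation ($xy=0$ unless $r(x)=s(y)$; vertices are the paths of length 0). For $a\in\mathcal{G}_1$ put $\rho_a=\sum_{b,b'\in\mathcal{G}_1}W_{abb'}\,bb'$. Then $A=A(\mathcal{G},W)=\mathbb{C}\mathcal{G}/\langle\rho_a:a\in\mathcal{G}_1\rangle=\bigoplus_pA_p$. Since $W$ is $\nu$-invariant, $\nu$ induces an automorphism $\beta$ of $A$. ${}_1A_{\beta^{-1}}$ is the vector space $A$ with standard left action and right action twisted by $\beta^{-1}$: $x\cdot a\cdot y=xa\beta^{-1}(y)$. The form. $A$ is a Frobenius algebra with a non-degenerate form $(x,y)=f(xy)$, where $f:A\to\mathbb{C}$ is a linear function which is $0$ on every element of degree $<h-3$, non-zero on each one-dimensional space $i\cdot A_{h-3}\cdot\nu(i)$ ($i\in\mathcal{G}_0$), and satisfies $(x,y)=(y,\beta(x))$ for all $x,y\in A$. The homogeneous basis $\{x_j\}$ consists of elements of the spaces $i\cdot A_p\cdot l$ ($i,l\in\mathcal{G}_0$), and the dual basis satisfies $(x_j,x_{j'}^{\ast})=\delta_{j,j'}$. The complex. $R=(\mathbb{C}\mathcal{G})_0$ is the span of the vertices, $V=(\mathbb{C}\mathcal{G})_1$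 is the span of the edges, and $\widetilde{V}=\bigoplus_{a\in\mathcal{G}_1}\mathbb{C}\widetilde{a}$, where $\widetilde{a}$ is the reverse of $a$, with source $r(a)$ and range $s(a)$; these are $R$-$R$ bimodules. $B[m]$ denotes the graded space $B$ with grading shifted by $m$. The maps are, for $x,y\in A$, $a\in\mathcal{G}_1$, $$\mu_0(x\otimes y)=xy,\qquad \mu_1(x\otimes a\otimes y)=xa\otimes y-x\otimes ay,$$ $$\mu_2(x\otimes\widetilde{a}\otimes y)=\sum_{b,b'\in\mathcal{G}_1}W_{abb'}(xb\otimes b'\otimes y+x\otimes b\otimes b'y),$$ $$\mu_3(x\otimes y)=\sum_{a\in\mathcal{G}_1}xa\otimes\widetilde{a}\otimes y-\sum_{a\in\mathcal{G}_1}x\otimes\widetilde{a}\otimes ay.$$ *)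

theory Defs
  imports
    Complex_Main
    "HOL-Library.Poly_Mapping"
    "HOL-Algebra.Module"
    "HOL-Algebra.QuotRing"
    "HOL-Algebra.Generated_Groups"
    "Graph_Theory.Arc_Walk"
begin

section \<open>The \<open>SU(3)\<close> \<open>ADE\<close> graphs\<close>

text \<open>All graphs share one vertex type: \<open>Wt p l\<close> is the vertex \<open>(p,l)\<close> of \<open>A\<^sup>(\<^sup>n\<^sup>)\<close>,
  \<open>Orb X\<close> an orbit \<open>X\<close> of size 3 of such pairs, \<open>Fxd m\<close> the vertex \<open>(k',k')\<^sub>m\<close>, \<open>Num i\<close> a numbered
  vertex, \<open>Col x c\<close> a numbered vertex with a colour in \<open>{0,1,2}\<close> (standing for \<open>\<int>/3\<close>), and
  \<open>Ltr x\<close>, \<open>Sub x s\<close> a letter without or with index.\<close>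

datatype letter = Li | Lj | Lk | Lp | Lq | Lr

datatype vertex =
    Wt nat nat
  | Orb "(nat \<times> nat) set"
  | Fxd nat
  | Num nat
  | Col nat nat
  | Ltr letter
  | Sub letter nat

text \<open>An arc \<open>(u, v, k)\<close> is the \<open>k\<close>-th of the parallel arcs from \<open>u\<close> to \<open>v\<close>.\<close>

type_synonym arc = "vertex \<times> vertex \<times> nat"

definition digraph_of_mult :: "vertex set \<Rightarrow> (vertex \<Rightarrow> vertex \<Rightarrow> nat) \<Rightarrow> (vertex, arc) pre_digraph" where
  "digraph_of_mult V m =
     \<lparr>verts = V, arcs = {(u, v, k). u \<in> V \<and> v \<in> V \<and> k < m u v}, tail = fst, head = fst \<circ> snd\<rparr>"

definition mult_of_list :: "('a \<times> 'a list) list \<Rightarrow> 'a \<Rightarrow> 'a \<Rightarrow> nat" where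
  "mult_of_list L u v = count_list (concat (map (\<lambda>(x, ys). map (Pair x) ys) L)) (u, v)"

subsection \<open>The graphs \<open>A\<^sup>(\<^sup>n\<^sup>)\<close> and \<open>D\<^sup>(\<^sup>n\<^sup>)\<close>\<close>

definition wts :: "nat \<Rightarrow> (nat \<times> nat) set" where
  "wts n = {(p, l). p + l \<le> n - 3}"

definition wt_arc :: "nat \<times> nat \<Rightarrow> nat \<times> nat \<Rightarrow> bool" where
  "wt_arc x y \<longleftrightarrow>
     (let (p, l) = x; (p', l') = y
      in (p' = p + 1 \<and> l' = l) \<or> (p = p' + 1 \<and> l' = l + 1) \<or> (p' = p \<and> l = l' + 1))"

definition rot :: "nat \<Rightarrow> nat \<times> nat \<Rightarrow> nat \<times> nat" where
  "rot n x = (let (p, l) = x in (n - 3 - p - l, p))"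

definition A_graph :: "nat \<Rightarrow> (vertex, arc) pre_digraph" where
  "A_graph n = digraph_of_mult {Wt p l | p l. (p, l) \<in> wts n}
     (\<lambda>u v. case (u, v) of (Wt p l, Wt p' l') \<Rightarrow> of_bool (wt_arc (p, l) (p', l')) | _ \<Rightarrow> 0)"

definition rot_orbit :: "nat \<Rightarrow> nat \<times> nat \<Rightarrow> (nat \<times> nat) set" where
  "rot_orbit n x = {x, rot n x, rot n (rot n x)}"

text \<open>Since \<open>rot n\<close> is an automorphism of \<open>A\<^sup>(\<^sup>n\<^sup>)\<close>, the number of arcs from \<open>Orb X\<close> to \<open>Orb Y\<close>
  does not depend on the representative of \<open>X\<close> that is chosen. For \<open>n = 3k' + 3\<close> the fixed
  point is \<open>(k',k')\<close> with \<open>k' = n div 3 - 1\<close>.\<close>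

definition D_mult :: "nat \<Rightarrow> vertex \<Rightarrow> vertex \<Rightarrow> nat" where
  "D_mult n u v =
     (let c = (n div 3 - 1, n div 3 - 1) in
      case (u, v) of
        (Orb X, Orb Y) \<Rightarrow> card {y \<in> Y. wt_arc (SOME x. x \<in> X) y}
      | (Orb X, Fxd m) \<Rightarrow> of_bool (\<exists>x\<in>X. wt_arc x c)
      | (Fxd m, Orb X) \<Rightarrow> of_bool (\<exists>x\<in>X. wt_arc c x)
      | _ \<Rightarrow> 0)"

definition D_graph :: "nat \<Rightarrow> (vertex, arc) pre_digraph" where
  "D_graph n = digraph_of_mult
     ({Orb (rot_orbit n x) | x. x \<in> wts n \<and> card (rot_orbit n x) = 3}
       \<union> (if 3 dvd n then {Fxd 1, Fxd 2, Fxd 3} else {}))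
     (D_mult n)"

subsection \<open>The graphs \<open>A\<^sup>(\<^sup>n\<^sup>)\<^sup>*\<close> and \<open>D\<^sup>(\<^sup>n\<^sup>)\<^sup>*\<close>\<close>

definition Astar_mult :: "nat \<Rightarrow> nat \<Rightarrow> nat \<Rightarrow> nat" where
  "Astar_mult n a b =
     of_bool (b = a + 1 \<or> a = b + 1 \<or> (a = b \<and> (even n \<or> a \<noteq> (n - 1) div 2)))"

definition Astar_graph :: "nat \<Rightarrow> (vertex, arc) pre_digraph" where
  "Astar_graph n = digraph_of_mult (Num ` {1..(n - 1) div 2})
     (\<lambda>u v. case (u, v) of (Num a, Num b) \<Rightarrow> Astar_mult n a b | _ \<Rightarrow> 0)"

text \<open>The threefold cover with an arc from \<open>x\<^sub>c\<close> to \<open>y\<^sub>c\<^sub>+\<^sub>1\<close> for each arc from \<open>x\<close> to \<open>y\<close>.\<close>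

definition colour_graph :: "nat set \<Rightarrow> (nat \<Rightarrow> nat \<Rightarrow> nat) \<Rightarrow> (vertex, arc) pre_digraph" where
  "colour_graph V m = digraph_of_mult {Col x c | x c. x \<in> V \<and> c < 3}
     (\<lambda>u v. case (u, v) of
        (Col x c, Col y d) \<Rightarrow> (if d = (c + 1) mod 3 then m x y else 0) | _ \<Rightarrow> 0)"

definition Dstar_graph :: "nat \<Rightarrow> (vertex, arc) pre_digraph" where
  "Dstar_graph n = colour_graph {1..(n - 1) div 2} (Astar_mult n)"

subsection \<open>The exceptional graphs\<close>

definition num_graph :: "nat \<Rightarrow> (nat \<times> nat list) list \<Rightarrow> (vertex, arc) pre_digraph" where
  "num_graph N L = digraph_of_mult (Num ` {1..N})
     (\<lambda>u v. case (u, v) of (Num a, Num b) \<Rightarrow> mult_of_list L a b | _ \<Rightarrow> 0)"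

definition E8star_adj :: "(nat \<times> nat list) list" where
  "E8star_adj = [(1, [2]), (2, [2, 3, 4]), (3, [1, 2, 3]), (4, [3])]"

definition E8star_graph :: "(vertex, arc) pre_digraph" where
  "E8star_graph = num_graph 4 E8star_adj"

definition E8_graph :: "(vertex, arc) pre_digraph" where
  "E8_graph = colour_graph {1..4} (mult_of_list E8star_adj)"

definition E12_1_graph :: "(vertex, arc) pre_digraph" where
  "E12_1_graph = digraph_of_mult
     ({Sub x s | x s. x \<in> {Li, Lj, Lk} \<and> s \<in> {1..3}} \<union> {Ltr Lp, Ltr Lq, Ltr Lr})
     (mult_of_list
       (concat (map (\<lambda>s.
          [(Sub Li s, [Sub Lj s]), (Sub Lj s, [Sub Lk s]), (Sub Lk s, [Sub Li s]),
           (Sub Lj s, [Ltr Lr]), (Ltr Lp, [Sub Lj s]),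
           (Ltr Lq, [Sub Lk s]), (Sub Lk s, [Ltr Lp])]) [1, 2, 3])
        @ [(Ltr Lq, [Ltr Lr]), (Ltr Lr, [Ltr Lp, Ltr Lp]), (Ltr Lp, [Ltr Lq, Ltr Lq])]))"

definition E12_2_graph :: "(vertex, arc) pre_digraph" where
  "E12_2_graph = digraph_of_mult
     ({Ltr Li, Ltr Lj, Ltr Lk} \<union> {Sub x s | x s. x \<in> {Lp, Lq, Lr} \<and> s \<in> {1..3}})
     (mult_of_list
       ([(Ltr Li, [Ltr Lj]), (Ltr Lj, [Ltr Lk]), (Ltr Lk, [Ltr Li])]
        @ concat (map (\<lambda>s.
          [(Ltr Lj, [Sub Lr s]), (Sub Lp s, [Ltr Lj]),
           (Sub Lq s, [Ltr Lk]), (Ltr Lk, [Sub Lp s])]) [1, 2, 3])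
        @ [(Sub Lr 1, [Sub Lp 1, Sub Lp 3]), (Sub Lr 2, [Sub Lp 1, Sub Lp 2]),
           (Sub Lr 3, [Sub Lp 2, Sub Lp 3]),
           (Sub Lp 1, [Sub Lq 1, Sub Lq 3]), (Sub Lp 2, [Sub Lq 1, Sub Lq 2]),
           (Sub Lp 3, [Sub Lq 2, Sub Lq 3]),
           (Sub Lq 1, [Sub Lr 2]), (Sub Lq 2, [Sub Lr 3]), (Sub Lq 3, [Sub Lr 1])]))"

definition E12_5_graph :: "(vertex, arc) pre_digraph" where
  "E12_5_graph = num_graph 17
     [(1, [6, 7, 8]), (2, [6, 7, 9]), (3, [7, 8, 11]), (4, [7, 10]), (5, [8, 9]),
      (6, [12, 13]), (7, [12, 13, 14, 15]), (8, [13, 14, 17]), (9, [13, 16]), (10, [15]),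
      (11, [14]), (12, [1, 2]), (13, [1, 2, 3, 5]), (14, [1, 3, 4]), (15, [2, 4]),
      (16, [5]), (17, [3])]"

definition E24_graph :: "(vertex, arc) pre_digraph" where
  "E24_graph = num_graph 24
     [(1, [9]), (2, [9, 10, 11]), (3, [10, 12, 14]), (4, [11, 12, 14]), (5, [11, 13, 14]),
      (6, [11, 13, 15]), (7, [14, 15, 16]), (8, [16]), (9, [17, 18]), (10, [17, 19]),
      (11, [18, 19, 20, 22]), (12, [19, 21]), (13, [20, 22]), (14, [19, 21, 22, 23]),
      (15, [22, 24]), (16, [23, 24]), (17, [1, 2]), (18, [2, 6]), (19, [2, 3, 4, 5]),
      (20, [5, 6]), (21, [3, 4]), (22, [4, 5, 6, 7]), (23, [3, 7]), (24, [7, 8])]"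

subsection \<open>The list\<close>

datatype ade =
    A_ade nat
  | D_ade nat
  | Astar_ade nat
  | Dstar_ade nat
  | E8star_ade
  | E8_ade
  | E12_1_ade
  | E12_2_ade
  | E12_5_ade
  | E24_ade

fun su3_ade :: "ade \<Rightarrow> bool" where
  "su3_ade (A_ade n) = (n \<ge> 4)"
| "su3_ade (D_ade n) = (n \<ge> 5)"
| "su3_ade (Astar_ade n) = (n \<ge> 5)"
| "su3_ade (Dstar_ade n) = (n \<ge> 5)"
| "su3_ade _ = True"

fun ade_graph :: "ade \<Rightarrow> (vertex, arc) pre_digraph" where
  "ade_graph (A_ade n) = A_graph n"
| "ade_graph (D_ade n) = D_graph n"
| "ade_graph (Astar_ade n) = Astar_graph n"
| "ade_graph (Dstar_ade n) = Dstar_graph n"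
| "ade_graph E8star_ade = E8star_graph"
| "ade_graph E8_ade = E8_graph"
| "ade_graph E12_1_ade = E12_1_graph"
| "ade_graph E12_2_ade = E12_2_graph"
| "ade_graph E12_5_ade = E12_5_graph"
| "ade_graph E24_ade = E24_graph"

fun coxeter :: "ade \<Rightarrow> nat" where
  "coxeter (A_ade n) = n"
| "coxeter (D_ade n) = n"
| "coxeter (Astar_ade n) = n"
| "coxeter (Dstar_ade n) = n"
| "coxeter E8star_ade = 8"
| "coxeter E8_ade = 8"
| "coxeter E12_1_ade = 12"
| "coxeter E12_2_ade = 12"
| "coxeter E12_5_ade = 12"
| "coxeter E24_ade = 24"

fun nu_vert :: "ade \<Rightarrow> vertex \<Rightarrow> vertex" where
  "nu_vert (A_ade n) (Wt p l) = (case rot n (p, l) of (p', l') \<Rightarrow> Wt p' l')"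
| "nu_vert (Dstar_ade n) (Col m c) = Col m ((c + n) mod 3)"
| "nu_vert E8_ade (Col x c) = Col x ((c + 2) mod 3)"
| "nu_vert _ v = v"

text \<open>Where \<open>nu_vert\<close> is not the identity there are no parallel arcs, so the index is 0.\<close>

fun nu_arc :: "ade \<Rightarrow> arc \<Rightarrow> arc" where
  "nu_arc g (u, v, k) = (nu_vert g u, nu_vert g v, k)"


section \<open>Cell systems\<close>

definition arcs_from_to :: "('v, 'e) pre_digraph \<Rightarrow> 'v \<Rightarrow> 'v \<Rightarrow> 'e set" where
  "arcs_from_to G u v = {e \<in> arcs G. tail G e = u \<and> head G e = v}"

definition triangle :: "('v, 'e) pre_digraph \<Rightarrow> 'e \<Rightarrow> 'e \<Rightarrow> 'e \<Rightarrow> bool" where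
  "triangle G a b c \<longleftrightarrow> a \<in> arcs G \<and> b \<in> arcs G \<and> c \<in> arcs G \<and>
     head G a = tail G b \<and> head G b = tail G c \<and> head G c = tail G a"

definition q2 :: "nat \<Rightarrow> real" where "q2 h = 2 * cos (pi / real h)"
definition q3 :: "nat \<Rightarrow> real" where "q3 h = 1 + 2 * cos (2 * pi / real h)"

definition perron_frobenius :: "('v, 'e) pre_digraph \<Rightarrow> nat \<Rightarrow> ('v \<Rightarrow> real) \<Rightarrow> bool" where
  "perron_frobenius G h \<phi> \<longleftrightarrow> (\<forall>i\<in>verts G. \<phi> i > 0) \<and>
     (\<forall>i\<in>verts G. (\<Sum>j\<in>verts G. real (card (arcs_from_to G i j)) * \<phi> j) = q3 h * \<phi> i)"

text \<open>A cell system is a total function that vanishes off triangles; thus \<open>W a b b'\<close> is the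
  \<open>W\<^bsub>abb'\<^esub>\<close> that occurs in the relations of the algebra.\<close>

definition cell_system ::
  "('v, 'e) pre_digraph \<Rightarrow> nat \<Rightarrow> ('v \<Rightarrow> real) \<Rightarrow> ('e \<Rightarrow> 'e \<Rightarrow> 'e \<Rightarrow> complex) \<Rightarrow> bool" where
  "cell_system G h \<phi> W \<longleftrightarrow>
     (\<forall>a b c. \<not> triangle G a b c \<longrightarrow> W a b c = 0) \<and>
     (\<forall>a b c. triangle G a b c \<longrightarrow> W a b c = W b c a) \<and>
     (\<forall>i\<in>verts G. \<forall>j\<in>verts G. \<forall>a\<in>arcs_from_to G i j. \<forall>a'\<in>arcs_from_to G i j.
        (\<Sum>k\<in>verts G. \<Sum>b\<in>arcs_from_to G j k. \<Sum>c\<in>arcs_from_to G k i. W a b c * cnj (W a' b c))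
        = of_bool (a = a') * of_real (q2 h * \<phi> i * \<phi> j)) \<and>
     (\<forall>i1\<in>verts G. \<forall>i2\<in>verts G. \<forall>i3\<in>verts G. \<forall>i4\<in>verts G.
      \<forall>a1\<in>arcs_from_to G i1 i2. \<forall>a2\<in>arcs_from_to G i3 i2.
      \<forall>a3\<in>arcs_from_to G i3 i4. \<forall>a4\<in>arcs_from_to G i1 i4.
        (\<Sum>k\<in>verts G. \<Sum>b1\<in>arcs_from_to G k i1. \<Sum>b2\<in>arcs_from_to G i2 k.
         \<Sum>b3\<in>arcs_from_to G k i3. \<Sum>b4\<in>arcs_from_to G i4 k.
           of_real (inverse (\<phi> k)) *
           W a1 b2 b1 * cnj (W a2 b2 b3) * W a3 b4 b3 * cnj (W a4 b4 b1))
        = of_bool (a1 = a4 \<and> a2 = a3) * of_real (\<phi> i1 * \<phi> i2 * \<phi> i3)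
          + of_bool (a1 = a2 \<and> a3 = a4) * of_real (\<phi> i1 * \<phi> i2 * \<phi> i4))"

definition cell_invariant ::
  "('v, 'e) pre_digraph \<Rightarrow> ('e \<Rightarrow> 'e) \<Rightarrow> ('e \<Rightarrow> 'e \<Rightarrow> 'e \<Rightarrow> complex) \<Rightarrow> bool" where
  "cell_invariant G \<nu> W \<longleftrightarrow>
     (\<forall>a b c. triangle G a b c \<longrightarrow> W a b c = W (\<nu> a) (\<nu> b) (\<nu> c))"


section \<open>Bimodules\<close>

text \<open>As for the library's modules, \<open>mult\<close> and \<open>one\<close> of the underlying ring record are irrelevant.\<close>

record ('l, 'm, 'r) bimod = "('l, 'm) module" +
  rsmult :: "'m \<Rightarrow> 'r \<Rightarrow> 'm" (infixl \<open>\<odot>r\<index>\<close> 70)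
  grading :: "nat \<Rightarrow> 'm set"

locale bimodule = L: ring A + Rt: ring B + M: abelian_group M
  for A :: "('a, 'i) ring_scheme" and B :: "('b, 'j) ring_scheme"
    and M :: "('a, 'm, 'b, 'k) bimod_scheme" +
  assumes smult_closed: "\<lbrakk>a \<in> carrier A; m \<in> carrier M\<rbrakk> \<Longrightarrow> a \<odot>\<^bsub>M\<^esub> m \<in> carrier M"
    and smult_l_distr: "\<lbrakk>a \<in> carrier A; a' \<in> carrier A; m \<in> carrier M\<rbrakk>
      \<Longrightarrow> (a \<oplus>\<^bsub>A\<^esub> a') \<odot>\<^bsub>M\<^esub> m = a \<odot>\<^bsub>M\<^esub> m \<oplus>\<^bsub>M\<^esub> a' \<odot>\<^bsub>M\<^esub> m"
    and smult_r_distr: "\<lbrakk>a \<in> carrier A; m \<in> carrier M; m' \<in> carrier M\<rbrakk>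
      \<Longrightarrow> a \<odot>\<^bsub>M\<^esub> (m \<oplus>\<^bsub>M\<^esub> m') = a \<odot>\<^bsub>M\<^esub> m \<oplus>\<^bsub>M\<^esub> a \<odot>\<^bsub>M\<^esub> m'"
    and smult_assoc: "\<lbrakk>a \<in> carrier A; a' \<in> carrier A; m \<in> carrier M\<rbrakk>
      \<Longrightarrow> (a \<otimes>\<^bsub>A\<^esub> a') \<odot>\<^bsub>M\<^esub> m = a \<odot>\<^bsub>M\<^esub> (a' \<odot>\<^bsub>M\<^esub> m)"
    and smult_one: "m \<in> carrier M \<Longrightarrow> \<one>\<^bsub>A\<^esub> \<odot>\<^bsub>M\<^esub> m = m"
    and rsmult_closed: "\<lbrakk>m \<in> carrier M; b \<in> carrier B\<rbrakk> \<Longrightarrow> m \<odot>r\<^bsub>M\<^esub> b \<in> carrier M"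
    and rsmult_r_distr: "\<lbrakk>m \<in> carrier M; b \<in> carrier B; b' \<in> carrier B\<rbrakk>
      \<Longrightarrow> m \<odot>r\<^bsub>M\<^esub> (b \<oplus>\<^bsub>B\<^esub> b') = m \<odot>r\<^bsub>M\<^esub> b \<oplus>\<^bsub>M\<^esub> m \<odot>r\<^bsub>M\<^esub> b'"
    and rsmult_l_distr: "\<lbrakk>m \<in> carrier M; m' \<in> carrier M; b \<in> carrier B\<rbrakk>
      \<Longrightarrow> (m \<oplus>\<^bsub>M\<^esub> m') \<odot>r\<^bsub>M\<^esub> b = m \<odot>r\<^bsub>M\<^esub> b \<oplus>\<^bsub>M\<^esub> m' \<odot>r\<^bsub>M\<^esub> b"
    and rsmult_assoc: "\<lbrakk>m \<in> carrier M; b \<in> carrier B; b' \<in> carrier B\<rbrakk>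
      \<Longrightarrow> m \<odot>r\<^bsub>M\<^esub> (b \<otimes>\<^bsub>B\<^esub> b') = (m \<odot>r\<^bsub>M\<^esub> b) \<odot>r\<^bsub>M\<^esub> b'"
    and rsmult_one: "m \<in> carrier M \<Longrightarrow> m \<odot>r\<^bsub>M\<^esub> \<one>\<^bsub>B\<^esub> = m"
    and smult_rsmult: "\<lbrakk>a \<in> carrier A; m \<in> carrier M; b \<in> carrier B\<rbrakk>
      \<Longrightarrow> (a \<odot>\<^bsub>M\<^esub> m) \<odot>r\<^bsub>M\<^esub> b = a \<odot>\<^bsub>M\<^esub> (m \<odot>r\<^bsub>M\<^esub> b)"

definition bimod_hom ::
  "('a, 'i) ring_scheme \<Rightarrow> ('b, 'j) ring_scheme \<Rightarrow> ('a, 'm, 'b) bimod \<Rightarrow> ('a, 'n, 'b) bimod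
     \<Rightarrow> ('m \<Rightarrow> 'n) set" where
  "bimod_hom A B M N =
     {f. bimodule A B M \<and> bimodule A B N \<and> f \<in> carrier M \<rightarrow> carrier N \<and>
         (\<forall>m\<in>carrier M. \<forall>m'\<in>carrier M. f (m \<oplus>\<^bsub>M\<^esub> m') = f m \<oplus>\<^bsub>N\<^esub> f m') \<and>
         (\<forall>a\<in>carrier A. \<forall>m\<in>carrier M. f (a \<odot>\<^bsub>M\<^esub> m) = a \<odot>\<^bsub>N\<^esub> f m) \<and>
         (\<forall>m\<in>carrier M. \<forall>b\<in>carrier B. f (m \<odot>r\<^bsub>M\<^esub> b) = f m \<odot>r\<^bsub>N\<^esub> b)}"

definition graded_hom ::
  "('a, 'i) ring_scheme \<Rightarrow> ('b, 'j) ring_scheme \<Rightarrow> ('a, 'm, 'b) bimod \<Rightarrow> ('a, 'n, 'b) bimod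
     \<Rightarrow> ('m \<Rightarrow> 'n) set" where
  "graded_hom A B M N = {f \<in> bimod_hom A B M N. \<forall>p. f ` grading M p \<subseteq> grading N p}"

definition bimod_iso ::
  "('a, 'i) ring_scheme \<Rightarrow> ('b, 'j) ring_scheme \<Rightarrow> ('a, 'm, 'b) bimod \<Rightarrow> ('a, 'n, 'b) bimod
     \<Rightarrow> bool" where
  "bimod_iso A B M N \<longleftrightarrow> (\<exists>f\<in>bimod_hom A B M N. bij_betw f (carrier M) (carrier N))"

text \<open>\<open>M[s]\<close>, with \<open>M[s]\<^sub>p = M\<^sub>p\<^sub>-\<^sub>s\<close>.\<close>

definition shift :: "nat \<Rightarrow> ('a, 'm, 'b) bimod \<Rightarrow> ('a, 'm, 'b) bimod" where
  "shift s M = M\<lparr>grading := \<lambda>p. if s \<le> p then grading M (p - s) else {\<zero>\<^bsub>M\<^esub>}\<rparr>"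

text \<open>A ring as a bimodule, scalars acting through the maps \<open>l\<close> and \<open>r\<close>.\<close>

definition ring_bimod ::
  "('m, 'i) ring_scheme \<Rightarrow> ('a \<Rightarrow> 'm) \<Rightarrow> ('b \<Rightarrow> 'm) \<Rightarrow> (nat \<Rightarrow> 'm set) \<Rightarrow> ('a, 'm, 'b) bimod" where
  "ring_bimod S l r gr =
     \<lparr>carrier = carrier S, mult = mult S, one = one S, zero = zero S, add = add S,
      smult = (\<lambda>a x. l a \<otimes>\<^bsub>S\<^esub> x), rsmult = (\<lambda>x b. x \<otimes>\<^bsub>S\<^esub> r b), grading = gr\<rparr>"

subsection \<open>Tensor products\<close>

text \<open>The tensor product over \<open>R\<close> is the free abelian group on pairs modulo biadditivity and
  \<open>(x r, y) = (x, r y)\<close>. Its elements are cosets; since the action on the quotient is well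
  defined, the unions below are unions of a single coset.\<close>

definition tensor_free ::
  "('a, 'm, 'r) bimod \<Rightarrow> ('r, 'n, 'b) bimod \<Rightarrow> ('m \<times> 'n \<Rightarrow>\<^sub>0 int) ring" where
  "tensor_free M N =
     \<lparr>carrier = {z. Poly_Mapping.keys z \<subseteq> carrier M \<times> carrier N},
      mult = undefined, one = undefined, zero = 0, add = (+)\<rparr>"

definition tensor_rels ::
  "('r, 'i) ring_scheme \<Rightarrow> ('a, 'm, 'r) bimod \<Rightarrow> ('r, 'n, 'b) bimod \<Rightarrow> ('m \<times> 'n \<Rightarrow>\<^sub>0 int) set" where
  "tensor_rels R M N =
     {frag_of (x \<oplus>\<^bsub>M\<^esub> x', y) - frag_of (x, y) - frag_of (x', y) | x x' y.
        x \<in> carrier M \<and> x' \<in> carrier M \<and> y \<in> carrier N} \<union>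
     {frag_of (x, y \<oplus>\<^bsub>N\<^esub> y') - frag_of (x, y) - frag_of (x, y') | x y y'.
        x \<in> carrier M \<and> y \<in> carrier N \<and> y' \<in> carrier N} \<union>
     {frag_of (x \<odot>r\<^bsub>M\<^esub> r, y) - frag_of (x, r \<odot>\<^bsub>N\<^esub> y) | x r y.
        x \<in> carrier M \<and> r \<in> carrier R \<and> y \<in> carrier N}"

definition tensor_null ::
  "('r, 'i) ring_scheme \<Rightarrow> ('a, 'm, 'r) bimod \<Rightarrow> ('r, 'n, 'b) bimod \<Rightarrow> ('m \<times> 'n \<Rightarrow>\<^sub>0 int) set" where
  "tensor_null R M N = generate (add_monoid (tensor_free M N)) (tensor_rels R M N)"

definition tensor_coset ::
  "('r, 'i) ring_scheme \<Rightarrow> ('a, 'm, 'r) bimod \<Rightarrow> ('r, 'n, 'b) bimod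
     \<Rightarrow> ('m \<times> 'n \<Rightarrow>\<^sub>0 int) \<Rightarrow> ('m \<times> 'n \<Rightarrow>\<^sub>0 int) set" where
  "tensor_coset R M N z = tensor_null R M N +>\<^bsub>tensor_free M N\<^esub> z"

definition tensor ::
  "('r, 'i) ring_scheme \<Rightarrow> ('a, 'm, 'r) bimod \<Rightarrow> ('r, 'n, 'b) bimod
     \<Rightarrow> ('a, ('m \<times> 'n \<Rightarrow>\<^sub>0 int) set, 'b) bimod" where
  "tensor R M N =
     \<lparr>carrier = a_rcosets\<^bsub>tensor_free M N\<^esub> (tensor_null R M N),
      mult = undefined, one = undefined,
      zero = tensor_null R M N,
      add = set_add (tensor_free M N),
      smult = (\<lambda>a Z. \<Union>z\<in>Z. tensor_coset R M N (frag_extend (\<lambda>(x, y). frag_of (a \<odot>\<^bsub>M\<^esub> x, y)) z)),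
      rsmult = (\<lambda>Z b. \<Union>z\<in>Z. tensor_coset R M N (frag_extend (\<lambda>(x, y). frag_of (x, y \<odot>r\<^bsub>N\<^esub> b)) z)),
      grading = (\<lambda>p. tensor_coset R M N ` generate (add_monoid (tensor_free M N))
        {frag_of (x, y) | x y q s. q + s = p \<and> x \<in> grading M q \<and> y \<in> grading N s})\<rparr>"

definition pure_tensor ::
  "('r, 'i) ring_scheme \<Rightarrow> ('a, 'm, 'r) bimod \<Rightarrow> ('r, 'n, 'b) bimod
     \<Rightarrow> 'm \<Rightarrow> 'n \<Rightarrow> ('m \<times> 'n \<Rightarrow>\<^sub>0 int) set" where
  "pure_tensor R M N x y = tensor_coset R M N (frag_of (x, y))"


section \<open>The algebra of a cell system\<close>

text \<open>A path is its initial vertex together with its list of arcs. An element of the path algebra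
  is a finitely supported complex function on paths.\<close>

type_synonym ('v, 'e) path = "'v \<times> 'e list"
type_synonym ('v, 'e) pathvec = "('v, 'e) path \<Rightarrow>\<^sub>0 complex"
type_synonym ('v, 'e) algelt = "('v, 'e) pathvec set"

definition paths :: "('v, 'e) pre_digraph \<Rightarrow> ('v, 'e) path set" where
  "paths G = {(u, p). \<exists>v. pre_digraph.awalk G u p v}"

definition path_algebra :: "('v, 'e) pre_digraph \<Rightarrow> ('v, 'e) pathvec ring" where
  "path_algebra G =
     \<lparr>carrier = {x. Poly_Mapping.keys x \<subseteq> paths G},
      mult = (\<lambda>x y. \<Sum>(u, p)\<in>Poly_Mapping.keys x. \<Sum>(v, q)\<in>Poly_Mapping.keys y.
         if pre_digraph.awlast G u p = v
         then Poly_Mapping.single (u, p @ q)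
                (Poly_Mapping.lookup x (u, p) * Poly_Mapping.lookup y (v, q))
         else 0),
      one = (\<Sum>v\<in>verts G. Poly_Mapping.single (v, []) 1),
      zero = 0,
      add = (+)\<rparr>"

definition path_part :: "('v, 'e) pre_digraph \<Rightarrow> nat \<Rightarrow> ('v, 'e) pathvec set" where
  "path_part G p =
     {x \<in> carrier (path_algebra G). \<forall>w\<in>Poly_Mapping.keys x. length (snd w) = p}"

definition vertex_ring :: "('v, 'e) pre_digraph \<Rightarrow> ('v, 'e) pathvec ring" where
  "vertex_ring G = path_algebra G\<lparr>carrier := path_part G 0\<rparr>"

definition arc_bimod ::
  "('v, 'e) pre_digraph \<Rightarrow> (('v, 'e) pathvec, ('v, 'e) pathvec, ('v, 'e) pathvec) bimod" where
  "arc_bimod G = ring_bimod (path_algebra G\<lparr>carrier := path_part G 1\<rparr>) (\<lambda>r. r) (\<lambda>r. r)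
     (\<lambda>p. if p = 1 then path_part G 1 else {0})"

definition reverse_graph :: "('v, 'e) pre_digraph \<Rightarrow> ('v, 'e) pre_digraph" where
  "reverse_graph G = G\<lparr>tail := head G, head := tail G\<rparr>"

text \<open>\<open>arc_vec G a\<close> is the path \<open>a\<close>, and \<open>arc_vec (reverse_graph G) a\<close> is the reversed arc.
  The paths of length 0 of \<open>G\<close> and of \<open>reverse_graph G\<close> are the same, so that
  \<open>arc_bimod (reverse_graph G)\<close> is again a bimodule over \<open>vertex_ring G\<close>.\<close>

definition arc_vec :: "('v, 'e) pre_digraph \<Rightarrow> 'e \<Rightarrow> ('v, 'e) pathvec" where
  "arc_vec G a = Poly_Mapping.single (tail G a, [a]) 1"

definition rho :: "('v, 'e) pre_digraph \<Rightarrow> ('e \<Rightarrow> 'e \<Rightarrow> 'e \<Rightarrow> complex) \<Rightarrow> 'e \<Rightarrow> ('v, 'e) pathvec" where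
  "rho G W a = (\<Sum>b\<in>arcs G. \<Sum>b'\<in>arcs G. Poly_Mapping.single (tail G b, [b, b']) (W a b b'))"

definition cell_ideal ::
  "('v, 'e) pre_digraph \<Rightarrow> ('e \<Rightarrow> 'e \<Rightarrow> 'e \<Rightarrow> complex) \<Rightarrow> ('v, 'e) pathvec set" where
  "cell_ideal G W = Idl\<^bsub>path_algebra G\<^esub> (rho G W ` arcs G)"

definition cell_algebra ::
  "('v, 'e) pre_digraph \<Rightarrow> ('e \<Rightarrow> 'e \<Rightarrow> 'e \<Rightarrow> complex) \<Rightarrow> ('v, 'e) algelt ring" where
  "cell_algebra G W = path_algebra G Quot cell_ideal G W"

definition cls ::
  "('v, 'e) pre_digraph \<Rightarrow> ('e \<Rightarrow> 'e \<Rightarrow> 'e \<Rightarrow> complex) \<Rightarrow> ('v, 'e) pathvec \<Rightarrow> ('v, 'e) algelt" where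
  "cls G W x = cell_ideal G W +>\<^bsub>path_algebra G\<^esub> x"

definition vert_elt ::
  "('v, 'e) pre_digraph \<Rightarrow> ('e \<Rightarrow> 'e \<Rightarrow> 'e \<Rightarrow> complex) \<Rightarrow> 'v \<Rightarrow> ('v, 'e) algelt" where
  "vert_elt G W i = cls G W (Poly_Mapping.single (i, []) 1)"

definition arc_elt ::
  "('v, 'e) pre_digraph \<Rightarrow> ('e \<Rightarrow> 'e \<Rightarrow> 'e \<Rightarrow> complex) \<Rightarrow> 'e \<Rightarrow> ('v, 'e) algelt" where
  "arc_elt G W a = cls G W (arc_vec G a)"

text \<open>The image in the algebra of \<open>c\<close> times the identity; complex scalars act by multiplication
  with these central elements.\<close>

definition scal ::
  "('v, 'e) pre_digraph \<Rightarrow> ('e \<Rightarrow> 'e \<Rightarrow> 'e \<Rightarrow> complex) \<Rightarrow> complex \<Rightarrow> ('v, 'e) algelt" where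
  "scal G W c = cls G W (\<Sum>v\<in>verts G. Poly_Mapping.single (v, []) c)"

definition alg_part ::
  "('v, 'e) pre_digraph \<Rightarrow> ('e \<Rightarrow> 'e \<Rightarrow> 'e \<Rightarrow> complex) \<Rightarrow> nat \<Rightarrow> ('v, 'e) algelt set" where
  "alg_part G W p = cls G W ` path_part G p"

definition corner ::
  "('v, 'e) pre_digraph \<Rightarrow> ('e \<Rightarrow> 'e \<Rightarrow> 'e \<Rightarrow> complex) \<Rightarrow> 'v \<Rightarrow> nat \<Rightarrow> 'v \<Rightarrow> ('v, 'e) algelt set" where
  "corner G W i p l =
     (\<lambda>x. vert_elt G W i \<otimes>\<^bsub>cell_algebra G W\<^esub> x \<otimes>\<^bsub>cell_algebra G W\<^esub> vert_elt G W l) ` alg_part G W p"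

definition path_map :: "('v \<Rightarrow> 'v) \<Rightarrow> ('e \<Rightarrow> 'e) \<Rightarrow> ('v, 'e) pathvec \<Rightarrow> ('v, 'e) pathvec" where
  "path_map \<nu>0 \<nu>1 x = (\<Sum>(u, p)\<in>Poly_Mapping.keys x.
     Poly_Mapping.single (\<nu>0 u, map \<nu>1 p) (Poly_Mapping.lookup x (u, p)))"

text \<open>The map induced on the quotient by the graph automorphism \<open>(\<nu>0, \<nu>1)\<close>.\<close>

definition beta ::
  "('v, 'e) pre_digraph \<Rightarrow> ('e \<Rightarrow> 'e \<Rightarrow> 'e \<Rightarrow> complex) \<Rightarrow> ('v \<Rightarrow> 'v) \<Rightarrow> ('e \<Rightarrow> 'e)
     \<Rightarrow> ('v, 'e) algelt \<Rightarrow> ('v, 'e) algelt" where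
  "beta G W \<nu>0 \<nu>1 X = (\<Union>x\<in>X. cls G W (path_map \<nu>0 \<nu>1 x))"

subsection \<open>The Frobenius form\<close>

definition frobenius_form ::
  "('v, 'e) pre_digraph \<Rightarrow> ('e \<Rightarrow> 'e \<Rightarrow> 'e \<Rightarrow> complex) \<Rightarrow> nat \<Rightarrow> ('v \<Rightarrow> 'v) \<Rightarrow> ('e \<Rightarrow> 'e)
     \<Rightarrow> (('v, 'e) algelt \<Rightarrow> complex) \<Rightarrow> bool" where
  "frobenius_form G W h \<nu>0 \<nu>1 f \<longleftrightarrow>
    (let A = cell_algebra G W in
     (\<forall>x\<in>carrier A. \<forall>y\<in>carrier A. f (x \<oplus>\<^bsub>A\<^esub> y) = f x + f y) \<and>
     (\<forall>c. \<forall>x\<in>carrier A. f (scal G W c \<otimes>\<^bsub>A\<^esub> x) = c * f x) \<and>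
     (\<forall>x\<in>carrier A. (\<forall>y\<in>carrier A. f (x \<otimes>\<^bsub>A\<^esub> y) = 0) \<longrightarrow> x = \<zero>\<^bsub>A\<^esub>) \<and>
     (\<forall>y\<in>carrier A. (\<forall>x\<in>carrier A. f (x \<otimes>\<^bsub>A\<^esub> y) = 0) \<longrightarrow> y = \<zero>\<^bsub>A\<^esub>) \<and>
     (\<forall>p<h - 3. \<forall>x\<in>alg_part G W p. f x = 0) \<and>
     (\<forall>i\<in>verts G. \<exists>u. corner G W i (h - 3) (\<nu>0 i) = range (\<lambda>c. scal G W c \<otimes>\<^bsub>A\<^esub> u) \<and>
        u \<in> carrier A \<and> f u \<noteq> 0) \<and>
     (\<forall>x\<in>carrier A. \<forall>y\<in>carrier A. f (x \<otimes>\<^bsub>A\<^esub> y) = f (y \<otimes>\<^bsub>A\<^esub> beta G W \<nu>0 \<nu>1 x)))"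

text \<open>The corner \<open>i \<cdot> A\<^sub>p \<cdot> l\<close> is the image of the degree \<open>p\<close> part under \<open>x \<mapsto> i x l\<close>. A
  homogeneous basis is a complex vector space basis whose members lie in the spaces \<open>i \<cdot> A\<^sub>p \<cdot> l\<close>.\<close>

definition homogeneous_basis ::
  "('v, 'e) pre_digraph \<Rightarrow> ('e \<Rightarrow> 'e \<Rightarrow> 'e \<Rightarrow> complex) \<Rightarrow> ('v, 'e) algelt set \<Rightarrow> bool" where
  "homogeneous_basis G W B \<longleftrightarrow>
     B \<subseteq> (\<Union>i\<in>verts G. \<Union>l\<in>verts G. \<Union>p. corner G W i p l) \<and>
     (\<forall>x\<in>carrier (cell_algebra G W). \<exists>!c. finite {b. c b \<noteq> 0} \<and> {b. c b \<noteq> 0} \<subseteq> B \<and>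
        x = finsum (cell_algebra G W) (\<lambda>b. scal G W (c b) \<otimes>\<^bsub>cell_algebra G W\<^esub> b) {b. c b \<noteq> 0})"

definition dual_basis ::
  "('v, 'e) pre_digraph \<Rightarrow> ('e \<Rightarrow> 'e \<Rightarrow> 'e \<Rightarrow> complex) \<Rightarrow> (('v, 'e) algelt \<Rightarrow> complex)
     \<Rightarrow> ('v, 'e) algelt set \<Rightarrow> (('v, 'e) algelt \<Rightarrow> ('v, 'e) algelt) \<Rightarrow> bool" where
  "dual_basis G W f B d \<longleftrightarrow> d \<in> B \<rightarrow> carrier (cell_algebra G W) \<and>
     (\<forall>b\<in>B. \<forall>b'\<in>B. f (b \<otimes>\<^bsub>cell_algebra G W\<^esub> d b') = of_bool (b = b'))"

subsection \<open>The bimodules of the complex\<close>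

definition A_A ::
  "('v, 'e) pre_digraph \<Rightarrow> ('e \<Rightarrow> 'e \<Rightarrow> 'e \<Rightarrow> complex)
     \<Rightarrow> (('v, 'e) algelt, ('v, 'e) algelt, ('v, 'e) algelt) bimod" where
  "A_A G W = ring_bimod (cell_algebra G W) (\<lambda>x. x) (\<lambda>x. x) (alg_part G W)"

definition A_twisted ::
  "('v, 'e) pre_digraph \<Rightarrow> ('e \<Rightarrow> 'e \<Rightarrow> 'e \<Rightarrow> complex) \<Rightarrow> (('v, 'e) algelt \<Rightarrow> ('v, 'e) algelt)
     \<Rightarrow> (('v, 'e) algelt, ('v, 'e) algelt, ('v, 'e) algelt) bimod" where
  "A_twisted G W \<sigma> = ring_bimod (cell_algebra G W) (\<lambda>x. x) \<sigma> (alg_part G W)"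

definition A_R ::
  "('v, 'e) pre_digraph \<Rightarrow> ('e \<Rightarrow> 'e \<Rightarrow> 'e \<Rightarrow> complex)
     \<Rightarrow> (('v, 'e) algelt, ('v, 'e) algelt, ('v, 'e) pathvec) bimod" where
  "A_R G W = ring_bimod (cell_algebra G W) (\<lambda>x. x) (cls G W) (alg_part G W)"

definition R_A ::
  "('v, 'e) pre_digraph \<Rightarrow> ('e \<Rightarrow> 'e \<Rightarrow> 'e \<Rightarrow> complex)
     \<Rightarrow> (('v, 'e) pathvec, ('v, 'e) algelt, ('v, 'e) algelt) bimod" where
  "R_A G W = ring_bimod (cell_algebra G W) (cls G W) (\<lambda>x. x) (alg_part G W)"

definition AA where
  "AA G W = tensor (vertex_ring G) (A_R G W) (R_A G W)"

definition tAA where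
  "tAA G W x y = pure_tensor (vertex_ring G) (A_R G W) (R_A G W) x y"

text \<open>For \<open>H = G\<close> this is \<open>A \<otimes>\<^sub>R V \<otimes>\<^sub>R A\<close>, and for \<open>H = reverse_graph G\<close> it is the one with the
  reversed arcs in the middle.\<close>

definition AEA where
  "AEA G W H =
     tensor (vertex_ring G) (tensor (vertex_ring G) (A_R G W) (arc_bimod H)) (R_A G W)"

definition tAEA where
  "tAEA G W H x a y =
     pure_tensor (vertex_ring G) (tensor (vertex_ring G) (A_R G W) (arc_bimod H)) (R_A G W)
       (pure_tensor (vertex_ring G) (A_R G W) (arc_bimod H) x (arc_vec H a)) y"

subsection \<open>The maps of the complex\<close>

text \<open>Pure tensors generate, so each specification determines its map on the carrier; that the
  formulas are compatible with the tensor relations is contained in the existence of a map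
  that satisfies the specification. The gradings put arcs and reversed arcs in degree 1.\<close>

definition mu0_spec where
  "mu0_spec G W \<mu> \<longleftrightarrow>
     \<mu> \<in> graded_hom (cell_algebra G W) (cell_algebra G W) (AA G W) (A_A G W) \<and>
     (\<forall>x\<in>carrier (cell_algebra G W). \<forall>y\<in>carrier (cell_algebra G W).
        \<mu> (tAA G W x y) = x \<otimes>\<^bsub>cell_algebra G W\<^esub> y)"

definition mu1_spec where
  "mu1_spec G W \<mu> \<longleftrightarrow>
     \<mu> \<in> graded_hom (cell_algebra G W) (cell_algebra G W) (AEA G W G) (AA G W) \<and>
     (\<forall>x\<in>carrier (cell_algebra G W). \<forall>a\<in>arcs G. \<forall>y\<in>carrier (cell_algebra G W).
        \<mu> (tAEA G W G x a y) =
          tAA G W (x \<otimes>\<^bsub>cell_algebra G W\<^esub> arc_elt G W a) y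
            \<ominus>\<^bsub>AA G W\<^esub> tAA G W x (arc_elt G W a \<otimes>\<^bsub>cell_algebra G W\<^esub> y))"

definition mu2_spec where
  "mu2_spec G W \<mu> \<longleftrightarrow>
     \<mu> \<in> graded_hom (cell_algebra G W) (cell_algebra G W)
           (shift 1 (AEA G W (reverse_graph G))) (AEA G W G) \<and>
     (\<forall>x\<in>carrier (cell_algebra G W). \<forall>a\<in>arcs G. \<forall>y\<in>carrier (cell_algebra G W).
        \<mu> (tAEA G W (reverse_graph G) x a y) =
          finsum (AEA G W G)
            (\<lambda>(b, b'). scal G W (W a b b') \<odot>\<^bsub>AEA G W G\<^esub>
               (tAEA G W G (x \<otimes>\<^bsub>cell_algebra G W\<^esub> arc_elt G W b) b' y
                 \<oplus>\<^bsub>AEA G W G\<^esub> tAEA G W G x b (arc_elt G W b' \<otimes>\<^bsub>cell_algebra G W\<^esub> y)))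
            (arcs G \<times> arcs G))"

definition mu3_spec where
  "mu3_spec G W \<mu> \<longleftrightarrow>
     \<mu> \<in> graded_hom (cell_algebra G W) (cell_algebra G W)
           (shift 3 (AA G W)) (shift 1 (AEA G W (reverse_graph G))) \<and>
     (\<forall>x\<in>carrier (cell_algebra G W). \<forall>y\<in>carrier (cell_algebra G W).
        \<mu> (tAA G W x y) =
          finsum (AEA G W (reverse_graph G))
            (\<lambda>a. tAEA G W (reverse_graph G) (x \<otimes>\<^bsub>cell_algebra G W\<^esub> arc_elt G W a) a y) (arcs G)
          \<ominus>\<^bsub>AEA G W (reverse_graph G)\<^esub>
          finsum (AEA G W (reverse_graph G))
            (\<lambda>a. tAEA G W (reverse_graph G) x a (arc_elt G W a \<otimes>\<^bsub>cell_algebra G W\<^esub> y)) (arcs G))"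

definition mu4_spec where
  "mu4_spec G W h \<sigma> B d \<mu> \<longleftrightarrow>
     \<mu> \<in> graded_hom (cell_algebra G W) (cell_algebra G W)
           (shift h (A_twisted G W \<sigma>)) (shift 3 (AA G W)) \<and>
     (\<forall>x\<in>carrier (cell_algebra G W).
        \<mu> x = x \<odot>\<^bsub>AA G W\<^esub> finsum (AA G W) (\<lambda>b. tAA G W b (d b)) B)"

end

theory Submission
  imports Defs "HOL-Library.Function_Algebras"
begin

text \<open>The conditions on a cell system say that the operators \<open>U\<close> on paths represent a Hecke
  algebra, so Wenzl's recursion gives projections onto the path vectors annihilated by all
  relations. The coefficient \<open>[3] - [n] [2] / [n + 1]\<close> vanishes for \<open>n = h - 3\<close>, whence the
  projection on paths of length \<open>h - 2\<close> has weighted trace \<open>0\<close> and is zero, and \<open>A\<close> has no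
  elements of degree above \<open>h - 3\<close>.

  Then \<open>A\<close> is finite dimensional and the Frobenius form turns the bimodules of the complex into
  spaces of bilinear forms on \<open>A\<close>. The maps \<open>\<mu>\<^sub>3\<close> and \<open>\<mu>\<^sub>1\<close> become commutators with arcs, so a form in
  the kernel of \<open>\<mu>\<^sub>3\<close> is \<open>(u, g) \<mapsto> f (g u y)\<close> for some \<open>y\<close>, that is, an element of the image of \<open>\<mu>\<^sub>4\<close>.
  Exactness at the other places is the statement that a family \<open>(T\<^sub>a)\<close> of bilinear forms extends
  to a \<open>\<tau>\<close> with \<open>\<tau>(a u, g) = T\<^sub>a(u, g) + \<tau>(u, g a)\<close> if and only if it is compatible with the
  relations of \<open>A\<close>: that gives exactness at \<open>\<mu>\<^sub>2\<close> directly, and at \<open>\<mu>\<^sub>1\<close> by duality.\<close>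

section \<open>Symmetric path vectors\<close>

text \<open>No hypothesis bounds the degrees of \<open>A\<close> from above: \<open>f\<close> is
  only known to vanish below degree \<open>h - 3\<close>, and \<open>B\<close> could be infinite.
  The vanishing of long paths settles both. It applies to \<open>A\<close> because, for fixed
  \<open>u\<close>, the values \<open>f (p u)\<close> on paths \<open>p\<close> form, after
  conjugation, a vector killed by all relations; non-degeneracy then kills the paths themselves. In
  the coefficient, [3] is the Perron-Frobenius eigenvalue and [2] comes from condition (I); it
  equals [n + 3] / [n + 1]. Trace 0 suffices because the weights are positive and the diagonal
  entries of a self-adjoint projection are squared norms. Condition (II) is used once, for a Hecke
  relation on vectors killed by the lower relations; its unwanted term is a trace that cyclic
  symmetry of \<open>W\<close> turns into a lower relation. The tensor products are quotients of
  free abelian groups, where every map needs a proof that it is well defined. For forms a map is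
  just a formula, and dual bases lead back to tensors. The twist by \<beta> arises because f (x y) =
  f (y \<beta>(x)) turns left multiplication on a tensor into right multiplication in an argument of
  its form.\<close>

definition qn :: "nat \<Rightarrow> nat \<Rightarrow> real" where
  "qn h k = sin (real k * pi / real h) / sin (pi / real h)"

lemma qn_0 [simp]: "qn h 0 = 0"
  by (simp add: qn_def)

text \<open>\<open>qn h k\<close> is the quantum integer [k] at q = exp(i \<pi> / h). Its first
  positive zero is at k = h, and all divisions by quantum integers in Wenzl's recursion stay below
  that.\<close>

lemma qn_pos:
  assumes "0 < k" "k < h"
  shows "0 < qn h k"
proof -
  have "0 < sin (real k * pi / real h)"
    using assms by (intro sin_gt_zero) (auto simp: field_simps)
  moreover have "0 < sin (pi / real h)"
    using assms by (intro sin_gt_zero) (auto simp: field_simps)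
  ultimately show ?thesis
    by (simp add: qn_def)
qed

lemma qn_h: "0 < h \<Longrightarrow> qn h h = 0"
  by (simp add: qn_def)

text \<open>This is sin((k+2)t) + sin(kt) = 2 cos t sin((k+1)t) divided by sin t. It is the identity
  that keeps the coefficients [n] / [n+1] of the projections consistent from one step to the
  next.\<close>

lemma qn_rec: "q2 h * qn h (Suc k) = qn h (Suc (Suc k)) + qn h k"
proof -
  define t where "t = pi / real h"
  have "sin (real (Suc (Suc k)) * t) + sin (real k * t) = 2 * cos t * sin (real (Suc k) * t)"
    using sin_plus_sin[of "real (Suc (Suc k)) * t" "real k * t"]
    by (simp add: field_simps add_divide_distrib)
  then have "2 * cos t * sin (real (Suc k) * t) / sin t
      = sin (real (Suc (Suc k)) * t) / sin t + sin (real k * t) / sin t"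
    by (metis add_divide_distrib)
  then show ?thesis
    by (simp add: qn_def q2_def t_def)
qed

lemma q3_eq: "q3 h = q2 h * q2 h - 1"
proof -
  have "cos (2 * pi / real h) = 2 * cos (pi / real h) ^ 2 - 1"
    using cos_double_cos[of "pi / real h"] by simp
  then show ?thesis
    by (simp add: q3_def q2_def power2_eq_square)
qed

text \<open>Apply the recursion twice and use [3] = [2][2] - 1. For k + 3 = h the right side is [h]
  = 0, which is why paths of length \<open>h - 2\<close> die.\<close>

lemma qn_3: "q3 h * qn h (Suc k) - q2 h * qn h k = qn h (k + 3)"
proof -
  have "qn h (k + 3) = q2 h * qn h (Suc (Suc k)) - qn h (Suc k)"
    using qn_rec[of h "Suc k"] by (simp add: numeral_3_eq_3)
  also have "qn h (Suc (Suc k)) = q2 h * qn h (Suc k) - qn h k"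
    using qn_rec[of h k] by linarith
  finally show ?thesis
    by (simp add: q3_eq algebra_simps)
qed

text \<open>Vectors are functions on reversed arc lists: the head of the list is the last arc of the path.\<close>

type_synonym 'e lvec = "'e list \<Rightarrow> complex"

definition lin :: "('e lvec \<Rightarrow> 'e lvec) \<Rightarrow> bool" where
  "lin T \<longleftrightarrow> (\<forall>x y. T (\<lambda>w. x w + y w) = (\<lambda>w. T x w + T y w)) \<and>
             (\<forall>c x. T (\<lambda>w. c * x w) = (\<lambda>w. c * T x w))"

text \<open>This is 1 \<otimes> T: the front entry, that is the last arc, is a spectator. The value
  at \<open>[]\<close> is a default that makes \<open>lft\<close> of the identity the
  identity.\<close>

definition lft :: "('e lvec \<Rightarrow> 'e lvec) \<Rightarrow> 'e lvec \<Rightarrow> 'e lvec" where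
  "lft T x w = (case w of [] \<Rightarrow> x [] | a # v \<Rightarrow> T (\<lambda>u. x (a # u)) v)"

lemma lft_simps [simp]:
  "lft T x [] = x []" "lft T x (a # v) = T (\<lambda>u. x (a # u)) v"
  by (simp_all add: lft_def)

lemma lin_add: "lin T \<Longrightarrow> T (\<lambda>w. x w + y w) = (\<lambda>w. T x w + T y w)"
  and lin_scale: "lin T \<Longrightarrow> T (\<lambda>w. c * x w) = (\<lambda>w. c * T x w)"
  by (simp_all add: lin_def)

lemma lin_zero: "lin T \<Longrightarrow> T (\<lambda>w. 0) = (\<lambda>w. 0)"
  using lin_scale[of T 0] by simp

lemma lin_diff: "lin T \<Longrightarrow> T (\<lambda>w. x w - c * y w) = (\<lambda>w. T x w - c * T y w)"
  using lin_add[of T x "\<lambda>w. (- c) * y w"] lin_scale[of T "- c" y] by simp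

lemma lin_sum:
  assumes "lin T" "finite S"
  shows "T (\<lambda>w. \<Sum>i\<in>S. k i * f i w) = (\<lambda>w. \<Sum>i\<in>S. k i * T (f i) w)"
  using assms(2)
proof (induction S rule: finite_induct)
  case (insert i S)
  then show ?case
    using lin_add[OF assms(1), of "\<lambda>w. k i * f i w" "\<lambda>w. \<Sum>i\<in>S. k i * f i w"]
    by (simp add: lin_scale assms(1))
qed (simp add: lin_zero assms(1))

lemma lin_lft: "lin T \<Longrightarrow> lin (lft T)"
  unfolding lin_def by (auto simp: lft_def fun_eq_iff split: list.splits)

section \<open>The cell conditions as sums over all arcs\<close>

locale cells = fin_digraph G for G :: "('v, 'e) pre_digraph" +
  fixes h :: nat and \<phi> :: "'v \<Rightarrow> real" and W :: "'e \<Rightarrow> 'e \<Rightarrow> 'e \<Rightarrow> complex"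
  assumes h4: "4 \<le> h" and pf: "perron_frobenius G h \<phi>" and cs: "cell_system G h \<phi> W"
begin

abbreviation E where "E \<equiv> arcs G"

lemma W_tri: "W a b c \<noteq> 0 \<Longrightarrow> triangle G a b c"
  using cs unfolding cell_system_def by blast

lemma W_triD:
  assumes "W a b c \<noteq> 0"
  shows "a \<in> E" "b \<in> E" "c \<in> E" "head G a = tail G b" "head G b = tail G c" "head G c = tail G a"
  using W_tri[OF assms] unfolding triangle_def by auto

lemma W_cyc: "W a b c = W b c a"
proof (cases "triangle G a b c")
  case True
  then show ?thesis using cs unfolding cell_system_def by blast
next
  case False
  then have "\<not> triangle G b c a" unfolding triangle_def by auto
  with False show ?thesis using W_tri by metis
qed

lemma phi_pos: "v \<in> verts G \<Longrightarrow> 0 < \<phi> v"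
  using pf unfolding perron_frobenius_def by blast

lemma sum_arcs_from_to:
  fixes k :: "'e \<Rightarrow> 'c::comm_monoid_add"
  assumes "\<And>b. b \<in> E \<Longrightarrow> \<not> (tail G b = u \<and> head G b = v) \<Longrightarrow> k b = 0"
  shows "sum k (arcs_from_to G u v) = sum k E"
  by (rule sum.mono_neutral_left) (use assms in \<open>auto simp: arcs_from_to_def\<close>)

lemma sum_from:
  fixes k :: "'e \<Rightarrow> 'c::comm_monoid_add"
  assumes "\<And>b. b \<in> E \<Longrightarrow> tail G b \<noteq> u \<Longrightarrow> k b = 0"
  shows "(\<Sum>v\<in>verts G. sum k (arcs_from_to G u v)) = sum k E"
proof -
  have "(\<Sum>v\<in>verts G. sum k (arcs_from_to G u v))
      = (\<Sum>v\<in>verts G. sum k {b \<in> {b \<in> E. tail G b = u}. head G b = v})"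
    by (intro sum.cong refl arg_cong[where f = "sum k"]) (auto simp: arcs_from_to_def)
  also have "\<dots> = sum k {b \<in> E. tail G b = u}"
    by (rule sum.group) auto
  also have "\<dots> = sum k E"
    by (rule sum.mono_neutral_left) (use assms in auto)
  finally show ?thesis .
qed

lemma pf_sum:
  assumes "v \<in> verts G"
  shows "(\<Sum>b\<in>E. if tail G b = v then \<phi> (head G b) else 0) = q3 h * \<phi> v"
proof -
  have "(\<Sum>b\<in>E. if tail G b = v then \<phi> (head G b) else 0)
      = (\<Sum>u\<in>verts G. \<Sum>b\<in>arcs_from_to G v u. if tail G b = v then \<phi> (head G b) else 0)"
    by (rule sum_from[symmetric]) auto
  also have "\<dots> = (\<Sum>u\<in>verts G. real (card (arcs_from_to G v u)) * \<phi> u)"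
    by (intro sum.cong refl) (simp add: arcs_from_to_def)
  finally show ?thesis
    using pf assms unfolding perron_frobenius_def by auto
qed

text \<open>Condition (I) freed from vertices: arcs with different end points cannot both occur in a
  triangle with the same \<open>b\<close> and \<open>c\<close>, so the additional sums vanish, as
  does the right-hand side.\<close>

lemma cellI:
  assumes "a \<in> E" "a' \<in> E"
  shows "(\<Sum>b\<in>E. \<Sum>c\<in>E. W a b c * cnj (W a' b c))
    = (if a = a' then of_real (q2 h * \<phi> (tail G a) * \<phi> (head G a)) else 0)"
proof (cases "tail G a' = tail G a \<and> head G a' = head G a")
  case True
  have "(\<Sum>b\<in>E. \<Sum>c\<in>E. W a b c * cnj (W a' b c))
      = (\<Sum>k\<in>verts G. \<Sum>b\<in>arcs_from_to G (head G a) k. \<Sum>c\<in>E. W a b c * cnj (W a' b c))"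
    by (rule sum_from[symmetric], rule sum.neutral) (use W_triD(4) in fastforce)
  also have "\<dots> = (\<Sum>k\<in>verts G. \<Sum>b\<in>arcs_from_to G (head G a) k.
      \<Sum>c\<in>arcs_from_to G k (tail G a). W a b c * cnj (W a' b c))"
    by (intro sum.cong refl sum_arcs_from_to[symmetric])
      (auto simp: arcs_from_to_def dest: W_triD)
  also have "\<dots> = of_bool (a = a') * of_real (q2 h * \<phi> (tail G a) * \<phi> (head G a))"
    using cs[unfolded cell_system_def, THEN conjunct2, THEN conjunct2, THEN conjunct1,
        rule_format, of "tail G a" "head G a" a a'] assms True
    by (simp add: arcs_from_to_def)
  finally show ?thesis by auto
next
  case False
  have "W a b c = 0 \<or> W a' b c = 0" for b c
    using False W_triD(4,6)[of a b c] W_triD(4,6)[of a' b c] by metis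
  then have "W a b c * cnj (W a' b c) = 0" for b c
    by simp
  then have "(\<Sum>b\<in>E. \<Sum>c\<in>E. W a b c * cnj (W a' b c)) = 0"
    by (intro sum.neutral ballI)
  with False show ?thesis by auto
qed

text \<open>Condition (II) freed from vertices: the middle vertex k is recovered as the head of
  \<open>b2\<close>, and the incidences that tie \<open>a3\<close> and \<open>a4\<close> to the rest
  move into the \<open>if\<close>.\<close>

lemma cellII:
  assumes "a1 \<in> E" "a2 \<in> E" "a3 \<in> E" "a4 \<in> E" and inc: "head G a1 = head G a2"
  shows "(\<Sum>b1\<in>E. \<Sum>b2\<in>E. \<Sum>b3\<in>E. \<Sum>b4\<in>E. of_real (inverse (\<phi> (head G b2))) *
           W a1 b2 b1 * cnj (W a2 b2 b3) * W a3 b4 b3 * cnj (W a4 b4 b1))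
        = (if tail G a3 = tail G a2 \<and> head G a4 = head G a3 \<and> tail G a4 = tail G a1 then
            of_bool (a1 = a4 \<and> a2 = a3) * of_real (\<phi> (tail G a1) * \<phi> (head G a1) * \<phi> (tail G a2))
          + of_bool (a1 = a2 \<and> a3 = a4) * of_real (\<phi> (tail G a1) * \<phi> (head G a1) * \<phi> (head G a3))
          else 0)" (is "?L = _")
proof (cases "tail G a3 = tail G a2 \<and> head G a4 = head G a3 \<and> tail G a4 = tail G a1")
  case True
  define t where "t b1 b2 b3 b4 = W a1 b2 b1 * cnj (W a2 b2 b3) * W a3 b4 b3 * cnj (W a4 b4 b1)"
    for b1 b2 b3 b4
  \<comment> \<open>One non-zero summand gives four triangles, and these contain all incidences that
    restrict the ranges in (II).\<close>
  have z: "t b1 b2 b3 b4 = 0" if "\<not> (tail G b2 = head G a1 \<and> tail G b4 = head G a3 \<and>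
      head G b1 = tail G a1 \<and> head G b3 = tail G a2 \<and> tail G b1 = head G b2 \<and>
      tail G b3 = head G b2 \<and> head G b4 = head G b2)" for b1 b2 b3 b4
  proof (rule ccontr)
    assume "t b1 b2 b3 b4 \<noteq> 0"
    then have "W a1 b2 b1 \<noteq> 0" "W a2 b2 b3 \<noteq> 0" "W a3 b4 b3 \<noteq> 0" "W a4 b4 b1 \<noteq> 0"
      by (auto simp: t_def)
    from this[THEN W_triD(4)] this[THEN W_triD(5)] this[THEN W_triD(6)] that inc show False by simp
  qed
  have "?L = (\<Sum>b2\<in>E. \<Sum>b1\<in>E. \<Sum>b3\<in>E. \<Sum>b4\<in>E.
      of_real (inverse (\<phi> (head G b2))) * t b1 b2 b3 b4)"
    by (subst sum.swap) (simp add: t_def mult.assoc)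
  also have "\<dots> = (\<Sum>k\<in>verts G. \<Sum>b2\<in>arcs_from_to G (head G a1) k. \<Sum>b1\<in>E. \<Sum>b3\<in>E. \<Sum>b4\<in>E.
      of_real (inverse (\<phi> (head G b2))) * t b1 b2 b3 b4)"
    by (rule sum_from[symmetric]) (simp add: z)
  also have "\<dots> = (\<Sum>k\<in>verts G. \<Sum>b2\<in>arcs_from_to G (head G a1) k.
      \<Sum>b1\<in>arcs_from_to G k (tail G a1). \<Sum>b3\<in>arcs_from_to G k (tail G a2).
      \<Sum>b4\<in>arcs_from_to G (head G a3) k. of_real (inverse (\<phi> k)) * t b1 b2 b3 b4)"
  proof (intro sum.cong[OF refl])
    fix k b2 assume "b2 \<in> arcs_from_to G (head G a1) k"
    then have k: "head G b2 = k" by (simp add: arcs_from_to_def)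
    have 1: "(\<Sum>b4\<in>arcs_from_to G (head G a3) k. of_real (inverse (\<phi> k)) * t b1 b2 b3 b4)
        = (\<Sum>b4\<in>E. of_real (inverse (\<phi> k)) * t b1 b2 b3 b4)" for b1 b3
      by (rule sum_arcs_from_to) (simp add: z k)
    have 2: "(\<Sum>b3\<in>arcs_from_to G k (tail G a2). \<Sum>b4\<in>E. of_real (inverse (\<phi> k)) * t b1 b2 b3 b4)
       = (\<Sum>b3\<in>E. \<Sum>b4\<in>E. of_real (inverse (\<phi> k)) * t b1 b2 b3 b4)" for b1
      by (rule sum_arcs_from_to) (simp add: z k)
    have 3: "(\<Sum>b1\<in>arcs_from_to G k (tail G a1). \<Sum>b3\<in>E. \<Sum>b4\<in>E. of_real (inverse (\<phi> k)) * t b1 b2 b3 b4)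
       = (\<Sum>b1\<in>E. \<Sum>b3\<in>E. \<Sum>b4\<in>E. of_real (inverse (\<phi> k)) * t b1 b2 b3 b4)"
      by (rule sum_arcs_from_to) (simp add: z k)
    show "(\<Sum>b1\<in>E. \<Sum>b3\<in>E. \<Sum>b4\<in>E. of_real (inverse (\<phi> (head G b2))) * t b1 b2 b3 b4) =
      (\<Sum>b1\<in>arcs_from_to G k (tail G a1). \<Sum>b3\<in>arcs_from_to G k (tail G a2).
      \<Sum>b4\<in>arcs_from_to G (head G a3) k. of_real (inverse (\<phi> k)) * t b1 b2 b3 b4)"
      unfolding 1 2 3 k ..
  qed
  also have "\<dots> = (\<Sum>k\<in>verts G. \<Sum>b1\<in>arcs_from_to G k (tail G a1).
      \<Sum>b2\<in>arcs_from_to G (head G a1) k. \<Sum>b3\<in>arcs_from_to G k (tail G a2).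
      \<Sum>b4\<in>arcs_from_to G (head G a3) k. of_real (inverse (\<phi> k)) *
        W a1 b2 b1 * cnj (W a2 b2 b3) * W a3 b4 b3 * cnj (W a4 b4 b1))"
    by (intro sum.cong[OF refl], subst sum.swap) (simp add: t_def mult.assoc)
  also have "\<dots> = of_bool (a1 = a4 \<and> a2 = a3) * of_real (\<phi> (tail G a1) * \<phi> (head G a1) * \<phi> (tail G a2))
          + of_bool (a1 = a2 \<and> a3 = a4) * of_real (\<phi> (tail G a1) * \<phi> (head G a1) * \<phi> (head G a3))"
  proof -
    have "a1 \<in> arcs_from_to G (tail G a1) (head G a1)" "a2 \<in> arcs_from_to G (tail G a2) (head G a1)"
      "a3 \<in> arcs_from_to G (tail G a2) (head G a3)" "a4 \<in> arcs_from_to G (tail G a1) (head G a3)"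
      using assms True by (auto simp: arcs_from_to_def)
    then show ?thesis
      using cs[unfolded cell_system_def, THEN conjunct2, THEN conjunct2, THEN conjunct2,
        rule_format, of "tail G a1" "head G a1" "tail G a2" "head G a3" a1 a2 a3 a4] assms(1-4)
      by simp
  qed
  finally show ?thesis by (simp only: if_P[OF True])
next
  case False
  have "of_real (inverse (\<phi> (head G b2))) *
           W a1 b2 b1 * cnj (W a2 b2 b3) * W a3 b4 b3 * cnj (W a4 b4 b1) = 0" for b1 b2 b3 b4
  proof (rule ccontr)
    assume "\<not> ?thesis"
    then have "W a1 b2 b1 \<noteq> 0" "W a2 b2 b3 \<noteq> 0" "W a3 b4 b3 \<noteq> 0" "W a4 b4 b1 \<noteq> 0" by auto
    from this[THEN W_triD(4)] this[THEN W_triD(5)] this[THEN W_triD(6)] False show False by simp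
  qed
  then have "?L = 0" by (intro sum.neutral ballI)
  then show ?thesis by (simp only: if_not_P[OF False])
qed

end

lemma sum_rot3:
  "(\<Sum>a\<in>A. \<Sum>b\<in>B. \<Sum>c\<in>C. f a b c) = (\<Sum>c\<in>C. \<Sum>a\<in>A. \<Sum>b\<in>B. f a b c)"
proof -
  have "(\<Sum>a\<in>A. \<Sum>b\<in>B. \<Sum>c\<in>C. f a b c) = (\<Sum>a\<in>A. \<Sum>c\<in>C. \<Sum>b\<in>B. f a b c)"
    by (intro sum.cong[OF refl] sum.swap)
  then show ?thesis by (simp only: sum.swap[of _ C A])
qed

text \<open>The regrouping used in \<open>red_hecke\<close>: from the order in which the operators
  unfold to the order in which condition (II) sums.\<close>

lemma sum_perm6:
  "(\<Sum>c\<in>E. \<Sum>c'\<in>E. \<Sum>d\<in>E. \<Sum>b\<in>E. \<Sum>k\<in>E. \<Sum>a\<in>E. f a b c' k d c)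
   = (\<Sum>a\<in>E. \<Sum>b\<in>E. \<Sum>c'\<in>E. \<Sum>k\<in>E. \<Sum>d\<in>E. \<Sum>c\<in>E. f a b c' k d c)"
  unfolding sum.cartesian_product
  by (rule sum.reindex_bij_witness[of _ "\<lambda>(a, b, c', k, d, c). (c, c', d, b, k, a)"
        "\<lambda>(c, c', d, b, k, a). (a, b, c', k, d, c)"]) auto

section \<open>The generators of the Hecke algebra\<close>

context cells
begin

text \<open>The normalisation that absorbs the factor \<phi>\<phi> of condition (I), so that U U =
  [2] U with a constant that does not depend on the arc.\<close>

definition N :: "'e \<Rightarrow> complex" where
  "N a = of_real (inverse (\<phi> (tail G a) * \<phi> (head G a)))"

text \<open>\<open>ext\<close> inserts the relation of an arc at the end of a path, \<open>red\<close> is the adjoint of that, and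
  \<open>U\<close> is the corresponding generator of the Hecke algebra.\<close>

definition red :: "'e lvec \<Rightarrow> 'e lvec" where
  "red x w = (case w of [] \<Rightarrow> 0 | a # v \<Rightarrow> \<Sum>c\<in>E. \<Sum>c'\<in>E. cnj (W a c c') * x (c' # c # v))"

definition ext :: "'e lvec \<Rightarrow> 'e lvec" where
  "ext y w = (case w of c' # c # v \<Rightarrow> \<Sum>a\<in>E. N a * W a c c' * y (a # v) | _ \<Rightarrow> 0)"

definition U :: "'e lvec \<Rightarrow> 'e lvec" where
  "U x = ext (red x)"

lemma red_simps [simp]:
  "red x [] = 0"
  "red x (a # v) = (\<Sum>c\<in>E. \<Sum>c'\<in>E. cnj (W a c c') * x (c' # c # v))"
  by (simp_all add: red_def)

lemma ext_simps [simp]: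
  "ext y [] = 0" "ext y [a] = 0"
  "ext y (c' # c # v) = (\<Sum>a\<in>E. N a * W a c c' * y (a # v))"
  by (simp_all add: ext_def)

lemma list2_cases:
  obtains "w = []" | a where "w = [a]" | a b v where "w = a # b # v"
  by (cases w; cases "tl w"; auto)

lemma lin_red: "lin red"
  unfolding lin_def
  by (auto simp: fun_eq_iff red_def sum.distrib algebra_simps sum_distrib_left split: list.splits)

lemma lin_ext: "lin ext"
  unfolding lin_def
  by (auto simp: fun_eq_iff ext_def sum.distrib algebra_simps sum_distrib_left split: list.splits)

lemma lin_U: "lin U"
  using lin_red lin_ext unfolding lin_def U_def by simp

text \<open>\<open>red\<close> only touches the last two arcs, so it commutes with whatever acts
  below them. It shortens the path by one arc, hence one \<open>lft\<close> fewer on the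
  right.\<close>

lemma red_lft:
  assumes "lin T"
  shows "red (lft (lft T) x) = lft T (red x)"
proof
  fix w
  show "red (lft (lft T) x) w = lft T (red x) w"
  proof (cases w)
    case (Cons a v)
    have "T (\<lambda>u. \<Sum>c\<in>E. 1 * (\<Sum>c'\<in>E. cnj (W a c c') * x (c' # c # u)))
        = (\<lambda>u. \<Sum>c\<in>E. 1 * (\<Sum>c'\<in>E. cnj (W a c c') * T (\<lambda>u. x (c' # c # u)) u))"
      by (subst lin_sum[OF assms], simp, subst lin_sum[OF assms], simp, rule refl)
    then show ?thesis by (simp add: Cons fun_eq_iff)
  qed simp
qed

lemma ext_lft:
  assumes "lin T"
  shows "ext (lft T x) = lft (lft T) (ext x)"
proof
  fix w
  show "ext (lft T x) w = lft (lft T) (ext x) w"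
  proof (cases w rule: list2_cases)
    case (3 a b v)
    have "T (\<lambda>u. \<Sum>c\<in>E. (N c * W c b a) * x (c # u))
        = (\<lambda>u. \<Sum>c\<in>E. (N c * W c b a) * T (\<lambda>u. x (c # u)) u)"
      by (rule lin_sum[OF assms]) simp
    then show ?thesis by (simp add: 3 fun_eq_iff)
  qed simp_all
qed

text \<open>Far commutativity: the two operators act on disjoint sets of arcs.\<close>

lemma U_lft: "lin T \<Longrightarrow> lft (lft T) (U x) = U (lft (lft T) x)"
  by (simp add: U_def ext_lft red_lft)

lemma red_outside: "a \<notin> E \<Longrightarrow> red x (a # v) = 0"
  using W_triD(1) by (simp, intro sum.neutral ballI) auto

lemma phi_ne [simp]: "v \<in> verts G \<Longrightarrow> \<phi> v \<noteq> 0"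
  using phi_pos[of v] by simp

text \<open>Condition (I), with the weight \<open>N\<close> cancelling \<phi>\<phi>. This is U U =
  [2] U before the outer \<open>ext\<close> is applied.\<close>

lemma red_ext_red: "red (ext (red x)) = (\<lambda>w. of_real (q2 h) * red x w)"
proof
  fix w
  show "red (ext (red x)) w = of_real (q2 h) * red x w"
  proof (cases w)
    case (Cons a v)
    show ?thesis
    proof (cases "a \<in> E")
      case True
      let ?y = "\<lambda>a. red x (a # v)"
      have "red (ext (red x)) (a # v)
          = (\<Sum>c\<in>E. \<Sum>c'\<in>E. \<Sum>a'\<in>E. N a' * ?y a' * (W a' c c' * cnj (W a c c')))"
        by (simp add: sum_distrib_left algebra_simps del: red_simps(2))
          (simp add: red_simps(2)[of "ext (red x)"] sum_distrib_left algebra_simps del: red_simps(2))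
      also have "\<dots> = (\<Sum>a'\<in>E. \<Sum>c\<in>E. \<Sum>c'\<in>E. N a' * ?y a' * (W a' c c' * cnj (W a c c')))"
        by (rule sum_rot3)
      also have "\<dots> = (\<Sum>a'\<in>E. N a' * ?y a' * (\<Sum>c\<in>E. \<Sum>c'\<in>E. W a' c c' * cnj (W a c c')))"
        by (simp only: sum_distrib_left)
      also have "\<dots> = (\<Sum>a'\<in>E. if a' = a then of_real (q2 h) * ?y a else 0)"
        by (rule sum.cong[OF refl]) (use True in \<open>auto simp: cellI N_def field_simps simp del: red_simps\<close>)
      also have "\<dots> = of_real (q2 h) * ?y a"
        using True by (simp del: red_simps)
      finally show ?thesis by (simp only: Cons)
    next
      case False
      then show ?thesis by (simp add: Cons red_outside del: red_simps)
    qed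
  qed simp
qed

text \<open>Composability for reversed lists: the arc in front is travelled after the one behind
  it.\<close>

fun pth :: "'e list \<Rightarrow> bool" where
  "pth (a # b # w) \<longleftrightarrow> head G b = tail G a \<and> pth (b # w)"
| "pth _ \<longleftrightarrow> True"

definition supp :: "nat \<Rightarrow> 'e lvec \<Rightarrow> bool" where
  "supp m x \<longleftrightarrow> (\<forall>w. x w \<noteq> 0 \<longrightarrow> pth w \<and> length w = m \<and> set w \<subseteq> E)"

text \<open>By cyclic symmetry cnj (W a c c') = cnj (W c' a c), so summing over \<open>a\<close> and
  \<open>c\<close> for fixed \<open>c'\<close> gives the contraction of the part of \<open>z\<close>
  below \<open>c'\<close>, which is zero by \<open>red0\<close>. The restriction on the tail of
  \<open>a\<close> becomes one on the head of \<open>c'\<close>.\<close>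

lemma red_diag:
  assumes red0: "\<And>a. red (\<lambda>w. z (a # w)) = (\<lambda>_. 0)" and supp: "supp m z"
  shows "(\<Sum>a\<in>E. if tail G a = i then red z (a # a # w) else 0) = 0"
proof -
  have "(\<Sum>a\<in>E. if tail G a = i then red z (a # a # w) else 0)
     = (\<Sum>a\<in>E. \<Sum>c\<in>E. \<Sum>c'\<in>E. if head G c' = i then cnj (W c' a c) * z (c' # c # a # w) else 0)"
  proof (rule sum.cong[OF refl])
    fix a assume "a \<in> E"
    have "cnj (W a c c') = cnj (W c' a c)" for c c' using W_cyc[of c' a c] by simp
    moreover have "W c' a c = 0" if "(head G c' = i) \<noteq> (tail G a = i)" for c c'
      using that W_triD(4)[of c' a c] by metis
    ultimately show "(if tail G a = i then red z (a # a # w) else 0)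
      = (\<Sum>c\<in>E. \<Sum>c'\<in>E. if head G c' = i then cnj (W c' a c) * z (c' # c # a # w) else 0)"
      by (auto intro!: sum.cong sum.neutral sum.neutral[symmetric])
  qed
  also have "\<dots> = (\<Sum>c'\<in>E. \<Sum>a\<in>E. \<Sum>c\<in>E. if head G c' = i then cnj (W c' a c) * z (c' # c # a # w) else 0)"
    by (rule sum_rot3)
  also have "\<dots> = (\<Sum>c'\<in>E. if head G c' = i then red (\<lambda>w. z (c' # w)) (c' # w) else 0)"
    by (rule sum.cong[OF refl]) auto
  also have "\<dots> = 0"
    by (simp only: red0) simp
  finally show ?thesis .
qed

text \<open>With U1 acting on the last two arcs and U2 one place below, this is U1 U2 U1 - U1 = U2
  U1 U2 - U2 evaluated at a vector with U2 z = 0, stripped of the outer \<open>ext\<close>.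
  Condition (II) provides it.\<close>

lemma red_hecke:
  assumes red0: "\<And>a. red (\<lambda>w. z (a # w)) = (\<lambda>_. 0)" and supp: "supp m z" and m: "3 \<le> m"
  shows "red (lft U (U z)) = red z"
proof
  fix w0
  define y where "y = red z"
  \<comment> \<open>\<open>cellII\<close> needs two arcs with a common head; this holds wherever
    \<open>y\<close> is non-zero.\<close>
  have ysupp: "head G a = head G b" if "y (a # b # w) \<noteq> 0" for a b w
  proof -
    have "\<exists>c c'. cnj (W a c c') * z (c' # c # b # w) \<noteq> 0"
      using that unfolding y_def red_simps by (meson sum.not_neutral_contains_not_neutral)
    then obtain c c' where "W a c c' \<noteq> 0" "z (c' # c # b # w) \<noteq> 0" by auto
    then show ?thesis using W_triD(4)[of a c c'] supp unfolding supp_def by force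
  qed
  have short: "y w = 0" if "length w < 2" for w
  proof (cases w)
    case (Cons a v)
    have "z (c' # c # v) = 0" for c c'
      using supp m that Cons unfolding supp_def by force
    then show ?thesis by (simp add: Cons y_def)
  qed (simp add: y_def)
  show "red (lft U (U z)) w0 = red z w0"
  proof (cases w0 rule: list2_cases)
    case 1
    then show ?thesis by simp
  next
    case (2 g)
    then show ?thesis using short[of "[g]"] by (simp add: y_def U_def)
  next
    case (3 g e w)
    show ?thesis
    proof (cases "g \<in> E \<and> e \<in> E")
      case False
      show ?thesis
      proof (cases "e \<in> E")
        case True
        with False show ?thesis by (simp add: 3 red_outside del: red_simps)
      next
        case e: False
        then have "z (c' # c # e # w) = 0" for c c'
          using supp unfolding supp_def by force
        moreover have "U x (c # e # w) = 0" for x c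
          unfolding U_def ext_simps using e W_triD(2)[of _ e c] by (intro sum.neutral) auto
        ultimately show ?thesis by (simp add: 3)
      qed
    next
      case True
      let ?II = "\<lambda>a b. \<Sum>c'\<in>E. \<Sum>k\<in>E. \<Sum>d\<in>E. \<Sum>c\<in>E. of_real (inverse (\<phi> (head G k))) *
           W a k c' * cnj (W b k d) * W e c d * cnj (W g c c')"
      \<comment> \<open>In the triangle d b k the weight of \<open>d\<close> splits into a factor at
        the tail of \<open>b\<close> and one at the head of \<open>k\<close>. The latter is the
        inverse of \<phi> at the middle vertex of (II), and rotating the cells brings them into the
        order of (II).\<close>
      have coeff: "cnj (W g c c') * (N d * W d e c * (cnj (W d b k) * (N a * W a k c' * t)))
        = t * N a * of_real (inverse (\<phi> (tail G b))) * (of_real (inverse (\<phi> (head G k))) *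
           W a k c' * cnj (W b k d) * W e c d * cnj (W g c c'))" for a b c c' d k t
      proof (cases "W d b k = 0")
        case False
        then have "N d = of_real (inverse (\<phi> (tail G b))) * of_real (inverse (\<phi> (head G k)))"
          using W_triD(4,6)[OF False] by (simp add: N_def)
        then show ?thesis by (simp only: W_cyc[of d]) (simp add: mult_ac)
      qed (simp add: W_cyc[of d b k, symmetric])
      have "red (lft U (U z)) w0 = (\<Sum>c\<in>E. \<Sum>c'\<in>E. cnj (W g c c') * (\<Sum>d\<in>E. N d * W d e c *
          (\<Sum>b\<in>E. \<Sum>k\<in>E. cnj (W d b k) * (\<Sum>a\<in>E. N a * W a k c' * y (a # b # w)))))"
        by (simp only: 3 U_def red_simps(2)[of "lft _ _"] lft_simps ext_simps
            red_simps(2)[of "\<lambda>u. ext _ (_ # u)"] y_def[symmetric])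
      also have "\<dots> = (\<Sum>c\<in>E. \<Sum>c'\<in>E. \<Sum>d\<in>E. \<Sum>b\<in>E. \<Sum>k\<in>E. \<Sum>a\<in>E.
          y (a # b # w) * N a * of_real (inverse (\<phi> (tail G b))) * (of_real (inverse (\<phi> (head G k))) *
           W a k c' * cnj (W b k d) * W e c d * cnj (W g c c')))"
        by (simp only: sum_distrib_left coeff)
      also have "\<dots> = (\<Sum>a\<in>E. \<Sum>b\<in>E. \<Sum>c'\<in>E. \<Sum>k\<in>E. \<Sum>d\<in>E. \<Sum>c\<in>E.
          y (a # b # w) * N a * of_real (inverse (\<phi> (tail G b))) * (of_real (inverse (\<phi> (head G k))) *
           W a k c' * cnj (W b k d) * W e c d * cnj (W g c c')))"
        by (rule sum_perm6)
      also have "\<dots> = (\<Sum>a\<in>E. \<Sum>b\<in>E. y (a # b # w) * N a * of_real (inverse (\<phi> (tail G b))) * ?II a b)"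
        by (simp only: sum_distrib_left)
      \<comment> \<open>The first delta term of (II) reproduces \<open>y\<close> at (g, e). The
        second collapses to a diagonal sum, which \<open>red_diag\<close> kills.\<close>
      also have "\<dots> = (\<Sum>a\<in>E. \<Sum>b\<in>E. (if b = e then if a = g then y (g # e # w) else 0 else 0)
          + (if b = a then if e = g \<and> tail G a = tail G e then
               y (a # a # w) * (\<phi> (head G e) / \<phi> (tail G e)) else 0 else 0))"
      proof (intro sum.cong[OF refl])
        fix a b assume ab: "a \<in> E" "b \<in> E"
        show "y (a # b # w) * N a * of_real (inverse (\<phi> (tail G b))) * ?II a b
          = (if b = e then if a = g then y (g # e # w) else 0 else 0)
          + (if b = a then if e = g \<and> tail G a = tail G e then
               y (a # a # w) * (\<phi> (head G e) / \<phi> (tail G e)) else 0 else 0)"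
        proof (cases "y (a # b # w) = 0")
          case False
          then have inc: "head G a = head G b" by (rule ysupp)
          have II: "?II a b = (if tail G e = tail G b \<and> head G g = head G e \<and> tail G g = tail G a then
            of_bool (a = g \<and> b = e) * of_real (\<phi> (tail G a) * \<phi> (head G a) * \<phi> (tail G b))
          + of_bool (a = b \<and> e = g) * of_real (\<phi> (tail G a) * \<phi> (head G a) * \<phi> (head G e))
          else 0)"
            using True ab inc by (intro cellII) auto
          have cancel: "y (a # b # w) * N a * of_real (inverse (\<phi> (tail G b))) *
              of_real (\<phi> (tail G a) * \<phi> (head G a) * r) = y (a # b # w) * of_real (r / \<phi> (tail G b))"
            for r using ab by (simp add: N_def field_simps)
          let ?C = "tail G e = tail G b \<and> head G g = head G e \<and> tail G g = tail G a"
          let ?T = "y (a # b # w) * N a * of_real (inverse (\<phi> (tail G b)))"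
          have C: ?C if "a = g" "b = e" using inc that by simp
          have C': "?C \<longleftrightarrow> tail G a = tail G e" if "a = b" "e = g" using that by auto
          have 1: "?T * (of_bool (a = g \<and> b = e) * of_real (\<phi> (tail G a) * \<phi> (head G a) * \<phi> (tail G b)))
            = (if b = e then if a = g then y (g # e # w) else 0 else 0)"
          proof (cases "a = g \<and> b = e")
            case True
            then have "y (a # b # w) * of_real (\<phi> (tail G b) / \<phi> (tail G b)) = y (g # e # w)"
              using ab by simp
            with True show ?thesis unfolding cancel[symmetric] by (simp del: of_real_mult of_real_inverse)
          qed auto
          have 2: "?T * (of_bool (a = b \<and> e = g) * of_real (\<phi> (tail G a) * \<phi> (head G a) * \<phi> (head G e)))
            = (if b = a then if e = g then y (a # a # w) * (\<phi> (head G e) / \<phi> (tail G a)) else 0 else 0)"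
          proof (cases "a = b \<and> e = g")
            case True
            then have "y (a # b # w) * of_real (\<phi> (head G e) / \<phi> (tail G b))
                = y (a # a # w) * (\<phi> (head G e) / \<phi> (tail G a))"
              by simp
            with True show ?thesis unfolding cancel[symmetric] by (simp del: of_real_mult of_real_inverse)
          qed auto
          show ?thesis
          proof (cases ?C)
            case c: True
            have "tail G a = tail G e" if "b = a" using c that by metis
            then show ?thesis unfolding II if_P[OF c] distrib_left 1 2 by auto
          next
            case c: False
            from c C have "\<not> (a = g \<and> b = e)" by metis
            then have z1: "(if b = e then if a = g then y (g # e # w) else 0 else 0) = 0"
              by auto
            from c C' have "\<not> (a = b \<and> e = g \<and> tail G a = tail G e)" by metis
            then have z2: "(if b = a then if e = g \<and> tail G a = tail G e then
               y (a # a # w) * (\<phi> (head G e) / \<phi> (tail G e)) else 0 else 0) = 0"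
              by auto
            show ?thesis
              by (simp only: II if_not_P[OF c] z1 z2 mult_zero_right add_0_right)
          qed
        next
          case y0: True
          then have z1: "(if b = e then if a = g then y (g # e # w) else 0 else 0) = 0"
            by auto
          from y0 have z2: "(if b = a then if e = g \<and> tail G a = tail G e then
               y (a # a # w) * (\<phi> (head G e) / \<phi> (tail G e)) else 0 else 0) = 0"
            by auto
          show ?thesis
            by (simp only: y0 z1 z2 mult_zero_left add_0_right)
        qed
      qed
      also have "\<dots> = y (g # e # w) + (if e = g then (\<phi> (head G e) / \<phi> (tail G e)) *
          (\<Sum>a\<in>E. if tail G a = tail G e then y (a # a # w) else 0) else 0)"
        using True by (cases "e = g") (auto simp: sum.distrib sum_distrib_left intro!: sum.cong)
      also have "\<dots> = y (g # e # w)"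
        unfolding y_def using red_diag[OF red0 supp] by simp
      finally show ?thesis by (simp only: 3 y_def)
    qed
  qed
qed

end

section \<open>Symmetrisers and the vanishing of long paths\<close>

context cells
begin

definition cf :: "nat \<Rightarrow> complex" where
  "cf n = of_real (qn h n / qn h (Suc n))"

text \<open>Wenzl's recursion for the projection onto the symmetric vectors.\<close>

primrec Pr :: "nat \<Rightarrow> 'e lvec \<Rightarrow> 'e lvec" where
  "Pr 0 x = x"
| "Pr (Suc n) x = (\<lambda>w. lft (Pr n) x w - cf n * lft (Pr n) (U (lft (Pr n) x)) w)"

text \<open>Killed by the relation at every place among the last \<open>n\<close> arcs. A single arc
  has no such place, hence the guard \<open>0 < n\<close>.\<close>

primrec Sym :: "nat \<Rightarrow> 'e lvec \<Rightarrow> bool" where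
  "Sym 0 x \<longleftrightarrow> True"
| "Sym (Suc n) x \<longleftrightarrow> (0 < n \<longrightarrow> red x = (\<lambda>_. 0)) \<and> (\<forall>a. Sym n (\<lambda>w. x (a # w)))"

lemma cf_0 [simp]: "cf 0 = 0"
  by (simp add: cf_def)

lemma lin_Pr: "lin (Pr n)"
proof (induction n)
  case 0
  show ?case by (simp add: lin_def)
next
  case (Suc n)
  note L = lin_lft[OF Suc]
  show ?case
    unfolding lin_def
    by (auto simp: lin_add[OF L] lin_scale[OF L] lin_add[OF lin_U] lin_scale[OF lin_U]
        fun_eq_iff algebra_simps)
qed

lemma Sym_diff: "Sym n x \<Longrightarrow> Sym n y \<Longrightarrow> Sym n (\<lambda>w. x w - c * y w)"
  by (induction n arbitrary: x y) (simp_all add: lin_diff[OF lin_red])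

text \<open>On a symmetric vector \<open>U\<close> vanishes and only the identity term of the
  recursion survives. For \<open>n = 0\<close> nothing is known about \<open>U x\<close>, but there
  the coefficient \<open>cf 0\<close> is 0.\<close>

lemma Pr_fix: "Sym n x \<Longrightarrow> Pr n x = x"
proof (induction n arbitrary: x)
  case (Suc n)
  have L: "lft (Pr n) x = x"
  proof
    fix w show "lft (Pr n) x w = x w"
      by (cases w) (use Suc in auto)
  qed
  have Z: "cf n * lft (Pr n) (U x) w = 0" for w
  proof (cases "n = 0")
    case False
    then have "U x = (\<lambda>_. 0)"
      using Suc.prems by (simp add: U_def lin_zero[OF lin_ext])
    then show ?thesis by (simp add: lin_zero[OF lin_lft[OF lin_Pr]])
  qed simp
  show ?case unfolding Pr.simps L Z diff_0_right ..
qed simp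

text \<open>The common end vertex \<open>v\<close> keeps \<open>a # u\<close> composable when an
  operator under \<open>lft\<close> changes the tail \<open>u\<close>; the plain \<open>supp\<close>
  would not be preserved by \<open>lft\<close>.\<close>

definition suppv :: "nat \<Rightarrow> 'v \<Rightarrow> 'e lvec \<Rightarrow> bool" where
  "suppv m v x \<longleftrightarrow> (\<forall>w. x w \<noteq> 0 \<longrightarrow>
     pth w \<and> length w = m \<and> set w \<subseteq> E \<and> (w \<noteq> [] \<longrightarrow> head G (hd w) = v))"

lemma suppvD:
  assumes "suppv m v x" "x w \<noteq> 0"
  shows "pth w" "length w = m" "set w \<subseteq> E" "w \<noteq> [] \<Longrightarrow> head G (hd w) = v"
  using assms unfolding suppv_def by blast+

lemma suppv_supp: "suppv m v x \<Longrightarrow> supp m x"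
  unfolding suppv_def supp_def by blast

lemma suppv_tail:
  assumes "suppv (Suc m) v x"
  shows "suppv m (tail G a) (\<lambda>w. x (a # w))"
  unfolding suppv_def
proof (intro allI impI)
  fix w assume "x (a # w) \<noteq> 0"
  note * = suppvD[OF assms this]
  from * show "pth w \<and> length w = m \<and> set w \<subseteq> E \<and> (w \<noteq> [] \<longrightarrow> head G (hd w) = tail G a)"
    by (cases w) simp_all
qed

lemma suppv_lft:
  assumes T: "\<And>v x. suppv m v x \<Longrightarrow> suppv m v (T x)" and "lin T" and x: "suppv (Suc m) v x"
  shows "suppv (Suc m) v (lft T x)"
  unfolding suppv_def
proof (intro allI impI)
  fix w assume w: "lft T x w \<noteq> 0"
  show "pth w \<and> length w = Suc m \<and> set w \<subseteq> E \<and> (w \<noteq> [] \<longrightarrow> head G (hd w) = v)"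
  proof (cases w)
    case Nil
    then show ?thesis using w suppvD(2)[OF x, of "[]"] by auto
  next
    case (Cons a u)
    with w have u: "T (\<lambda>w. x (a # w)) u \<noteq> 0" by simp
    then have "(\<lambda>w. x (a # w)) \<noteq> (\<lambda>_. 0)"
      using lin_zero[OF \<open>lin T\<close>] by auto
    then obtain w' where "x (a # w') \<noteq> 0" by auto
    note 1 = suppvD[OF x this]
    note 2 = suppvD[OF T[OF suppv_tail[OF x]] u]
    show ?thesis
      using 1 2 unfolding Cons by (cases u) auto
  qed
qed

lemma red_nz:
  assumes "red x (a # v) \<noteq> 0"
  obtains c c' where "W a c c' \<noteq> 0" "x (c' # c # v) \<noteq> 0"
proof -
  have "\<exists>c c'. cnj (W a c c') * x (c' # c # v) \<noteq> 0"
    using assms unfolding red_simps by (meson sum.not_neutral_contains_not_neutral)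
  then show thesis using that by auto
qed

lemma suppv_U:
  assumes x: "suppv m v x"
  shows "suppv m v (U x)"
  unfolding suppv_def
proof (intro allI impI)
  fix w assume w: "U x w \<noteq> 0"
  show "pth w \<and> length w = m \<and> set w \<subseteq> E \<and> (w \<noteq> [] \<longrightarrow> head G (hd w) = v)"
  proof (cases w rule: list2_cases)
    case (3 c' c u)
    have "\<exists>a\<in>E. N a * W a c c' * red x (a # u) \<noteq> 0"
      using w unfolding 3 U_def ext_simps by (meson sum.not_neutral_contains_not_neutral)
    then obtain a where a: "W a c c' \<noteq> 0" "red x (a # u) \<noteq> 0" by auto
    then obtain b b' where b: "W a b b' \<noteq> 0" "x (b' # b # u) \<noteq> 0" by (metis red_nz)
    note A = W_triD[OF a(1)] and B = W_triD[OF b(1)] and X = suppvD[OF x b(2)]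
    have "head G c' = v" using A(6) B(6) X(4) by simp
    moreover have "pth (c # u)"
      using X(1) A(4) B(4) by (cases u) simp_all
    ultimately show ?thesis
      using A(2,3,5) X(2,3) by (simp add: 3)
  qed (use w in \<open>simp_all add: U_def\<close>)
qed

lemma suppv_diff: "suppv m v x \<Longrightarrow> suppv m v y \<Longrightarrow> suppv m v (\<lambda>w. x w - c * y w)"
  unfolding suppv_def by (metis diff_0_right mult_zero_right)

lemma suppv_Pr: "n \<le> m \<Longrightarrow> suppv m v x \<Longrightarrow> suppv m v (Pr n x)"
proof (induction n arbitrary: m v x)
  case (Suc n)
  then obtain k where m: "m = Suc k" "n \<le> k" by (cases m) auto
  have L: "suppv m v (lft (Pr n) x)" if "suppv m v x" for x
    unfolding m(1) by (rule suppv_lft[OF Suc.IH]) (use that m lin_Pr in auto)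
  show ?case
    unfolding Pr.simps by (intro suppv_diff L suppv_U Suc.prems)
qed simp

text \<open>With n = k + 1, expand \<open>Pr n\<close> once. The inner projection
  \<open>Pr k\<close> commutes with \<open>U\<close> and fixes \<open>z\<close>, so after
  \<open>red\<close> there remain [2] red z from \<open>red_ext_red\<close> and [k]/[k+1] red z from
  \<open>red_hecke\<close>.\<close>

lemma lft_Pr_U:
  assumes z: "\<And>a. Sym n (\<lambda>w. z (a # w))" and n: "0 < n" "Suc n < h" and m: "Suc n \<le> m" "supp m z"
  shows "red (lft (Pr n) (U z)) = (\<lambda>w. inverse (cf n) * red z w)"
proof -
  obtain k where k: "n = Suc k" using n by (cases n) auto
  have L: "lft (lft (Pr k)) z = z"
  proof
    fix w show "lft (lft (Pr k)) z w = z w"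
    proof (cases w rule: list2_cases)
      case (3 a b v)
      have "Sym k (\<lambda>w. z (a # b # w))" using z[of a] by (simp add: k)
      from Pr_fix[OF this] show ?thesis by (simp add: 3)
    qed simp_all
  qed
  have LU: "lft (lft (Pr k)) (U z) = U z"
    by (simp add: U_lft[OF lin_Pr] L)
  have eq: "lft (Pr n) (U z) = (\<lambda>w. U z w - cf k * lft (lft (Pr k)) (lft U (U z)) w)"
  proof
    fix w
    show "lft (Pr n) (U z) w = U z w - cf k * lft (lft (Pr k)) (lft U (U z)) w"
    proof (cases w)
      case (Cons a v)
      have "lft (Pr k) (\<lambda>u. U z (a # u)) = (\<lambda>u. U z (a # u))"
      proof
        fix u show "lft (Pr k) (\<lambda>u. U z (a # u)) u = U z (a # u)"
          using fun_cong[OF LU, of "a # u"] by simp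
      qed
      then show ?thesis by (simp add: Cons k)
    qed (simp add: U_def)
  qed
  have K: "cf k * red (lft (lft (Pr k)) (lft U (U z))) w = cf k * red z w" for w
  proof (cases "k = 0")
    case False
    have "red (\<lambda>w. z (a # w)) = (\<lambda>_. 0)" for a
      using z[of a] False by (simp add: k)
    then have "red (lft U (U z)) = red z"
      by (rule red_hecke[OF _ m(2)]) (use m False k in auto)
    then have "red (lft (lft (Pr k)) (lft U (U z))) = red (lft (lft (Pr k)) z)"
      by (simp add: red_lft[OF lin_Pr])
    then show ?thesis by (simp add: L)
  qed simp
  \<comment> \<open>The factor is [2] - [k]/[k+1] = [k+2]/[k+1], the inverse of
    \<open>cf (k + 1)\<close>.\<close>
  have "q2 h * qn h n = qn h (Suc n) + qn h k"
    using qn_rec[of h k] by (simp add: k)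
  moreover have "qn h n \<noteq> 0" "qn h (Suc n) \<noteq> 0"
    using qn_pos[of n h] qn_pos[of "Suc n" h] n by simp_all
  ultimately have "q2 h - qn h k / qn h n = inverse (qn h n / qn h (Suc n))"
    by (simp add: field_simps)
  then have q: "complex_of_real (q2 h) - cf k = inverse (cf n)"
    unfolding cf_def k by (metis of_real_diff of_real_inverse)
  show ?thesis
    unfolding eq lin_diff[OF lin_red] K unfolding U_def red_ext_red
    by (simp add: q[symmetric] algebra_simps)
qed

lemma cf_nz: "0 < n \<Longrightarrow> Suc n < h \<Longrightarrow> cf n \<noteq> 0"
  using qn_pos[of n h] qn_pos[of "Suc n" h] by (simp add: cf_def)

text \<open>The coefficient \<open>cf n\<close> is the inverse of the factor in
  \<open>lft_Pr_U\<close>, so the correction term cancels \<open>red z\<close>. The lower relations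
  survive because both terms are symmetric below the last arc.\<close>

lemma Sym_Pr: "n < h \<Longrightarrow> n \<le> m \<Longrightarrow> suppv m v x \<Longrightarrow> Sym n (Pr n x)"
proof (induction n arbitrary: m v x)
  case (Suc n)
  then obtain k where m: "m = Suc k" "n \<le> k" by (cases m) auto
  define z where "z = lft (Pr n) x"
  have zs: "suppv m v z"
    unfolding z_def m(1) by (rule suppv_lft[OF suppv_Pr]) (use Suc.prems m lin_Pr in auto)
  have za: "Sym n (\<lambda>w. z (a # w))" for a
    unfolding z_def lft_simps by (rule Suc.IH[OF _ m(2) suppv_tail]) (use Suc.prems m in auto)
  have "Sym n (Pr n (\<lambda>w. U z (a # w)))" for a
    by (rule Suc.IH[OF _ m(2) suppv_tail]) (use Suc.prems m suppv_U[OF zs] in auto)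
  then have "Sym n (\<lambda>w. z (a # w) - cf n * Pr n (\<lambda>w. U z (a # w)) w)" for a
    by (intro Sym_diff za)
  moreover have "red (\<lambda>w. z w - cf n * lft (Pr n) (U z) w) = (\<lambda>_. 0)" if "0 < n"
    using that Suc.prems cf_nz[of n] lft_Pr_U[OF za that _ _ suppv_supp[OF zs]]
    by (simp add: lin_diff[OF lin_red] mult.assoc[symmetric])
  ultimately show ?case
    by (simp add: z_def[symmetric])
qed simp

section \<open>Inner product and self-adjointness of the projections\<close>

primrec ip :: "nat \<Rightarrow> 'e lvec \<Rightarrow> 'e lvec \<Rightarrow> complex" where
  "ip 0 x y = x [] * cnj (y [])"
| "ip (Suc n) x y = (\<Sum>a\<in>E. ip n (\<lambda>w. x (a # w)) (\<lambda>w. y (a # w)))"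

lemma ip_cnj: "cnj (ip n x y) = ip n y x"
  by (induction n arbitrary: x y) simp_all

lemma ip_add: "ip n (\<lambda>w. x w + y w) z = ip n x z + ip n y z"
  by (induction n arbitrary: x y z) (simp_all add: sum.distrib algebra_simps)

lemma ip_scale: "ip n (\<lambda>w. c * x w) z = c * ip n x z"
  by (induction n arbitrary: x z) (simp_all add: sum_distrib_left)

lemma ip_zero [simp]: "ip n (\<lambda>_. 0) z = 0" "ip n z (\<lambda>_. 0) = 0"
  using ip_scale[of n 0 "\<lambda>_. 0" z] ip_cnj[of n "\<lambda>_. 0" z] by simp_all

lemma ip_diff: "ip n (\<lambda>w. x w - c * y w) z = ip n x z - c * ip n y z"
  using ip_add[of n x "\<lambda>w. (- c) * y w" z] ip_scale[of n "- c" y z] by simp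

lemma ip_diff_right: "ip n z (\<lambda>w. x w - c * y w) = ip n z x - cnj c * ip n z y"
  using arg_cong[OF ip_diff[of n x c y z], of cnj] by (simp add: ip_cnj)

lemma ip_sum:
  assumes "finite S"
  shows "ip n (\<lambda>w. \<Sum>i\<in>S. k i * f i w) z = (\<Sum>i\<in>S. k i * ip n (f i) z)"
  using assms by (induction S rule: finite_induct) (simp_all add: ip_add ip_scale)

lemma ip_lft:
  assumes "\<And>x y. ip n (T x) y = ip n x (T y)"
  shows "ip (Suc n) (lft T x) y = ip (Suc n) x (lft T y)"
  by (simp add: assms)

text \<open>\<open>ext\<close> and \<open>red\<close> are adjoint up to the weights
  \<open>N\<close>. As these are real, the composition \<open>U\<close> is self-adjoint.\<close>

lemma ip_ext:
  "ip (Suc (Suc n)) (ext u) y = (\<Sum>a\<in>E. N a * ip n (\<lambda>w. u (a # w)) (\<lambda>w. red y (a # w)))"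
proof -
  have R: "ip n x (\<lambda>w. red y (a # w)) = (\<Sum>c\<in>E. \<Sum>c'\<in>E. W a c c' * ip n x (\<lambda>w. y (c' # c # w)))" for a x
  proof -
    have "ip n x (\<lambda>w. red y (a # w)) = cnj (ip n (\<lambda>w. \<Sum>c\<in>E. 1 * (\<Sum>c'\<in>E. cnj (W a c c') * y (c' # c # w))) x)"
      by (simp add: ip_cnj)
    also have "\<dots> = (\<Sum>c\<in>E. \<Sum>c'\<in>E. W a c c' * ip n x (\<lambda>w. y (c' # c # w)))"
      by (subst ip_sum, simp, subst ip_sum) (simp_all add: ip_cnj)
    finally show ?thesis .
  qed
  have "ip (Suc (Suc n)) (ext u) y
     = (\<Sum>c'\<in>E. \<Sum>c\<in>E. \<Sum>a\<in>E. N a * W a c c' * ip n (\<lambda>w. u (a # w)) (\<lambda>w. y (c' # c # w)))"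
    by (simp add: ip_sum)
  also have "\<dots> = (\<Sum>a\<in>E. \<Sum>c'\<in>E. \<Sum>c\<in>E. N a * W a c c' * ip n (\<lambda>w. u (a # w)) (\<lambda>w. y (c' # c # w)))"
    by (rule sum_rot3)
  also have "\<dots> = (\<Sum>a\<in>E. \<Sum>c\<in>E. \<Sum>c'\<in>E. N a * W a c c' * ip n (\<lambda>w. u (a # w)) (\<lambda>w. y (c' # c # w)))"
    by (intro sum.cong[OF refl] sum.swap)
  finally show ?thesis
    by (simp add: R sum_distrib_left mult.assoc del: red_simps ip.simps)
qed

lemma ip_U: "ip (Suc n) (U x) y = ip (Suc n) x (U y)"
proof (cases n)
  case (Suc k)
  have N: "cnj (N a) = N a" for a by (simp add: N_def)
  have "ip (Suc n) x (U y) = cnj (ip (Suc n) (U y) x)"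
    by (simp only: ip_cnj)
  also have "\<dots> = ip (Suc n) (U x) y"
    unfolding Suc U_def ip_ext by (simp add: N ip_cnj del: red_simps)
  finally show ?thesis ..
qed (simp add: U_def)

text \<open>The recursion is a palindrome in self-adjoint operators, with a real
  coefficient.\<close>

lemma ip_Pr: "n \<le> m \<Longrightarrow> ip m (Pr n x) y = ip m x (Pr n y)"
proof (induction n arbitrary: m x y)
  case (Suc n)
  then obtain k where m: "m = Suc k" "n \<le> k" by (cases m) auto
  have L: "ip m (lft (Pr n) x) y = ip m x (lft (Pr n) y)" for x y
    unfolding m(1) by (rule ip_lft[OF Suc.IH[OF m(2)]])
  have Um: "ip m (U x) y = ip m x (U y)" for x y
    unfolding m(1) by (rule ip_U)
  have "cnj (cf n) = cf n" by (simp add: cf_def)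
  then show ?case
    by (simp add: ip_diff ip_diff_right L Um)
qed simp

lemma ip_pos: "0 \<le> Re (ip n x x)"
  by (induction n arbitrary: x) (simp_all add: sum_nonneg)

lemma ip_definite:
  "Re (ip n x x) = 0 \<Longrightarrow> length w = n \<Longrightarrow> set w \<subseteq> E \<Longrightarrow> x w = 0"
proof (induction n arbitrary: x w)
  case 0
  then have "(Re (x []))\<^sup>2 + (Im (x []))\<^sup>2 = 0" by (simp add: power2_eq_square)
  then show ?case using 0 by (simp add: complex_eq_iff sum_power2_eq_zero_iff)
next
  case (Suc n)
  obtain a v where w: "w = a # v" using Suc.prems by (cases w) auto
  have "Re (ip n (\<lambda>w. x (a # w)) (\<lambda>w. x (a # w))) = 0"
    using Suc.prems w by (simp add: sum_nonneg_eq_0_iff ip_pos)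
  from Suc.IH[OF this, of v] show ?case using Suc.prems w by simp
qed

lemma ip_null:
  assumes "\<And>w. length w = n \<Longrightarrow> set w \<subseteq> E \<Longrightarrow> y w = 0"
  shows "ip n x y = 0"
  using assms by (induction n arbitrary: x y) (auto intro!: sum.neutral)

definition dlt :: "'e list \<Rightarrow> 'e lvec" where
  "dlt w = (\<lambda>u. if u = w then 1 else 0)"

lemma dlt_tail: "(\<lambda>u. dlt (a # w) (b # u)) = (if b = a then dlt w else (\<lambda>_. 0))"
  by (auto simp: dlt_def)

lemma ip_dlt: "length w = n \<Longrightarrow> set w \<subseteq> E \<Longrightarrow> ip n x (dlt w) = x w"
proof (induction n arbitrary: x w)
  case 0
  then show ?case by (simp add: dlt_def)
next
  case (Suc n)
  obtain a v where w: "w = a # v" using Suc.prems by (cases w) auto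
  have "ip (Suc n) x (dlt w) = (\<Sum>b\<in>E. if b = a then ip n (\<lambda>w. x (a # w)) (dlt v) else 0)"
    unfolding w ip.simps by (rule sum.cong) (auto simp: dlt_tail)
  then show ?case using Suc w by simp
qed

lemma suppv_dlt:
  "pth w \<Longrightarrow> set w \<subseteq> E \<Longrightarrow> w \<noteq> [] \<Longrightarrow> suppv (length w) (head G (hd w)) (dlt w)"
  unfolding suppv_def dlt_def by auto

text \<open>Here \<open>z a\<close> is \<open>y\<close> prolonged by \<open>a\<close>. The weight at
  the head of \<open>a\<close> cancels one factor of \<open>N e\<close>, because \<open>e\<close>
  starts where \<open>a\<close> ends; after rotating the cells the sum over \<open>a\<close> and
  \<open>e\<close> is that of condition (I).\<close>

lemma weighted_partial_trace:
  assumes y: "suppv p v y" and "v \<in> verts G" and "0 < p"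
  defines "z \<equiv> \<lambda>a w. case w of [] \<Rightarrow> 0 | b # u \<Rightarrow> if b = a then y u else 0"
  shows "(\<lambda>w. \<Sum>a\<in>E. of_real (\<phi> (head G a)) * U (z a) (a # w))
    = (\<lambda>w. of_real (q2 h * \<phi> v) * y w)"
proof
  fix w
  show "(\<Sum>a\<in>E. of_real (\<phi> (head G a)) * U (z a) (a # w)) = of_real (q2 h * \<phi> v) * y w"
  proof (cases w)
    case Nil
    then have "y w = 0" using y \<open>0 < p\<close> unfolding suppv_def by auto
    then show ?thesis by (simp add: Nil U_def)
  next
    case (Cons b u)
    have rz: "red (z a) (e # u) = (\<Sum>c\<in>E. if a \<in> E then cnj (W e c a) * y (c # u) else 0)" for a e
      unfolding red_simps
      by (rule sum.cong) (simp_all add: z_def if_distrib cong: if_cong)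
    have "(\<Sum>a\<in>E. of_real (\<phi> (head G a)) * U (z a) (a # w))
      = (\<Sum>a\<in>E. \<Sum>e\<in>E. \<Sum>c\<in>E. of_real (\<phi> (head G a)) * (N e * W e b a * (cnj (W e c a) * y (c # u))))"
      by (simp add: Cons U_def rz sum_distrib_left del: red_simps)
    also have "\<dots> = (\<Sum>a\<in>E. \<Sum>e\<in>E. \<Sum>c\<in>E.
        of_real (inverse (\<phi> (tail G b))) * (W b a e * cnj (W c a e) * y (c # u)))"
    proof (intro sum.cong[OF refl])
      fix a e c assume "e \<in> E"
      show "of_real (\<phi> (head G a)) * (N e * W e b a * (cnj (W e c a) * y (c # u)))
        = of_real (inverse (\<phi> (tail G b))) * (W b a e * cnj (W c a e) * y (c # u))"
      proof (cases "W e b a = 0")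
        case False
        then have "\<phi> (head G a) \<noteq> 0" "head G e = tail G b" "tail G e = head G a"
          using W_triD[OF False] by simp_all
        then have "of_real (\<phi> (head G a)) * N e = of_real (inverse (\<phi> (tail G b)))"
          by (simp add: N_def)
        then have "of_real (\<phi> (head G a)) * (N e * W e b a * (cnj (W e c a) * y (c # u)))
          = of_real (inverse (\<phi> (tail G b))) * (W e b a * cnj (W e c a) * y (c # u))"
          by (metis mult.assoc)
        then show ?thesis by (simp only: W_cyc[of e])
      qed (simp add: W_cyc[of e b a, symmetric])
    qed
    also have "\<dots> = (\<Sum>c\<in>E. \<Sum>a\<in>E. \<Sum>e\<in>E.
        of_real (inverse (\<phi> (tail G b))) * (W b a e * cnj (W c a e) * y (c # u)))"
      by (rule sum_rot3)
    also have "\<dots> = (\<Sum>c\<in>E. of_real (inverse (\<phi> (tail G b))) * (\<Sum>a\<in>E. \<Sum>e\<in>E. W b a e * cnj (W c a e)) * y (c # u))"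
      by (simp only: sum_distrib_left sum_distrib_right mult.assoc)
    also have "\<dots> = (if b \<in> E then of_real (q2 h * \<phi> (head G b)) * y (b # u) else 0)"
    proof (cases "b \<in> E")
      case True
      have "(\<Sum>c\<in>E. of_real (inverse (\<phi> (tail G b))) * (\<Sum>a\<in>E. \<Sum>e\<in>E. W b a e * cnj (W c a e)) * y (c # u))
        = (\<Sum>c\<in>E. if c = b then of_real (q2 h * \<phi> (head G b)) * y (b # u) else 0)"
        using True by (intro sum.cong[OF refl]) (auto simp: cellI field_simps)
      then show ?thesis using True by simp
    next
      case False
      then have "W b a e = 0" for a e using W_triD(1)[of b a e] by auto
      with False show ?thesis by simp
    qed
    also have "\<dots> = of_real (q2 h * \<phi> v) * y w"
      using suppvD(3,4)[OF y, of w] by (auto simp: Cons)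
    finally show ?thesis .
  qed
qed

text \<open>Fix the path \<open>t\<close> below the last arc and sum the diagonal entries of the
  projection over all prolongations of \<open>t\<close>, weighted by \<phi> at the new end. The
  result is \<phi>(v) y(t) times [3] - [p][2]/[p+1], where p = h - 3, and hence zero.\<close>

lemma Pr_dlt_zero:
  assumes w: "length w = h - 2" "pth w" "set w \<subseteq> E" and u: "length u = h - 2" "set u \<subseteq> E"
  shows "Pr (h - 2) (dlt w) u = 0"
proof -
  define p where "p = h - 3"
  have h: "h = p + 3" "0 < p" "h - 2 = Suc p" using h4 by (auto simp: p_def)
  obtain a0 t where wt: "w = a0 # t" using w h by (cases w) auto
  have t: "length t = p" "pth t" "set t \<subseteq> E" "t \<noteq> []" "head G (hd t) = tail G a0" "a0 \<in> E"
    using w wt h by (cases t; simp)+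
  define v where "v = tail G a0"
  have v: "v \<in> verts G" using t by (simp add: v_def)
  have dt: "suppv p v (dlt t)"
    using suppv_dlt[of t] t by (simp add: v_def)
  define y where "y = Pr p (dlt t)"
  have ys: "suppv p v y" unfolding y_def by (rule suppv_Pr[OF order_refl dt])
  have ySym: "Sym p y" unfolding y_def by (rule Sym_Pr[OF _ order_refl dt]) (use h in auto)
  \<comment> \<open>One projected basis vector for each prolongation; the given path
    \<open>w\<close> is the case \<open>a = a0\<close>.\<close>
  define x where "x a = Pr (Suc p) (dlt (a # t))" for a
  have xs: "Sym (Suc p) (x a)" "x a w = ip (Suc p) (x a) (dlt w)"
    "Pr (Suc p) (x a) = x a"
    if a: "a \<in> E" "tail G a = v" and w: "length w = Suc p" "set w \<subseteq> E" for a w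
  proof -
    have "pth (a # t)" using t a by (cases t) (auto simp: v_def)
    then have sv: "suppv (Suc p) (head G a) (dlt (a # t))"
      using suppv_dlt[of "a # t"] t a by simp
    show S: "Sym (Suc p) (x a)"
      unfolding x_def by (rule Sym_Pr[OF _ order_refl sv]) (use h in auto)
    show "Pr (Suc p) (x a) = x a" by (rule Pr_fix[OF S])
    show "x a w = ip (Suc p) (x a) (dlt w)" by (rule ip_dlt[OF w, symmetric])
  qed
  \<comment> \<open>The projection fixes \<open>x a\<close> and is self-adjoint, so the diagonal
    entry is a squared norm.\<close>
  have diag: "x a (a # t) = ip (Suc p) (x a) (x a)" if a: "a \<in> E" "tail G a = v" for a
  proof -
    have "x a (a # t) = ip (Suc p) (Pr (Suc p) (x a)) (dlt (a # t))"
      using xs(2,3)[OF a, of "a # t"] t a by simp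
    also have "\<dots> = ip (Suc p) (x a) (x a)"
      by (subst ip_Pr[OF order_refl]) (simp only: x_def)
    finally show ?thesis .
  qed
  let ?z = "\<lambda>a w. case w of [] \<Rightarrow> 0 | b # u \<Rightarrow> if b = a then y u else 0"
  have z: "lft (Pr p) (dlt (a # t)) = ?z a" for a
  proof
    fix w show "lft (Pr p) (dlt (a # t)) w = ?z a w"
      by (cases w) (simp_all add: dlt_tail y_def lin_zero[OF lin_Pr], simp add: dlt_def)
  qed
  have val: "x a (a # t) = y t - cf p * Pr p (\<lambda>w. U (?z a) (a # w)) t" for a
    unfolding x_def Pr.simps z by simp
  \<comment> \<open>Arcs that do not prolong \<open>t\<close> contribute nothing, so the trace
    formula, which sums over all arcs, can be applied.\<close>
  have out: "U (?z a) (a # w) = 0" if "tail G a \<noteq> v" for a w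
  proof (rule ccontr)
    assume nz: "U (?z a) (a # w) \<noteq> 0"
    then obtain b u where w: "w = b # u" by (cases w) (auto simp: U_def)
    have "\<exists>e\<in>E. N e * W e b a * red (?z a) (e # u) \<noteq> 0"
      using nz unfolding w U_def ext_simps by (meson sum.not_neutral_contains_not_neutral)
    then obtain e where "W e b a \<noteq> 0" "red (?z a) (e # u) \<noteq> 0" by auto
    then obtain c c' where c: "W e c c' \<noteq> 0" "?z a (c' # c # u) \<noteq> 0" by (metis red_nz)
    then have "c' = a" "y (c # u) \<noteq> 0" by (auto split: if_splits)
    then have "head G c = v" using suppvD(4)[OF ys] by fastforce
    then show False using W_triD(5)[OF c(1)] that \<open>c' = a\<close> by simp
  qed
  have "(\<Sum>a\<in>E. of_real (\<phi> (head G a)) * Pr p (\<lambda>w. U (?z a) (a # w)) t)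
     = Pr p (\<lambda>w. \<Sum>a\<in>E. of_real (\<phi> (head G a)) * U (?z a) (a # w)) t"
    by (subst lin_sum[OF lin_Pr]) simp_all
  also have "\<dots> = of_real (q2 h * \<phi> v) * y t"
    unfolding weighted_partial_trace[OF ys v h(2)] lin_scale[OF lin_Pr] Pr_fix[OF ySym] ..
  finally have B: "(\<Sum>a\<in>E. of_real (\<phi> (head G a)) * Pr p (\<lambda>w. U (?z a) (a # w)) t)
     = of_real (q2 h * \<phi> v) * y t" .
  have "(\<Sum>a\<in>E. if tail G a = v then of_real (\<phi> (head G a)) * x a (a # t) else 0)
     = (\<Sum>a\<in>E. (if tail G a = v then of_real (\<phi> (head G a)) else 0) * y t
         - cf p * (of_real (\<phi> (head G a)) * Pr p (\<lambda>w. U (?z a) (a # w)) t))"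
    by (rule sum.cong[OF refl]) (auto simp: val out lin_zero[OF lin_Pr] algebra_simps)
  also have "\<dots> = (\<Sum>a\<in>E. if tail G a = v then of_real (\<phi> (head G a)) else 0) * y t
      - cf p * (of_real (q2 h * \<phi> v) * y t)"
    by (simp only: sum_subtractf sum_distrib_left[symmetric] sum_distrib_right[symmetric] B)
  also have "(\<Sum>a\<in>E. if tail G a = v then complex_of_real (\<phi> (head G a)) else 0)
      = of_real (\<Sum>a\<in>E. if tail G a = v then \<phi> (head G a) else 0)"
    by (simp add: of_real_sum if_distrib cong: if_cong)
  also have "\<dots> = of_real (q3 h * \<phi> v)"
    by (simp only: pf_sum[OF v])
  also have "of_real (q3 h * \<phi> v) * y t - cf p * (of_real (q2 h * \<phi> v) * y t)
      = of_real (\<phi> v * (q3 h - qn h p / qn h (Suc p) * q2 h)) * y t"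
    by (simp add: cf_def algebra_simps)
  \<comment> \<open>The numerator is [p + 3] = [h] = 0.\<close>
  also have "q3 h - qn h p / qn h (Suc p) * q2 h = 0"
    using qn_3[of h p] qn_h[of h] qn_pos[of "Suc p" h] h by (simp add: field_simps)
  finally have S: "(\<Sum>a\<in>E. if tail G a = v then of_real (\<phi> (head G a)) * x a (a # t) else 0) = 0"
    by simp
  \<comment> \<open>Non-negative terms with sum 0 vanish one by one. For \<open>a0\<close> the
    positive weight leaves a vanishing norm.\<close>
  have "(\<Sum>a\<in>E. if tail G a = v then \<phi> (head G a) * Re (ip (Suc p) (x a) (x a)) else 0) = 0"
    using arg_cong[OF S, of Re] by (simp add: Re_sum diag if_distrib cong: if_cong del: ip.simps)
  moreover have "0 \<le> (if tail G a = v then \<phi> (head G a) * Re (ip (Suc p) (x a) (x a)) else 0)"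
    if "a \<in> E" for a
    using that phi_pos[of "head G a"] ip_pos by (simp add: less_imp_le del: ip.simps)
  ultimately have "(if tail G a0 = v then \<phi> (head G a0) * Re (ip (Suc p) (x a0) (x a0)) else 0) = 0"
    using t(6) by (subst (asm) sum_nonneg_eq_0_iff) auto
  then have "Re (ip (Suc p) (x a0) (x a0)) = 0"
    using t(6) by (simp add: v_def del: ip.simps)
  from ip_definite[OF this, of u] show ?thesis
    using u h by (simp add: x_def wt)
qed

text \<open>The projection fixes \<open>x\<close> and is self-adjoint; moving it onto the basis
  vector of \<open>w\<close> gives 0.\<close>

theorem Sym_vanish:
  assumes x: "Sym (h - 2) x" and "\<And>w. x w \<noteq> 0 \<Longrightarrow> pth w"
    and w: "length w = h - 2" "set w \<subseteq> E"
  shows "x w = 0"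
proof (cases "pth w")
  case True
  have "x w = ip (h - 2) (Pr (h - 2) x) (dlt w)"
    using ip_dlt[OF w] Pr_fix[OF x] by simp
  also have "\<dots> = ip (h - 2) x (Pr (h - 2) (dlt w))"
    by (rule ip_Pr) simp
  also have "\<dots> = 0"
    by (rule ip_null) (use Pr_dlt_zero w True in blast)
  finally show ?thesis .
qed (use assms in blast)

end

section \<open>The path algebra\<close>

lemma pm_expand: "x = (\<Sum>k\<in>Poly_Mapping.keys x. Poly_Mapping.single k (Poly_Mapping.lookup x k))"
proof (rule poly_mapping_eqI)
  fix k
  have "Poly_Mapping.lookup (\<Sum>k\<in>Poly_Mapping.keys x. Poly_Mapping.single k (Poly_Mapping.lookup x k)) k
    = (\<Sum>i\<in>Poly_Mapping.keys x. if i = k then Poly_Mapping.lookup x k else 0)"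
    by (simp add: lookup_sum lookup_single when_def)
  then show "Poly_Mapping.lookup x k
    = Poly_Mapping.lookup (\<Sum>k\<in>Poly_Mapping.keys x. Poly_Mapping.single k (Poly_Mapping.lookup x k)) k"
    by (simp add: in_keys_iff)
qed

lemma pm_induct [consumes 1, case_names zero single add]:
  fixes x :: "'k \<Rightarrow>\<^sub>0 'b::comm_monoid_add"
  assumes x: "Poly_Mapping.keys x \<subseteq> S" and 0: "P 0"
    and s: "\<And>k c. k \<in> S \<Longrightarrow> P (Poly_Mapping.single k c)"
    and add: "\<And>x y. Poly_Mapping.keys x \<subseteq> S \<Longrightarrow> Poly_Mapping.keys y \<subseteq> S \<Longrightarrow> P x \<Longrightarrow> P y \<Longrightarrow> P (x + y)"
  shows "P x"
proof -
  have "P (\<Sum>k\<in>K. Poly_Mapping.single k (Poly_Mapping.lookup x k)) \<and>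
     Poly_Mapping.keys (\<Sum>k\<in>K. Poly_Mapping.single k (Poly_Mapping.lookup x k)) \<subseteq> S"
    if "finite K" "K \<subseteq> Poly_Mapping.keys x" for K
    using that
  proof (induction K rule: finite_induct)
    case (insert k K)
    have k: "Poly_Mapping.keys (Poly_Mapping.single k (Poly_Mapping.lookup x k)) \<subseteq> S" "k \<in> S"
      using insert.prems x by auto
    then show ?case
      using insert keys_add[of "Poly_Mapping.single k (Poly_Mapping.lookup x k)"
          "\<Sum>k\<in>K. Poly_Mapping.single k (Poly_Mapping.lookup x k)"]
      by (auto intro!: add s)
  qed (simp add: 0)
  from this[OF finite_keys order_refl] show ?thesis
    using pm_expand[of x] by metis
qed

context fin_digraph
begin

abbreviation CG where "CG \<equiv> path_algebra G"
abbreviation pmul (infixl \<open>\<star>\<close> 70) where "x \<star> y \<equiv> x \<otimes>\<^bsub>path_algebra G\<^esub> y"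
abbreviation sng where "sng u p c \<equiv> Poly_Mapping.single (u, p) (c::complex)"

lemma paths_Nil [simp]: "(u, []) \<in> paths G \<longleftrightarrow> u \<in> verts G"
  by (auto simp: paths_def awalk_def)

lemma paths_Cons [simp]:
  "(u, a # p) \<in> paths G \<longleftrightarrow> a \<in> arcs G \<and> tail G a = u \<and> (head G a, p) \<in> paths G"
  by (auto simp: paths_def awalk_def)

lemma awlast_append: "awlast u (p @ q) = awlast (awlast u p) q"
  by (induction p arbitrary: u) simp_all

lemma paths_append:
  "(u, p) \<in> paths G \<Longrightarrow> (awlast u p, q) \<in> paths G \<Longrightarrow> (u, p @ q) \<in> paths G"
  by (induction p arbitrary: u) simp_all

lemma awlast_verts: "(u, p) \<in> paths G \<Longrightarrow> awlast u p \<in> verts G"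
  by (induction p arbitrary: u) simp_all

lemma paths_verts: "(u, p) \<in> paths G \<Longrightarrow> u \<in> verts G"
  by (auto simp: paths_def awalk_def)

lemma pa_simps:
  "add CG = (+)" "zero CG = 0" "carrier CG = {x. Poly_Mapping.keys x \<subseteq> paths G}"
  "one CG = (\<Sum>v\<in>verts G. sng v [] 1)"
  by (simp_all add: path_algebra_def)

lemma pa_mult:
  "x \<star> y = (\<Sum>k\<in>Poly_Mapping.keys x. \<Sum>l\<in>Poly_Mapping.keys y.
     if awlast (fst k) (snd k) = fst l then
       Poly_Mapping.single (fst k, snd k @ snd l) (Poly_Mapping.lookup x k * Poly_Mapping.lookup y l) else 0)"
  by (simp add: path_algebra_def case_prod_unfold cong: if_cong)

lemma pa_distr_r: "(x + y) \<star> z = x \<star> z + y \<star> z"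
  unfolding pa_mult
  by (rule setsum_keys_plus_distrib)
    (auto intro!: sum.neutral simp: sum.distrib[symmetric] distrib_right single_add intro!: sum.cong)

lemma pa_distr_l: "z \<star> (x + y) = z \<star> x + z \<star> y"
  unfolding pa_mult sum.distrib[symmetric]
  by (intro sum.cong[OF refl] setsum_keys_plus_distrib) (auto simp: distrib_left single_add)

lemma pa_zero [simp]: "0 \<star> z = 0" "z \<star> 0 = 0"
  by (simp_all add: pa_mult)

lemma pa_single:
  "sng u p c \<star> sng v q d = (if awlast u p = v then sng u (p @ q) (c * d) else 0)"
  by (auto simp: pa_mult)

lemma pa_closed_single: "(u, p) \<in> paths G \<Longrightarrow> sng u p c \<in> carrier CG"
  by (simp add: pa_simps)

lemma pa_closed_zero [simp]: "0 \<in> carrier CG"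
  by (simp add: pa_simps)

lemma pa_closed_add: "x \<in> carrier CG \<Longrightarrow> y \<in> carrier CG \<Longrightarrow> x + y \<in> carrier CG"
  using keys_add[of x y] by (auto simp: pa_simps)

lemma pa_closed_uminus: "x \<in> carrier CG \<Longrightarrow> - x \<in> carrier CG"
  by (simp add: pa_simps keys_def)

lemma pa_closed_sum: "(\<And>i. i \<in> S \<Longrightarrow> f i \<in> carrier CG) \<Longrightarrow> sum f S \<in> carrier CG"
  by (induction S rule: infinite_finite_induct) (auto intro: pa_closed_add)

lemma pa_induct [consumes 1, case_names zero single add]:
  assumes "x \<in> carrier CG" "P 0"
    "\<And>u p c. (u, p) \<in> paths G \<Longrightarrow> P (sng u p c)"
    "\<And>x y. x \<in> carrier CG \<Longrightarrow> y \<in> carrier CG \<Longrightarrow> P x \<Longrightarrow> P y \<Longrightarrow> P (x + y)"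
  shows "P x"
proof -
  from assms(1) have "Poly_Mapping.keys x \<subseteq> paths G" by (simp add: pa_simps)
  then show ?thesis
  proof (induction x rule: pm_induct)
    case (single k c)
    then show ?case using assms(3)[of "fst k" "snd k" c] by simp
  qed (use assms in \<open>auto simp: pa_simps\<close>)
qed

lemma pa_closed_mult: "x \<in> carrier CG \<Longrightarrow> y \<in> carrier CG \<Longrightarrow> x \<star> y \<in> carrier CG"
proof (induction x rule: pa_induct)
  case (single u p c)
  from single(2,1) show ?case
  proof (induction y rule: pa_induct)
    case (single v q d)
    then show ?case
      by (auto simp: pa_single intro!: pa_closed_single paths_append)
  qed (auto simp: pa_distr_l intro: pa_closed_add)
qed (auto simp: pa_distr_r intro: pa_closed_add)

lemma pa_sum_l: "finite S \<Longrightarrow> z \<star> (sum f S) = (\<Sum>i\<in>S. z \<star> f i)"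
  by (induction S rule: finite_induct) (simp_all add: pa_distr_l)

lemma pa_sum_r: "finite S \<Longrightarrow> (sum f S) \<star> z = (\<Sum>i\<in>S. f i \<star> z)"
  by (induction S rule: finite_induct) (simp_all add: pa_distr_r)

text \<open>The scalar \<open>c\<close> as an element of the path algebra; scalar multiplication is
  multiplication by these central elements.\<close>

definition psc :: "complex \<Rightarrow> ('a, 'b) pathvec" where
  "psc c = (\<Sum>v\<in>verts G. sng v [] c)"

lemma psc_closed [simp]: "psc c \<in> carrier CG"
  unfolding psc_def by (intro pa_closed_sum pa_closed_single) simp

lemma psc_single: "(u, p) \<in> paths G \<Longrightarrow> psc c \<star> sng u p d = sng u p (c * d)"
  using paths_verts[of u p] by (simp add: psc_def pa_sum_r pa_single)

lemma single_psc: "(u, p) \<in> paths G \<Longrightarrow> sng u p d \<star> psc c = sng u p (c * d)"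
  using awlast_verts[of u p] by (simp add: psc_def pa_sum_l pa_single mult.commute)

lemma psc_one: "x \<in> carrier CG \<Longrightarrow> psc 1 \<star> x = x"
  by (induction x rule: pa_induct) (simp_all add: psc_single pa_distr_l)

lemma psc_comm: "x \<in> carrier CG \<Longrightarrow> x \<star> psc c = psc c \<star> x"
  by (induction x rule: pa_induct) (simp_all add: psc_single single_psc pa_distr_l pa_distr_r)

lemma pa_assoc:
  assumes "x \<in> carrier CG" "y \<in> carrier CG" "z \<in> carrier CG"
  shows "x \<star> y \<star> z = x \<star> (y \<star> z)"
  using assms(1)
proof (induction x rule: pa_induct)
  case (single u p c)
  from assms(2) show ?case
  proof (induction y rule: pa_induct)
    case (single v q d)
    from assms(3) show ?case
      by (induction z rule: pa_induct) (simp_all add: pa_single pa_distr_l awlast_append mult.assoc)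
  qed (simp_all add: pa_distr_l pa_distr_r)
qed (simp_all add: pa_distr_r)

lemma one_psc: "\<one>\<^bsub>CG\<^esub> = psc 1"
  by (simp add: pa_simps psc_def)

lemma path_algebra_ring: "ring CG"
proof (rule ringI)
  show "abelian_group CG"
  proof (rule abelian_groupI)
    fix x assume "x \<in> carrier CG"
    then show "\<exists>y\<in>carrier CG. y \<oplus>\<^bsub>CG\<^esub> x = \<zero>\<^bsub>CG\<^esub>"
      by (intro bexI[of _ "- x"]) (simp_all add: pa_simps(1,2) pa_closed_uminus)
  qed (auto simp: pa_simps(1,2) pa_closed_add algebra_simps)
  show "monoid CG"
    by (rule monoidI) (simp_all add: pa_closed_mult pa_assoc one_psc psc_one psc_comm)
qed (simp_all add: pa_simps(1,2) pa_distr_l pa_distr_r)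

lemma psc_add: "psc (c + d) = psc c + psc d"
  by (simp add: psc_def single_add sum.distrib)

lemma psc_0 [simp]: "psc 0 = 0"
  by (simp add: psc_def)

lemma psc_mult: "psc c \<star> psc d = psc (c * d)"
  unfolding psc_def[of d] psc_def[of "c * d"] by (simp add: pa_sum_l psc_single)

lemma single_scaled: "(u, p) \<in> paths G \<Longrightarrow> sng u p c = psc c \<star> sng u p 1"
  by (simp add: psc_single)

lemma psc_minus: "x \<in> carrier CG \<Longrightarrow> psc (- 1) \<star> x = - x"
  using pa_distr_r[of "psc 1" "psc (- 1)" x] psc_add[of 1 "- 1"]
  by (simp add: psc_one eq_neg_iff_add_eq_0 add.commute)

lemma path_part_iff:
  "x \<in> path_part G n \<longleftrightarrow> Poly_Mapping.keys x \<subseteq> {(u, p). (u, p) \<in> paths G \<and> length p = n}"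
  unfolding path_part_def by (auto simp: pa_simps)

lemma path_part_closed: "x \<in> path_part G n \<Longrightarrow> x \<in> carrier CG"
  by (simp add: path_part_def)

lemma path_part_single: "(u, p) \<in> paths G \<Longrightarrow> length p = n \<Longrightarrow> sng u p c \<in> path_part G n"
  by (simp add: path_part_iff)

lemma path_part_zero [simp]: "0 \<in> path_part G n"
  by (simp add: path_part_iff)

lemma path_part_add: "x \<in> path_part G n \<Longrightarrow> y \<in> path_part G n \<Longrightarrow> x + y \<in> path_part G n"
  using keys_add[of x y] unfolding path_part_iff by blast

lemma path_part_uminus: "x \<in> path_part G n \<Longrightarrow> - x \<in> path_part G n"
  unfolding path_part_iff by (simp add: keys_def)

lemma path_part_sum: "(\<And>i. i \<in> S \<Longrightarrow> f i \<in> path_part G n) \<Longrightarrow> sum f S \<in> path_part G n"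
  by (induction S rule: infinite_finite_induct) (auto intro: path_part_add)

lemma path_part_induct [consumes 1, case_names zero single add]:
  assumes "x \<in> path_part G n" "P 0"
    "\<And>u p c. (u, p) \<in> paths G \<Longrightarrow> length p = n \<Longrightarrow> P (sng u p c)"
    "\<And>x y. x \<in> path_part G n \<Longrightarrow> y \<in> path_part G n \<Longrightarrow> P x \<Longrightarrow> P y \<Longrightarrow> P (x + y)"
  shows "P x"
  using assms(1)[unfolded path_part_iff]
proof (induction x rule: pm_induct)
  case (single k c)
  then show ?case using assms(3)[of "fst k" "snd k" c] by auto
qed (use assms in \<open>auto simp: path_part_iff\<close>)

lemma path_part_mult:
  assumes "x \<in> path_part G m" "y \<in> path_part G n"
  shows "x \<star> y \<in> path_part G (m + n)"
  using assms(1)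
proof (induction x rule: path_part_induct)
  case (single u p c)
  from assms(2) show ?case
  proof (induction y rule: path_part_induct)
    case (single v q d)
    then show ?case using \<open>(u, p) \<in> paths G\<close> \<open>length p = m\<close>
      by (auto simp: pa_single intro!: path_part_single paths_append)
  qed (auto simp: pa_distr_l intro: path_part_add)
qed (auto simp: pa_distr_r intro: path_part_add)

lemma psc_part: "psc c \<in> path_part G 0"
  unfolding psc_def by (intro path_part_sum path_part_single) auto

end

section \<open>The algebra of a cell system\<close>

locale cell_alg = fin_digraph G for G :: "('v, 'e) pre_digraph" +
  fixes W :: "'e \<Rightarrow> 'e \<Rightarrow> 'e \<Rightarrow> complex"
  assumes W_triangle: "W a b c \<noteq> 0 \<Longrightarrow> triangle G a b c"
begin

abbreviation A where "A \<equiv> cell_algebra G W"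
abbreviation amul (infixl \<open>\<cdot>\<close> 70) where "x \<cdot> y \<equiv> x \<otimes>\<^bsub>cell_algebra G W\<^esub> y"
abbreviation ve where "ve \<equiv> vert_elt G W"
abbreviation ae where "ae \<equiv> arc_elt G W"
abbreviation sc where "sc \<equiv> scal G W"
abbreviation gr where "gr \<equiv> alg_part G W"

lemma W_triangleD:
  assumes "W a b c \<noteq> 0"
  shows "a \<in> arcs G" "b \<in> arcs G" "c \<in> arcs G"
    "head G a = tail G b" "head G b = tail G c" "head G c = tail G a"
  using W_triangle[OF assms] unfolding triangle_def by auto

lemma rho_closed: "rho G W a \<in> carrier CG"
  unfolding rho_def
proof (intro pa_closed_sum)
  fix b b' assume "b \<in> arcs G" "b' \<in> arcs G"
  then show "sng (tail G b) [b, b'] (W a b b') \<in> carrier CG"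
    using W_triangleD(5)[of a b b'] by (cases "W a b b' = 0") (auto intro!: pa_closed_single)
qed

lemma ideal_I: "ideal (cell_ideal G W) CG"
  unfolding cell_ideal_def
  by (rule ring.genideal_ideal[OF path_algebra_ring]) (use rho_closed in auto)

lemma I_closed:
  "x \<in> cell_ideal G W \<Longrightarrow> x \<in> carrier CG"
  "0 \<in> cell_ideal G W"
  "x \<in> cell_ideal G W \<Longrightarrow> y \<in> cell_ideal G W \<Longrightarrow> x + y \<in> cell_ideal G W"
  "x \<in> cell_ideal G W \<Longrightarrow> y \<in> carrier CG \<Longrightarrow> x \<star> y \<in> cell_ideal G W"
  "x \<in> cell_ideal G W \<Longrightarrow> y \<in> carrier CG \<Longrightarrow> y \<star> x \<in> cell_ideal G W"
proof -
  interpret ideal "cell_ideal G W" CG by (rule ideal_I)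
  show "x \<in> cell_ideal G W \<Longrightarrow> x \<in> carrier CG" by (rule a_Hcarr)
  show "0 \<in> cell_ideal G W" using additive_subgroup.zero_closed[OF is_additive_subgroup] by (simp add: pa_simps)
  show "x \<in> cell_ideal G W \<Longrightarrow> y \<in> cell_ideal G W \<Longrightarrow> x + y \<in> cell_ideal G W"
    using additive_subgroup.a_closed[OF is_additive_subgroup] by (simp add: pa_simps)
  show "x \<in> cell_ideal G W \<Longrightarrow> y \<in> carrier CG \<Longrightarrow> x \<star> y \<in> cell_ideal G W" by (rule I_r_closed)
  show "x \<in> cell_ideal G W \<Longrightarrow> y \<in> carrier CG \<Longrightarrow> y \<star> x \<in> cell_ideal G W" by (rule I_l_closed)
qed

lemma I_uminus: "x \<in> cell_ideal G W \<Longrightarrow> - x \<in> cell_ideal G W"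
  using I_closed(5)[of x "psc (- 1)"] psc_minus[of x] I_closed(1)[of x] by simp

lemma cls_eq_image: "cls G W x = (\<lambda>i. i + x) ` cell_ideal G W"
  unfolding cls_def a_r_coset_def' by (auto simp: pa_simps)

lemma cls_eq_iff:
  "cls G W x = cls G W y \<longleftrightarrow> x - y \<in> cell_ideal G W"
proof
  assume "cls G W x = cls G W y"
  then have "0 + x \<in> (\<lambda>i. i + y) ` cell_ideal G W"
    unfolding cls_eq_image using I_closed(2) by blast
  then show "x - y \<in> cell_ideal G W" by auto
next
  assume xy: "x - y \<in> cell_ideal G W"
  have "i + x \<in> (\<lambda>i. i + y) ` cell_ideal G W" if "i \<in> cell_ideal G W" for i
    by (rule image_eqI[of _ _ "i + (x - y)"]) (use that xy I_closed(3) in auto)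
  moreover have "i + y \<in> (\<lambda>i. i + x) ` cell_ideal G W" if "i \<in> cell_ideal G W" for i
    by (rule image_eqI[of _ _ "i + - (x - y)"]) (use that I_uminus[OF xy] I_closed(3) in auto)
  ultimately show "cls G W x = cls G W y"
    unfolding cls_eq_image by blast
qed

lemma A_ring: "ring A"
  unfolding cell_algebra_def by (rule ideal.quotient_is_ring[OF ideal_I])

sublocale A: ring A
  by (rule A_ring)

lemma A_carrier: "carrier A = cls G W ` carrier CG"
  unfolding cell_algebra_def FactRing_def cls_def A_RCOSETS_def'
  by (auto simp: A_RCOSETS_def')

lemma A_cases: "x \<in> carrier A \<Longrightarrow> (\<And>t. t \<in> carrier CG \<Longrightarrow> x = cls G W t \<Longrightarrow> P) \<Longrightarrow> P"
  unfolding A_carrier by blast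

lemma cls_hom: "cls G W \<in> ring_hom CG A"
  using ideal.rcos_ring_hom[OF ideal_I] unfolding cell_algebra_def cls_def by (simp add: eta_contract_eq)

lemma cls_closed [simp]: "x \<in> carrier CG \<Longrightarrow> cls G W x \<in> carrier A"
  by (simp add: A_carrier)

lemma cls_mult: "x \<in> carrier CG \<Longrightarrow> y \<in> carrier CG \<Longrightarrow> cls G W (x \<star> y) = cls G W x \<cdot> cls G W y"
  using ring_hom_mult[OF cls_hom] .

lemma cls_add: "x \<in> carrier CG \<Longrightarrow> y \<in> carrier CG \<Longrightarrow> cls G W (x + y) = cls G W x \<oplus>\<^bsub>A\<^esub> cls G W y"
  using ring_hom_add[OF cls_hom] by (simp add: pa_simps)

lemma cls_zero: "cls G W 0 = \<zero>\<^bsub>A\<^esub>"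
  by (simp add: cell_algebra_def FactRing_def cls_eq_image)

lemma cls_zero_iff: "cls G W x = \<zero>\<^bsub>A\<^esub> \<longleftrightarrow> x \<in> cell_ideal G W"
  using cls_eq_iff[of x 0] by (simp add: cls_zero)

lemma sc_psc: "sc c = cls G W (psc c)"
  by (simp add: scal_def psc_def)

lemma sc_closed [simp]: "sc c \<in> carrier A"
  by (simp add: sc_psc)

lemma sc_one: "sc 1 = \<one>\<^bsub>A\<^esub>"
  using ring_hom_one[OF cls_hom] by (simp add: sc_psc one_psc)

lemma sc_mult: "sc c \<cdot> sc d = sc (c * d)"
  by (simp add: sc_psc cls_mult[symmetric] psc_mult)

lemma sc_add: "sc (c + d) = sc c \<oplus>\<^bsub>A\<^esub> sc d"
  by (simp add: sc_psc cls_add[symmetric] psc_add)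

lemma sc_zero: "sc 0 = \<zero>\<^bsub>A\<^esub>"
  by (simp add: sc_psc cls_zero)

lemma sc_comm: "x \<in> carrier A \<Longrightarrow> x \<cdot> sc c = sc c \<cdot> x"
  by (elim A_cases) (simp add: sc_psc cls_mult[symmetric] psc_comm)

lemma sc_sc: "x \<in> carrier A \<Longrightarrow> sc c \<cdot> (sc d \<cdot> x) = sc (c * d) \<cdot> x"
  by (simp add: A.m_assoc[symmetric] sc_mult)

lemma sc_pull: "x \<in> carrier A \<Longrightarrow> y \<in> carrier A \<Longrightarrow> x \<cdot> (sc c \<cdot> y) = sc c \<cdot> (x \<cdot> y)"
  by (metis A.m_assoc sc_closed sc_comm)

lemma sc_minus: "x \<in> carrier A \<Longrightarrow> sc (- 1) \<cdot> x = \<ominus>\<^bsub>A\<^esub> x"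
proof -
  assume x: "x \<in> carrier A"
  have "sc (- 1) \<cdot> x \<oplus>\<^bsub>A\<^esub> x = (sc (- 1) \<oplus>\<^bsub>A\<^esub> sc 1) \<cdot> x"
    using x by (simp add: A.l_distr sc_one)
  also have "\<dots> = \<zero>\<^bsub>A\<^esub>"
    using x by (simp add: sc_add[symmetric] sc_zero)
  finally show ?thesis
    using x by (metis A.add.inv_equality A.m_closed sc_closed)
qed

lemma A_minus_eq:
  assumes "x \<in> carrier A" "y \<in> carrier A" "x \<ominus>\<^bsub>A\<^esub> y = \<zero>\<^bsub>A\<^esub>"
  shows "x = y"
proof -
  have "x \<oplus>\<^bsub>A\<^esub> \<ominus>\<^bsub>A\<^esub> y = \<zero>\<^bsub>A\<^esub>" using assms(3) by (simp add: a_minus_def)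
  then have "\<ominus>\<^bsub>A\<^esub> (\<ominus>\<^bsub>A\<^esub> y) = x" using assms by (intro A.minus_equality) auto
  then show ?thesis using assms by simp
qed

lemma ve_closed [simp]: "v \<in> verts G \<Longrightarrow> ve v \<in> carrier A"
  unfolding vert_elt_def by (intro cls_closed pa_closed_single) simp

lemma ae_closed [simp]: "a \<in> arcs G \<Longrightarrow> ae a \<in> carrier A"
  unfolding arc_elt_def arc_vec_def by (intro cls_closed pa_closed_single) simp

lemma arc_vec_closed: "a \<in> arcs G \<Longrightarrow> arc_vec G a \<in> carrier CG"
  unfolding arc_vec_def by (intro pa_closed_single) simp

lemma ve_ve: "u \<in> verts G \<Longrightarrow> v \<in> verts G \<Longrightarrow> ve u \<cdot> ve v = (if u = v then ve u else \<zero>\<^bsub>A\<^esub>)"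
  by (simp add: vert_elt_def cls_mult[symmetric] pa_closed_single pa_single cls_zero)

lemma ve_ae: "v \<in> verts G \<Longrightarrow> a \<in> arcs G \<Longrightarrow> ve v \<cdot> ae a = (if v = tail G a then ae a else \<zero>\<^bsub>A\<^esub>)"
  by (auto simp: vert_elt_def arc_elt_def arc_vec_def cls_mult[symmetric] pa_closed_single pa_single cls_zero)

lemma ae_ve: "v \<in> verts G \<Longrightarrow> a \<in> arcs G \<Longrightarrow> ae a \<cdot> ve v = (if v = head G a then ae a else \<zero>\<^bsub>A\<^esub>)"
  by (auto simp: vert_elt_def arc_elt_def arc_vec_def cls_mult[symmetric] pa_closed_single pa_single cls_zero)

lemma cls_sum:
  "finite S \<Longrightarrow> (\<And>i. i \<in> S \<Longrightarrow> t i \<in> carrier CG) \<Longrightarrow>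
    cls G W (sum t S) = finsum A (\<lambda>i. cls G W (t i)) S"
  by (induction S rule: finite_induct) (auto simp: cls_zero cls_add pa_closed_sum A.finsum_insert)

lemma ve_sum: "finsum A ve (verts G) = \<one>\<^bsub>A\<^esub>"
  by (subst sc_one[symmetric])
    (simp add: sc_psc psc_def vert_elt_def[abs_def] cls_sum pa_closed_single)

lemma cls_single_Nil: "u \<in> verts G \<Longrightarrow> cls G W (sng u [] c) = sc c \<cdot> ve u"
  by (simp add: vert_elt_def sc_psc cls_mult[symmetric] pa_closed_single psc_single)

lemma cls_single_Cons:
  "(u, a # p) \<in> paths G \<Longrightarrow> cls G W (sng u (a # p) c) = ae a \<cdot> cls G W (sng (head G a) p c)"
  by (simp add: arc_elt_def arc_vec_def cls_mult[symmetric] pa_closed_single pa_single)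

text \<open>Paths are peeled off from the left. This rule carries statements about the action of
  single arcs over to all of \<open>A\<close>.\<close>

lemma A_induct [consumes 1, case_names zero vert arc add]:
  assumes x: "x \<in> carrier A" and z: "P \<zero>\<^bsub>A\<^esub>"
    and v: "\<And>v c. v \<in> verts G \<Longrightarrow> P (sc c \<cdot> ve v)"
    and a: "\<And>a x. a \<in> arcs G \<Longrightarrow> x \<in> carrier A \<Longrightarrow> P x \<Longrightarrow> P (ae a \<cdot> x)"
    and add: "\<And>x y. x \<in> carrier A \<Longrightarrow> y \<in> carrier A \<Longrightarrow> P x \<Longrightarrow> P y \<Longrightarrow> P (x \<oplus>\<^bsub>A\<^esub> y)"
  shows "P x"
proof -
  have s: "P (cls G W (sng u p c))" if "(u, p) \<in> paths G" for u p c
    using that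
  proof (induction p arbitrary: u)
    case (Cons b p)
    then show ?case by (subst cls_single_Cons) (auto intro!: a cls_closed pa_closed_single)
  qed (simp add: cls_single_Nil v)
  obtain t where t: "t \<in> carrier CG" "x = cls G W t" using x by (rule A_cases)
  from t(1) have "P (cls G W t)"
    by (induction t rule: pa_induct) (auto simp: cls_zero z s cls_add intro!: add)
  then show ?thesis by (simp add: t)
qed

lemma gr_closed: "x \<in> gr n \<Longrightarrow> x \<in> carrier A"
  unfolding alg_part_def using path_part_closed by auto

lemma gr_zero [simp]: "\<zero>\<^bsub>A\<^esub> \<in> gr n"
  unfolding alg_part_def using cls_zero by (metis image_eqI path_part_zero)

lemma gr_add: "x \<in> gr n \<Longrightarrow> y \<in> gr n \<Longrightarrow> x \<oplus>\<^bsub>A\<^esub> y \<in> gr n"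
  unfolding alg_part_def by (auto simp: cls_add[symmetric] path_part_closed intro!: imageI path_part_add)

lemma gr_mult: "x \<in> gr m \<Longrightarrow> y \<in> gr n \<Longrightarrow> x \<cdot> y \<in> gr (m + n)"
  unfolding alg_part_def by (auto simp: cls_mult[symmetric] path_part_closed intro!: imageI path_part_mult)

lemma gr_sc: "sc c \<in> gr 0"
  unfolding alg_part_def sc_psc using psc_part by blast

lemma gr_ve: "v \<in> verts G \<Longrightarrow> ve v \<in> gr 0"
  unfolding alg_part_def vert_elt_def by (intro imageI path_part_single) simp_all

lemma gr_ae: "a \<in> arcs G \<Longrightarrow> ae a \<in> gr 1"
  unfolding alg_part_def arc_elt_def arc_vec_def by (intro imageI path_part_single) simp_all

lemma gr_sc_mult: "x \<in> gr n \<Longrightarrow> sc c \<cdot> x \<in> gr n"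
  using gr_mult[OF gr_sc, of x n c] by simp

lemma gr_uminus: "x \<in> gr n \<Longrightarrow> \<ominus>\<^bsub>A\<^esub> x \<in> gr n"
  using gr_sc_mult[of x n "- 1"] by (simp add: sc_minus gr_closed)

lemma A_gr_induct [consumes 1, case_names zero hom add]:
  assumes x: "x \<in> carrier A"
    and z: "P \<zero>\<^bsub>A\<^esub>" and h: "\<And>n x. x \<in> gr n \<Longrightarrow> P x"
    and add: "\<And>x y. x \<in> carrier A \<Longrightarrow> y \<in> carrier A \<Longrightarrow> P x \<Longrightarrow> P y \<Longrightarrow> P (x \<oplus>\<^bsub>A\<^esub> y)"
  shows "P x"
proof -
  obtain t where t: "t \<in> carrier CG" "x = cls G W t" using x by (rule A_cases)
  have s: "cls G W (sng u p c) \<in> gr (length p)" if "(u, p) \<in> paths G" for u p c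
    unfolding alg_part_def by (intro imageI path_part_single that refl)
  from t(1) have "P (cls G W t)"
    by (induction t rule: pa_induct) (auto simp: cls_zero z cls_add intro!: add intro: h s)
  then show ?thesis by (simp add: t)
qed

text \<open>The complex-linear functionals. Identities in \<open>A\<close> are mostly tested on
  functionals, so that sums live in the complex numbers and not in \<open>finsum\<close>.\<close>

definition lfun :: "(('v, 'e) algelt \<Rightarrow> complex) \<Rightarrow> bool" where
  "lfun l \<longleftrightarrow> (\<forall>x\<in>carrier A. \<forall>y\<in>carrier A. l (x \<oplus>\<^bsub>A\<^esub> y) = l x + l y) \<and>
     (\<forall>c. \<forall>x\<in>carrier A. l (sc c \<cdot> x) = c * l x)"

lemma lfun_add: "lfun l \<Longrightarrow> x \<in> carrier A \<Longrightarrow> y \<in> carrier A \<Longrightarrow> l (x \<oplus>\<^bsub>A\<^esub> y) = l x + l y"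
  and lfun_sc: "lfun l \<Longrightarrow> x \<in> carrier A \<Longrightarrow> l (sc c \<cdot> x) = c * l x"
  unfolding lfun_def by blast+

lemma lfun_zero: "lfun l \<Longrightarrow> l \<zero>\<^bsub>A\<^esub> = 0"
  using lfun_sc[of l "\<zero>\<^bsub>A\<^esub>" 0] by simp

lemma lfunI:
  "(\<And>x y. x \<in> carrier A \<Longrightarrow> y \<in> carrier A \<Longrightarrow> l (x \<oplus>\<^bsub>A\<^esub> y) = l x + l y) \<Longrightarrow>
   (\<And>c x. x \<in> carrier A \<Longrightarrow> l (sc c \<cdot> x) = c * l x) \<Longrightarrow> lfun l"
  unfolding lfun_def by blast

lemma lfun_finsum:
  assumes "lfun l" "finite S" "\<And>i. i \<in> S \<Longrightarrow> t i \<in> carrier A"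
  shows "l (finsum A t S) = (\<Sum>i\<in>S. l (t i))"
  using assms(2,3)
proof (induction S rule: finite_induct)
  case (insert i S)
  then have "l (finsum A t (insert i S)) = l (t i \<oplus>\<^bsub>A\<^esub> finsum A t S)"
    by (subst A.finsum_insert) auto
  also have "\<dots> = l (t i) + l (finsum A t S)"
    using insert.prems by (intro lfun_add[OF assms(1)] A.finsum_closed) auto
  finally show ?case using insert by simp
qed (simp add: lfun_zero assms(1))

lemma lfun_minus: "lfun l \<Longrightarrow> x \<in> carrier A \<Longrightarrow> y \<in> carrier A \<Longrightarrow> l (x \<ominus>\<^bsub>A\<^esub> y) = l x - l y"
  unfolding a_minus_def by (simp add: lfun_add sc_minus[symmetric] lfun_sc)

lemma lfun_mult_l: "lfun l \<Longrightarrow> y \<in> carrier A \<Longrightarrow> lfun (\<lambda>x. l (y \<cdot> x))"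
  unfolding lfun_def by (auto simp: A.r_distr sc_pull)

lemma lfun_mult_r: "lfun l \<Longrightarrow> y \<in> carrier A \<Longrightarrow> lfun (\<lambda>x. l (x \<cdot> y))"
  unfolding lfun_def by (auto simp: A.l_distr A.m_assoc)

lemma lfun_const_mult: "lfun l \<Longrightarrow> lfun (\<lambda>x. c * l x)"
  unfolding lfun_def by (auto simp: algebra_simps)

lemma lfun_plus: "lfun l \<Longrightarrow> lfun l' \<Longrightarrow> lfun (\<lambda>x. l x + l' x)"
  unfolding lfun_def by (auto simp: algebra_simps)

lemma lfun_diff: "lfun l \<Longrightarrow> lfun l' \<Longrightarrow> lfun (\<lambda>x. l x - l' x)"
  unfolding lfun_def by (auto simp: algebra_simps)

lemma lfun_0 [simp]: "lfun (\<lambda>_. 0)"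
  unfolding lfun_def by simp

lemma lfun_sum: "(\<And>i. i \<in> S \<Longrightarrow> lfun (l i)) \<Longrightarrow> lfun (\<lambda>x. \<Sum>i\<in>S. l i x)"
  by (induction S rule: infinite_finite_induct) (auto intro: lfun_plus)

lemma lfun_cls_sum:
  assumes "lfun l" "finite S" "\<And>i. i \<in> S \<Longrightarrow> t i \<in> carrier CG"
  shows "l (cls G W (sum t S)) = (\<Sum>i\<in>S. l (cls G W (t i)))"
  using assms by (simp add: cls_sum lfun_finsum)

lemma cls_single2:
  assumes "b \<in> arcs G" "b' \<in> arcs G" "head G b = tail G b'"
  shows "cls G W (sng (tail G b) [b, b'] c) = sc c \<cdot> (ae b \<cdot> ae b')"
  using assms by (simp add: arc_elt_def arc_vec_def sc_psc cls_mult[symmetric] pa_closed_single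
      pa_single psc_single)

text \<open>The defining relations in the form in which they are used later. If \<open>a\<close> is
  not an arc, all coefficients vanish.\<close>

lemma rel_fun:
  assumes l: "lfun l"
  shows "(\<Sum>b\<in>arcs G. \<Sum>b'\<in>arcs G. W a b b' * l (ae b \<cdot> ae b')) = 0"
proof (cases "a \<in> arcs G")
  case True
  have s: "sng (tail G b) [b, b'] (W a b b') \<in> carrier CG" if "b \<in> arcs G" "b' \<in> arcs G" for b b'
    using that W_triangleD(5)[of a b b'] by (cases "W a b b' = 0") (auto intro!: pa_closed_single)
  have "rho G W a \<in> cell_ideal G W"
    unfolding cell_ideal_def
    by (rule subsetD[OF ring.genideal_self[OF path_algebra_ring]]) (use rho_closed True in auto)
  then have "0 = l (cls G W (rho G W a))"
    by (simp add: cls_zero_iff[symmetric] lfun_zero l)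
  also have "\<dots> = (\<Sum>b\<in>arcs G. \<Sum>b'\<in>arcs G. l (cls G W (sng (tail G b) [b, b'] (W a b b'))))"
    unfolding rho_def by (subst lfun_cls_sum[OF l], simp, intro pa_closed_sum s, simp_all)
      (intro sum.cong refl lfun_cls_sum[OF l], auto intro: s)
  also have "\<dots> = (\<Sum>b\<in>arcs G. \<Sum>b'\<in>arcs G. W a b b' * l (ae b \<cdot> ae b'))"
  proof (intro sum.cong[OF refl])
    fix b b' assume "b \<in> arcs G" "b' \<in> arcs G"
    then show "l (cls G W (sng (tail G b) [b, b'] (W a b b'))) = W a b b' * l (ae b \<cdot> ae b')"
      using W_triangleD(5)[of a b b']
      by (cases "W a b b' = 0") (auto simp: cls_single2 lfun_sc[OF l] cls_zero lfun_zero[OF l])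
  qed
  finally show ?thesis by simp
next
  case False
  then have "W a b b' = 0" for b b' using W_triangleD(1)[of a b b'] by auto
  then show ?thesis by simp
qed

text \<open>The product of a path given by its reversed list, the convention of
  \<open>lvec\<close>.\<close>

primrec lw :: "'e list \<Rightarrow> ('v, 'e) algelt" where
  "lw [] = \<one>\<^bsub>A\<^esub>"
| "lw (a # w) = lw w \<cdot> ae a"

lemma lw_closed: "set w \<subseteq> arcs G \<Longrightarrow> lw w \<in> carrier A"
  by (induction w) auto

lemma cls_single_lw:
  "(u, p) \<in> paths G \<Longrightarrow> cls G W (sng u p c) = sc c \<cdot> (ve u \<cdot> lw (rev p))"
proof (induction p rule: rev_induct)
  case Nil
  then show ?case by (simp add: cls_single_Nil)
next
  case (snoc a p)
  have p: "(u, p) \<in> paths G \<and> a \<in> arcs G \<and> tail G a = awlast u p"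
    using snoc.prems by (induction p arbitrary: u) auto
  then have "set (rev p) \<subseteq> arcs G" by (auto simp: paths_def awalk_def)
  note [simp] = lw_closed[OF this] paths_verts[OF conjunct1[OF p]]
  have "cls G W (sng u (p @ [a]) c) = cls G W (sng u p c \<star> arc_vec G a)"
    using p by (simp add: arc_vec_def pa_single)
  also have "\<dots> = sc c \<cdot> (ve u \<cdot> lw (rev p)) \<cdot> ae a"
    using p snoc.IH by (simp add: cls_mult pa_closed_single arc_vec_closed arc_elt_def)
  finally show ?case using p by (simp add: A.m_assoc)
qed

lemma gr_trivial:
  assumes "\<And>w. set w \<subseteq> arcs G \<Longrightarrow> length w = n \<Longrightarrow> lw w = \<zero>\<^bsub>A\<^esub>" "x \<in> gr n"
  shows "x = \<zero>\<^bsub>A\<^esub>"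
proof -
  obtain t where t: "t \<in> path_part G n" "x = cls G W t"
    using assms(2) unfolding alg_part_def by blast
  from t(1) have "cls G W t = \<zero>\<^bsub>A\<^esub>"
  proof (induction t rule: path_part_induct)
    case (single u p c)
    then have "lw (rev p) = \<zero>\<^bsub>A\<^esub>"
      by (intro assms(1)) (auto simp: paths_def awalk_def)
    then show ?case using single paths_verts by (simp add: cls_single_lw)
  qed (auto simp: cls_zero cls_add path_part_closed)
  then show ?thesis by (simp add: t)
qed

end

section \<open>Solving the Leibniz rule on the quotient\<close>

context cell_alg
begin

text \<open>The values on paths of the form that satisfies the Leibniz rule
  \<open>\<tau>(a u, g) = T\<^sub>a(u, g) + \<tau>(u, g a)\<close> and vanishes on vertices.\<close>

primrec tp :: "('e \<Rightarrow> ('v, 'e) algelt \<Rightarrow> ('v, 'e) algelt \<Rightarrow> complex) \<Rightarrow> 'e list \<Rightarrow>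
    ('v, 'e) algelt \<Rightarrow> complex" where
  "tp T [] g = 0"
| "tp T (a # p) g = T a (cls G W (sng (head G a) p 1)) g + tp T p (g \<cdot> ae a)"

definition tt where
  "tt T x g = (\<Sum>k\<in>Poly_Mapping.keys x. Poly_Mapping.lookup x k * tp T (snd k) g)"

lemma tt_add: "tt T (x + y) g = tt T x g + tt T y g"
  unfolding tt_def by (rule setsum_keys_plus_distrib) (auto simp: algebra_simps)

lemma tt_zero [simp]: "tt T 0 g = 0"
  by (simp add: tt_def)

lemma tt_single: "tt T (sng u p c) g = c * tp T p g"
  by (cases "c = 0") (simp_all add: tt_def)

lemma tt_psc: "x \<in> carrier CG \<Longrightarrow> tt T (psc c \<star> x) g = c * tt T x g"
  by (induction x rule: pa_induct) (simp_all add: psc_single tt_single pa_distr_l tt_add algebra_simps)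

lemma tt_uminus: "tt T (- x) g = - tt T x g"
  using tt_add[of T x "- x" g] by (simp add: eq_neg_iff_add_eq_0 add.commute)

lemma tt_sum: "finite S \<Longrightarrow> tt T (sum f S) g = (\<Sum>i\<in>S. tt T (f i) g)"
  by (induction S rule: finite_induct) (simp_all add: tt_add)

text \<open>The Leibniz rule prescribes \<tau> on paths and hence on the path algebra. It descends
  to \<open>A\<close> if it vanishes on the ideal, and \<open>cyc\<close> says that the Leibniz
  terms of each relation cancel.\<close>

lemma derivation_exists:
  assumes Tu: "\<And>a g. a \<in> arcs G \<Longrightarrow> g \<in> carrier A \<Longrightarrow> lfun (\<lambda>u. T a u g)"
    and Tg: "\<And>a u. a \<in> arcs G \<Longrightarrow> u \<in> carrier A \<Longrightarrow> lfun (\<lambda>g. T a u g)"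
    and Th: "\<And>a u g. a \<in> arcs G \<Longrightarrow> u \<in> carrier A \<Longrightarrow> g \<in> carrier A \<Longrightarrow>
        T a (ve (head G a) \<cdot> u) g = T a u g"
    and Tt: "\<And>a u g. a \<in> arcs G \<Longrightarrow> u \<in> carrier A \<Longrightarrow> g \<in> carrier A \<Longrightarrow>
        T a u (g \<cdot> ve (tail G a)) = T a u g"
    and cyc: "\<And>c u g. c \<in> arcs G \<Longrightarrow> u \<in> carrier A \<Longrightarrow> g \<in> carrier A \<Longrightarrow>
        (\<Sum>b\<in>arcs G. \<Sum>b'\<in>arcs G. W c b b' * (T b (ae b' \<cdot> u) g + T b' u (g \<cdot> ae b))) = 0"
  obtains \<tau> where "\<And>g. g \<in> carrier A \<Longrightarrow> lfun (\<lambda>u. \<tau> u g)" "\<And>u. u \<in> carrier A \<Longrightarrow> lfun (\<tau> u)"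
    "\<And>a u g. a \<in> arcs G \<Longrightarrow> u \<in> carrier A \<Longrightarrow> g \<in> carrier A \<Longrightarrow>
      \<tau> (ae a \<cdot> u) g = T a u g + \<tau> u (g \<cdot> ae a)"
proof -
  have cl: "cls G W (sng u p c) \<in> carrier A" if "(u, p) \<in> paths G" for u p c
    using that by (intro cls_closed pa_closed_single)
  have lp: "lfun (tp T p)" if "(u, p) \<in> paths G" for u p
    using that
  proof (induction p arbitrary: u)
    case (Cons a p)
    show ?case
      unfolding tp.simps
      by (rule lfun_plus, rule Tg) (use Cons cl in \<open>auto intro!: lfun_mult_r\<close>)
  next
    case Nil
    have "tp T [] = (\<lambda>_. 0)" by (simp add: fun_eq_iff)
    then show ?case by simp
  qed
  have lt: "lfun (tt T x)" if "x \<in> carrier CG" for x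
    using that
  proof (induction x rule: pa_induct)
    case (single u p c)
    then show ?case using lfun_const_mult[OF lp] by (simp add: tt_single[abs_def])
  next
    case (add x y)
    then show ?case using lfun_plus by (simp add: tt_add[abs_def])
  qed (simp add: tt_def)
  \<comment> \<open>Only the component of \<open>g\<close> that ends where the path starts
    matters.\<close>
  have compat: "tp T p (g \<cdot> ve u) = tp T p g" if "(u, p) \<in> paths G" "g \<in> carrier A" for u p g
  proof (cases p)
    case (Cons a q)
    with that have a: "a \<in> arcs G" "tail G a = u" "(head G a, q) \<in> paths G" by auto
    then have "ve u \<cdot> ae a = ae a" by (auto simp: ve_ae)
    then have "g \<cdot> ve u \<cdot> ae a = g \<cdot> ae a"
      using that a by (simp add: A.m_assoc paths_verts)
    then show ?thesis
      using Tt[of a "cls G W (sng (head G a) q 1)" g] a that cl by (simp add: Cons)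
  qed simp
  have leib: "tt T (arc_vec G a \<star> x) g = T a (cls G W x) g + tt T x (g \<cdot> ae a)"
    if a: "a \<in> arcs G" and x: "x \<in> carrier CG" and g: "g \<in> carrier A" for a x g
    using x
  proof (induction x rule: pa_induct)
    case zero
    show ?case using lfun_zero[OF Tu[OF a g]] by (simp add: cls_zero)
  next
    case (single u p c)
    have T1: "T a (cls G W (sng u p c)) g = c * T a (cls G W (sng u p 1)) g"
      using lfun_sc[OF Tu[OF a g], of "cls G W (sng u p 1)" c] single cl
      by (simp add: single_scaled[of u p c] cls_mult pa_closed_single sc_psc)
    show ?case
    proof (cases "head G a = u")
      case True
      then show ?thesis
        by (simp add: arc_vec_def pa_single tt_single T1 algebra_simps)
    next
      \<comment> \<open>The product is 0 in the path algebra, so both Leibniz terms have to vanish: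
        the first by the condition \<open>Th\<close> at the head of \<open>a\<close>, the second
        because \<open>g a\<close> ends at the head of \<open>a\<close> and not at
        \<open>u\<close>.\<close>
      case False
      have u: "u \<in> verts G" using single paths_verts by blast
      have "ve (head G a) \<cdot> cls G W (sng u p c) = \<zero>\<^bsub>A\<^esub>"
        using False single a
        by (simp add: vert_elt_def cls_mult[symmetric] pa_closed_single pa_single cls_zero)
      then have "T a (cls G W (sng u p c)) g = 0"
        using Th[OF a cl[OF single, of c] g] lfun_zero[OF Tu[OF a g]] by simp
      moreover have "tp T p (g \<cdot> ae a) = 0"
      proof -
        have "tp T p (g \<cdot> ae a) = tp T p (g \<cdot> ae a \<cdot> ve u)"
          by (rule compat[symmetric]) (use single a g in auto)
        also have "g \<cdot> ae a \<cdot> ve u = \<zero>\<^bsub>A\<^esub>"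
          using False a g u by (simp add: A.m_assoc ae_ve)
        finally show ?thesis using lfun_zero[OF lp[OF single]] by simp
      qed
      ultimately show ?thesis
        using False by (simp add: arc_vec_def pa_single tt_single)
    qed
  next
    case (add x y)
    then show ?case
      using a g by (simp add: pa_distr_l tt_add cls_add lfun_add[OF Tu[OF a g]])
  qed
  \<comment> \<open>A two-sided ideal by construction; what remains is that it contains the
    relations.\<close>
  define J where "J = {x \<in> carrier CG. \<forall>w\<in>carrier CG. \<forall>y\<in>carrier CG. \<forall>g\<in>carrier A. tt T (w \<star> x \<star> y) g = 0}"
  \<comment> \<open>Two applications of the Leibniz rule give three terms per summand. The first two
    cancel by \<open>cyc\<close>; the third is a functional of the product of two arcs, to which
    \<open>rel_fun\<close> applies.\<close>
  have rho0: "tt T (rho G W c \<star> y) g = 0" if c: "c \<in> arcs G" and y: "y \<in> carrier CG" and g: "g \<in> carrier A" for c y g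
  proof -
    have "tt T (rho G W c \<star> y) g
      = (\<Sum>b\<in>arcs G. \<Sum>b'\<in>arcs G. tt T (sng (tail G b) [b, b'] (W c b b') \<star> y) g)"
      unfolding rho_def by (simp add: pa_sum_r tt_sum)
    also have "\<dots> = (\<Sum>b\<in>arcs G. \<Sum>b'\<in>arcs G.
        W c b b' * (T b (ae b' \<cdot> cls G W y) g + T b' (cls G W y) (g \<cdot> ae b))
        + W c b b' * tt T y (g \<cdot> (ae b \<cdot> ae b')))"
    proof (intro sum.cong[OF refl])
      fix b b' assume b: "b \<in> arcs G" "b' \<in> arcs G"
      show "tt T (sng (tail G b) [b, b'] (W c b b') \<star> y) g
        = W c b b' * (T b (ae b' \<cdot> cls G W y) g + T b' (cls G W y) (g \<cdot> ae b))
        + W c b b' * tt T y (g \<cdot> (ae b \<cdot> ae b'))"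
      proof (cases "W c b b' = 0")
        case False
        then have "head G b = tail G b'" using W_triangleD(5)[of c b b'] by simp
        then have "sng (tail G b) [b, b'] (W c b b') = psc (W c b b') \<star> (arc_vec G b \<star> arc_vec G b')"
          using b by (simp add: arc_vec_def pa_single psc_single)
        then have "tt T (sng (tail G b) [b, b'] (W c b b') \<star> y) g
          = W c b b' * tt T (arc_vec G b \<star> (arc_vec G b' \<star> y)) g"
          using b y by (simp add: pa_assoc arc_vec_closed pa_closed_mult tt_psc)
        also have "\<dots> = W c b b' * (T b (ae b' \<cdot> cls G W y) g + T b' (cls G W y) (g \<cdot> ae b)
            + tt T y (g \<cdot> ae b \<cdot> ae b'))"
          using b y g by (simp add: leib arc_vec_closed pa_closed_mult cls_mult arc_elt_def[symmetric] add.assoc)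
        finally show ?thesis using b g by (simp add: A.m_assoc algebra_simps)
      qed simp
    qed
    also have "\<dots> = (\<Sum>b\<in>arcs G. \<Sum>b'\<in>arcs G. W c b b' * tt T y (g \<cdot> (ae b \<cdot> ae b')))"
      using cyc[OF c cls_closed[OF y] g] by (simp add: sum.distrib)
    also have "\<dots> = 0"
      by (rule rel_fun[OF lfun_mult_l[OF lt[OF y] g]])
    finally show ?thesis .
  qed
  have "rho G W c \<in> J" if c: "c \<in> arcs G" for c
    unfolding J_def
  proof (intro CollectI conjI ballI rho_closed)
    have rI: "rho G W c \<in> cell_ideal G W"
      unfolding cell_ideal_def
      by (rule subsetD[OF ring.genideal_self[OF path_algebra_ring]]) (use rho_closed c in auto)
    \<comment> \<open>Peeling an arc off the left factor leaves a shorter path, with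
      \<open>g a\<close> in place of \<open>g\<close>, and a term of \<open>T\<close> at the class
      of an element of the ideal, which is 0.\<close>
    have pth0: "tt T (sng u p d \<star> (rho G W c \<star> y)) g = 0"
      if "(u, p) \<in> paths G" "y \<in> carrier CG" "g \<in> carrier A" for u p d y g
      using that(1,3)
    proof (induction p arbitrary: u g)
      case Nil
      \<comment> \<open>All terms of the relation of \<open>c\<close> start at the head of
        \<open>c\<close>, so a vertex on the left either keeps or kills it.\<close>
      have "sng u [] 1 \<star> rho G W c = (if u = head G c then rho G W c else 0)"
      proof -
        have "sng u [] 1 \<star> rho G W c
          = (\<Sum>b\<in>arcs G. \<Sum>b'\<in>arcs G. sng u [] 1 \<star> sng (tail G b) [b, b'] (W c b b'))"
          by (simp add: rho_def pa_sum_l)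
        also have "\<dots> = (\<Sum>b\<in>arcs G. \<Sum>b'\<in>arcs G.
            if u = head G c then sng (tail G b) [b, b'] (W c b b') else 0)"
        proof (intro sum.cong[OF refl])
          fix b b'
          show "sng u [] 1 \<star> sng (tail G b) [b, b'] (W c b b')
            = (if u = head G c then sng (tail G b) [b, b'] (W c b b') else 0)"
            using W_triangleD(4)[of c b b'] by (cases "W c b b' = 0") (auto simp: pa_single)
        qed
        also have "\<dots> = (if u = head G c then rho G W c else 0)"
          by (simp add: rho_def)
        finally show ?thesis .
      qed
      then have "sng u [] d \<star> (rho G W c \<star> y) = psc d \<star> ((if u = head G c then rho G W c else 0) \<star> y)"
        using Nil that(2) rho_closed
        by (simp add: single_scaled[of u "[]" d] pa_assoc pa_closed_single pa_closed_mult)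
          (metis (no_types, lifting) pa_assoc pa_closed_single paths_Nil pa_zero)
      then show ?case
        using rho0[OF c that(2)] Nil that(2) rho_closed by (auto simp: tt_psc pa_closed_mult)
    next
      case (Cons a p)
      let ?x = "sng (head G a) p d \<star> (rho G W c \<star> y)"
      have x: "?x \<in> carrier CG"
        using Cons that(2) rho_closed by (simp add: pa_closed_mult pa_closed_single)
      have "?x \<in> cell_ideal G W"
        using Cons.prems that(2) rI by (intro I_closed(4,5) pa_closed_single) auto
      then have 0: "cls G W ?x = \<zero>\<^bsub>A\<^esub>" by (simp add: cls_zero_iff)
      have "sng u (a # p) d \<star> (rho G W c \<star> y) = arc_vec G a \<star> ?x"
        using Cons.prems that(2) rho_closed
        by (simp add: pa_assoc[symmetric] arc_vec_closed pa_closed_single pa_closed_mult)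
          (simp add: arc_vec_def pa_single)
      then show ?case
        using Cons.prems Cons.IH[of "head G a" "g \<cdot> ae a"] leib[OF _ x, of a g]
          lfun_zero[OF Tu, of a g] by (simp add: 0)
    qed
    fix w y g assume w: "w \<in> carrier CG" and y: "y \<in> carrier CG" and g: "g \<in> carrier A"
    from w have "tt T (w \<star> (rho G W c \<star> y)) g = 0"
      by (induction w rule: pa_induct) (use y g pth0 in \<open>auto simp: pa_distr_r tt_add\<close>)
    then show "tt T (w \<star> rho G W c \<star> y) g = 0"
      using w y rho_closed by (simp add: pa_assoc)
  qed
  moreover have "ideal J CG"
  proof (rule idealI[OF path_algebra_ring])
    interpret ring CG by (rule path_algebra_ring)
    show "subgroup J (add_monoid CG)"
    proof (rule group.subgroupI)
      show "group (add_monoid CG)" by (rule a_group)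
      show "J \<noteq> {}" by (rule ex_in_conv[THEN iffD1], rule exI[of _ 0]) (simp add: J_def)
      fix x assume x: "x \<in> J"
      have "inv\<^bsub>add_monoid CG\<^esub> x = - x"
      proof -
        have "\<ominus>\<^bsub>CG\<^esub> x = - x"
          using x by (intro minus_equality) (auto simp: J_def pa_simps(1,2) pa_closed_uminus)
        then show ?thesis by (simp add: a_inv_def)
      qed
      moreover have "w \<star> - x = - (w \<star> x)" "- x \<star> y = - (x \<star> y)" "- (w \<star> x) \<star> y = - (w \<star> x \<star> y)" for w y
        using pa_distr_l[of w x "- x"] pa_distr_r[of x "- x" y] pa_distr_r[of "w \<star> x" "- (w \<star> x)" y]
        by (simp_all add: eq_neg_iff_add_eq_0 add.commute)
      ultimately show "inv\<^bsub>add_monoid CG\<^esub> x \<in> J"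
        using x by (simp add: J_def pa_closed_uminus tt_uminus)
      fix y assume "y \<in> J"
      then show "x \<otimes>\<^bsub>add_monoid CG\<^esub> y \<in> J"
        using x by (simp add: J_def pa_simps(1) pa_closed_add pa_distr_l pa_distr_r tt_add)
    qed (auto simp: J_def)
    fix a x assume ax: "a \<in> J" "x \<in> carrier CG"
    then show "x \<star> a \<in> J" "a \<star> x \<in> J"
      by (auto simp: J_def pa_closed_mult pa_assoc[symmetric]) (auto simp: pa_assoc pa_closed_mult)
  qed
  ultimately have IJ: "cell_ideal G W \<subseteq> J"
    unfolding cell_ideal_def by (intro ring.genideal_minimal[OF path_algebra_ring]) auto
  have van: "tt T x g = 0" if "x \<in> cell_ideal G W" "g \<in> carrier A" for x g
  proof -
    have "tt T (psc 1 \<star> x \<star> psc 1) g = 0" using that IJ unfolding J_def by auto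
    then show ?thesis using I_closed(1)[OF that(1)] by (simp add: psc_one psc_comm)
  qed
  \<comment> \<open>Any representative gives the same value, by \<open>van\<close>.\<close>
  define \<tau> where "\<tau> u g = tt T (SOME x. x \<in> carrier CG \<and> cls G W x = u) g" for u g
  have \<tau>: "\<tau> (cls G W x) g = tt T x g" if "x \<in> carrier CG" "g \<in> carrier A" for x g
  proof -
    let ?y = "SOME y. y \<in> carrier CG \<and> cls G W y = cls G W x"
    have y: "?y \<in> carrier CG \<and> cls G W ?y = cls G W x"
      by (rule someI[of _ x]) (use that in auto)
    then have "?y - x \<in> cell_ideal G W" using cls_eq_iff by blast
    then have "tt T (?y - x) g = 0" by (rule van[OF _ that(2)])
    then show ?thesis
      unfolding \<tau>_def using tt_add[of T "?y - x" x g] by simp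
  qed
  show thesis
  proof (rule that[of \<tau>])
    show "lfun (\<lambda>u. \<tau> u g)" if g: "g \<in> carrier A" for g
    proof (rule lfunI)
      fix x y assume "x \<in> carrier A" "y \<in> carrier A"
      then show "\<tau> (x \<oplus>\<^bsub>A\<^esub> y) g = \<tau> x g + \<tau> y g"
        using g by (elim A_cases) (simp add: cls_add[symmetric] \<tau> pa_closed_add tt_add)
    next
      fix c x assume "x \<in> carrier A"
      then show "\<tau> (sc c \<cdot> x) g = c * \<tau> x g"
        using g by (elim A_cases) (simp add: sc_psc cls_mult[symmetric] \<tau> pa_closed_mult tt_psc)
    qed
    show "lfun (\<tau> u)" if u: "u \<in> carrier A" for u
    proof -
      obtain x where x: "x \<in> carrier CG" "u = cls G W x" using u by (rule A_cases)
      show ?thesis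
        using lt[OF x(1)] x unfolding lfun_def by (simp add: \<tau>)
    qed
    fix a u g assume a: "a \<in> arcs G" and u: "u \<in> carrier A" and g: "g \<in> carrier A"
    obtain x where x: "x \<in> carrier CG" "u = cls G W x" using u by (rule A_cases)
    have "ae a \<cdot> u = cls G W (arc_vec G a \<star> x)"
      using x a by (simp add: cls_mult arc_vec_closed arc_elt_def)
    then show "\<tau> (ae a \<cdot> u) g = T a u g + \<tau> u (g \<cdot> ae a)"
      using x a g by (simp add: \<tau> leib pa_closed_mult arc_vec_closed)
  qed
qed

end

section \<open>The automorphism induced by \<nu>\<close>

locale cell_nu = cell_alg G W for G :: "('v, 'e) pre_digraph" and W +
  fixes \<nu>0 :: "'v \<Rightarrow> 'v" and \<nu>1 :: "'e \<Rightarrow> 'e"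
  assumes nu0: "bij_betw \<nu>0 (verts G) (verts G)" and nu1: "bij_betw \<nu>1 (arcs G) (arcs G)"
    and nu_tail: "a \<in> arcs G \<Longrightarrow> tail G (\<nu>1 a) = \<nu>0 (tail G a)"
    and nu_head: "a \<in> arcs G \<Longrightarrow> head G (\<nu>1 a) = \<nu>0 (head G a)"
    and W_nu: "triangle G a b c \<Longrightarrow> W a b c = W (\<nu>1 a) (\<nu>1 b) (\<nu>1 c)"
begin

abbreviation pm where "pm \<equiv> path_map \<nu>0 \<nu>1"
abbreviation bt where "bt \<equiv> beta G W \<nu>0 \<nu>1"

lemma nu0_in [simp]: "v \<in> verts G \<Longrightarrow> \<nu>0 v \<in> verts G"
  using nu0 by (auto simp: bij_betw_def)

lemma nu1_in [simp]: "a \<in> arcs G \<Longrightarrow> \<nu>1 a \<in> arcs G"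
  using nu1 by (auto simp: bij_betw_def)

lemma nu0_eq_iff: "u \<in> verts G \<Longrightarrow> v \<in> verts G \<Longrightarrow> \<nu>0 u = \<nu>0 v \<longleftrightarrow> u = v"
  using nu0 by (auto simp: bij_betw_def inj_on_def)

text \<open>\<nu> is injective on vertices and therefore reflects triangles; off triangles both
  sides vanish.\<close>

lemma W_nu':
  assumes "a \<in> arcs G" "b \<in> arcs G" "c \<in> arcs G"
  shows "W (\<nu>1 a) (\<nu>1 b) (\<nu>1 c) = W a b c"
proof (cases "triangle G a b c")
  case False
  then have "\<not> triangle G (\<nu>1 a) (\<nu>1 b) (\<nu>1 c)"
    using assms by (simp add: triangle_def nu_tail nu_head nu0_eq_iff)
  with False show ?thesis using W_triangle by metis
qed (simp add: W_nu)

lemma pm_single: "pm (sng u p c) = sng (\<nu>0 u) (map \<nu>1 p) c"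
  by (simp add: path_map_def)

lemma pm_zero [simp]: "pm 0 = 0"
  by (simp add: path_map_def)

lemma pm_add: "pm (x + y) = pm x + pm y"
  unfolding path_map_def case_prod_unfold
  using setsum_keys_plus_distrib[of "\<lambda>k c. Poly_Mapping.single (\<nu>0 (fst k), map \<nu>1 (snd k)) c" x y]
  by (simp add: single_add)

lemma pm_uminus: "pm (- x) = - pm x"
  using pm_add[of x "- x"] by (simp add: eq_neg_iff_add_eq_0 add.commute)

lemma pm_sum: "finite S \<Longrightarrow> pm (sum f S) = (\<Sum>i\<in>S. pm (f i))"
  by (induction S rule: finite_induct) (simp_all add: pm_add)

lemma nu_paths: "(u, p) \<in> paths G \<Longrightarrow> (\<nu>0 u, map \<nu>1 p) \<in> paths G"
proof (induction p arbitrary: u)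
  case (Cons a p)
  then show ?case using nu_tail nu_head by auto
qed simp

lemma nu_awlast: "(u, p) \<in> paths G \<Longrightarrow> awlast (\<nu>0 u) (map \<nu>1 p) = \<nu>0 (awlast u p)"
proof (induction p arbitrary: u)
  case (Cons a p)
  then show ?case using nu_head by auto
qed simp

lemma pm_closed: "x \<in> carrier CG \<Longrightarrow> pm x \<in> carrier CG"
  by (induction x rule: pa_induct)
    (auto simp: pm_single pm_add intro!: pa_closed_single pa_closed_add nu_paths)

lemma pm_mult:
  assumes "x \<in> carrier CG" "y \<in> carrier CG"
  shows "pm (x \<star> y) = pm x \<star> pm y"
  using assms(1)
proof (induction x rule: pa_induct)
  case (single u p c)
  from assms(2) show ?case
  proof (induction y rule: pa_induct)
    case (single v q d)
    then show ?case using \<open>(u, p) \<in> paths G\<close>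
      by (simp add: pa_single pm_single nu_awlast nu0_eq_iff awlast_verts paths_verts)
  qed (simp_all add: pa_distr_l pm_add)
qed (simp_all add: pa_distr_r pm_add)

lemma pm_psc: "pm (psc c) = psc c"
proof -
  have "pm (psc c) = (\<Sum>v\<in>verts G. sng (\<nu>0 v) [] c)"
    by (simp add: psc_def pm_sum pm_single)
  also have "\<dots> = psc c"
    unfolding psc_def using nu0 by (rule sum.reindex_bij_betw)
  finally show ?thesis .
qed

lemma pm_rho:
  assumes "a \<in> arcs G"
  shows "pm (rho G W a) = rho G W (\<nu>1 a)"
proof -
  have "pm (rho G W a) = (\<Sum>b\<in>arcs G. \<Sum>b'\<in>arcs G.
      sng (tail G (\<nu>1 b)) [\<nu>1 b, \<nu>1 b'] (W (\<nu>1 a) (\<nu>1 b) (\<nu>1 b')))"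
    unfolding rho_def using assms by (simp add: pm_sum pm_single nu_tail W_nu')
  also have "\<dots> = (\<Sum>b\<in>arcs G. \<Sum>b'\<in>arcs G. sng (tail G (\<nu>1 b)) [\<nu>1 b, b'] (W (\<nu>1 a) (\<nu>1 b) b'))"
    by (intro sum.cong[OF refl] sum.reindex_bij_betw[OF nu1])
  also have "\<dots> = rho G W (\<nu>1 a)"
    unfolding rho_def
    using sum.reindex_bij_betw[OF nu1, of "\<lambda>b. \<Sum>b'\<in>arcs G. sng (tail G b) [b, b'] (W (\<nu>1 a) b b')"] .
  finally show ?thesis .
qed

text \<open>The preimage of the ideal is an ideal, and it contains the relations because \<nu>
  permutes them.\<close>

lemma pm_I: "x \<in> cell_ideal G W \<Longrightarrow> pm x \<in> cell_ideal G W"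
proof -
  define J where "J = {x \<in> carrier CG. pm x \<in> cell_ideal G W}"
  interpret ring CG by (rule path_algebra_ring)
  have "ideal J CG"
  proof (rule idealI[OF path_algebra_ring])
    show "subgroup J (add_monoid CG)"
    proof (rule group.subgroupI)
      show "group (add_monoid CG)" by (rule a_group)
      show "J \<noteq> {}" by (rule ex_in_conv[THEN iffD1], rule exI[of _ 0]) (simp add: J_def I_closed(2))
      fix x assume x: "x \<in> J"
      have "\<ominus>\<^bsub>CG\<^esub> x = - x"
        using x by (intro minus_equality) (auto simp: J_def pa_simps(1,2) pa_closed_uminus)
      then show "inv\<^bsub>add_monoid CG\<^esub> x \<in> J"
        using x unfolding a_inv_def[symmetric] by (simp add: J_def pa_closed_uminus pm_uminus I_uminus)
      fix y assume "y \<in> J"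
      then show "x \<otimes>\<^bsub>add_monoid CG\<^esub> y \<in> J"
        using x by (simp add: J_def pa_simps(1) pa_closed_add pm_add I_closed(3))
    qed (auto simp: J_def)
    fix a x assume "a \<in> J" "x \<in> carrier CG"
    then show "x \<star> a \<in> J" "a \<star> x \<in> J"
      by (simp_all add: J_def pa_closed_mult pm_mult I_closed(4,5) pm_closed)
  qed
  moreover have "rho G W ` arcs G \<subseteq> J"
  proof
    fix r assume "r \<in> rho G W ` arcs G"
    then obtain a where a: "a \<in> arcs G" "r = rho G W a" by auto
    have "rho G W (\<nu>1 a) \<in> cell_ideal G W"
      unfolding cell_ideal_def
      by (rule subsetD[OF genideal_self]) (use rho_closed a in auto)
    then show "r \<in> J" using a by (simp add: J_def rho_closed pm_rho)
  qed
  ultimately have "cell_ideal G W \<subseteq> J"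
    unfolding cell_ideal_def by (rule genideal_minimal)
  then show "x \<in> cell_ideal G W \<Longrightarrow> pm x \<in> cell_ideal G W"
    by (auto simp: J_def)
qed

lemma bt_cls: "bt (cls G W t) = cls G W (pm t)"
proof -
  have "cls G W (pm x) = cls G W (pm t)" if "x \<in> cls G W t" for x
  proof -
    from that have "x - t \<in> cell_ideal G W" by (auto simp: cls_eq_image)
    from pm_I[OF this] show ?thesis
      using pm_add[of x "- t"] by (simp add: cls_eq_iff pm_uminus)
  qed
  moreover have "t \<in> cls G W t"
    unfolding cls_eq_image using I_closed(2) by force
  ultimately show ?thesis unfolding beta_def by blast
qed

lemma bt_closed [simp]: "x \<in> carrier A \<Longrightarrow> bt x \<in> carrier A"
  by (elim A_cases) (simp add: bt_cls pm_closed)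

lemma bt_add: "x \<in> carrier A \<Longrightarrow> y \<in> carrier A \<Longrightarrow> bt (x \<oplus>\<^bsub>A\<^esub> y) = bt x \<oplus>\<^bsub>A\<^esub> bt y"
  by (elim A_cases) (simp add: cls_add[symmetric] bt_cls pm_closed pm_add)

lemma bt_mult: "x \<in> carrier A \<Longrightarrow> y \<in> carrier A \<Longrightarrow> bt (x \<cdot> y) = bt x \<cdot> bt y"
  by (elim A_cases) (simp add: cls_mult[symmetric] bt_cls pm_closed pm_mult)

lemma bt_sc: "bt (sc c) = sc c"
  by (simp add: sc_psc bt_cls pm_psc)

lemma bt_zero: "bt \<zero>\<^bsub>A\<^esub> = \<zero>\<^bsub>A\<^esub>"
  using bt_sc[of 0] by (simp add: sc_zero)

lemma bt_one: "bt \<one>\<^bsub>A\<^esub> = \<one>\<^bsub>A\<^esub>"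
  using bt_sc[of 1] by (simp add: sc_one)

lemma bt_ve: "bt (ve v) = ve (\<nu>0 v)"
  by (simp add: vert_elt_def bt_cls pm_single)

lemma bt_ae: "a \<in> arcs G \<Longrightarrow> bt (ae a) = ae (\<nu>1 a)"
  by (simp add: arc_elt_def arc_vec_def bt_cls pm_single nu_tail)

text \<open>Surjectivity can be read off the generators; injectivity will come from the
  form.\<close>

lemma bt_surj: "x \<in> carrier A \<Longrightarrow> \<exists>y\<in>carrier A. bt y = x"
proof (induction x rule: A_induct)
  case zero
  show ?case by (intro bexI[of _ "\<zero>\<^bsub>A\<^esub>"]) (simp_all add: bt_zero)
next
  case (vert v c)
  then obtain u where u: "u \<in> verts G" "v = \<nu>0 u" using nu0 by (auto simp: bij_betw_def)
  then show ?case by (intro bexI[of _ "sc c \<cdot> ve u"]) (simp_all add: bt_mult bt_sc bt_ve)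
next
  case (arc a x)
  from \<open>a \<in> arcs G\<close> obtain b where "b \<in> arcs G" "a = \<nu>1 b"
    using nu1 unfolding bij_betw_def by blast
  moreover from arc obtain y where "y \<in> carrier A" "bt y = x" by blast
  ultimately show ?case by (intro bexI[of _ "ae b \<cdot> y"]) (simp_all add: bt_mult bt_ae)
next
  case (add x y)
  then obtain x' y' where "x' \<in> carrier A" "bt x' = x" "y' \<in> carrier A" "bt y' = y" by auto
  then show ?case by (intro bexI[of _ "x' \<oplus>\<^bsub>A\<^esub> y'"]) (simp_all add: bt_add)
qed

end

section \<open>The Frobenius form\<close>

locale frob = cells G h \<phi> W + cell_nu G W \<nu>0 \<nu>1
  for G :: "('v, 'e) pre_digraph" and h \<phi> W \<nu>0 \<nu>1 +
  fixes f :: "('v, 'e) algelt \<Rightarrow> complex" and B :: "('v, 'e) algelt set"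
    and d :: "('v, 'e) algelt \<Rightarrow> ('v, 'e) algelt"
  assumes ff: "frobenius_form G W h \<nu>0 \<nu>1 f"
    and hb: "homogeneous_basis G W B"
    and db: "dual_basis G W f B d"
begin

lemmas ffU = ff[unfolded frobenius_form_def Let_def]

lemma f_lfun: "lfun f"
  unfolding lfun_def using ffU[THEN conjunct1] ffU[THEN conjunct2, THEN conjunct1] by (rule conjI)

lemma f_nd_l: "x \<in> carrier A \<Longrightarrow> (\<And>y. y \<in> carrier A \<Longrightarrow> f (x \<cdot> y) = 0) \<Longrightarrow> x = \<zero>\<^bsub>A\<^esub>"
  by (rule ffU[THEN conjunct2, THEN conjunct2, THEN conjunct1, rule_format])

lemma f_nd_r: "y \<in> carrier A \<Longrightarrow> (\<And>x. x \<in> carrier A \<Longrightarrow> f (x \<cdot> y) = 0) \<Longrightarrow> y = \<zero>\<^bsub>A\<^esub>"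
  by (rule ffU[THEN conjunct2, THEN conjunct2, THEN conjunct2, THEN conjunct1, rule_format])

lemma f_low: "p < h - 3 \<Longrightarrow> x \<in> gr p \<Longrightarrow> f x = 0"
  by (rule ffU[THEN conjunct2, THEN conjunct2, THEN conjunct2, THEN conjunct2, THEN conjunct1, rule_format])

lemma f_nu: "x \<in> carrier A \<Longrightarrow> y \<in> carrier A \<Longrightarrow> f (x \<cdot> y) = f (y \<cdot> bt x)"
  by (rule ffU[THEN conjunct2, THEN conjunct2, THEN conjunct2, THEN conjunct2, THEN conjunct2,
      THEN conjunct2, rule_format])

lemma f_eqI_r:
  assumes "x \<in> carrier A" "y \<in> carrier A" "\<And>z. z \<in> carrier A \<Longrightarrow> f (z \<cdot> x) = f (z \<cdot> y)"
  shows "x = y"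
proof -
  have "x \<ominus>\<^bsub>A\<^esub> y = \<zero>\<^bsub>A\<^esub>"
    by (rule f_nd_r) (use assms lfun_minus[OF lfun_mult_l[OF f_lfun]] in auto)
  then show ?thesis by (rule A_minus_eq[OF assms(1,2)])
qed

lemma f_eqI_l:
  assumes "x \<in> carrier A" "y \<in> carrier A" "\<And>z. z \<in> carrier A \<Longrightarrow> f (x \<cdot> z) = f (y \<cdot> z)"
  shows "x = y"
proof -
  have "x \<ominus>\<^bsub>A\<^esub> y = \<zero>\<^bsub>A\<^esub>"
    by (rule f_nd_l) (use assms lfun_minus[OF lfun_mult_r[OF f_lfun]] in auto)
  then show ?thesis by (rule A_minus_eq[OF assms(1,2)])
qed

text \<open>The relations of \<open>A\<close> make \<open>lvf u\<close> symmetric, so that the vanishing theorem applies to it.\<close>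

definition lvf :: "('v, 'e) algelt \<Rightarrow> 'e lvec" where
  "lvf u w = (if set w \<subseteq> arcs G then cnj (f (lw w \<cdot> u)) else 0)"

text \<open>Removing the last arc \<open>a\<close> replaces \<open>u\<close> by \<open>a u\<close>,
  so the induction runs over all \<open>u\<close>. The conjugate in \<open>lvf\<close> matches the
  conjugate cells in \<open>red\<close>, which makes the contraction the conjugate of a
  relation.\<close>

lemma Sym_lvf: "u \<in> carrier A \<Longrightarrow> Sym n (lvf u)"
proof (induction n arbitrary: u)
  case (Suc n)
  have "red (lvf u) w = 0" for w
  proof (cases w)
    case (Cons a v)
    show ?thesis
    proof (cases "set v \<subseteq> arcs G")
      case True
      have l: "lfun (\<lambda>x. f (lw v \<cdot> (x \<cdot> u)))"
        by (rule lfun_mult_r[OF lfun_mult_l[OF f_lfun]]) (use True lw_closed Suc.prems in auto)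
      have "red (lvf u) (a # v) = (\<Sum>c\<in>E. \<Sum>c'\<in>E. cnj (W a c c' * f (lw v \<cdot> (ae c \<cdot> ae c' \<cdot> u))))"
        unfolding red_simps
        by (intro sum.cong[OF refl]) (use True lw_closed Suc.prems in \<open>simp add: lvf_def A.m_assoc\<close>)
      also have "\<dots> = cnj (\<Sum>c\<in>E. \<Sum>c'\<in>E. W a c c' * f (lw v \<cdot> (ae c \<cdot> ae c' \<cdot> u)))"
        by (simp only: cnj_sum)
      also have "\<dots> = 0"
        by (simp only: rel_fun[OF l]) simp
      finally show ?thesis by (simp only: Cons)
    qed (simp add: Cons lvf_def)
  qed simp
  moreover have "Sym n (\<lambda>w. lvf u (a # w))" for a
  proof (cases "a \<in> arcs G")
    case True
    then have "(\<lambda>w. lvf u (a # w)) = lvf (ae a \<cdot> u)"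
      using Suc.prems lw_closed by (auto simp: lvf_def A.m_assoc fun_eq_iff)
    then show ?thesis using Suc True by simp
  next
    case False
    then have "(\<lambda>w. lvf u (a # w)) = (\<lambda>w. lvf \<zero>\<^bsub>A\<^esub> w)"
      using lw_closed by (auto simp: lvf_def fun_eq_iff lfun_zero[OF f_lfun])
    then show ?thesis using Suc.IH[of "\<zero>\<^bsub>A\<^esub>"] by simp
  qed
  ultimately show ?case by auto
qed simp

lemma lw_pth: "set w \<subseteq> arcs G \<Longrightarrow> \<not> pth w \<Longrightarrow> lw w = \<zero>\<^bsub>A\<^esub>"
proof (induction w rule: pth.induct)
  case (1 a b w)
  then have ab: "a \<in> arcs G" "b \<in> arcs G" "lw w \<in> carrier A" by (auto intro: lw_closed)
  show ?case
  proof (cases "pth (b # w)")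
    case True
    then have ne: "head G b \<noteq> tail G a" using 1 by simp
    have "ae b \<cdot> ae a = (ae b \<cdot> ve (head G b)) \<cdot> ae a"
      using ab by (simp add: ae_ve)
    also have "\<dots> = \<zero>\<^bsub>A\<^esub>" using ab ne by (simp add: A.m_assoc ve_ae)
    finally show ?thesis using ab by (simp add: A.m_assoc)
  next
    case False
    then have "lw (b # w) = \<zero>\<^bsub>A\<^esub>" using 1 by simp
    then show ?thesis using ab by simp
  qed
qed simp_all

text \<open>Every pairing of the word with some \<open>y\<close> is an entry of a symmetric vector
  of length \<open>h - 2\<close> and vanishes; non-degeneracy does the rest.\<close>

lemma lw_zero: "set w \<subseteq> arcs G \<Longrightarrow> length w = h - 2 \<Longrightarrow> lw w = \<zero>\<^bsub>A\<^esub>"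
proof (rule f_nd_l)
  fix y assume w: "set w \<subseteq> arcs G" "length w = h - 2" and y: "y \<in> carrier A"
  have "lvf y w = 0"
  proof (rule Sym_vanish[OF Sym_lvf[OF y] _ w(2,1)])
    fix w assume "lvf y w \<noteq> 0"
    then show "pth w"
      by (cases "pth w") (use lw_pth[of w] y lfun_zero[OF f_lfun] in \<open>auto simp: lvf_def split: if_splits\<close>)
  qed
  then show "f (lw w \<cdot> y) = 0" using w by (simp add: lvf_def)
qed (rule lw_closed)

lemma lw_append: "set (w @ w') \<subseteq> arcs G \<Longrightarrow> lw (w @ w') = lw w' \<cdot> lw w"
  by (induction w) (use lw_closed in \<open>auto simp: A.m_assoc\<close>)

lemma lw_gr: "set w \<subseteq> arcs G \<Longrightarrow> lw w \<in> gr (length w)"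
proof (induction w)
  case Nil
  show ?case using gr_sc[of 1] by (simp add: sc_one)
next
  case (Cons a w)
  then have "lw w \<cdot> ae a \<in> gr (length w + 1)" by (intro gr_mult gr_ae) auto
  then show ?case by simp
qed

text \<open>A word of length at least \<open>h - 2\<close> has a factor of length exactly
  \<open>h - 2\<close>, which is already zero.\<close>

lemma gr_nilpotent:
  assumes "h - 2 \<le> n" "x \<in> gr n"
  shows "x = \<zero>\<^bsub>A\<^esub>"
proof (rule gr_trivial[OF _ assms(2)])
  fix w assume w: "set w \<subseteq> arcs G" "length w = n"
  let ?m = "n - (h - 2)"
  have s: "set (take ?m w) \<subseteq> arcs G" "set (drop ?m w) \<subseteq> arcs G"
    using w(1) set_take_subset set_drop_subset by fastforce+
  have "lw w = lw (drop ?m w) \<cdot> lw (take ?m w)"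
    using lw_append[of "take ?m w" "drop ?m w"] w by simp
  also have "lw (drop ?m w) = \<zero>\<^bsub>A\<^esub>"
    by (rule lw_zero) (use assms w s in auto)
  finally show "lw w = \<zero>\<^bsub>A\<^esub>" using lw_closed[OF s(1)] by simp
qed

text \<open>Below \<open>h - 3\<close> this is part of the hypothesis on the form; above it nothing
  is left in \<open>A\<close>.\<close>

lemma f_deg: "x \<in> gr n \<Longrightarrow> n \<noteq> h - 3 \<Longrightarrow> f x = 0"
proof (cases "n < h - 3")
  case False
  assume "x \<in> gr n" "n \<noteq> h - 3"
  then have "x = \<zero>\<^bsub>A\<^esub>" using False h4 by (intro gr_nilpotent[of n]) auto
  then show ?thesis using lfun_zero[OF f_lfun] by simp
qed (rule f_low)

lemma gr_decomp:
  "x \<in> carrier A \<Longrightarrow> \<exists>t. (\<forall>n. t n \<in> gr n) \<and> x = finsum A t {..h - 3}"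
proof (induction x rule: A_gr_induct)
  case zero
  show ?case by (rule exI[of _ "\<lambda>_. \<zero>\<^bsub>A\<^esub>"]) (simp add: A.finsum_zero)
next
  case (hom n x)
  let ?t = "\<lambda>m. if n = m then x else \<zero>\<^bsub>A\<^esub>"
  have "x = finsum A ?t {..h - 3}"
  proof (cases "n \<le> h - 3")
    case True
    then show ?thesis
      using A.finsum_singleton[of n "{..h - 3}" "\<lambda>_. x"] gr_closed[OF hom] by auto
  next
    case False
    then have "x = \<zero>\<^bsub>A\<^esub>" using h4 hom by (intro gr_nilpotent[of n]) auto
    then show ?thesis by (simp add: A.finsum_zero cong: if_cong)
  qed
  then show ?case using hom by (intro exI[of _ ?t]) auto
next
  case (add x y)
  then obtain t t' where t: "\<forall>n. t n \<in> gr n" "x = finsum A t {..h - 3}"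
    "\<forall>n. t' n \<in> gr n" "y = finsum A t' {..h - 3}" by auto
  then have "x \<oplus>\<^bsub>A\<^esub> y = finsum A (\<lambda>n. t n \<oplus>\<^bsub>A\<^esub> t' n) {..h - 3}"
    by (subst A.finsum_addf) (auto intro: gr_closed)
  then show ?case using t gr_add by (intro exI[of _ "\<lambda>n. t n \<oplus>\<^bsub>A\<^esub> t' n"]) auto
qed

lemma corner_gr:
  assumes "i \<in> verts G" "l \<in> verts G" "x \<in> corner G W i p l"
  shows "x \<in> gr p"
proof -
  obtain y where y: "y \<in> gr p" "x = ve i \<cdot> y \<cdot> ve l"
    using assms(3) unfolding corner_def by blast
  have "ve i \<cdot> y \<cdot> ve l \<in> gr (0 + p + 0)"
    by (intro gr_mult gr_ve assms y)
  then show ?thesis by (simp add: y)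
qed

lemma B_gr: "b \<in> B \<Longrightarrow> \<exists>p. b \<in> gr p"
proof -
  assume "b \<in> B"
  then have "b \<in> (\<Union>i\<in>verts G. \<Union>l\<in>verts G. \<Union>p. corner G W i p l)"
    by (rule subsetD[OF hb[unfolded homogeneous_basis_def, THEN conjunct1]])
  then show ?thesis by (elim UN_E) (rule exI, rule corner_gr)
qed

lemma B_closed [simp]: "b \<in> B \<Longrightarrow> b \<in> carrier A"
  using B_gr gr_closed by blast

lemma d_closed [simp]: "b \<in> B \<Longrightarrow> d b \<in> carrier A"
  using db unfolding dual_basis_def by auto

lemma f_dual: "b \<in> B \<Longrightarrow> b' \<in> B \<Longrightarrow> f (b \<cdot> d b') = of_bool (b = b')"
  using db unfolding dual_basis_def by auto

section \<open>Expansion in dual bases\<close>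

lemma B_ex:
  assumes "x \<in> carrier A"
  obtains c where "finite {b. c b \<noteq> 0}" "{b. c b \<noteq> 0} \<subseteq> B"
    "x = finsum A (\<lambda>b. sc (c b) \<cdot> b) {b. c b \<noteq> 0}"
proof -
  have "\<exists>c. finite {b. c b \<noteq> 0} \<and> {b. c b \<noteq> 0} \<subseteq> B \<and>
      x = finsum A (\<lambda>b. sc (c b) \<cdot> b) {b. c b \<noteq> 0}"
    by (rule ex1_implies_ex, rule hb[unfolded homogeneous_basis_def, THEN conjunct2, rule_format, OF assms])
  then show thesis by (elim exE conjE) (rule that)
qed

lemma B_span_coeff:
  assumes "finite S" "S \<subseteq> B" "x = finsum A (\<lambda>b. sc (c b) \<cdot> b) S" "b \<in> B"
  shows "f (x \<cdot> d b) = (if b \<in> S then c b else 0)"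
proof -
  have "f (x \<cdot> d b) = (\<Sum>b'\<in>S. f (sc (c b') \<cdot> b' \<cdot> d b))"
    unfolding assms(3) using assms by (intro lfun_finsum[OF lfun_mult_r[OF f_lfun]]) auto
  also have "\<dots> = (\<Sum>b'\<in>S. if b' = b then c b else 0)"
  proof (rule sum.cong[OF refl])
    fix b' assume "b' \<in> S"
    then have b': "b' \<in> B" using assms by auto
    show "f (sc (c b') \<cdot> b' \<cdot> d b) = (if b' = b then c b else 0)"
      using b' assms(4) lfun_sc[OF f_lfun, of "b' \<cdot> d b" "c b'"] f_dual[OF b' assms(4)]
      by (simp add: A.m_assoc)
  qed
  also have "\<dots> = (if b \<in> S then c b else 0)"
    using assms(1) by simp
  finally show ?thesis .
qed

lemma finite_support: "x \<in> carrier A \<Longrightarrow> finite {b \<in> B. f (x \<cdot> d b) \<noteq> 0}"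
proof (elim B_ex)
  fix c assume c: "finite {b. c b \<noteq> 0}" "{b. c b \<noteq> 0} \<subseteq> B"
    "x = finsum A (\<lambda>b. sc (c b) \<cdot> b) {b. c b \<noteq> 0}"
  then have "{b \<in> B. f (x \<cdot> d b) \<noteq> 0} \<subseteq> {b. c b \<noteq> 0}"
    using B_span_coeff[OF c] by auto
  then show ?thesis using c(1) finite_subset by blast
qed

lemma exp_span:
  assumes x: "x \<in> carrier A" and S: "finite S" "S \<subseteq> B" "{b \<in> B. f (x \<cdot> d b) \<noteq> 0} \<subseteq> S"
  shows "x = finsum A (\<lambda>b. sc (f (x \<cdot> d b)) \<cdot> b) S"
proof -
  obtain c where c: "finite {b. c b \<noteq> 0}" "{b. c b \<noteq> 0} \<subseteq> B"
    "x = finsum A (\<lambda>b. sc (c b) \<cdot> b) {b. c b \<noteq> 0}" using x by (rule B_ex)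
  have fc: "f (x \<cdot> d b) = c b" if "b \<in> B" for b
    using B_span_coeff[OF c that] by auto
  have "x = finsum A (\<lambda>b. sc (c b) \<cdot> b) {b. c b \<noteq> 0}" by (rule c)
  also have "\<dots> = finsum A (\<lambda>b. sc (c b) \<cdot> b) S"
  proof (rule A.add.finprod_mono_neutral_cong_left[OF S(1)])
    show "{b. c b \<noteq> 0} \<subseteq> S"
    proof
      fix b assume "b \<in> {b. c b \<noteq> 0}"
      then have "b \<in> B" "c b \<noteq> 0" using c(2) by auto
      then show "b \<in> S" using S(3) fc by auto
    qed
  qed (use S c(2) in \<open>auto simp: sc_zero subset_iff\<close>)
  also have "\<dots> = finsum A (\<lambda>b. sc (f (x \<cdot> d b)) \<cdot> b) S"
    by (rule A.finsum_cong') (use S fc in auto)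
  finally show ?thesis .
qed

text \<open>\<open>A\<close> is spanned by finitely many paths, and each of them pairs non-trivially
  with finitely many dual vectors only. For \<open>b\<close> outside the union of these supports,
  \<open>d b\<close> would be orthogonal to all of \<open>A\<close>, against f (b d b) = 1.\<close>

lemma finite_B: "finite B"
proof -
  \<comment> \<open>The bound \<open>h\<close> is generous: longer words vanish by
    \<open>gr_nilpotent\<close>.\<close>
  define L where "L = {w. set w \<subseteq> arcs G \<and> length w \<le> h}"
  have "finite L" unfolding L_def by (intro finite_lists_length_le) simp
  define S where "S = (\<Union>v\<in>verts G. \<Union>w\<in>L. {b \<in> B. f (ve v \<cdot> lw w \<cdot> d b) \<noteq> 0})"
  have fS: "finite S" unfolding S_def
    using \<open>finite L\<close> by (intro finite_UN_I finite_support) (auto simp: L_def intro: lw_closed)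
  have *: "f (x \<cdot> d b) = 0" if x: "x \<in> carrier A" and b: "b \<in> B" "b \<notin> S" for x b
    using x
  proof (elim A_cases)
    fix t assume t: "t \<in> carrier CG" "x = cls G W t"
    from t(1) have "f (cls G W t \<cdot> d b) = 0"
    proof (induction t rule: pa_induct)
      case (single u p c)
      have s: "set (rev p) \<subseteq> arcs G" using single by (auto simp: paths_def awalk_def)
      have u: "u \<in> verts G" using single paths_verts by blast
      have "f (ve u \<cdot> lw (rev p) \<cdot> d b) = 0"
      proof (cases "length p \<le> h")
        case True
        then show ?thesis using b s u unfolding S_def L_def by fastforce
      next
        case False
        have "lw (rev p) \<in> gr (length (rev p))" using s by (rule lw_gr)
        then have "lw (rev p) = \<zero>\<^bsub>A\<^esub>" using False by (intro gr_nilpotent[of "length (rev p)"]) auto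
        then show ?thesis using u b lfun_zero[OF f_lfun] by simp
      qed
      then show ?case
        using lfun_sc[OF f_lfun, of "ve u \<cdot> lw (rev p) \<cdot> d b" c] single u b lw_closed[OF s]
        by (simp add: cls_single_lw A.m_assoc)
    next
      case (add x y)
      then show ?case
        using b by (simp add: cls_add lfun_add[OF lfun_mult_r[OF f_lfun]])
    qed (use b lfun_zero[OF f_lfun] in \<open>simp add: cls_zero\<close>)
    then show ?thesis by (simp add: t)
  qed
  have "B \<subseteq> S"
  proof
    fix b assume b: "b \<in> B"
    show "b \<in> S"
      using *[of b b] f_dual[OF b b] b by fastforce
  qed
  then show ?thesis using fS finite_subset by blast
qed

lemma exp1: "x \<in> carrier A \<Longrightarrow> x = finsum A (\<lambda>b. sc (f (x \<cdot> d b)) \<cdot> b) B"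
  by (rule exp_span) (auto simp: finite_B)

text \<open>The way dual bases are used later: a sum over \<open>b\<close> of a value of
  \<open>f\<close> at \<open>d b\<close> times a functional at \<open>b\<close> collapses to a
  single value.\<close>

lemma lfun_exp1:
  assumes "lfun l" "x \<in> carrier A"
  shows "l x = (\<Sum>b\<in>B. f (x \<cdot> d b) * l b)"
proof -
  have "l x = l (finsum A (\<lambda>b. sc (f (x \<cdot> d b)) \<cdot> b) B)" using exp1[OF assms(2)] by simp
  also have "\<dots> = (\<Sum>b\<in>B. l (sc (f (x \<cdot> d b)) \<cdot> b))"
    by (rule lfun_finsum[OF assms(1) finite_B]) simp
  finally show ?thesis by (simp add: lfun_sc[OF assms(1)])
qed

lemma f_eqB:
  assumes "x \<in> carrier A" "y \<in> carrier A" "\<And>b. b \<in> B \<Longrightarrow> f (b \<cdot> x) = f (b \<cdot> y)"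
  shows "x = y"
proof (rule f_eqI_r[OF assms(1,2)])
  fix z assume z: "z \<in> carrier A"
  show "f (z \<cdot> x) = f (z \<cdot> y)"
    using lfun_exp1[OF lfun_mult_r[OF f_lfun assms(1)] z] lfun_exp1[OF lfun_mult_r[OF f_lfun assms(2)] z]
      assms(3) by simp
qed

text \<open>Both sides have the same pairing with every basis element, and \<open>f_eqB\<close> says
  that these pairings separate.\<close>

lemma exp2: "x \<in> carrier A \<Longrightarrow> x = finsum A (\<lambda>b. sc (f (b \<cdot> x)) \<cdot> d b) B"
proof (rule f_eqB)
  fix b assume x: "x \<in> carrier A" and b: "b \<in> B"
  have "f (b \<cdot> finsum A (\<lambda>b. sc (f (b \<cdot> x)) \<cdot> d b) B) = (\<Sum>b'\<in>B. f (b \<cdot> (sc (f (b' \<cdot> x)) \<cdot> d b')))"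
    using b x by (intro lfun_finsum[OF lfun_mult_l[OF f_lfun] finite_B]) auto
  also have "\<dots> = (\<Sum>b'\<in>B. if b' = b then f (b \<cdot> x) else 0)"
    by (rule sum.cong[OF refl])
      (use b x in \<open>auto simp: lfun_sc[OF lfun_mult_l[OF f_lfun]] f_dual\<close>)
  also have "\<dots> = f (b \<cdot> x)" using b by (simp add: finite_B)
  finally show "f (b \<cdot> x) = f (b \<cdot> finsum A (\<lambda>b. sc (f (b \<cdot> x)) \<cdot> d b) B)" by simp
qed (auto intro!: A.finsum_closed)

lemma lfun_exp2:
  assumes "lfun l" "x \<in> carrier A"
  shows "l x = (\<Sum>b\<in>B. f (b \<cdot> x) * l (d b))"
proof -
  have "l x = l (finsum A (\<lambda>b. sc (f (b \<cdot> x)) \<cdot> d b) B)" using exp2[OF assms(2)] by simp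
  also have "\<dots> = (\<Sum>b\<in>B. l (sc (f (b \<cdot> x)) \<cdot> d b))"
    by (rule lfun_finsum[OF assms(1) finite_B]) simp
  finally show ?thesis by (simp add: lfun_sc[OF assms(1)])
qed

definition dg where "dg b = (SOME p. b \<in> gr p)"

lemma dg: "b \<in> B \<Longrightarrow> b \<in> gr (dg b)"
  unfolding dg_def by (rule someI_ex[OF B_gr])

lemma dg_le: "b \<in> B \<Longrightarrow> dg b \<le> h - 3"
proof (rule ccontr)
  assume b: "b \<in> B" "\<not> dg b \<le> h - 3"
  then have "b = \<zero>\<^bsub>A\<^esub>" using gr_nilpotent[OF _ dg] h4 by auto
  then show False using f_dual[OF b(1) b(1)] b(1) d_closed[OF b(1)] lfun_zero[OF f_lfun] by auto
qed

text \<open>Degree p pairs only with degree h - 3 - p. So the component of \<open>d b\<close> in the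
  complementary degree has the same pairings with \<open>B\<close> as \<open>d b\<close>
  itself.\<close>

lemma d_gr:
  assumes b: "b \<in> B"
  shows "d b \<in> gr (h - 3 - dg b)"
proof -
  obtain t where t: "\<forall>n. t n \<in> gr n" "d b = finsum A t {..h - 3}"
    using gr_decomp[OF d_closed[OF b]] by auto
  then have tc: "t n \<in> carrier A" for n using gr_closed by blast
  let ?q = "h - 3 - dg b"
  have val: "f (b' \<cdot> t n) = 0" if "b' \<in> B" "n \<noteq> h - 3 - dg b'" for b' n
    by (rule f_deg[OF gr_mult[OF dg[OF that(1)]]]) (use t that dg_le[OF that(1)] in auto)
  have "d b = t ?q"
  proof (rule f_eqB)
    fix b' assume b': "b' \<in> B"
    have "f (b' \<cdot> d b) = (\<Sum>n\<in>{..h - 3}. f (b' \<cdot> t n))"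
      unfolding t(2) using b' tc by (intro lfun_finsum[OF lfun_mult_l[OF f_lfun]]) auto
    also have "\<dots> = (\<Sum>n\<in>{h - 3 - dg b'}. f (b' \<cdot> t n))"
      by (rule sum.mono_neutral_right) (use val b' in auto)
    finally have eq: "f (b' \<cdot> d b) = f (b' \<cdot> t (h - 3 - dg b'))" by simp
    show "f (b' \<cdot> d b) = f (b' \<cdot> t ?q)"
    proof (cases "dg b' = dg b")
      case False
      then have "b' \<noteq> b" "?q \<noteq> h - 3 - dg b'" using dg_le[OF b] dg_le[OF b'] by auto
      then show ?thesis using val[OF b'] f_dual[OF b' b] by simp
    qed (simp add: eq)
  qed (use b tc in auto)
  then show ?thesis using t(1) by metis
qed

section \<open>The inverse of \<beta>\<close>

abbreviation sg where "sg \<equiv> inv_into (carrier A) bt"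

text \<open>Since f (x z) = f (z \<beta>(x)), the image \<beta>(x) determines all pairings of
  \<open>x\<close> and hence \<open>x\<close>.\<close>

lemma bt_bij: "bij_betw bt (carrier A) (carrier A)"
proof -
  have "inj_on bt (carrier A)"
  proof (rule inj_onI)
    fix x y assume xy: "x \<in> carrier A" "y \<in> carrier A" "bt x = bt y"
    show "x = y"
    proof (rule f_eqI_l[OF xy(1,2)])
      fix z assume z: "z \<in> carrier A"
      show "f (x \<cdot> z) = f (y \<cdot> z)" unfolding f_nu[OF xy(1) z] f_nu[OF xy(2) z] xy(3) by (rule refl)
    qed
  qed
  then show ?thesis unfolding bij_betw_def using bt_surj by force
qed

lemma sg_closed [simp]: "x \<in> carrier A \<Longrightarrow> sg x \<in> carrier A"
  using bt_bij by (metis bij_betw_def inv_into_into)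

lemma bt_sg [simp]: "x \<in> carrier A \<Longrightarrow> bt (sg x) = x"
  using bt_bij by (metis bij_betw_def f_inv_into_f)

lemma sg_bt [simp]: "x \<in> carrier A \<Longrightarrow> sg (bt x) = x"
  using bt_bij by (metis bij_betw_def inv_into_f_f)

lemma sg_eqI: "x \<in> carrier A \<Longrightarrow> bt x = y \<Longrightarrow> sg y = x"
  by auto

lemma sg_add: "x \<in> carrier A \<Longrightarrow> y \<in> carrier A \<Longrightarrow> sg (x \<oplus>\<^bsub>A\<^esub> y) = sg x \<oplus>\<^bsub>A\<^esub> sg y"
  by (rule sg_eqI) (simp_all add: bt_add)

lemma sg_mult: "x \<in> carrier A \<Longrightarrow> y \<in> carrier A \<Longrightarrow> sg (x \<cdot> y) = sg x \<cdot> sg y"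
  by (rule sg_eqI) (simp_all add: bt_mult)

lemma sg_one: "sg \<one>\<^bsub>A\<^esub> = \<one>\<^bsub>A\<^esub>"
  by (rule sg_eqI) (simp_all add: bt_one)

lemma f_sg: "x \<in> carrier A \<Longrightarrow> y \<in> carrier A \<Longrightarrow> f (sg x \<cdot> y) = f (y \<cdot> x)"
  using f_nu[of "sg x" y] by simp

end

section \<open>Bimodules embedded into bilinear functions\<close>

text \<open>The bimodule \<open>P\<close> is the sum over \<open>k \<in> K\<close> of \<open>A s(k) \<otimes> r(k) A\<close> (tensor product over the
  complex numbers), \<open>\<gamma> x k y\<close> being \<open>x s(k) \<otimes> r(k) y\<close>. The form identifies it with a space of
  bilinear forms, \<open>\<Theta> z k (u, g)\<close>, on which all maps of the complex have explicit formulas.\<close>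

locale fbim = frob G h \<phi> W \<nu>0 \<nu>1 f B d
  for G :: "('v, 'e) pre_digraph" and h \<phi> W \<nu>0 \<nu>1 f B d +
  fixes P :: "(('v, 'e) algelt, 'p, ('v, 'e) algelt) bimod" and K :: "'k set"
    and s r :: "'k \<Rightarrow> 'v"
    and \<gamma> :: "('v, 'e) algelt \<Rightarrow> 'k \<Rightarrow> ('v, 'e) algelt \<Rightarrow> 'p"
    and \<Theta> :: "'p \<Rightarrow> 'k \<Rightarrow> ('v, 'e) algelt \<Rightarrow> ('v, 'e) algelt \<Rightarrow> complex"
    and \<delta> :: nat
  assumes finite_K: "finite K"
    and s_verts [simp]: "k \<in> K \<Longrightarrow> s k \<in> verts G" and r_verts [simp]: "k \<in> K \<Longrightarrow> r k \<in> verts G"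
    and bim: "bimodule A A P"
    and gm_closed [simp]: "x \<in> carrier A \<Longrightarrow> k \<in> K \<Longrightarrow> y \<in> carrier A \<Longrightarrow> \<gamma> x k y \<in> carrier P"
    and gm_smult: "w \<in> carrier A \<Longrightarrow> x \<in> carrier A \<Longrightarrow> k \<in> K \<Longrightarrow> y \<in> carrier A \<Longrightarrow>
      w \<odot>\<^bsub>P\<^esub> \<gamma> x k y = \<gamma> (w \<cdot> x) k y"
    and gm_rsmult: "w \<in> carrier A \<Longrightarrow> x \<in> carrier A \<Longrightarrow> k \<in> K \<Longrightarrow> y \<in> carrier A \<Longrightarrow>
      \<gamma> x k y \<odot>r\<^bsub>P\<^esub> w = \<gamma> x k (y \<cdot> w)"
    and gm_add_l: "x \<in> carrier A \<Longrightarrow> x' \<in> carrier A \<Longrightarrow> k \<in> K \<Longrightarrow> y \<in> carrier A \<Longrightarrow>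
      \<gamma> (x \<oplus>\<^bsub>A\<^esub> x') k y = \<gamma> x k y \<oplus>\<^bsub>P\<^esub> \<gamma> x' k y"
    and gm_add_r: "x \<in> carrier A \<Longrightarrow> k \<in> K \<Longrightarrow> y \<in> carrier A \<Longrightarrow> y' \<in> carrier A \<Longrightarrow>
      \<gamma> x k (y \<oplus>\<^bsub>A\<^esub> y') = \<gamma> x k y \<oplus>\<^bsub>P\<^esub> \<gamma> x k y'"
    and gm_sc: "x \<in> carrier A \<Longrightarrow> k \<in> K \<Longrightarrow> y \<in> carrier A \<Longrightarrow>
      \<gamma> (sc c \<cdot> x) k y = \<gamma> x k (sc c \<cdot> y)"
    and gm_s: "x \<in> carrier A \<Longrightarrow> k \<in> K \<Longrightarrow> y \<in> carrier A \<Longrightarrow> \<gamma> (x \<cdot> ve (s k)) k y = \<gamma> x k y"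
    and gm_r: "x \<in> carrier A \<Longrightarrow> k \<in> K \<Longrightarrow> y \<in> carrier A \<Longrightarrow> \<gamma> x k (ve (r k) \<cdot> y) = \<gamma> x k y"
    and span: "z \<in> carrier P \<Longrightarrow> Q \<zero>\<^bsub>P\<^esub> \<Longrightarrow>
      (\<And>x k y. x \<in> carrier A \<Longrightarrow> k \<in> K \<Longrightarrow> y \<in> carrier A \<Longrightarrow> Q (\<gamma> x k y)) \<Longrightarrow>
      (\<And>z z'. z \<in> carrier P \<Longrightarrow> z' \<in> carrier P \<Longrightarrow> Q z \<Longrightarrow> Q z' \<Longrightarrow> Q (z \<oplus>\<^bsub>P\<^esub> z')) \<Longrightarrow> Q z"
    and Th_add: "z \<in> carrier P \<Longrightarrow> z' \<in> carrier P \<Longrightarrow> k \<in> K \<Longrightarrow> u \<in> carrier A \<Longrightarrow> g \<in> carrier A \<Longrightarrow>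
      \<Theta> (z \<oplus>\<^bsub>P\<^esub> z') k u g = \<Theta> z k u g + \<Theta> z' k u g"
    and Th_gm: "x \<in> carrier A \<Longrightarrow> k \<in> K \<Longrightarrow> y \<in> carrier A \<Longrightarrow> k' \<in> K \<Longrightarrow>
      u \<in> carrier A \<Longrightarrow> g \<in> carrier A \<Longrightarrow>
      \<Theta> (\<gamma> x k y) k' u g = (if k' = k then f (x \<cdot> (ve (s k) \<cdot> u)) * f (g \<cdot> (ve (r k) \<cdot> y)) else 0)"
    and gm_grading: "x \<in> gr p \<Longrightarrow> k \<in> K \<Longrightarrow> y \<in> gr q \<Longrightarrow> \<gamma> x k y \<in> grading P (p + q + \<delta>)"
    and grading_span: "z \<in> grading P n \<Longrightarrow> Q \<zero>\<^bsub>P\<^esub> \<Longrightarrow>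
      (\<And>x k y p q. x \<in> gr p \<Longrightarrow> k \<in> K \<Longrightarrow> y \<in> gr q \<Longrightarrow> p + q + \<delta> = n \<Longrightarrow> Q (\<gamma> x k y)) \<Longrightarrow>
      (\<And>z z'. z \<in> carrier P \<Longrightarrow> z' \<in> carrier P \<Longrightarrow> Q z \<Longrightarrow> Q z' \<Longrightarrow> Q (z \<oplus>\<^bsub>P\<^esub> z')) \<Longrightarrow> Q z"
    and grading_zero: "\<zero>\<^bsub>P\<^esub> \<in> grading P n"
    and grading_add: "z \<in> grading P n \<Longrightarrow> z' \<in> grading P n \<Longrightarrow> z \<oplus>\<^bsub>P\<^esub> z' \<in> grading P n"
begin

sublocale P: abelian_group P
  using bim unfolding bimodule_def by blast

lemma smult_closed: "w \<in> carrier A \<Longrightarrow> z \<in> carrier P \<Longrightarrow> w \<odot>\<^bsub>P\<^esub> z \<in> carrier P"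
  using bimodule.smult_closed[OF bim] .

lemma rsmult_closed: "w \<in> carrier A \<Longrightarrow> z \<in> carrier P \<Longrightarrow> z \<odot>r\<^bsub>P\<^esub> w \<in> carrier P"
  using bimodule.rsmult_closed[OF bim] .

lemma P_zero_eqI: "z \<in> carrier P \<Longrightarrow> z = z \<oplus>\<^bsub>P\<^esub> z \<Longrightarrow> z = \<zero>\<^bsub>P\<^esub>"
  using P.add.l_cancel_one' by simp

lemma gm_zero_l: "k \<in> K \<Longrightarrow> y \<in> carrier A \<Longrightarrow> \<gamma> \<zero>\<^bsub>A\<^esub> k y = \<zero>\<^bsub>P\<^esub>"
  using gm_add_l[of "\<zero>\<^bsub>A\<^esub>" "\<zero>\<^bsub>A\<^esub>" k y] by (intro P_zero_eqI) auto

lemma gm_zero_r: "k \<in> K \<Longrightarrow> x \<in> carrier A \<Longrightarrow> \<gamma> x k \<zero>\<^bsub>A\<^esub> = \<zero>\<^bsub>P\<^esub>"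
  using gm_add_r[of x k "\<zero>\<^bsub>A\<^esub>" "\<zero>\<^bsub>A\<^esub>"] by (intro P_zero_eqI) auto

lemma gm_finsum_l:
  assumes "finite S" "k \<in> K" "y \<in> carrier A" "\<And>i. i \<in> S \<Longrightarrow> t i \<in> carrier A"
  shows "\<gamma> (finsum A t S) k y = finsum P (\<lambda>i. \<gamma> (t i) k y) S"
  using assms(1,4)
proof (induction S rule: finite_induct)
  case (insert i S)
  then have "\<gamma> (t i \<oplus>\<^bsub>A\<^esub> finsum A t S) k y = \<gamma> (t i) k y \<oplus>\<^bsub>P\<^esub> \<gamma> (finsum A t S) k y"
    using assms(2,3) by (intro gm_add_l A.finsum_closed) auto
  moreover have "finsum A t (insert i S) = t i \<oplus>\<^bsub>A\<^esub> finsum A t S"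
    using insert by (intro A.finsum_insert) auto
  ultimately show ?case
    using insert assms(2,3) by (subst P.finsum_insert) auto
qed (simp add: gm_zero_l assms)

lemma gm_finsum_r:
  assumes "finite S" "k \<in> K" "x \<in> carrier A" "\<And>i. i \<in> S \<Longrightarrow> t i \<in> carrier A"
  shows "\<gamma> x k (finsum A t S) = finsum P (\<lambda>i. \<gamma> x k (t i)) S"
  using assms(1,4)
proof (induction S rule: finite_induct)
  case (insert i S)
  then have "\<gamma> x k (t i \<oplus>\<^bsub>A\<^esub> finsum A t S) = \<gamma> x k (t i) \<oplus>\<^bsub>P\<^esub> \<gamma> x k (finsum A t S)"
    using assms(2,3) by (intro gm_add_r A.finsum_closed) auto
  moreover have "finsum A t (insert i S) = t i \<oplus>\<^bsub>A\<^esub> finsum A t S"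
    using insert by (intro A.finsum_insert) auto
  ultimately show ?case
    using insert assms(2,3) by (subst P.finsum_insert) auto
qed (simp add: gm_zero_r assms)

lemma Th_zero: "k \<in> K \<Longrightarrow> u \<in> carrier A \<Longrightarrow> g \<in> carrier A \<Longrightarrow> \<Theta> \<zero>\<^bsub>P\<^esub> k u g = 0"
  using Th_add[of "\<zero>\<^bsub>P\<^esub>" "\<zero>\<^bsub>P\<^esub>" k u g] by simp

lemma Th_finsum:
  assumes "finite S" "\<And>i. i \<in> S \<Longrightarrow> t i \<in> carrier P" "k \<in> K" "u \<in> carrier A" "g \<in> carrier A"
  shows "\<Theta> (finsum P t S) k u g = (\<Sum>i\<in>S. \<Theta> (t i) k u g)"
  using assms(1,2)
proof (induction S rule: finite_induct)
  case (insert i S)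
  then have "\<Theta> (t i \<oplus>\<^bsub>P\<^esub> finsum P t S) k u g = \<Theta> (t i) k u g + \<Theta> (finsum P t S) k u g"
    using assms(3-) by (intro Th_add P.finsum_closed) auto
  moreover have "finsum P t (insert i S) = t i \<oplus>\<^bsub>P\<^esub> finsum P t S"
    using insert by (intro P.finsum_insert) auto
  ultimately show ?case using insert by simp
qed (simp add: Th_zero assms)

lemma Th_uminus:
  assumes "z \<in> carrier P" "k \<in> K" "u \<in> carrier A" "g \<in> carrier A"
  shows "\<Theta> (\<ominus>\<^bsub>P\<^esub> z) k u g = - \<Theta> z k u g"
  using Th_add[of "\<ominus>\<^bsub>P\<^esub> z" z k u g] assms Th_zero[of k u g] by (simp add: P.l_neg eq_neg_iff_add_eq_0)

lemma Th_minus: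
  assumes "z \<in> carrier P" "z' \<in> carrier P" "k \<in> K" "u \<in> carrier A" "g \<in> carrier A"
  shows "\<Theta> (z \<ominus>\<^bsub>P\<^esub> z') k u g = \<Theta> z k u g - \<Theta> z' k u g"
  using assms by (simp add: a_minus_def Th_add Th_uminus)

text \<open>In f (w x s u) the factor \<open>w\<close> moves to the other end as \<beta>(w). Hence
  left multiplication on tensors is right multiplication in the first argument of the form.\<close>

lemma Th_smult:
  assumes w: "w \<in> carrier A" and z: "z \<in> carrier P" and k: "k \<in> K" "u \<in> carrier A" "g \<in> carrier A"
  shows "\<Theta> (w \<odot>\<^bsub>P\<^esub> z) k u g = \<Theta> z k (u \<cdot> bt w) g"
  using z
proof (rule span)
  have "w \<odot>\<^bsub>P\<^esub> \<zero>\<^bsub>P\<^esub> = \<zero>\<^bsub>P\<^esub>"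
    using bimodule.smult_r_distr[OF bim w, of "\<zero>\<^bsub>P\<^esub>" "\<zero>\<^bsub>P\<^esub>"] smult_closed[OF w, of "\<zero>\<^bsub>P\<^esub>"]
    by (intro P_zero_eqI) auto
  then show "\<Theta> (w \<odot>\<^bsub>P\<^esub> \<zero>\<^bsub>P\<^esub>) k u g = \<Theta> \<zero>\<^bsub>P\<^esub> k (u \<cdot> bt w) g"
    using w k by (simp add: Th_zero)
  fix x k' y assume x: "x \<in> carrier A" "k' \<in> K" "y \<in> carrier A"
  have "f (w \<cdot> (x \<cdot> (ve (s k') \<cdot> u))) = f (x \<cdot> (ve (s k') \<cdot> u) \<cdot> bt w)"
    by (rule f_nu) (use w x k in auto)
  then show "\<Theta> (w \<odot>\<^bsub>P\<^esub> \<gamma> x k' y) k u g = \<Theta> (\<gamma> x k' y) k (u \<cdot> bt w) g"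
    using w x k by (simp add: gm_smult Th_gm A.m_assoc)
next
  fix z z' assume "z \<in> carrier P" "z' \<in> carrier P"
    "\<Theta> (w \<odot>\<^bsub>P\<^esub> z) k u g = \<Theta> z k (u \<cdot> bt w) g" "\<Theta> (w \<odot>\<^bsub>P\<^esub> z') k u g = \<Theta> z' k (u \<cdot> bt w) g"
  then show "\<Theta> (w \<odot>\<^bsub>P\<^esub> (z \<oplus>\<^bsub>P\<^esub> z')) k u g = \<Theta> (z \<oplus>\<^bsub>P\<^esub> z') k (u \<cdot> bt w) g"
    using w k by (simp add: bimodule.smult_r_distr[OF bim] Th_add smult_closed)
qed

text \<open>The mirror image: in f (g r y w) the last factor moves to the front as the preimage of
  \<open>w\<close> under \<beta>.\<close>

lemma Th_rsmult:
  assumes w: "w \<in> carrier A" and z: "z \<in> carrier P" and k: "k \<in> K" "u \<in> carrier A" "g \<in> carrier A"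
  shows "\<Theta> (z \<odot>r\<^bsub>P\<^esub> w) k u g = \<Theta> z k u (sg w \<cdot> g)"
  using z
proof (rule span)
  have "\<zero>\<^bsub>P\<^esub> \<odot>r\<^bsub>P\<^esub> w = \<zero>\<^bsub>P\<^esub>"
    using bimodule.rsmult_l_distr[OF bim, of "\<zero>\<^bsub>P\<^esub>" "\<zero>\<^bsub>P\<^esub>" w] rsmult_closed[OF w, of "\<zero>\<^bsub>P\<^esub>"] w
    by (intro P_zero_eqI) auto
  then show "\<Theta> (\<zero>\<^bsub>P\<^esub> \<odot>r\<^bsub>P\<^esub> w) k u g = \<Theta> \<zero>\<^bsub>P\<^esub> k u (sg w \<cdot> g)"
    using w k by (simp add: Th_zero)
  fix x k' y assume x: "x \<in> carrier A" "k' \<in> K" "y \<in> carrier A"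
  have "f (sg w \<cdot> (g \<cdot> (ve (r k') \<cdot> y))) = f (g \<cdot> (ve (r k') \<cdot> y) \<cdot> w)"
    by (rule f_sg) (use w x k in auto)
  then show "\<Theta> (\<gamma> x k' y \<odot>r\<^bsub>P\<^esub> w) k u g = \<Theta> (\<gamma> x k' y) k u (sg w \<cdot> g)"
    using w x k by (simp add: gm_rsmult Th_gm A.m_assoc)
next
  fix z z' assume "z \<in> carrier P" "z' \<in> carrier P"
    "\<Theta> (z \<odot>r\<^bsub>P\<^esub> w) k u g = \<Theta> z k u (sg w \<cdot> g)" "\<Theta> (z' \<odot>r\<^bsub>P\<^esub> w) k u g = \<Theta> z' k u (sg w \<cdot> g)"
  then show "\<Theta> ((z \<oplus>\<^bsub>P\<^esub> z') \<odot>r\<^bsub>P\<^esub> w) k u g = \<Theta> (z \<oplus>\<^bsub>P\<^esub> z') k u (sg w \<cdot> g)"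
    using w k by (simp add: bimodule.rsmult_l_distr[OF bim] Th_add rsmult_closed)
qed

text \<open>Families of bilinear forms on s(k)A and A r(k), extended by the vertex conditions to all
  of \<open>A\<close>. By \<open>form_Th\<close> and \<open>Th_Rz\<close> these are exactly the
  forms of tensors.\<close>

definition form where
  "form t \<longleftrightarrow> (\<forall>k\<in>K. (\<forall>g\<in>carrier A. lfun (\<lambda>u. t k u g)) \<and> (\<forall>u\<in>carrier A. lfun (t k u)) \<and>
     (\<forall>u\<in>carrier A. \<forall>g\<in>carrier A. t k (ve (s k) \<cdot> u) g = t k u g \<and> t k u (g \<cdot> ve (r k)) = t k u g))"

lemma formD:
  assumes "form t" "k \<in> K"
  shows "g \<in> carrier A \<Longrightarrow> lfun (\<lambda>u. t k u g)" "u \<in> carrier A \<Longrightarrow> lfun (t k u)"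
    "u \<in> carrier A \<Longrightarrow> g \<in> carrier A \<Longrightarrow> t k (ve (s k) \<cdot> u) g = t k u g"
    "u \<in> carrier A \<Longrightarrow> g \<in> carrier A \<Longrightarrow> t k u (g \<cdot> ve (r k)) = t k u g"
  using assms unfolding form_def by blast+

lemma ve_idem: "v \<in> verts G \<Longrightarrow> u \<in> carrier A \<Longrightarrow> ve v \<cdot> (ve v \<cdot> u) = ve v \<cdot> u"
  by (simp add: A.m_assoc[symmetric] ve_ve)

lemma form_Th: "z \<in> carrier P \<Longrightarrow> form (\<Theta> z)"
proof (rule span)
  show "form (\<Theta> \<zero>\<^bsub>P\<^esub>)"
    unfolding form_def lfun_def by (auto simp: Th_zero)
next
  fix x k y assume x: "x \<in> carrier A" "k \<in> K" "y \<in> carrier A"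
  have 1: "lfun (\<lambda>u. f (x \<cdot> (ve (s k) \<cdot> u)))"
    by (intro lfun_mult_l[OF lfun_mult_l[OF f_lfun]]) (use x in auto)
  have 2: "lfun (\<lambda>g. f (g \<cdot> (ve (r k) \<cdot> y)))"
    by (intro lfun_mult_r[OF f_lfun]) (use x in auto)
  show "form (\<Theta> (\<gamma> x k y))"
    unfolding form_def
  proof (intro ballI conjI)
    fix k' g assume k': "k' \<in> K" "g \<in> carrier A"
    show "lfun (\<lambda>u. \<Theta> (\<gamma> x k y) k' u g)"
      using lfun_add[OF 1] lfun_sc[OF 1] x k' unfolding lfun_def by (auto simp: Th_gm algebra_simps)
  next
    fix k' u assume k': "k' \<in> K" "u \<in> carrier A"
    show "lfun (\<Theta> (\<gamma> x k y) k' u)"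
      using lfun_add[OF 2] lfun_sc[OF 2] x k' unfolding lfun_def by (auto simp: Th_gm algebra_simps)
  next
    fix k' u g assume "k' \<in> K" "u \<in> carrier A" "g \<in> carrier A"
    then show "\<Theta> (\<gamma> x k y) k' (ve (s k') \<cdot> u) g = \<Theta> (\<gamma> x k y) k' u g"
      "\<Theta> (\<gamma> x k y) k' u (g \<cdot> ve (r k')) = \<Theta> (\<gamma> x k y) k' u g"
      using x by (auto simp: Th_gm ve_idem A.m_assoc)
  qed
next
  fix z z' assume z: "z \<in> carrier P" "z' \<in> carrier P" "form (\<Theta> z)" "form (\<Theta> z')"
  show "form (\<Theta> (z \<oplus>\<^bsub>P\<^esub> z'))"
    unfolding form_def
  proof (intro ballI conjI)
    fix k g assume k: "k \<in> K" "g \<in> carrier A"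
    show "lfun (\<lambda>u. \<Theta> (z \<oplus>\<^bsub>P\<^esub> z') k u g)"
      using lfun_plus[OF formD(1)[OF z(3) k] formD(1)[OF z(4) k]] z k
      unfolding lfun_def by (simp add: Th_add)
  next
    fix k u assume k: "k \<in> K" "u \<in> carrier A"
    show "lfun (\<Theta> (z \<oplus>\<^bsub>P\<^esub> z') k u)"
      using lfun_plus[OF formD(2)[OF z(3) k] formD(2)[OF z(4) k]] z k
      unfolding lfun_def by (simp add: Th_add)
  next
    fix k u g assume k: "k \<in> K" "u \<in> carrier A" "g \<in> carrier A"
    then show "\<Theta> (z \<oplus>\<^bsub>P\<^esub> z') k (ve (s k) \<cdot> u) g = \<Theta> (z \<oplus>\<^bsub>P\<^esub> z') k u g"
      "\<Theta> (z \<oplus>\<^bsub>P\<^esub> z') k u (g \<cdot> ve (r k)) = \<Theta> (z \<oplus>\<^bsub>P\<^esub> z') k u g"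
      using z formD(3,4)[OF z(3) k] formD(3,4)[OF z(4) k] by (simp_all add: Th_add)
  qed
qed

text \<open>The inverse of \<open>\<Theta>\<close>, by dual bases.\<close>

definition Rz where
  "Rz t = finsum P (\<lambda>k. finsum P (\<lambda>b. finsum P (\<lambda>b'.
     \<gamma> (sc (t k (d b) b') \<cdot> b) k (d b')) B) B) K"

lemma Rz_closed: "Rz t \<in> carrier P"
  unfolding Rz_def by (intro P.finsum_closed Pi_I gm_closed) auto

lemma P_cong:
  "(\<And>i. i \<in> S \<Longrightarrow> t i = t' i) \<Longrightarrow> (\<And>i. i \<in> S \<Longrightarrow> t' i \<in> carrier P) \<Longrightarrow> finsum P t S = finsum P t' S"
  by (rule P.finsum_cong') auto

lemma P_add:
  assumes "\<And>i. i \<in> S \<Longrightarrow> t i = t1 i \<oplus>\<^bsub>P\<^esub> t2 i"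
    and "\<And>i. i \<in> S \<Longrightarrow> t1 i \<in> carrier P" "\<And>i. i \<in> S \<Longrightarrow> t2 i \<in> carrier P"
  shows "finsum P t S = finsum P t1 S \<oplus>\<^bsub>P\<^esub> finsum P t2 S"
proof -
  have "finsum P t S = finsum P (\<lambda>i. t1 i \<oplus>\<^bsub>P\<^esub> t2 i) S"
    by (rule P_cong) (use assms in auto)
  also have "\<dots> = finsum P t1 S \<oplus>\<^bsub>P\<^esub> finsum P t2 S"
    by (rule P.finsum_addf) (use assms in auto)
  finally show ?thesis .
qed

lemma P_null: "(\<And>i. i \<in> S \<Longrightarrow> t i = \<zero>\<^bsub>P\<^esub>) \<Longrightarrow> finsum P t S = \<zero>\<^bsub>P\<^esub>"
  using P_cong[of S t "\<lambda>_. \<zero>\<^bsub>P\<^esub>"] by (simp add: P.finsum_zero)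

lemma P_sum_closed: "(\<And>i. i \<in> S \<Longrightarrow> t i \<in> carrier P) \<Longrightarrow> finsum P t S \<in> carrier P"
  by (rule P.finsum_closed) auto

lemma Rz_add: "Rz (\<lambda>k u g. t k u g + t' k u g) = Rz t \<oplus>\<^bsub>P\<^esub> Rz t'"
  unfolding Rz_def
  by (intro P_add P_sum_closed gm_closed) (auto simp: sc_add A.l_distr gm_add_l)

lemma Rz_cong:
  assumes "\<And>k u g. k \<in> K \<Longrightarrow> u \<in> carrier A \<Longrightarrow> g \<in> carrier A \<Longrightarrow> t k u g = t' k u g"
  shows "Rz t = Rz t'"
  unfolding Rz_def
  by (intro P.finsum_cong' Pi_I P.finsum_closed gm_closed refl) (auto simp: assms)

text \<open>Both sides are additive. On a generator the two dual expansions reassemble x s(k) on the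
  left and r(k) y on the right. Consequently a tensor is determined by its form.\<close>

lemma P_expand: "z \<in> carrier P \<Longrightarrow> Rz (\<Theta> z) = z"
proof (rule span)
  have "Rz (\<Theta> \<zero>\<^bsub>P\<^esub>) = Rz (\<lambda>_ _ _. 0)" by (rule Rz_cong) (simp add: Th_zero)
  moreover have "Rz (\<lambda>_ _ _. 0) = Rz (\<lambda>_ _ _. 0) \<oplus>\<^bsub>P\<^esub> Rz (\<lambda>_ _ _. 0)"
    using Rz_add[of "\<lambda>_ _ _. 0" "\<lambda>_ _ _. 0"] by simp
  ultimately show "Rz (\<Theta> \<zero>\<^bsub>P\<^esub>) = \<zero>\<^bsub>P\<^esub>"
    using P_zero_eqI[OF Rz_closed] by metis
next
  fix x k y assume x: "x \<in> carrier A" "k \<in> K" "y \<in> carrier A"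
  define X where "X = x \<cdot> ve (s k)"
  define Y where "Y = ve (r k) \<cdot> y"
  have XY: "X \<in> carrier A" "Y \<in> carrier A" using x by (auto simp: X_def Y_def)
  have "Rz (\<Theta> (\<gamma> x k y)) = finsum P (\<lambda>k'. if k = k' then finsum P (\<lambda>b. finsum P (\<lambda>b'.
     \<gamma> (sc (f (X \<cdot> d b) * f (b' \<cdot> Y)) \<cdot> b) k' (d b')) B) B else \<zero>\<^bsub>P\<^esub>) K"
    unfolding Rz_def
  proof (rule P.finsum_cong')
    fix k' assume k': "k' \<in> K"
    show "finsum P (\<lambda>b. finsum P (\<lambda>b'. \<gamma> (sc (\<Theta> (\<gamma> x k y) k' (d b) b') \<cdot> b) k' (d b')) B) B
      = (if k = k' then finsum P (\<lambda>b. finsum P (\<lambda>b'.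
          \<gamma> (sc (f (X \<cdot> d b) * f (b' \<cdot> Y)) \<cdot> b) k' (d b')) B) B else \<zero>\<^bsub>P\<^esub>)"
    proof (cases "k = k'")
      case True
      then show ?thesis using x k'
        by (simp, intro P.finsum_cong' Pi_I P.finsum_closed gm_closed refl)
          (auto simp: Th_gm X_def Y_def A.m_assoc)
    next
      case False
      have "\<gamma> (sc (\<Theta> (\<gamma> x k y) k' (d b) b') \<cdot> b) k' (d b') = \<zero>\<^bsub>P\<^esub>" if "b \<in> B" "b' \<in> B" for b b'
        using False that x k' by (simp add: Th_gm sc_zero gm_zero_l)
      then have "finsum P (\<lambda>b. finsum P (\<lambda>b'. \<gamma> (sc (\<Theta> (\<gamma> x k y) k' (d b) b') \<cdot> b) k' (d b')) B) B = \<zero>\<^bsub>P\<^esub>"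
        by (intro P_null)
      then show ?thesis
        by (simp only: False if_False)
    qed
  qed (auto intro!: P.finsum_closed)
  also have "\<dots> = finsum P (\<lambda>b. finsum P (\<lambda>b'. \<gamma> (sc (f (X \<cdot> d b) * f (b' \<cdot> Y)) \<cdot> b) k (d b')) B) B"
    by (rule P.finsum_singleton) (use x finite_K in \<open>auto intro!: P.finsum_closed\<close>)
  also have "\<dots> = finsum P (\<lambda>b. finsum P (\<lambda>b'. \<gamma> (sc (f (X \<cdot> d b)) \<cdot> b) k (sc (f (b' \<cdot> Y)) \<cdot> d b')) B) B"
  proof (intro P.finsum_cong' Pi_I P.finsum_closed gm_closed refl)
    fix b b' assume "b \<in> B" "b' \<in> B"
    then show "\<gamma> (sc (f (X \<cdot> d b) * f (b' \<cdot> Y)) \<cdot> b) k (d b')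
      = \<gamma> (sc (f (X \<cdot> d b)) \<cdot> b) k (sc (f (b' \<cdot> Y)) \<cdot> d b')"
      using x gm_sc[of "sc (f (X \<cdot> d b)) \<cdot> b" k "d b'" "f (b' \<cdot> Y)"] by (simp add: sc_sc mult.commute)
  qed (use x in auto)
  also have "\<dots> = finsum P (\<lambda>b. \<gamma> (sc (f (X \<cdot> d b)) \<cdot> b) k Y) B"
  proof (intro P.finsum_cong' Pi_I gm_closed refl)
    fix b assume "b \<in> B"
    then have "finsum P (\<lambda>b'. \<gamma> (sc (f (X \<cdot> d b)) \<cdot> b) k (sc (f (b' \<cdot> Y)) \<cdot> d b')) B
      = \<gamma> (sc (f (X \<cdot> d b)) \<cdot> b) k (finsum A (\<lambda>b'. sc (f (b' \<cdot> Y)) \<cdot> d b') B)"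
      using x by (intro gm_finsum_r[symmetric] finite_B) auto
    then show "finsum P (\<lambda>b'. \<gamma> (sc (f (X \<cdot> d b)) \<cdot> b) k (sc (f (b' \<cdot> Y)) \<cdot> d b')) B
      = \<gamma> (sc (f (X \<cdot> d b)) \<cdot> b) k Y"
      using exp2[OF XY(2)] by simp
  qed (use x XY in auto)
  also have "\<dots> = \<gamma> (finsum A (\<lambda>b. sc (f (X \<cdot> d b)) \<cdot> b) B) k Y"
    by (rule gm_finsum_l[symmetric]) (use x XY finite_B in auto)
  also have "\<dots> = \<gamma> X k Y" using exp1[OF XY(1)] by simp
  also have "\<dots> = \<gamma> x k y" using x by (simp add: X_def Y_def gm_s gm_r)
  finally show "Rz (\<Theta> (\<gamma> x k y)) = \<gamma> x k y" .
next
  fix z z' assume z: "z \<in> carrier P" "z' \<in> carrier P" "Rz (\<Theta> z) = z" "Rz (\<Theta> z') = z'"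
  have "Rz (\<Theta> (z \<oplus>\<^bsub>P\<^esub> z')) = Rz (\<lambda>k u g. \<Theta> z k u g + \<Theta> z' k u g)"
    by (rule Rz_cong) (use z in \<open>simp add: Th_add\<close>)
  then show "Rz (\<Theta> (z \<oplus>\<^bsub>P\<^esub> z')) = z \<oplus>\<^bsub>P\<^esub> z'"
    by (simp add: Rz_add z)
qed

lemma Th_inj:
  assumes "z \<in> carrier P" "z' \<in> carrier P"
    "\<And>k u g. k \<in> K \<Longrightarrow> u \<in> carrier A \<Longrightarrow> g \<in> carrier A \<Longrightarrow> \<Theta> z k u g = \<Theta> z' k u g"
  shows "z = z'"
proof -
  have "Rz (\<Theta> z) = Rz (\<Theta> z')" by (rule Rz_cong) (rule assms(3))
  then show ?thesis by (simp only: P_expand assms(1,2))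
qed

text \<open>The other half of the identification: evaluating the reconstructed tensor contracts both
  dual bases, and the vertex conditions remove the inserted vertices. Homomorphisms can thus be
  defined by prescribing forms.\<close>

lemma Th_Rz:
  assumes t: "form t" and k: "k \<in> K" "u \<in> carrier A" "g \<in> carrier A"
  shows "\<Theta> (Rz t) k u g = t k u g"
proof -
  have "\<Theta> (Rz t) k u g = (\<Sum>k'\<in>K. \<Theta> (finsum P (\<lambda>b. finsum P (\<lambda>b'.
      \<gamma> (sc (t k' (d b) b') \<cdot> b) k' (d b')) B) B) k u g)"
    unfolding Rz_def by (rule Th_finsum[OF finite_K _ k]) (intro P_sum_closed gm_closed; simp)
  also have "\<dots> = (\<Sum>k'\<in>K. \<Sum>b\<in>B. \<Theta> (finsum P (\<lambda>b'.
      \<gamma> (sc (t k' (d b) b') \<cdot> b) k' (d b')) B) k u g)"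
    by (intro sum.cong[OF refl] Th_finsum[OF finite_B _ k] P_sum_closed gm_closed; simp)
  also have "\<dots> = (\<Sum>k'\<in>K. \<Sum>b\<in>B. \<Sum>b'\<in>B. \<Theta> (\<gamma> (sc (t k' (d b) b') \<cdot> b) k' (d b')) k u g)"
    by (intro sum.cong[OF refl] Th_finsum[OF finite_B _ k] gm_closed; simp)
  also have "\<dots> = (\<Sum>k'\<in>K. if k' = k then (\<Sum>b\<in>B. \<Sum>b'\<in>B. f (b \<cdot> (ve (s k) \<cdot> u)) * (f (g \<cdot> ve (r k) \<cdot> d b') * t k (d b) b')) else 0)"
  proof (rule sum.cong[OF refl])
    fix k' assume k': "k' \<in> K"
    have "\<Theta> (\<gamma> (sc (t k' (d b) b') \<cdot> b) k' (d b')) k u g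
      = (if k' = k then f (b \<cdot> (ve (s k) \<cdot> u)) * (f (g \<cdot> ve (r k) \<cdot> d b') * t k (d b) b') else 0)"
      if "b \<in> B" "b' \<in> B" for b b'
      using that k k' by (auto simp: Th_gm A.m_assoc lfun_sc[OF f_lfun])
    then show "(\<Sum>b\<in>B. \<Sum>b'\<in>B. \<Theta> (\<gamma> (sc (t k' (d b) b') \<cdot> b) k' (d b')) k u g)
      = (if k' = k then (\<Sum>b\<in>B. \<Sum>b'\<in>B. f (b \<cdot> (ve (s k) \<cdot> u)) * (f (g \<cdot> ve (r k) \<cdot> d b') * t k (d b) b')) else 0)"
      by (auto intro!: sum.cong sum.neutral)
  qed
  also have "\<dots> = (\<Sum>b\<in>B. f (b \<cdot> (ve (s k) \<cdot> u)) * (\<Sum>b'\<in>B. f (g \<cdot> ve (r k) \<cdot> d b') * t k (d b) b'))"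
    using k finite_K by (simp add: sum_distrib_left)
  also have "\<dots> = (\<Sum>b\<in>B. f (b \<cdot> (ve (s k) \<cdot> u)) * t k (d b) (g \<cdot> ve (r k)))"
    by (intro sum.cong[OF refl] arg_cong2[where f = "(*)"] lfun_exp1[symmetric])
      (use k in \<open>auto intro!: formD(2)[OF t]\<close>)
  also have "\<dots> = t k (ve (s k) \<cdot> u) (g \<cdot> ve (r k))"
    by (rule lfun_exp2[symmetric]) (use k in \<open>auto intro!: formD(1)[OF t]\<close>)
  also have "\<dots> = t k u g"
    using k by (simp add: formD(3,4)[OF t])
  finally show ?thesis .
qed

end

section \<open>Tensor products of bimodules\<close>

lemma sum_keys_add:
  fixes F :: "'k \<Rightarrow> 'b::comm_monoid_add \<Rightarrow> 'c::comm_monoid_add"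
  assumes "\<And>k. F k 0 = 0" "\<And>k a b. F k (a + b) = F k a + F k b"
  shows "(\<Sum>k\<in>Poly_Mapping.keys (x + y). F k (Poly_Mapping.lookup (x + y) k))
    = (\<Sum>k\<in>Poly_Mapping.keys x. F k (Poly_Mapping.lookup x k))
      + (\<Sum>k\<in>Poly_Mapping.keys y. F k (Poly_Mapping.lookup y k))"
  by (rule setsum_keys_plus_distrib) (simp_all add: assms)

locale tens =
  fixes RA :: "('a, 'i) ring_scheme" and R :: "('r, 'j) ring_scheme" and RB :: "('b, 'l) ring_scheme"
    and M :: "('a, 'm, 'r) bimod" and N :: "('r, 'n, 'b) bimod"
  assumes bM: "bimodule RA R M" and bN: "bimodule R RB N"
begin

sublocale M: bimodule RA R M by (rule bM)
sublocale N: bimodule R RB N by (rule bN)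

abbreviation F where "F \<equiv> tensor_free M N"
abbreviation Nul where "Nul \<equiv> tensor_null R M N"
abbreviation T where "T \<equiv> tensor R M N"
abbreviation cst where "cst \<equiv> tensor_coset R M N"
abbreviation pt where "pt \<equiv> pure_tensor R M N"

lemma F_simps: "add F = (+)" "zero F = 0"
  "carrier F = {z. Poly_Mapping.keys z \<subseteq> carrier M \<times> carrier N}"
  by (simp_all add: tensor_free_def)

lemma F_zero [simp]: "0 \<in> carrier F"
  by (simp add: F_simps)

lemma F_add: "z \<in> carrier F \<Longrightarrow> z' \<in> carrier F \<Longrightarrow> z + z' \<in> carrier F"
  using keys_add[of z z'] by (auto simp: F_simps)

lemma F_uminus: "z \<in> carrier F \<Longrightarrow> - z \<in> carrier F"
  by (simp add: F_simps)

lemma F_diff: "z \<in> carrier F \<Longrightarrow> z' \<in> carrier F \<Longrightarrow> z - z' \<in> carrier F"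
  using F_add[OF _ F_uminus, of z z'] by simp

lemma F_of: "x \<in> carrier M \<Longrightarrow> y \<in> carrier N \<Longrightarrow> frag_of (x, y) \<in> carrier F"
  by (simp add: F_simps)

lemma F_group: "group (add_monoid F)"
proof (rule groupI)
  fix x assume "x \<in> carrier (add_monoid F)"
  then show "\<exists>y\<in>carrier (add_monoid F). y \<otimes>\<^bsub>add_monoid F\<^esub> x = \<one>\<^bsub>add_monoid F\<^esub>"
    by (intro bexI[of _ "- x"]) (simp_all add: F_simps(1,2) F_uminus)
qed (auto simp: F_simps(1,2) F_add)

lemma F_inv: "x \<in> carrier F \<Longrightarrow> inv\<^bsub>add_monoid F\<^esub> x = - x"
  by (rule group.inv_equality[OF F_group]) (auto simp: F_simps(1,2) F_uminus)

lemma rel1: "x \<in> carrier M \<Longrightarrow> x' \<in> carrier M \<Longrightarrow> y \<in> carrier N \<Longrightarrow>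
    frag_of (x \<oplus>\<^bsub>M\<^esub> x', y) - frag_of (x, y) - frag_of (x', y) \<in> tensor_rels R M N"
  unfolding tensor_rels_def by blast

lemma rel2: "x \<in> carrier M \<Longrightarrow> y \<in> carrier N \<Longrightarrow> y' \<in> carrier N \<Longrightarrow>
    frag_of (x, y \<oplus>\<^bsub>N\<^esub> y') - frag_of (x, y) - frag_of (x, y') \<in> tensor_rels R M N"
  unfolding tensor_rels_def by blast

lemma rel3: "x \<in> carrier M \<Longrightarrow> c \<in> carrier R \<Longrightarrow> y \<in> carrier N \<Longrightarrow>
    frag_of (x \<odot>r\<^bsub>M\<^esub> c, y) - frag_of (x, c \<odot>\<^bsub>N\<^esub> y) \<in> tensor_rels R M N"
  unfolding tensor_rels_def by blast

lemma rels_cases: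
  assumes "z \<in> tensor_rels R M N"
  obtains (1) x x' y where "x \<in> carrier M" "x' \<in> carrier M" "y \<in> carrier N"
      "z = frag_of (x \<oplus>\<^bsub>M\<^esub> x', y) - frag_of (x, y) - frag_of (x', y)"
  | (2) x y y' where "x \<in> carrier M" "y \<in> carrier N" "y' \<in> carrier N"
      "z = frag_of (x, y \<oplus>\<^bsub>N\<^esub> y') - frag_of (x, y) - frag_of (x, y')"
  | (3) x c y where "x \<in> carrier M" "c \<in> carrier R" "y \<in> carrier N"
      "z = frag_of (x \<odot>r\<^bsub>M\<^esub> c, y) - frag_of (x, c \<odot>\<^bsub>N\<^esub> y)"
  using assms unfolding tensor_rels_def by (elim UnE CollectE exE conjE) (rule that; assumption)+

lemma rels_F: "tensor_rels R M N \<subseteq> carrier F"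
proof
  fix z assume "z \<in> tensor_rels R M N"
  then show "z \<in> carrier F"
    by (cases z rule: rels_cases) (auto intro!: F_diff F_of M.rsmult_closed N.smult_closed)
qed

lemma Nul_induct [consumes 1, case_names zero rel uminus add]:
  assumes "z \<in> Nul" "P 0" "\<And>z. z \<in> tensor_rels R M N \<Longrightarrow> P z"
    "\<And>z. z \<in> Nul \<Longrightarrow> P z \<Longrightarrow> P (- z)"
    "\<And>z z'. z \<in> Nul \<Longrightarrow> z' \<in> Nul \<Longrightarrow> P z \<Longrightarrow> P z' \<Longrightarrow> P (z + z')"
  shows "P z"
  using assms(1) unfolding tensor_null_def
proof (induction z rule: generate.induct)
  case one
  then show ?case using assms(2) by (simp add: F_simps)
next
  case (incl z)
  then show ?case by (rule assms(3))
next
  case (inv z)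
  then have "z \<in> Nul" unfolding tensor_null_def by (rule generate.incl)
  moreover have "z \<in> carrier F" using inv rels_F by blast
  ultimately show ?case using assms(3)[OF inv] assms(4) by (simp only: F_inv)
next
  case (eng z z')
  then show ?case using assms(5)[of z z'] by (simp add: F_simps tensor_null_def)
qed

lemma Nul_zero [simp]: "0 \<in> Nul"
  unfolding tensor_null_def using generate.one[of "add_monoid F"] by (simp add: F_simps)

lemma Nul_add: "z \<in> Nul \<Longrightarrow> z' \<in> Nul \<Longrightarrow> z + z' \<in> Nul"
  unfolding tensor_null_def using generate.eng[of z "add_monoid F"] by (simp add: F_simps)

lemma Nul_rel: "z \<in> tensor_rels R M N \<Longrightarrow> z \<in> Nul"
  unfolding tensor_null_def by (rule generate.incl)

lemma Nul_uminus: "z \<in> Nul \<Longrightarrow> - z \<in> Nul"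
proof (induction z rule: Nul_induct)
  case (rel z)
  then have "inv\<^bsub>add_monoid F\<^esub> z \<in> Nul" unfolding tensor_null_def by (rule generate.inv)
  moreover have "z \<in> carrier F" using rel rels_F by blast
  ultimately show ?case by (simp only: F_inv)
next
  case (add z z')
  then show ?case using Nul_add by fastforce
qed simp_all

lemma cst_image: "cst z = (\<lambda>n. n + z) ` Nul"
  unfolding tensor_coset_def a_r_coset_def' by (auto simp: F_simps)

lemma cst_mem: "w \<in> cst z \<longleftrightarrow> w - z \<in> Nul"
proof
  assume "w - z \<in> Nul"
  then show "w \<in> cst z" unfolding cst_image by (intro image_eqI[of _ _ "w - z"]) auto
qed (auto simp: cst_image)

lemma cst_eq_iff: "cst z = cst z' \<longleftrightarrow> z - z' \<in> Nul"
proof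
  assume "cst z = cst z'"
  then have "z \<in> cst z'" using cst_mem[of z z] by simp
  then show "z - z' \<in> Nul" by (simp add: cst_mem)
next
  assume *: "z - z' \<in> Nul"
  have "w - z \<in> Nul \<longleftrightarrow> w - z' \<in> Nul" for w
  proof
    assume "w - z \<in> Nul"
    from Nul_add[OF this *] show "w - z' \<in> Nul" by simp
  next
    assume "w - z' \<in> Nul"
    from Nul_add[OF this Nul_uminus[OF *]] show "w - z \<in> Nul" by simp
  qed
  then show "cst z = cst z'" by (auto simp: cst_mem)
qed

lemma cst_eqI: "z - z' \<in> Nul \<Longrightarrow> cst z = cst z'"
  by (simp add: cst_eq_iff)

lemma T_carrier: "carrier T = cst ` carrier F"
  unfolding tensor_def tensor_coset_def by (auto simp: A_RCOSETS_def')

lemma T_cases: "Z \<in> carrier T \<Longrightarrow> (\<And>z. z \<in> carrier F \<Longrightarrow> Z = cst z \<Longrightarrow> P) \<Longrightarrow> P"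
  unfolding T_carrier by blast

lemma cst_closed [simp]: "z \<in> carrier F \<Longrightarrow> cst z \<in> carrier T"
  by (simp add: T_carrier)

lemma T_zero: "\<zero>\<^bsub>T\<^esub> = cst 0"
  by (simp add: tensor_def cst_image)

lemma T_add: "cst z \<oplus>\<^bsub>T\<^esub> cst z' = cst (z + z')"
proof -
  have "cst z \<oplus>\<^bsub>T\<^esub> cst z' = {a + b | a b. a \<in> cst z \<and> b \<in> cst z'}"
    by (auto simp: tensor_def set_add_def' F_simps)
  also have "\<dots> = cst (z + z')"
  proof (intro subset_antisym subsetI)
    fix w assume "w \<in> {a + b | a b. a \<in> cst z \<and> b \<in> cst z'}"
    then obtain a b where "w = a + b" "a - z \<in> Nul" "b - z' \<in> Nul" by (auto simp: cst_mem)
    then show "w \<in> cst (z + z')" using Nul_add[of "a - z" "b - z'"] by (simp add: cst_mem algebra_simps)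
  next
    fix w assume "w \<in> cst (z + z')"
    then have "w - z' \<in> cst z" "z' \<in> cst z'" by (simp_all add: cst_mem algebra_simps)
    then show "w \<in> {a + b | a b. a \<in> cst z \<and> b \<in> cst z'}"
      by (intro CollectI exI[of _ "w - z'"] exI[of _ z']) simp
  qed
  finally show ?thesis .
qed

lemma pt_def: "pt x y = cst (frag_of (x, y))"
  by (simp add: pure_tensor_def)

lemma pt_closed [simp]: "x \<in> carrier M \<Longrightarrow> y \<in> carrier N \<Longrightarrow> pt x y \<in> carrier T"
  by (simp add: pt_def F_of)

lemma T_abelian_group: "abelian_group T"
proof (rule abelian_groupI)
  fix x assume "x \<in> carrier T"
  then obtain z where z: "z \<in> carrier F" "x = cst z" by (rule T_cases)
  then show "\<exists>y\<in>carrier T. y \<oplus>\<^bsub>T\<^esub> x = \<zero>\<^bsub>T\<^esub>"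
    by (intro bexI[of _ "cst (- z)"]) (simp_all add: T_add T_zero F_uminus)
  show "\<zero>\<^bsub>T\<^esub> \<oplus>\<^bsub>T\<^esub> x = x" using z by (simp add: T_zero T_add)
next
  fix x y assume "x \<in> carrier T" "y \<in> carrier T"
  then obtain z z' where z: "z \<in> carrier F" "x = cst z" "z' \<in> carrier F" "y = cst z'"
    by (elim T_cases)
  then show "x \<oplus>\<^bsub>T\<^esub> y \<in> carrier T" "x \<oplus>\<^bsub>T\<^esub> y = y \<oplus>\<^bsub>T\<^esub> x"
    by (simp_all add: T_add F_add add.commute)
  fix t assume "t \<in> carrier T"
  then obtain z'' where "z'' \<in> carrier F" "t = cst z''" by (elim T_cases)
  then show "x \<oplus>\<^bsub>T\<^esub> y \<oplus>\<^bsub>T\<^esub> t = x \<oplus>\<^bsub>T\<^esub> (y \<oplus>\<^bsub>T\<^esub> t)"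
    using z by (simp add: T_add add.assoc)
qed (simp add: T_zero)

sublocale T: abelian_group T by (rule T_abelian_group)

lemma pt_add_l:
  "x \<in> carrier M \<Longrightarrow> x' \<in> carrier M \<Longrightarrow> y \<in> carrier N \<Longrightarrow> pt (x \<oplus>\<^bsub>M\<^esub> x') y = pt x y \<oplus>\<^bsub>T\<^esub> pt x' y"
  unfolding pt_def T_add
  using rel1[of x x' y] by (intro cst_eqI Nul_rel) (simp add: diff_diff_eq)

lemma pt_add_r:
  "x \<in> carrier M \<Longrightarrow> y \<in> carrier N \<Longrightarrow> y' \<in> carrier N \<Longrightarrow> pt x (y \<oplus>\<^bsub>N\<^esub> y') = pt x y \<oplus>\<^bsub>T\<^esub> pt x y'"
  unfolding pt_def T_add
  using rel2[of x y y'] by (intro cst_eqI Nul_rel) (simp add: diff_diff_eq)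

lemma pt_bal:
  "x \<in> carrier M \<Longrightarrow> c \<in> carrier R \<Longrightarrow> y \<in> carrier N \<Longrightarrow> pt (x \<odot>r\<^bsub>M\<^esub> c) y = pt x (c \<odot>\<^bsub>N\<^esub> y)"
  unfolding pt_def by (intro cst_eqI Nul_rel rel3)

lemma T_zero_eqI: "z \<in> carrier T \<Longrightarrow> z = z \<oplus>\<^bsub>T\<^esub> z \<Longrightarrow> z = \<zero>\<^bsub>T\<^esub>"
  using T.add.l_cancel_one' by simp

lemma pt_zero_l: "y \<in> carrier N \<Longrightarrow> pt \<zero>\<^bsub>M\<^esub> y = \<zero>\<^bsub>T\<^esub>"
  using pt_add_l[of "\<zero>\<^bsub>M\<^esub>" "\<zero>\<^bsub>M\<^esub>" y] by (intro T_zero_eqI) auto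

lemma pt_zero_r: "x \<in> carrier M \<Longrightarrow> pt x \<zero>\<^bsub>N\<^esub> = \<zero>\<^bsub>T\<^esub>"
  using pt_add_r[of x "\<zero>\<^bsub>N\<^esub>" "\<zero>\<^bsub>N\<^esub>"] by (intro T_zero_eqI) auto

lemma pt_uminus: "x \<in> carrier M \<Longrightarrow> y \<in> carrier N \<Longrightarrow> cst (- frag_of (x, y)) = pt (\<ominus>\<^bsub>M\<^esub> x) y"
proof -
  assume xy: "x \<in> carrier M" "y \<in> carrier N"
  have "pt (\<ominus>\<^bsub>M\<^esub> x) y \<oplus>\<^bsub>T\<^esub> pt x y = \<zero>\<^bsub>T\<^esub>"
    using xy pt_add_l[of "\<ominus>\<^bsub>M\<^esub> x" x y] by (simp add: M.M.l_neg pt_zero_l)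
  moreover have "cst (- frag_of (x, y)) \<oplus>\<^bsub>T\<^esub> pt x y = \<zero>\<^bsub>T\<^esub>"
    by (simp add: pt_def T_add T_zero)
  ultimately have eq: "cst (- frag_of (x, y)) \<oplus>\<^bsub>T\<^esub> pt x y = pt (\<ominus>\<^bsub>M\<^esub> x) y \<oplus>\<^bsub>T\<^esub> pt x y"
    by simp
  show ?thesis
    by (rule T.add.right_cancel[THEN iffD1, OF _ _ _ eq]) (use xy in \<open>auto intro!: cst_closed F_uminus F_of\<close>)
qed

text \<open>\<open>frag_induction\<close> proceeds by differences, so the claim is carried for z and
  - z together. By \<open>pt_uminus\<close> the negative of a pure tensor is pure, and the rule
  itself needs no case for negatives.\<close>

lemma T_induct [consumes 1, case_names zero pure add]:
  assumes Z: "Z \<in> carrier T" and 0: "Q \<zero>\<^bsub>T\<^esub>"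
    and p: "\<And>x y. x \<in> carrier M \<Longrightarrow> y \<in> carrier N \<Longrightarrow> Q (pt x y)"
    and a: "\<And>Z Z'. Z \<in> carrier T \<Longrightarrow> Z' \<in> carrier T \<Longrightarrow> Q Z \<Longrightarrow> Q Z' \<Longrightarrow> Q (Z \<oplus>\<^bsub>T\<^esub> Z')"
  shows "Q Z"
proof -
  obtain z where z: "z \<in> carrier F" "Z = cst z" using Z by (rule T_cases)
  from z(1) have "Poly_Mapping.keys z \<subseteq> carrier M \<times> carrier N" by (simp add: F_simps)
  then have "z \<in> carrier F \<and> Q (cst z) \<and> Q (cst (- z))"
  proof (induction z rule: frag_induction)
    case zero
    show ?case using 0 by (simp add: T_zero)
  next
    case (one k)
    then obtain x y where k: "k = (x, y)" "x \<in> carrier M" "y \<in> carrier N" by auto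
    then show ?case using p[of x y] p[of "\<ominus>\<^bsub>M\<^esub> x" y] pt_uminus[of x y] by (simp add: F_of pt_def)
  next
    case (diff z z')
    then have c: "cst z \<in> carrier T" "cst (- z) \<in> carrier T" "cst z' \<in> carrier T" "cst (- z') \<in> carrier T"
      by (simp_all add: F_uminus)
    have "Q (cst z \<oplus>\<^bsub>T\<^esub> cst (- z'))" "Q (cst (- z) \<oplus>\<^bsub>T\<^esub> cst z')"
      using a c diff by blast+
    then show ?case using diff by (simp add: T_add F_diff)
  qed
  then show ?thesis using z by simp
qed

definition lm where "lm c = frag_extend (\<lambda>(x, y). frag_of (c \<odot>\<^bsub>M\<^esub> x, y))"
definition rm where "rm c = frag_extend (\<lambda>(x, y). frag_of (x, y \<odot>r\<^bsub>N\<^esub> c))"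

lemma lm_Nul: "z \<in> Nul \<Longrightarrow> c \<in> carrier RA \<Longrightarrow> lm c z \<in> Nul"
proof (induction z rule: Nul_induct)
  case (rel z)
  from rel(1) have "lm c z \<in> tensor_rels R M N"
  proof (cases z rule: rels_cases)
    case (1 x x' y)
    then show ?thesis
      using rel(2) rel1[of "c \<odot>\<^bsub>M\<^esub> x" "c \<odot>\<^bsub>M\<^esub> x'" y]
      by (simp add: lm_def frag_extend_diff M.smult_r_distr M.smult_closed)
  next
    case (2 x y y')
    then show ?thesis
      using rel(2) rel2[of "c \<odot>\<^bsub>M\<^esub> x" y y'] by (simp add: lm_def frag_extend_diff M.smult_closed)
  next
    case (3 x r y)
    then show ?thesis
      using rel(2) rel3[of "c \<odot>\<^bsub>M\<^esub> x" r y]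
      by (simp add: lm_def frag_extend_diff M.smult_closed M.smult_rsmult)
  qed
  then show ?case by (rule Nul_rel)
qed (auto simp: lm_def frag_extend_minus frag_extend_add intro: Nul_add Nul_uminus)

lemma rm_Nul: "z \<in> Nul \<Longrightarrow> c \<in> carrier RB \<Longrightarrow> rm c z \<in> Nul"
proof (induction z rule: Nul_induct)
  case (rel z)
  from rel(1) have "rm c z \<in> tensor_rels R M N"
  proof (cases z rule: rels_cases)
    case (1 x x' y)
    then show ?thesis
      using rel(2) rel1[of x x' "y \<odot>r\<^bsub>N\<^esub> c"] by (simp add: rm_def frag_extend_diff N.rsmult_closed)
  next
    case (2 x y y')
    then show ?thesis
      using rel(2) rel2[of x "y \<odot>r\<^bsub>N\<^esub> c" "y' \<odot>r\<^bsub>N\<^esub> c"]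
      by (simp add: rm_def frag_extend_diff N.rsmult_closed N.rsmult_l_distr)
  next
    case (3 x r y)
    then show ?thesis
      using rel(2) rel3[of x r "y \<odot>r\<^bsub>N\<^esub> c"]
      by (simp add: rm_def frag_extend_diff N.rsmult_closed N.smult_rsmult)
  qed
  then show ?case by (rule Nul_rel)
qed (auto simp: rm_def frag_extend_minus frag_extend_add intro: Nul_add Nul_uminus)

lemma lm_F:
  assumes "c \<in> carrier RA" "z \<in> carrier F"
  shows "lm c z \<in> carrier F"
proof -
  from assms(2) have "Poly_Mapping.keys z \<subseteq> carrier M \<times> carrier N" by (simp add: F_simps)
  then show ?thesis
    by (induction z rule: frag_induction)
      (use assms(1) in \<open>auto simp: lm_def frag_extend_diff intro!: F_diff F_of M.smult_closed\<close>)
qed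

lemma rm_F:
  assumes "c \<in> carrier RB" "z \<in> carrier F"
  shows "rm c z \<in> carrier F"
proof -
  from assms(2) have "Poly_Mapping.keys z \<subseteq> carrier M \<times> carrier N" by (simp add: F_simps)
  then show ?thesis
    by (induction z rule: frag_induction)
      (use assms(1) in \<open>auto simp: rm_def frag_extend_diff intro!: F_diff F_of N.rsmult_closed\<close>)
qed

text \<open>The action is a union over the members of a coset. By \<open>lm_Nul\<close> all of them
  give the same coset, so the union is that single coset.\<close>

lemma T_smult:
  assumes "c \<in> carrier RA"
  shows "c \<odot>\<^bsub>T\<^esub> cst z = cst (lm c z)"
proof -
  have *: "cst (lm c w) = cst (lm c z)" if "w \<in> cst z" for w
    using lm_Nul[OF _ assms, of "w - z"] that
    by (intro cst_eqI) (simp add: cst_mem lm_def frag_extend_diff)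
  have "z \<in> cst z" by (simp add: cst_mem)
  then have ne: "cst z \<noteq> {}" by blast
  have "c \<odot>\<^bsub>T\<^esub> cst z = (\<Union>w\<in>cst z. cst (lm c w))"
    by (simp add: tensor_def lm_def)
  also have "\<dots> = (\<Union>w\<in>cst z. cst (lm c z))"
    by (rule SUP_cong[OF refl]) (rule *)
  also have "\<dots> = cst (lm c z)"
    by (simp only: UN_constant ne if_False)
  finally show ?thesis .
qed

lemma T_rsmult:
  assumes "c \<in> carrier RB"
  shows "cst z \<odot>r\<^bsub>T\<^esub> c = cst (rm c z)"
proof -
  have *: "cst (rm c w) = cst (rm c z)" if "w \<in> cst z" for w
    using rm_Nul[OF _ assms, of "w - z"] that
    by (intro cst_eqI) (simp add: cst_mem rm_def frag_extend_diff)
  have "z \<in> cst z" by (simp add: cst_mem)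
  then have ne: "cst z \<noteq> {}" by blast
  have "cst z \<odot>r\<^bsub>T\<^esub> c = (\<Union>w\<in>cst z. cst (rm c w))"
    by (simp add: tensor_def rm_def)
  also have "\<dots> = (\<Union>w\<in>cst z. cst (rm c z))"
    by (rule SUP_cong[OF refl]) (rule *)
  also have "\<dots> = cst (rm c z)"
    by (simp only: UN_constant ne if_False)
  finally show ?thesis .
qed

lemma T_smult_pt: "c \<in> carrier RA \<Longrightarrow> c \<odot>\<^bsub>T\<^esub> pt x y = pt (c \<odot>\<^bsub>M\<^esub> x) y"
  by (simp add: pt_def T_smult) (simp add: lm_def)

lemma T_rsmult_pt: "c \<in> carrier RB \<Longrightarrow> pt x y \<odot>r\<^bsub>T\<^esub> c = pt x (y \<odot>r\<^bsub>N\<^esub> c)"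
  by (simp add: pt_def T_rsmult) (simp add: rm_def)

lemma T_smult_add:
  "c \<in> carrier RA \<Longrightarrow> Z \<in> carrier T \<Longrightarrow> Z' \<in> carrier T \<Longrightarrow>
    c \<odot>\<^bsub>T\<^esub> (Z \<oplus>\<^bsub>T\<^esub> Z') = c \<odot>\<^bsub>T\<^esub> Z \<oplus>\<^bsub>T\<^esub> c \<odot>\<^bsub>T\<^esub> Z'"
  by (elim T_cases) (simp add: T_add T_smult lm_def frag_extend_add)

lemma T_rsmult_add:
  "c \<in> carrier RB \<Longrightarrow> Z \<in> carrier T \<Longrightarrow> Z' \<in> carrier T \<Longrightarrow>
    (Z \<oplus>\<^bsub>T\<^esub> Z') \<odot>r\<^bsub>T\<^esub> c = Z \<odot>r\<^bsub>T\<^esub> c \<oplus>\<^bsub>T\<^esub> Z' \<odot>r\<^bsub>T\<^esub> c"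
  by (elim T_cases) (simp add: T_add T_rsmult rm_def frag_extend_add)

lemma T_smult_zero: "c \<in> carrier RA \<Longrightarrow> c \<odot>\<^bsub>T\<^esub> \<zero>\<^bsub>T\<^esub> = \<zero>\<^bsub>T\<^esub>"
  by (simp add: T_zero T_smult lm_def)

lemma T_rsmult_zero: "c \<in> carrier RB \<Longrightarrow> \<zero>\<^bsub>T\<^esub> \<odot>r\<^bsub>T\<^esub> c = \<zero>\<^bsub>T\<^esub>"
  by (simp add: T_zero T_rsmult rm_def)

lemma T_smult_closed: "c \<in> carrier RA \<Longrightarrow> Z \<in> carrier T \<Longrightarrow> c \<odot>\<^bsub>T\<^esub> Z \<in> carrier T"
  by (elim T_cases) (simp add: T_smult lm_F)

lemma T_rsmult_closed: "c \<in> carrier RB \<Longrightarrow> Z \<in> carrier T \<Longrightarrow> Z \<odot>r\<^bsub>T\<^esub> c \<in> carrier T"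
  by (elim T_cases) (simp add: T_rsmult rm_F)

lemma T_a_swap:
  assumes "a \<in> carrier T" "b \<in> carrier T" "c \<in> carrier T" "e \<in> carrier T"
  shows "a \<oplus>\<^bsub>T\<^esub> b \<oplus>\<^bsub>T\<^esub> (c \<oplus>\<^bsub>T\<^esub> e) = a \<oplus>\<^bsub>T\<^esub> c \<oplus>\<^bsub>T\<^esub> (b \<oplus>\<^bsub>T\<^esub> e)"
  using assms by (simp add: T.a_ac)

lemma T_bimodule: "bimodule RA RB T"
proof (intro bimodule.intro bimodule_axioms.intro)
  show "ring RA" "ring RB" "abelian_group T"
    by (rule M.L.ring_axioms, rule N.Rt.ring_axioms, rule T_abelian_group)
  fix a a' m assume a: "a \<in> carrier RA" "a' \<in> carrier RA"
  show "m \<in> carrier T \<Longrightarrow> (a \<oplus>\<^bsub>RA\<^esub> a') \<odot>\<^bsub>T\<^esub> m = a \<odot>\<^bsub>T\<^esub> m \<oplus>\<^bsub>T\<^esub> a' \<odot>\<^bsub>T\<^esub> m"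
  proof (induction m rule: T_induct)
    case (pure x y)
    then show ?case using a by (simp add: T_smult_pt M.smult_l_distr pt_add_l M.smult_closed)
  next
    case (add Z Z')
    then show ?case using a by (simp add: T_smult_add T_a_swap T_smult_closed)
  qed (use a in \<open>simp add: T_smult_zero\<close>)
  show "m \<in> carrier T \<Longrightarrow> (a \<otimes>\<^bsub>RA\<^esub> a') \<odot>\<^bsub>T\<^esub> m = a \<odot>\<^bsub>T\<^esub> (a' \<odot>\<^bsub>T\<^esub> m)"
  proof (induction m rule: T_induct)
    case (pure x y)
    then show ?case using a by (simp add: T_smult_pt M.smult_assoc)
  next
    case (add Z Z')
    then show ?case using a by (simp add: T_smult_add T_smult_closed)
  qed (use a in \<open>simp add: T_smult_zero\<close>)
next
  fix m assume "m \<in> carrier T"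
  then show "\<one>\<^bsub>RA\<^esub> \<odot>\<^bsub>T\<^esub> m = m"
  proof (induction m rule: T_induct)
    case (pure x y)
    then show ?case by (simp add: T_smult_pt M.smult_one)
  qed (simp_all add: T_smult_zero T_smult_add)
  from \<open>m \<in> carrier T\<close> show "m \<odot>r\<^bsub>T\<^esub> \<one>\<^bsub>RB\<^esub> = m"
  proof (induction m rule: T_induct)
    case (pure x y)
    then show ?case by (simp add: T_rsmult_pt N.rsmult_one)
  qed (simp_all add: T_rsmult_zero T_rsmult_add)
next
  fix m b b' assume b: "b \<in> carrier RB" "b' \<in> carrier RB"
  show "m \<in> carrier T \<Longrightarrow> m \<odot>r\<^bsub>T\<^esub> (b \<oplus>\<^bsub>RB\<^esub> b') = m \<odot>r\<^bsub>T\<^esub> b \<oplus>\<^bsub>T\<^esub> m \<odot>r\<^bsub>T\<^esub> b'"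
  proof (induction m rule: T_induct)
    case (pure x y)
    then show ?case using b by (simp add: T_rsmult_pt N.rsmult_r_distr pt_add_r N.rsmult_closed)
  next
    case (add Z Z')
    then show ?case using b by (simp add: T_rsmult_add T_a_swap T_rsmult_closed)
  qed (use b in \<open>simp add: T_rsmult_zero\<close>)
  show "m \<in> carrier T \<Longrightarrow> m \<odot>r\<^bsub>T\<^esub> (b \<otimes>\<^bsub>RB\<^esub> b') = (m \<odot>r\<^bsub>T\<^esub> b) \<odot>r\<^bsub>T\<^esub> b'"
  proof (induction m rule: T_induct)
    case (pure x y)
    then show ?case using b by (simp add: T_rsmult_pt N.rsmult_assoc)
  next
    case (add Z Z')
    then show ?case using b by (simp add: T_rsmult_add T_rsmult_closed)
  qed (use b in \<open>simp add: T_rsmult_zero\<close>)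
next
  fix a b m assume ab: "a \<in> carrier RA" "b \<in> carrier RB"
  show "m \<in> carrier T \<Longrightarrow> (a \<odot>\<^bsub>T\<^esub> m) \<odot>r\<^bsub>T\<^esub> b = a \<odot>\<^bsub>T\<^esub> (m \<odot>r\<^bsub>T\<^esub> b)"
  proof (induction m rule: T_induct)
    case (pure x y)
    then show ?case using ab by (simp add: T_rsmult_pt T_smult_pt)
  next
    case (add Z Z')
    then show ?case using ab
      by (simp add: T_rsmult_add T_smult_add T_rsmult_closed T_smult_closed)
  qed (use ab in \<open>simp add: T_rsmult_zero T_smult_zero\<close>)
qed (auto simp: T_smult_add T_rsmult_add T_smult_closed T_rsmult_closed)

text \<open>The universal property for complex-valued maps, which is enough to construct forms of
  tensors. The value is computed at a chosen representative; it does not depend on the choice when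
  \<open>p\<close> is balanced.\<close>

definition lift :: "('m \<Rightarrow> 'n \<Rightarrow> complex) \<Rightarrow> ('m \<times> 'n \<Rightarrow>\<^sub>0 int) set \<Rightarrow> complex" where
  "lift p Z = (let z = (SOME z. z \<in> carrier F \<and> cst z = Z) in
     \<Sum>k\<in>Poly_Mapping.keys z. of_int (Poly_Mapping.lookup z k) * p (fst k) (snd k))"

definition balanced :: "('m \<Rightarrow> 'n \<Rightarrow> complex) \<Rightarrow> bool" where
  "balanced p \<longleftrightarrow>
     (\<forall>x\<in>carrier M. \<forall>x'\<in>carrier M. \<forall>y\<in>carrier N. p (x \<oplus>\<^bsub>M\<^esub> x') y = p x y + p x' y) \<and>
     (\<forall>x\<in>carrier M. \<forall>y\<in>carrier N. \<forall>y'\<in>carrier N. p x (y \<oplus>\<^bsub>N\<^esub> y') = p x y + p x y') \<and>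
     (\<forall>x\<in>carrier M. \<forall>c\<in>carrier R. \<forall>y\<in>carrier N. p (x \<odot>r\<^bsub>M\<^esub> c) y = p x (c \<odot>\<^bsub>N\<^esub> y))"

lemma
  assumes "balanced p"
  shows lift_pt: "x \<in> carrier M \<Longrightarrow> y \<in> carrier N \<Longrightarrow> lift p (pt x y) = p x y"
    and lift_add: "Z \<in> carrier T \<Longrightarrow> Z' \<in> carrier T \<Longrightarrow> lift p (Z \<oplus>\<^bsub>T\<^esub> Z') = lift p Z + lift p Z'"
proof -
  define e where "e z = (\<Sum>k\<in>Poly_Mapping.keys z. of_int (Poly_Mapping.lookup z k) * p (fst k) (snd k))" for z
  have e_add: "e (z + z') = e z + e z'" for z z'
    unfolding e_def by (rule sum_keys_add) (simp_all add: algebra_simps)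
  have e_of: "e (frag_of (x, y)) = p x y" for x y
    by (simp add: e_def)
  have e_0: "e 0 = 0" by (simp add: e_def)
  have e_uminus: "e (- z) = - e z" for z
    using e_add[of z "- z"] by (simp add: e_0 eq_neg_iff_add_eq_0 add.commute)
  have e_diff: "e (z - z') = e z - e z'" for z z'
    using e_add[of z "- z'"] by (simp add: e_uminus)
  have null: "e z = 0" if "z \<in> Nul" for z
    using that
  proof (induction z rule: Nul_induct)
    case (rel z)
    then show ?case
      using assms unfolding balanced_def
      by (cases z rule: rels_cases) (simp_all add: e_diff e_of)
  qed (simp_all add: e_0 e_uminus e_add)
  have lift: "lift p (cst z) = e z" if "z \<in> carrier F" for z
  proof -
    let ?z = "SOME w. w \<in> carrier F \<and> cst w = cst z"
    have "?z \<in> carrier F \<and> cst ?z = cst z"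
      by (rule someI[of _ z]) (use that in simp)
    then have "e (?z - z) = 0" by (intro null) (simp add: cst_eq_iff)
    then show ?thesis by (simp add: lift_def Let_def e_def[symmetric] e_diff)
  qed
  show "x \<in> carrier M \<Longrightarrow> y \<in> carrier N \<Longrightarrow> lift p (pt x y) = p x y"
    by (simp add: pt_def lift F_of e_of)
  show "Z \<in> carrier T \<Longrightarrow> Z' \<in> carrier T \<Longrightarrow> lift p (Z \<oplus>\<^bsub>T\<^esub> Z') = lift p Z + lift p Z'"
    by (elim T_cases) (simp add: T_add lift F_add e_add)
qed

definition gens where
  "gens p = {frag_of (x, y) | x y q s. q + s = p \<and> x \<in> grading M q \<and> y \<in> grading N s}"

lemma T_grading: "grading T p = cst ` generate (add_monoid F) (gens p)"
  unfolding tensor_def gens_def by simp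

context
  assumes gM: "\<And>q. grading M q \<subseteq> carrier M" and gN: "\<And>q. grading N q \<subseteq> carrier N"
begin

lemma gens_F: "gens p \<subseteq> carrier F"
  using gM gN unfolding gens_def by (auto intro!: F_of)

lemma grading_closed: "Z \<in> grading T p \<Longrightarrow> Z \<in> carrier T"
  unfolding T_grading using group.generate_in_carrier[OF F_group, of "gens p"] gens_F by auto

lemma pt_grading: "x \<in> grading M q \<Longrightarrow> y \<in> grading N s \<Longrightarrow> pt x y \<in> grading T (q + s)"
  unfolding T_grading pt_def by (intro imageI generate.incl) (auto simp: gens_def)

lemma zero_grading: "\<zero>\<^bsub>T\<^esub> \<in> grading T p"
  unfolding T_grading T_zero using generate.one[of "add_monoid F" "gens p"] by (simp add: F_simps)

lemma add_grading: "Z \<in> grading T p \<Longrightarrow> Z' \<in> grading T p \<Longrightarrow> Z \<oplus>\<^bsub>T\<^esub> Z' \<in> grading T p"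
proof -
  assume "Z \<in> grading T p" "Z' \<in> grading T p"
  then obtain z z' where "z \<in> generate (add_monoid F) (gens p)" "Z = cst z"
    "z' \<in> generate (add_monoid F) (gens p)" "Z' = cst z'" unfolding T_grading by auto
  then show ?thesis
    using generate.eng[of z "add_monoid F" "gens p" z'] unfolding T_grading
    by (auto simp: T_add F_simps intro!: imageI)
qed

lemma inv_grading:
  assumes "Z \<in> grading T p"
  shows "\<ominus>\<^bsub>T\<^esub> Z \<in> grading T p"
proof -
  obtain z where z: "z \<in> generate (add_monoid F) (gens p)" "Z = cst z"
    using assms unfolding T_grading by auto
  have zF: "z \<in> carrier F"
    using group.generate_in_carrier[OF F_group, of "gens p"] gens_F z by auto
  have "inv\<^bsub>add_monoid F\<^esub> z \<in> generate (add_monoid F) (gens p)"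
    using group.generate_m_inv_closed[OF F_group _ z(1)] gens_F by auto
  then have "- z \<in> generate (add_monoid F) (gens p)" by (simp only: F_inv[OF zF])
  moreover have "\<ominus>\<^bsub>T\<^esub> Z = cst (- z)"
    using zF z by (intro T.minus_equality) (simp_all add: T_add T_zero F_uminus)
  ultimately show ?thesis unfolding T_grading by blast
qed

text \<open>A graded piece is generated as a group, so negatives of generators occur. The premise
  \<open>inv\<close> turns them into pure tensors of the same degree.\<close>

lemma grading_induct [consumes 1, case_names inv zero pure add]:
  assumes Z: "Z \<in> grading T p" and inv: "\<And>x q. x \<in> grading M q \<Longrightarrow> \<ominus>\<^bsub>M\<^esub> x \<in> grading M q"
    and 0: "Q \<zero>\<^bsub>T\<^esub>"
    and p: "\<And>x y q s. q + s = p \<Longrightarrow> x \<in> grading M q \<Longrightarrow> y \<in> grading N s \<Longrightarrow> Q (pt x y)"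
    and a: "\<And>Z Z'. Z \<in> carrier T \<Longrightarrow> Z' \<in> carrier T \<Longrightarrow> Q Z \<Longrightarrow> Q Z' \<Longrightarrow> Q (Z \<oplus>\<^bsub>T\<^esub> Z')"
  shows "Q Z"
proof -
  obtain z where z: "z \<in> generate (add_monoid F) (gens p)" "Z = cst z" using Z unfolding T_grading by auto
  from z(1) have "Q (cst z)"
  proof (induction z rule: generate.induct)
    case one
    then show ?case using 0 by (simp add: T_zero F_simps)
  next
    case (incl z)
    then show ?case using p by (auto simp: gens_def pt_def)
  next
    case (inv z)
    then obtain x y q s where *: "z = frag_of (x, y)" "q + s = p" "x \<in> grading M q" "y \<in> grading N s"
      by (auto simp: gens_def)
    then have xy: "x \<in> carrier M" "y \<in> carrier N" using gM gN by auto
    have "inv\<^bsub>add_monoid F\<^esub> z = - frag_of (x, y)" unfolding *(1) by (rule F_inv[OF F_of[OF xy]])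
    then show ?case using p[OF *(2) assms(2)[OF *(3)] *(4)] pt_uminus[OF xy] by simp
  next
    case (eng z z')
    have "z \<in> carrier F" "z' \<in> carrier F"
      using eng(1,2) group.generate_in_carrier[OF F_group, of "gens p"] gens_F by auto
    then show ?case using a[OF cst_closed cst_closed, of z z'] eng by (simp add: T_add F_simps)
  qed
  then show ?thesis by (simp add: z)
qed

end

end

lemma ring_bimod_simps:
  "carrier (ring_bimod S l r gr) = carrier S" "add (ring_bimod S l r gr) = add S"
  "zero (ring_bimod S l r gr) = zero S" "a \<odot>\<^bsub>ring_bimod S l r gr\<^esub> x = l a \<otimes>\<^bsub>S\<^esub> x"
  "x \<odot>r\<^bsub>ring_bimod S l r gr\<^esub> b = x \<otimes>\<^bsub>S\<^esub> r b" "grading (ring_bimod S l r gr) = gr"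
  by (simp_all add: ring_bimod_def)

lemma ring_bimod_bimodule:
  assumes "ring S" "ring RA" "ring RB"
    and l: "\<And>a. a \<in> carrier RA \<Longrightarrow> l a \<in> carrier S"
      "\<And>a b. a \<in> carrier RA \<Longrightarrow> b \<in> carrier RA \<Longrightarrow> l (a \<oplus>\<^bsub>RA\<^esub> b) = l a \<oplus>\<^bsub>S\<^esub> l b"
      "\<And>a b. a \<in> carrier RA \<Longrightarrow> b \<in> carrier RA \<Longrightarrow> l (a \<otimes>\<^bsub>RA\<^esub> b) = l a \<otimes>\<^bsub>S\<^esub> l b"
      "l \<one>\<^bsub>RA\<^esub> = \<one>\<^bsub>S\<^esub>"
    and r: "\<And>a. a \<in> carrier RB \<Longrightarrow> r a \<in> carrier S"
      "\<And>a b. a \<in> carrier RB \<Longrightarrow> b \<in> carrier RB \<Longrightarrow> r (a \<oplus>\<^bsub>RB\<^esub> b) = r a \<oplus>\<^bsub>S\<^esub> r b"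
      "\<And>a b. a \<in> carrier RB \<Longrightarrow> b \<in> carrier RB \<Longrightarrow> r (a \<otimes>\<^bsub>RB\<^esub> b) = r a \<otimes>\<^bsub>S\<^esub> r b"
      "r \<one>\<^bsub>RB\<^esub> = \<one>\<^bsub>S\<^esub>"
  shows "bimodule RA RB (ring_bimod S l r gr)"
proof (intro bimodule.intro bimodule_axioms.intro)
  interpret S: ring S by fact
  show "ring RA" "ring RB" by fact+
  show "abelian_group (ring_bimod S l r gr)"
  proof (rule abelian_groupI)
    fix x assume "x \<in> carrier (ring_bimod S l r gr)"
    then show "\<exists>y\<in>carrier (ring_bimod S l r gr). y \<oplus>\<^bsub>ring_bimod S l r gr\<^esub> x = \<zero>\<^bsub>ring_bimod S l r gr\<^esub>"
      by (intro bexI[of _ "\<ominus>\<^bsub>S\<^esub> x"]) (simp_all add: ring_bimod_simps S.l_neg)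
  qed (simp_all add: ring_bimod_simps S.a_ac)
qed (simp_all add: ring_bimod_simps l r assms(1) ring.ring_simprules monoid.r_one[OF ring.is_monoid[OF assms(1)]])

section \<open>The vertex ring and the arc bimodules\<close>

context fin_digraph
begin

lemma vr_simps: "carrier (vertex_ring G) = path_part G 0" "add (vertex_ring G) = (+)"
  "zero (vertex_ring G) = 0" "mult (vertex_ring G) = mult CG" "one (vertex_ring G) = psc 1"
  by (simp_all add: vertex_ring_def pa_simps(1,2) one_psc[symmetric])

lemma part0_mult: "x \<in> path_part G 0 \<Longrightarrow> y \<in> path_part G 0 \<Longrightarrow> x \<star> y \<in> path_part G 0"
  using path_part_mult[of x 0 y 0] by simp

lemma vr_ring: "ring (vertex_ring G)"
proof (rule ringI)
  show "abelian_group (vertex_ring G)"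
  proof (rule abelian_groupI)
    fix x assume "x \<in> carrier (vertex_ring G)"
    then show "\<exists>y\<in>carrier (vertex_ring G). y \<oplus>\<^bsub>vertex_ring G\<^esub> x = \<zero>\<^bsub>vertex_ring G\<^esub>"
      by (intro bexI[of _ "- x"]) (simp_all add: vr_simps path_part_uminus)
  qed (auto simp: vr_simps path_part_add algebra_simps)
  show "monoid (vertex_ring G)"
    by (rule monoidI)
      (simp_all add: vr_simps part0_mult psc_part pa_assoc path_part_closed psc_one psc_comm)
qed (simp_all add: vr_simps pa_distr_l pa_distr_r)

context
  fixes H :: "('a, 'b) pre_digraph"
  assumes H: "fin_digraph H" and VH: "verts H = verts G"
begin

interpretation H: fin_digraph H by (rule H)

lemma part0_eq: "path_part H 0 = path_part G 0"
proof -
  have "(u, p) \<in> paths H \<and> length p = 0 \<longleftrightarrow> (u, p) \<in> paths G \<and> length p = 0" for u p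
    by (cases p) (auto simp: VH)
  then show ?thesis
    unfolding set_eq_iff path_part_iff H.path_part_iff by simp
qed

text \<open>Products of vertices do not see the arcs. This makes the reversed arcs a bimodule over
  the vertex ring of \<open>G\<close> itself.\<close>

lemma part0_mult_eq:
  assumes "x \<in> path_part G 0" "y \<in> path_part G 0"
  shows "x \<star> y = x \<otimes>\<^bsub>path_algebra H\<^esub> y"
  using assms(1)
proof (induction x rule: path_part_induct)
  case (single u p c)
  from assms(2) show ?case
  proof (induction y rule: path_part_induct)
    case (single v q e)
    then show ?case using \<open>length p = 0\<close> by (simp add: pa_single H.pa_single)
  qed (simp_all add: pa_distr_l H.pa_distr_l)
qed (simp_all add: pa_distr_r H.pa_distr_r)

lemma psc_eq: "H.psc c = psc c"
  by (simp add: psc_def H.psc_def VH)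

lemma arc_simps: "carrier (arc_bimod H) = path_part H 1" "add (arc_bimod H) = (+)"
  "zero (arc_bimod H) = 0" "x \<odot>\<^bsub>arc_bimod H\<^esub> m = x \<otimes>\<^bsub>path_algebra H\<^esub> m"
  "m \<odot>r\<^bsub>arc_bimod H\<^esub> x = m \<otimes>\<^bsub>path_algebra H\<^esub> x"
  "grading (arc_bimod H) = (\<lambda>p. if p = 1 then path_part H 1 else {0})"
  by (simp_all add: arc_bimod_def ring_bimod_simps H.pa_simps(1,2))

lemma arc_closed:
  "x \<in> path_part G 0 \<Longrightarrow> m \<in> path_part H 1 \<Longrightarrow> x \<otimes>\<^bsub>path_algebra H\<^esub> m \<in> path_part H 1"
  "x \<in> path_part G 0 \<Longrightarrow> m \<in> path_part H 1 \<Longrightarrow> m \<otimes>\<^bsub>path_algebra H\<^esub> x \<in> path_part H 1"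
  using H.path_part_mult[of x 0 m 1] H.path_part_mult[of m 1 x 0] by (simp_all add: part0_eq)

lemma part0_H: "x \<in> path_part G 0 \<Longrightarrow> x \<in> carrier (path_algebra H)"
  using H.path_part_closed[of x 0] by (simp add: part0_eq)

lemma arc_bimod_bim: "bimodule (vertex_ring G) (vertex_ring G) (arc_bimod H)"
proof (intro bimodule.intro bimodule_axioms.intro vr_ring)
  show "abelian_group (arc_bimod H)"
  proof (rule abelian_groupI)
    fix x assume "x \<in> carrier (arc_bimod H)"
    then show "\<exists>y\<in>carrier (arc_bimod H). y \<oplus>\<^bsub>arc_bimod H\<^esub> x = \<zero>\<^bsub>arc_bimod H\<^esub>"
      by (intro bexI[of _ "- x"]) (simp_all add: arc_simps H.path_part_uminus)
  qed (auto simp: arc_simps H.path_part_add algebra_simps)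
qed (simp_all add: arc_simps vr_simps arc_closed[simplified] H.pa_distr_l H.pa_distr_r part0_mult_eq
      H.pa_assoc H.path_part_closed part0_H psc_eq[symmetric] H.psc_one H.psc_comm)

lemma arc_induct [consumes 1, case_names zero arc add]:
  assumes "m \<in> path_part H 1" "Q 0"
    "\<And>c a. a \<in> arcs H \<Longrightarrow> Q (psc c \<otimes>\<^bsub>path_algebra H\<^esub> arc_vec H a)"
    "\<And>x y. x \<in> path_part H 1 \<Longrightarrow> y \<in> path_part H 1 \<Longrightarrow> Q x \<Longrightarrow> Q y \<Longrightarrow> Q (x + y)"
  shows "Q m"
  using assms(1)
proof (induction m rule: H.path_part_induct)
  case (single u p c)
  then obtain a where a: "p = [a]" "a \<in> arcs H" "u = tail H a" by (cases p) auto
  then have "Poly_Mapping.single (u, p) c = psc c \<otimes>\<^bsub>path_algebra H\<^esub> arc_vec H a"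
    by (simp add: psc_eq[symmetric] arc_vec_def H.psc_single)
  then show ?case using assms(3)[OF a(2)] by simp
qed (use assms in auto)

text \<open>A vertex on the left acts on the coefficient of an arc through the tail; in
  \<open>coef_r\<close> it acts through the head. These are the balance conditions for the
  coefficient functionals.\<close>

lemma coef_l:
  assumes "x \<in> path_part G 0" "m \<in> path_part H 1" "k \<in> arcs H"
  shows "Poly_Mapping.lookup (x \<otimes>\<^bsub>path_algebra H\<^esub> m) (tail H k, [k])
    = Poly_Mapping.lookup x (tail H k, []) * Poly_Mapping.lookup m (tail H k, [k])"
  using assms(1)
proof (induction x rule: path_part_induct)
  case (single u p c)
  from assms(2) show ?case
  proof (induction m rule: H.path_part_induct)
    case (single v q e)
    then show ?case using \<open>length p = 0\<close> by (auto simp: H.pa_single lookup_single when_def)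
  qed (simp_all add: H.pa_distr_l lookup_add algebra_simps)
qed (simp_all add: H.pa_distr_r lookup_add algebra_simps)

lemma coef_r:
  assumes "x \<in> path_part G 0" "m \<in> path_part H 1" "k \<in> arcs H"
  shows "Poly_Mapping.lookup (m \<otimes>\<^bsub>path_algebra H\<^esub> x) (tail H k, [k])
    = Poly_Mapping.lookup x (head H k, []) * Poly_Mapping.lookup m (tail H k, [k])"
  using assms(1)
proof (induction x rule: path_part_induct)
  case (single u p c)
  from assms(2) show ?case
  proof (induction m rule: H.path_part_induct)
    case (single v q e)
    then obtain a where "q = [a]" by (cases q) auto
    then show ?case using \<open>length p = 0\<close> by (auto simp: H.pa_single lookup_single when_def)
  qed (simp_all add: H.pa_distr_r lookup_add algebra_simps)
qed (simp_all add: H.pa_distr_l lookup_add algebra_simps)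

end

end

context cell_alg
begin

lemma A_R_simps: "carrier (A_R G W) = carrier A" "add (A_R G W) = add A" "zero (A_R G W) = zero A"
  "a \<odot>\<^bsub>A_R G W\<^esub> x = a \<cdot> x" "x \<odot>r\<^bsub>A_R G W\<^esub> c = x \<cdot> cls G W c" "grading (A_R G W) = gr"
  by (simp_all add: A_R_def ring_bimod_simps)

lemma R_A_simps: "carrier (R_A G W) = carrier A" "add (R_A G W) = add A" "zero (R_A G W) = zero A"
  "c \<odot>\<^bsub>R_A G W\<^esub> x = cls G W c \<cdot> x" "x \<odot>r\<^bsub>R_A G W\<^esub> a = x \<cdot> a" "grading (R_A G W) = gr"
  by (simp_all add: R_A_def ring_bimod_simps)

lemma A_R_bim: "bimodule A (vertex_ring G) (A_R G W)"
  unfolding A_R_def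
  by (rule ring_bimod_bimodule)
    (auto simp: A_ring vr_ring vr_simps path_part_closed cls_add cls_mult sc_psc[symmetric] sc_one)

lemma R_A_bim: "bimodule (vertex_ring G) A (R_A G W)"
  unfolding R_A_def
  by (rule ring_bimod_bimodule)
    (auto simp: A_ring vr_ring vr_simps path_part_closed cls_add cls_mult sc_psc[symmetric] sc_one)

lemma A_R_inv: "x \<in> carrier A \<Longrightarrow> \<ominus>\<^bsub>A_R G W\<^esub> x = \<ominus>\<^bsub>A\<^esub> x"
  by (simp add: a_inv_def m_inv_def A_R_simps)

text \<open>Next to a fixed vertex the vertex ring acts by scalars, so balance over R reduces to
  complex linearity.\<close>

lemma cls_ve:
  assumes "c \<in> path_part G 0" "v \<in> verts G"
  shows "cls G W c \<cdot> ve v = sc (Poly_Mapping.lookup c (v, [])) \<cdot> ve v"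
    and "ve v \<cdot> cls G W c = sc (Poly_Mapping.lookup c (v, [])) \<cdot> ve v"
proof -
  have "cls G W c \<cdot> ve v = sc (Poly_Mapping.lookup c (v, [])) \<cdot> ve v \<and>
      ve v \<cdot> cls G W c = sc (Poly_Mapping.lookup c (v, [])) \<cdot> ve v"
    using assms(1)
  proof (induction c rule: path_part_induct)
    case zero
    show ?case using assms(2) by (simp add: cls_zero sc_zero)
  next
    case (single u p c)
    then have "p = []" "u \<in> verts G" by auto
    then show ?case using assms(2)
      by (auto simp: cls_single_Nil A.m_assoc sc_pull ve_ve lookup_single when_def sc_zero)
  next
    case (add x y)
    then show ?case using assms(2)
      by (simp add: cls_add path_part_closed A.l_distr A.r_distr lookup_add sc_add)
  qed
  then show "cls G W c \<cdot> ve v = sc (Poly_Mapping.lookup c (v, [])) \<cdot> ve v"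
    "ve v \<cdot> cls G W c = sc (Poly_Mapping.lookup c (v, [])) \<cdot> ve v" by blast+
qed

end

sublocale cell_alg \<subseteq> TA: tens "cell_algebra G W" "vertex_ring G" "cell_algebra G W" "A_R G W" "R_A G W"
  by (intro tens.intro A_R_bim R_A_bim)

locale arc_tens = cell_alg G W for G :: "('v, 'e) pre_digraph" and W +
  fixes H :: "('v, 'e) pre_digraph"
  assumes fH: "fin_digraph H" and VH: "verts H = verts G" and EH: "arcs H = arcs G"
begin

sublocale H: fin_digraph H by (rule fH)

sublocale I: tens A "vertex_ring G" "vertex_ring G" "A_R G W" "arc_bimod H"
  by (intro tens.intro A_R_bim arc_bimod_bim[OF fH VH])

sublocale O: tens A "vertex_ring G" A "tensor (vertex_ring G) (A_R G W) (arc_bimod H)" "R_A G W"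
  by (intro tens.intro I.T_bimodule R_A_bim)

end

section \<open>A \<otimes> A over the vertex ring as a space of forms\<close>

context frob
begin

text \<open>The vertex inserted into both factors makes the product of the two values balanced over
  the whole vertex ring.\<close>

definition ThA :: "((('v, 'e) algelt \<times> ('v, 'e) algelt) \<Rightarrow>\<^sub>0 int) set \<Rightarrow> 'v \<Rightarrow> ('v, 'e) algelt \<Rightarrow>
    ('v, 'e) algelt \<Rightarrow> complex" where
  "ThA Z v u g = TA.lift (\<lambda>x y. f (x \<cdot> (ve v \<cdot> u)) * f (g \<cdot> (ve v \<cdot> y))) Z"

lemma f_cls_l:
  assumes "x \<in> carrier A" "c \<in> path_part G 0" "v \<in> verts G" "u \<in> carrier A"
  shows "f (x \<cdot> cls G W c \<cdot> (ve v \<cdot> u)) = Poly_Mapping.lookup c (v, []) * f (x \<cdot> (ve v \<cdot> u))"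
proof -
  have c: "cls G W c \<in> carrier A" using assms by (simp add: path_part_closed)
  have "x \<cdot> cls G W c \<cdot> (ve v \<cdot> u) = x \<cdot> ((cls G W c \<cdot> ve v) \<cdot> u)"
    using assms c by (simp add: A.m_assoc)
  also have "\<dots> = sc (Poly_Mapping.lookup c (v, [])) \<cdot> (x \<cdot> (ve v \<cdot> u))"
    using assms by (simp add: cls_ve A.m_assoc sc_pull)
  finally show ?thesis using assms by (simp add: lfun_sc[OF f_lfun])
qed

lemma f_cls_r:
  assumes "y \<in> carrier A" "c \<in> path_part G 0" "v \<in> verts G" "g \<in> carrier A"
  shows "f (g \<cdot> (ve v \<cdot> (cls G W c \<cdot> y))) = Poly_Mapping.lookup c (v, []) * f (g \<cdot> (ve v \<cdot> y))"
proof -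
  have c: "cls G W c \<in> carrier A" using assms by (simp add: path_part_closed)
  have "g \<cdot> (ve v \<cdot> (cls G W c \<cdot> y)) = g \<cdot> ((ve v \<cdot> cls G W c) \<cdot> y)"
    using assms c by (simp add: A.m_assoc)
  also have "\<dots> = sc (Poly_Mapping.lookup c (v, [])) \<cdot> (g \<cdot> (ve v \<cdot> y))"
    using assms by (simp add: cls_ve A.m_assoc sc_pull)
  finally show ?thesis using assms by (simp add: lfun_sc[OF f_lfun])
qed

lemma balA:
  assumes "v \<in> verts G" "u \<in> carrier A" "g \<in> carrier A"
  shows "TA.balanced (\<lambda>x y. f (x \<cdot> (ve v \<cdot> u)) * f (g \<cdot> (ve v \<cdot> y)))"
  unfolding TA.balanced_def A_R_simps R_A_simps vr_simps
  using assms
  by (simp add: f_cls_l f_cls_r A.l_distr A.r_distr lfun_add[OF f_lfun] algebra_simps)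

lemma AA_eq: "AA G W = TA.T"
  by (simp add: AA_def)

lemma tAA_eq: "tAA G W x y = TA.pt x y"
  by (simp add: tAA_def)

text \<open>The unit is the sum of the vertices, so every pure tensor is a sum of tensors whose left
  factor ends at one vertex. These are the generators of \<open>fbim\<close>.\<close>

lemma pt_finsum_ve:
  assumes "x \<in> carrier A" "y \<in> carrier A" "Q \<zero>\<^bsub>TA.T\<^esub>"
    "\<And>v. v \<in> verts G \<Longrightarrow> Q (TA.pt (x \<cdot> ve v) y)"
    "\<And>Z Z'. Z \<in> carrier TA.T \<Longrightarrow> Z' \<in> carrier TA.T \<Longrightarrow> Q Z \<Longrightarrow> Q Z' \<Longrightarrow> Q (Z \<oplus>\<^bsub>TA.T\<^esub> Z')"
  shows "Q (TA.pt x y)"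
proof -
  have "Q (TA.pt (x \<cdot> finsum A ve S) y)" if "finite S" "S \<subseteq> verts G" for S
    using that
  proof (induction S rule: finite_induct)
    case empty
    then show ?case using assms TA.pt_zero_l[of y] by (simp add: A_R_simps R_A_simps)
  next
    case (insert v S)
    then have v: "v \<in> verts G" "finsum A ve S \<in> carrier A"
      by (auto intro!: A.finsum_closed)
    have "finsum A ve (insert v S) = ve v \<oplus>\<^bsub>A\<^esub> finsum A ve S"
      using insert by (intro A.finsum_insert) auto
    then have "TA.pt (x \<cdot> finsum A ve (insert v S)) y
      = TA.pt (x \<cdot> ve v) y \<oplus>\<^bsub>TA.T\<^esub> TA.pt (x \<cdot> finsum A ve S) y"
      using v assms(1,2) TA.pt_add_l[of "x \<cdot> ve v" "x \<cdot> finsum A ve S" y]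
      by (simp add: A.r_distr A_R_simps R_A_simps)
    then show ?case
      using insert v assms by (simp add: A_R_simps R_A_simps)
  qed
  from this[of "verts G"] show ?thesis using assms(1) by (simp add: ve_sum)
qed

lemma single_part0: "v \<in> verts G \<Longrightarrow> sng v [] 1 \<in> path_part G 0"
  by (simp add: path_part_single)

text \<open>Over the vertex ring the tensor product splits into the complex tensor products of A v
  and v A. The index set is therefore the vertex set, with \<open>s\<close> and \<open>r\<close> the
  identity.\<close>

lemma fbim_AA: "fbim G h \<phi> W \<nu>0 \<nu>1 f B d (AA G W) (verts G) (\<lambda>v. v) (\<lambda>v. v)
    (\<lambda>x v y. tAA G W (x \<cdot> ve v) y) ThA 0"
  unfolding AA_eq tAA_eq
proof (intro fbim.intro fbim_axioms.intro frob_axioms)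
  note S = A_R_simps R_A_simps
  show "finite (verts G)" by simp
  show "bimodule A A TA.T" by (rule TA.T_bimodule)
  show "Q z" if z: "z \<in> carrier TA.T" and 0: "Q \<zero>\<^bsub>TA.T\<^esub>" and
    p: "\<And>x k y. x \<in> carrier A \<Longrightarrow> k \<in> verts G \<Longrightarrow> y \<in> carrier A \<Longrightarrow> Q (TA.pt (x \<cdot> ve k) y)"
    and a: "\<And>z z'. z \<in> carrier TA.T \<Longrightarrow> z' \<in> carrier TA.T \<Longrightarrow> Q z \<Longrightarrow> Q z' \<Longrightarrow> Q (z \<oplus>\<^bsub>TA.T\<^esub> z')" for z Q
    using z
  proof (induction z rule: TA.T_induct)
    case (pure x y)
    then have xy: "x \<in> carrier A" "y \<in> carrier A" by (simp_all add: S)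
    show ?case by (rule pt_finsum_ve[OF xy 0 _ a]) (rule p[OF xy(1) _ xy(2)])
  next
    case (add Z Z')
    then show ?case by (rule a)
  qed (rule 0)
  show "ThA (z \<oplus>\<^bsub>TA.T\<^esub> z') k u g = ThA z k u g + ThA z' k u g"
    if "z \<in> carrier TA.T" "z' \<in> carrier TA.T" "k \<in> verts G" "u \<in> carrier A" "g \<in> carrier A" for z z' k u g
    unfolding ThA_def by (rule TA.lift_add[OF balA]) (use that in auto)
  show "ThA (TA.pt (x \<cdot> ve k) y) k' u g
      = (if k' = k then f (x \<cdot> (ve k \<cdot> u)) * f (g \<cdot> (ve k \<cdot> y)) else 0)"
    if "x \<in> carrier A" "k \<in> verts G" "y \<in> carrier A" "k' \<in> verts G" "u \<in> carrier A" "g \<in> carrier A"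
    for x k y k' u g
  proof -
    have "x \<cdot> ve k \<cdot> (ve k' \<cdot> u) = x \<cdot> ((ve k \<cdot> ve k') \<cdot> u)"
      using that by (simp add: A.m_assoc)
    then show ?thesis
      unfolding ThA_def using that
      by (subst TA.lift_pt[OF balA]) (auto simp: S ve_ve lfun_zero[OF f_lfun])
  qed
  show "TA.pt (sc c \<cdot> x \<cdot> ve k) y = TA.pt (x \<cdot> ve k) (sc c \<cdot> y)"
    if "x \<in> carrier A" "k \<in> verts G" "y \<in> carrier A" for c x k y
  proof -
    have "sc c \<cdot> x \<cdot> ve k = (x \<cdot> ve k) \<cdot> sc c" using that by (simp add: A.m_assoc sc_comm)
    then show ?thesis
      using TA.pt_bal[of "x \<cdot> ve k" "psc c" y] that by (simp add: S vr_simps psc_part sc_psc)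
  qed
  show "TA.pt (x \<cdot> ve k \<cdot> ve k) y = TA.pt (x \<cdot> ve k) y"
    if "x \<in> carrier A" "k \<in> verts G" for x k y
    using that by (simp add: A.m_assoc ve_ve)
  show "TA.pt (x \<cdot> ve k) (ve k \<cdot> y) = TA.pt (x \<cdot> ve k) y"
    if "x \<in> carrier A" "k \<in> verts G" "y \<in> carrier A" for x k y
    using TA.pt_bal[of "x \<cdot> ve k" "sng k [] 1" y] that
    by (simp add: S vr_simps single_part0 vert_elt_def[symmetric] A.m_assoc ve_ve)
  show "TA.pt (x \<cdot> ve k) y \<in> grading TA.T (p + q + 0)"
    if "x \<in> gr p" "k \<in> verts G" "y \<in> gr q" for x p k y q
    using TA.pt_grading[of "x \<cdot> ve k" p y q] gr_mult[OF that(1) gr_ve[OF that(2)]] that gr_closed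
    by (auto simp: S)
  have sub: "\<And>q. grading (A_R G W) q \<subseteq> carrier (A_R G W)" "\<And>q. grading (R_A G W) q \<subseteq> carrier (R_A G W)"
    using gr_closed by (auto simp: S)
  show "Q z" if z: "z \<in> grading TA.T n" and 0: "Q \<zero>\<^bsub>TA.T\<^esub>" and
    p: "\<And>x k y p q. x \<in> gr p \<Longrightarrow> k \<in> verts G \<Longrightarrow> y \<in> gr q \<Longrightarrow> p + q + 0 = n \<Longrightarrow> Q (TA.pt (x \<cdot> ve k) y)"
    and a: "\<And>z z'. z \<in> carrier TA.T \<Longrightarrow> z' \<in> carrier TA.T \<Longrightarrow> Q z \<Longrightarrow> Q z' \<Longrightarrow> Q (z \<oplus>\<^bsub>TA.T\<^esub> z')" for z n Q
    using z
  proof (rule TA.grading_induct[OF sub])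
    show "x \<in> grading (A_R G W) q \<Longrightarrow> \<ominus>\<^bsub>A_R G W\<^esub> x \<in> grading (A_R G W) q" for x q
      using gr_uminus gr_closed by (simp add: A_R_simps A_R_inv)
    fix x y q s assume *: "q + s = n" "x \<in> grading (A_R G W) q" "y \<in> grading (R_A G W) s"
    then have xy: "x \<in> gr q" "y \<in> gr s" by (simp_all add: S)
    show "Q (TA.pt x y)"
    proof (rule pt_finsum_ve[OF _ _ 0 _ a])
      fix v assume "v \<in> verts G"
      then show "Q (TA.pt (x \<cdot> ve v) y)" by (rule p[OF xy(1) _ xy(2)]) (use * in simp)
    qed (use xy gr_closed in blast)+
  qed (rule 0, rule a)
  show "\<zero>\<^bsub>TA.T\<^esub> \<in> grading TA.T n" for n
    by (rule TA.zero_grading[OF sub])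
  show "z \<oplus>\<^bsub>TA.T\<^esub> z' \<in> grading TA.T n" if "z \<in> grading TA.T n" "z' \<in> grading TA.T n" for z z' n
    by (rule TA.add_grading[OF sub that])
  fix w x k y assume "w \<in> carrier A" "x \<in> carrier A" "k \<in> verts G" "y \<in> carrier A"
  then show "w \<odot>\<^bsub>TA.T\<^esub> TA.pt (x \<cdot> ve k) y = TA.pt (w \<cdot> x \<cdot> ve k) y"
    "TA.pt (x \<cdot> ve k) y \<odot>r\<^bsub>TA.T\<^esub> w = TA.pt (x \<cdot> ve k) (y \<cdot> w)"
    by (simp_all add: TA.T_smult_pt TA.T_rsmult_pt S A.m_assoc)
next
  note S = A_R_simps R_A_simps
  fix x x' k y assume "x \<in> carrier A" "x' \<in> carrier A" "k \<in> verts G" "y \<in> carrier A"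
  then show "TA.pt ((x \<oplus>\<^bsub>A\<^esub> x') \<cdot> ve k) y = TA.pt (x \<cdot> ve k) y \<oplus>\<^bsub>TA.T\<^esub> TA.pt (x' \<cdot> ve k) y"
    using TA.pt_add_l[of "x \<cdot> ve k" "x' \<cdot> ve k" y] by (simp add: S A.l_distr)
next
  note S = A_R_simps R_A_simps
  fix x y' k y assume "x \<in> carrier A" "k \<in> verts G" "y \<in> carrier A" "y' \<in> carrier A"
  then show "TA.pt (x \<cdot> ve k) (y \<oplus>\<^bsub>A\<^esub> y') = TA.pt (x \<cdot> ve k) y \<oplus>\<^bsub>TA.T\<^esub> TA.pt (x \<cdot> ve k) y'"
    using TA.pt_add_r[of "x \<cdot> ve k" y y'] by (simp add: S)
qed (simp_all add: A_R_simps R_A_simps)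

end

section \<open>The triple tensor products as spaces of forms\<close>

locale frob_arc = frob G h \<phi> W \<nu>0 \<nu>1 f B d + arc_tens G W H
  for G :: "('v, 'e) pre_digraph" and h \<phi> W \<nu>0 \<nu>1 f B d and H :: "('v, 'e) pre_digraph"
begin

text \<open>The inner tensor product is evaluated first, with \<open>k\<close> and \<open>u\<close>
  fixed. Its value is then one factor of the balanced map on the outer tensor product.\<close>

definition ThI where
  "ThI X k u = I.lift (\<lambda>x m. f (x \<cdot> (ve (tail H k) \<cdot> u)) * Poly_Mapping.lookup m (tail H k, [k])) X"

definition ThE where
  "ThE Z k u g = O.lift (\<lambda>X y. ThI X k u * f (g \<cdot> (ve (head H k) \<cdot> y))) Z"

lemma tl_hd_H [simp]: "k \<in> arcs G \<Longrightarrow> tail H k \<in> verts G" "k \<in> arcs G \<Longrightarrow> head H k \<in> verts G"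
  using H.tail_in_verts[of k] H.head_in_verts[of k] VH EH by simp_all

lemmas EO_simps = A_R_simps R_A_simps arc_simps[OF fH VH] vr_simps

lemma balI:
  assumes "k \<in> arcs G" "u \<in> carrier A"
  shows "I.balanced (\<lambda>x m. f (x \<cdot> (ve (tail H k) \<cdot> u)) * Poly_Mapping.lookup m (tail H k, [k]))"
  unfolding I.balanced_def EO_simps
  using assms EH
  by (simp add: f_cls_l coef_l[OF fH VH] A.l_distr lookup_add lfun_add[OF f_lfun] algebra_simps)

lemma ThI_pt: "k \<in> arcs G \<Longrightarrow> u \<in> carrier A \<Longrightarrow> x \<in> carrier A \<Longrightarrow> m \<in> path_part H 1 \<Longrightarrow>
    ThI (I.pt x m) k u = f (x \<cdot> (ve (tail H k) \<cdot> u)) * Poly_Mapping.lookup m (tail H k, [k])"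
  unfolding ThI_def by (rule I.lift_pt[OF balI]) (simp_all add: EO_simps)

lemma ThI_add: "k \<in> arcs G \<Longrightarrow> u \<in> carrier A \<Longrightarrow> X \<in> carrier I.T \<Longrightarrow> X' \<in> carrier I.T \<Longrightarrow>
    ThI (X \<oplus>\<^bsub>I.T\<^esub> X') k u = ThI X k u + ThI X' k u"
  unfolding ThI_def by (rule I.lift_add[OF balI])

text \<open>The balance needed for the outer tensor product: the vertex ring acts from the right by
  the scalar at the head of \<open>k\<close>.\<close>

lemma ThI_r:
  assumes k: "k \<in> arcs G" "u \<in> carrier A" and c: "c \<in> path_part G 0" and X: "X \<in> carrier I.T"
  shows "ThI (X \<odot>r\<^bsub>I.T\<^esub> c) k u = Poly_Mapping.lookup c (head H k, []) * ThI X k u"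
  using X
proof (induction X rule: I.T_induct)
  case zero
  have "ThI \<zero>\<^bsub>I.T\<^esub> k u = 0" using ThI_add[OF k, of "\<zero>\<^bsub>I.T\<^esub>" "\<zero>\<^bsub>I.T\<^esub>"] by simp
  then show ?case using c by (simp add: I.T_rsmult_zero EO_simps)
next
  case (pure x m)
  then show ?case
    using k c EH arc_closed(2)[OF fH VH c, of m]
    by (simp add: I.T_rsmult_pt EO_simps ThI_pt[simplified] coef_r[OF fH VH, simplified])
next
  case (add Z Z')
  have "c \<in> carrier (vertex_ring G)" using c by (simp add: EO_simps)
  then show ?case
    using add k by (simp add: I.T_rsmult_add ThI_add I.T_rsmult_closed distrib_left)
qed

lemma balO:
  assumes "k \<in> arcs G" "u \<in> carrier A" "g \<in> carrier A"
  shows "O.balanced (\<lambda>X y. ThI X k u * f (g \<cdot> (ve (head H k) \<cdot> y)))"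
  unfolding O.balanced_def EO_simps
  using assms
  by (simp add: ThI_add ThI_r f_cls_r A.r_distr lfun_add[OF f_lfun] algebra_simps)

lemma AEA_eq: "AEA G W H = O.T"
  by (simp add: AEA_def)

lemma tAEA_eq: "tAEA G W H x a y = O.pt (I.pt x (arc_vec H a)) y"
  by (simp add: tAEA_def)

lemma arc_vec_part: "a \<in> arcs G \<Longrightarrow> arc_vec H a \<in> path_part H 1"
  unfolding arc_vec_def by (rule H.path_part_single) (use EH VH in auto)

lemma Ipt_closed: "x \<in> carrier A \<Longrightarrow> m \<in> path_part H 1 \<Longrightarrow> I.pt x m \<in> carrier I.T"
  by (rule I.pt_closed) (simp_all add: EO_simps)

lemma psc_arc_l:
  "x \<in> carrier A \<Longrightarrow> a \<in> arcs G \<Longrightarrow>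
    I.pt x (psc c \<otimes>\<^bsub>path_algebra H\<^esub> arc_vec H a) = I.pt (sc c \<cdot> x) (arc_vec H a)"
  using I.pt_bal[of x "psc c" "arc_vec H a"] arc_vec_part[of a]
  by (simp add: EO_simps psc_part sc_psc[symmetric] sc_comm)

lemma pt_arc_induct:
  assumes x: "x \<in> carrier A" and y: "y \<in> carrier A" and m: "m \<in> path_part H 1" and 0: "Q \<zero>\<^bsub>O.T\<^esub>"
    and p: "\<And>c a. a \<in> arcs G \<Longrightarrow> Q (tAEA G W H (sc c \<cdot> x) a y)"
    and a: "\<And>Z Z'. Z \<in> carrier O.T \<Longrightarrow> Z' \<in> carrier O.T \<Longrightarrow> Q Z \<Longrightarrow> Q Z' \<Longrightarrow> Q (Z \<oplus>\<^bsub>O.T\<^esub> Z')"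
  shows "Q (O.pt (I.pt x m) y)"
  using m
proof (induction m rule: arc_induct[OF fH VH, consumes 1, case_names zero arc add])
  case zero
  have "I.pt x 0 = \<zero>\<^bsub>I.T\<^esub>"
    using I.pt_zero_r[of x] x by (simp add: EO_simps)
  then show ?case using 0 O.pt_zero_l[of y] y by (simp add: EO_simps)
next
  case (arc c a)
  then show ?case using p[of a c] x EH by (simp add: psc_arc_l tAEA_eq)
next
  case (add m m')
  have "I.pt x (m + m') = I.pt x m \<oplus>\<^bsub>I.T\<^esub> I.pt x m'"
    using I.pt_add_r[of x m m'] add x by (simp add: EO_simps)
  moreover have "O.pt (I.pt x m \<oplus>\<^bsub>I.T\<^esub> I.pt x m') y = O.pt (I.pt x m) y \<oplus>\<^bsub>O.T\<^esub> O.pt (I.pt x m') y"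
    by (rule O.pt_add_l) (use add x y in \<open>auto simp: EO_simps intro!: Ipt_closed\<close>)
  ultimately show ?case
    using a[OF O.pt_closed O.pt_closed add(3,4)] add x y Ipt_closed by (simp add: EO_simps)
qed

lemma tAEA_closed: "x \<in> carrier A \<Longrightarrow> a \<in> arcs G \<Longrightarrow> y \<in> carrier A \<Longrightarrow> tAEA G W H x a y \<in> carrier O.T"
  unfolding tAEA_eq by (rule O.pt_closed) (simp_all add: Ipt_closed[OF _ arc_vec_part] EO_simps)

text \<open>The middle factor splits over its arcs, which become the index set. The shift is 1
  because arcs have degree 1, reversed ones included.\<close>

lemma fbim_AEA: "fbim G h \<phi> W \<nu>0 \<nu>1 f B d (AEA G W H) (arcs G) (tail H) (head H) (tAEA G W H) ThE 1"
  unfolding AEA_eq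
proof (intro fbim.intro fbim_axioms.intro frob_axioms)
  show "finite (arcs G)" by simp
  show "bimodule A A O.T" by (rule O.T_bimodule)
  show "tAEA G W H x k y \<in> carrier O.T" if "x \<in> carrier A" "k \<in> arcs G" "y \<in> carrier A" for x k y
    by (rule tAEA_closed[OF that])
  show "Q z" if z: "z \<in> carrier O.T" and 0: "Q \<zero>\<^bsub>O.T\<^esub>" and
    p: "\<And>x k y. x \<in> carrier A \<Longrightarrow> k \<in> arcs G \<Longrightarrow> y \<in> carrier A \<Longrightarrow> Q (tAEA G W H x k y)"
    and a: "\<And>z z'. z \<in> carrier O.T \<Longrightarrow> z' \<in> carrier O.T \<Longrightarrow> Q z \<Longrightarrow> Q z' \<Longrightarrow> Q (z \<oplus>\<^bsub>O.T\<^esub> z')" for z Q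
    using z
  proof (induction z rule: O.T_induct)
    case (pure X y)
    then have y: "y \<in> carrier A" by (simp add: EO_simps)
    from pure(1) show ?case
    proof (induction X rule: I.T_induct)
      case zero
      then show ?case using 0 O.pt_zero_l[of y] y by (simp add: EO_simps)
    next
      case (pure x m)
      then have x: "x \<in> carrier A" and m: "m \<in> path_part H 1" by (simp_all add: EO_simps)
      show ?case
        by (rule pt_arc_induct[OF x y m 0 _ a]) (rule p; use x y in simp)
    next
      case (add X X')
      then show ?case
        using O.pt_add_l[of X X' y] a[OF O.pt_closed O.pt_closed] y by (simp add: EO_simps)
    qed
  next
    case (add Z Z')
    then show ?case by (rule a)
  qed (rule 0)
  show "ThE (z \<oplus>\<^bsub>O.T\<^esub> z') k u g = ThE z k u g + ThE z' k u g"
    if "z \<in> carrier O.T" "z' \<in> carrier O.T" "k \<in> arcs G" "u \<in> carrier A" "g \<in> carrier A" for z z' k u g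
    unfolding ThE_def by (rule O.lift_add[OF balO]) (use that in auto)
  show "ThE (tAEA G W H x k y) k' u g
      = (if k' = k then f (x \<cdot> (ve (tail H k) \<cdot> u)) * f (g \<cdot> (ve (head H k) \<cdot> y)) else 0)"
    if x: "x \<in> carrier A" "k \<in> arcs G" "y \<in> carrier A" "k' \<in> arcs G" "u \<in> carrier A" "g \<in> carrier A"
    for x k y k' u g
  proof -
    have "ThE (tAEA G W H x k y) k' u g = ThI (I.pt x (arc_vec H k)) k' u * f (g \<cdot> (ve (head H k') \<cdot> y))"
      unfolding ThE_def tAEA_eq
      by (rule O.lift_pt[OF balO]) (use x in \<open>auto simp: EO_simps intro!: Ipt_closed arc_vec_part\<close>)
    also have "ThI (I.pt x (arc_vec H k)) k' u
      = f (x \<cdot> (ve (tail H k') \<cdot> u)) * Poly_Mapping.lookup (arc_vec H k) (tail H k', [k'])"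
      by (rule ThI_pt) (use x arc_vec_part in auto)
    finally show ?thesis by (auto simp: arc_vec_def lookup_single when_def)
  qed
  show "tAEA G W H (sc c \<cdot> x) k y = tAEA G W H x k (sc c \<cdot> y)"
    if x: "x \<in> carrier A" "k \<in> arcs G" "y \<in> carrier A" for c x k y
  proof -
    have m: "arc_vec H k \<in> path_part H 1" by (rule arc_vec_part[OF x(2)])
    have c: "psc c \<in> carrier (vertex_ring G)" by (simp add: EO_simps psc_part)
    have "I.pt (sc c \<cdot> x) (arc_vec H k) = I.pt x (psc c \<otimes>\<^bsub>path_algebra H\<^esub> arc_vec H k)"
      using psc_arc_l[OF x(1,2)] by simp
    also have "\<dots> = I.pt x (arc_vec H k) \<odot>r\<^bsub>I.T\<^esub> psc c"
      using H.psc_comm[OF H.path_part_closed[OF m], of c]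
      by (simp add: I.T_rsmult_pt[OF c] EO_simps psc_eq[OF fH VH])
    finally show ?thesis
      unfolding tAEA_eq using O.pt_bal[OF Ipt_closed[OF x(1) m] c, of y] x
      by (simp add: EO_simps sc_psc)
  qed
  show "tAEA G W H (x \<cdot> ve (tail H k)) k y = tAEA G W H x k y"
    if x: "x \<in> carrier A" "k \<in> arcs G" "y \<in> carrier A" for x k y
  proof -
    have m: "arc_vec H k \<in> path_part H 1" by (rule arc_vec_part[OF x(2)])
    have "sng (tail H k) [] 1 \<otimes>\<^bsub>path_algebra H\<^esub> arc_vec H k = arc_vec H k"
      by (simp add: arc_vec_def H.pa_single)
    then show ?thesis
      unfolding tAEA_eq using I.pt_bal[of x "sng (tail H k) [] 1" "arc_vec H k"] x m
      by (simp add: EO_simps single_part0 vert_elt_def)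
  qed
  show "tAEA G W H x k (ve (head H k) \<cdot> y) = tAEA G W H x k y"
    if x: "x \<in> carrier A" "k \<in> arcs G" "y \<in> carrier A" for x k y
  proof -
    have m: "arc_vec H k \<in> path_part H 1" by (rule arc_vec_part[OF x(2)])
    have c: "sng (head H k) [] 1 \<in> carrier (vertex_ring G)" using x by (simp add: EO_simps single_part0)
    have "arc_vec H k \<otimes>\<^bsub>path_algebra H\<^esub> sng (head H k) [] 1 = arc_vec H k"
      by (simp add: arc_vec_def H.pa_single)
    then have "I.pt x (arc_vec H k) \<odot>r\<^bsub>I.T\<^esub> sng (head H k) [] 1 = I.pt x (arc_vec H k)"
      by (simp add: I.T_rsmult_pt[OF c] EO_simps)
    then show ?thesis
      unfolding tAEA_eq using O.pt_bal[OF Ipt_closed[OF x(1) m] c, of y] x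
      by (simp add: EO_simps vert_elt_def)
  qed
  have subA: "\<And>q. grading (A_R G W) q \<subseteq> carrier (A_R G W)" "\<And>q. grading (R_A G W) q \<subseteq> carrier (R_A G W)"
    using gr_closed by (auto simp: EO_simps)
  have subV: "\<And>q. grading (arc_bimod H) q \<subseteq> carrier (arc_bimod H)"
    by (auto simp: EO_simps)
  have subI: "\<And>q. grading I.T q \<subseteq> carrier I.T"
    using I.grading_closed[OF subA(1) subV] by auto
  have sc_gr: "sc c \<cdot> x \<in> gr p" if "x \<in> gr p" for c x p by (rule gr_sc_mult[OF that])
  show "tAEA G W H x k y \<in> grading O.T (p + q + 1)"
    if "x \<in> gr p" "k \<in> arcs G" "y \<in> gr q" for x p k y q
  proof -
    have "I.pt x (arc_vec H k) \<in> grading I.T (p + 1)"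
      by (rule I.pt_grading[OF subA(1) subV]) (use that arc_vec_part in \<open>auto simp: EO_simps\<close>)
    then have "O.pt (I.pt x (arc_vec H k)) y \<in> grading O.T (p + 1 + q)"
      by (rule O.pt_grading[OF subI subA(2)]) (use that in \<open>auto simp: EO_simps\<close>)
    then show ?thesis by (simp add: tAEA_eq ac_simps)
  qed
  show "Q z" if z: "z \<in> grading O.T n" and 0: "Q \<zero>\<^bsub>O.T\<^esub>" and
    p: "\<And>x k y p q. x \<in> gr p \<Longrightarrow> k \<in> arcs G \<Longrightarrow> y \<in> gr q \<Longrightarrow> p + q + 1 = n \<Longrightarrow> Q (tAEA G W H x k y)"
    and a: "\<And>z z'. z \<in> carrier O.T \<Longrightarrow> z' \<in> carrier O.T \<Longrightarrow> Q z \<Longrightarrow> Q z' \<Longrightarrow> Q (z \<oplus>\<^bsub>O.T\<^esub> z')" for z n Q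
    using z
  proof (rule O.grading_induct[OF subI subA(2)])
    show "X \<in> grading I.T q \<Longrightarrow> \<ominus>\<^bsub>I.T\<^esub> X \<in> grading I.T q" for X q
      by (rule I.inv_grading[OF subA(1) subV])
    fix X y q t assume *: "q + t = n" "X \<in> grading I.T q" "y \<in> grading (R_A G W) t"
    then have y: "y \<in> gr t" "y \<in> carrier A" using gr_closed by (auto simp: EO_simps)
    from *(2) show "Q (O.pt X y)"
    proof (rule I.grading_induct[OF subA(1) subV])
      show "x \<in> grading (A_R G W) q \<Longrightarrow> \<ominus>\<^bsub>A_R G W\<^esub> x \<in> grading (A_R G W) q" for x q
        using gr_uminus gr_closed by (simp add: A_R_simps A_R_inv)
      show "Q (O.pt \<zero>\<^bsub>I.T\<^esub> y)" using 0 O.pt_zero_l[of y] y by (simp add: EO_simps)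
      show "Q (O.pt (X \<oplus>\<^bsub>I.T\<^esub> X') y)" if "X \<in> carrier I.T" "X' \<in> carrier I.T" "Q (O.pt X y)" "Q (O.pt X' y)" for X X'
        using that O.pt_add_l[of X X' y] a[OF O.pt_closed O.pt_closed] y by (simp add: EO_simps)
      fix x m q1 q2 assume **: "q1 + q2 = q" "x \<in> grading (A_R G W) q1" "m \<in> grading (arc_bimod H) q2"
      then have x: "x \<in> gr q1" "x \<in> carrier A" using gr_closed by (auto simp: EO_simps)
      show "Q (O.pt (I.pt x m) y)"
      proof (cases "q2 = 1")
        case True
        then have m: "m \<in> path_part H 1" using ** by (simp add: EO_simps)
        show ?thesis
        proof (rule pt_arc_induct[OF x(2) y(2) m 0 _ a])
          fix c a assume "a \<in> arcs G"
          then show "Q (tAEA G W H (sc c \<cdot> x) a y)"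
            by (rule p[OF sc_gr[OF x(1)] _ y(1)]) (use * ** True in simp)
        qed
      next
        case False
        then have "m = 0" using ** by (simp add: EO_simps)
        then have "I.pt x m = \<zero>\<^bsub>I.T\<^esub>" using I.pt_zero_r[of x] x by (simp add: EO_simps)
        then show ?thesis using 0 O.pt_zero_l[of y] y by (simp add: EO_simps)
      qed
    qed
  qed (rule 0, rule a)
  show "\<zero>\<^bsub>O.T\<^esub> \<in> grading O.T n" for n
    by (rule O.zero_grading[OF subI subA(2)])
  show "z \<oplus>\<^bsub>O.T\<^esub> z' \<in> grading O.T n" if "z \<in> grading O.T n" "z' \<in> grading O.T n" for z z' n
    by (rule O.add_grading[OF subI subA(2) that])
  fix w x k y assume wx: "w \<in> carrier A" "x \<in> carrier A" "k \<in> arcs G" "y \<in> carrier A"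
  then show "w \<odot>\<^bsub>O.T\<^esub> tAEA G W H x k y = tAEA G W H (w \<cdot> x) k y"
    by (simp add: tAEA_eq O.T_smult_pt I.T_smult_pt EO_simps)
  show "tAEA G W H x k y \<odot>r\<^bsub>O.T\<^esub> w = tAEA G W H x k (y \<cdot> w)"
    using wx by (simp add: tAEA_eq O.T_rsmult_pt EO_simps)
  fix y' assume y': "y' \<in> carrier A"
  show "tAEA G W H x k (y \<oplus>\<^bsub>A\<^esub> y') = tAEA G W H x k y \<oplus>\<^bsub>O.T\<^esub> tAEA G W H x k y'"
    unfolding tAEA_eq
    using O.pt_add_r[of "I.pt x (arc_vec H k)" y y'] wx y' Ipt_closed[OF _ arc_vec_part] by (simp add: EO_simps)
next
  fix x x' k y assume x: "x \<in> carrier A" "x' \<in> carrier A" "k \<in> arcs G" "y \<in> carrier A"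
  have "I.pt (x \<oplus>\<^bsub>A\<^esub> x') (arc_vec H k) = I.pt x (arc_vec H k) \<oplus>\<^bsub>I.T\<^esub> I.pt x' (arc_vec H k)"
    using I.pt_add_l[of x x' "arc_vec H k"] x arc_vec_part[of k] by (simp add: EO_simps)
  then show "tAEA G W H (x \<oplus>\<^bsub>A\<^esub> x') k y = tAEA G W H x k y \<oplus>\<^bsub>O.T\<^esub> tAEA G W H x' k y"
    unfolding tAEA_eq
    using O.pt_add_l[of "I.pt x (arc_vec H k)" "I.pt x' (arc_vec H k)" y] x Ipt_closed[OF _ arc_vec_part]
    by (simp add: EO_simps)
qed simp_all

end

section \<open>The differentials\<close>

lemma bimodule_grading_update:
  assumes "bimodule RA RB M"
  shows "bimodule RA RB (M\<lparr>grading := g\<rparr>)"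
proof -
  interpret bimodule RA RB M by fact
  have "abelian_group (M\<lparr>grading := g\<rparr>)"
  proof (rule abelian_groupI)
    fix x assume "x \<in> carrier (M\<lparr>grading := g\<rparr>)"
    then show "\<exists>y\<in>carrier (M\<lparr>grading := g\<rparr>). y \<oplus>\<^bsub>M\<lparr>grading := g\<rparr>\<^esub> x = \<zero>\<^bsub>M\<lparr>grading := g\<rparr>\<^esub>"
      by (intro bexI[of _ "\<ominus>\<^bsub>M\<^esub> x"]) (simp_all add: M.l_neg)
  qed (simp_all add: M.a_ac)
  then show ?thesis
    by (intro bimodule.intro bimodule_axioms.intro L.ring_axioms Rt.ring_axioms)
      (simp_all add: smult_closed smult_l_distr smult_r_distr smult_assoc smult_one
        rsmult_closed rsmult_l_distr rsmult_r_distr rsmult_assoc rsmult_one smult_rsmult)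
qed

lemma bimod_hom_shift:
  assumes "m \<in> bimod_hom RA RB M N"
  shows "m \<in> bimod_hom RA RB (shift a M) (shift b N)" "m \<in> bimod_hom RA RB (shift a M) N"
  using assms unfolding bimod_hom_def shift_def by (simp_all add: bimodule_grading_update)

context fbim
begin

lemma gm_uminus:
  assumes "x \<in> carrier A" "k \<in> K" "y \<in> carrier A"
  shows "\<ominus>\<^bsub>P\<^esub> \<gamma> x k y = \<gamma> (\<ominus>\<^bsub>A\<^esub> x) k y"
  by (rule P.minus_equality) (use assms gm_add_l[of "\<ominus>\<^bsub>A\<^esub> x" x k y] in \<open>simp_all add: A.l_neg gm_zero_l\<close>)

lemma grading_closed: "z \<in> grading P n \<Longrightarrow> z \<in> carrier P"
  by (rule grading_span[of z n "\<lambda>z. z \<in> carrier P"]) (auto intro!: gm_closed intro: gr_closed)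

lemma grading_finsum:
  "finite S \<Longrightarrow> (\<And>i. i \<in> S \<Longrightarrow> t i \<in> grading P n) \<Longrightarrow> finsum P t S \<in> grading P n"
proof (induction S rule: finite_induct)
  case (insert i S)
  then have "finsum P t (insert i S) = t i \<oplus>\<^bsub>P\<^esub> finsum P t S"
    by (intro P.finsum_insert) (auto intro: grading_closed)
  then show ?case using insert by (auto intro: grading_add)
qed (simp add: grading_zero)

lemma grading_uminus: "z \<in> grading P n \<Longrightarrow> \<ominus>\<^bsub>P\<^esub> z \<in> grading P n"
proof (rule grading_span[of z n "\<lambda>z. \<ominus>\<^bsub>P\<^esub> z \<in> grading P n"])
  have eq: "\<ominus>\<^bsub>P\<^esub> \<zero>\<^bsub>P\<^esub> = \<zero>\<^bsub>P\<^esub>" by (rule P.minus_equality) auto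
  show "\<ominus>\<^bsub>P\<^esub> \<zero>\<^bsub>P\<^esub> \<in> grading P n" by (subst eq) (rule grading_zero)
next
  fix x k y p q assume *: "x \<in> gr p" "k \<in> K" "y \<in> gr q" "p + q + \<delta> = n"
  then show "\<ominus>\<^bsub>P\<^esub> \<gamma> x k y \<in> grading P n"
    using gm_grading[OF gr_uminus[OF *(1)] *(2,3)] by (simp add: gm_uminus gr_closed)
next
  fix z z' assume "z \<in> carrier P" "z' \<in> carrier P" "\<ominus>\<^bsub>P\<^esub> z \<in> grading P n" "\<ominus>\<^bsub>P\<^esub> z' \<in> grading P n"
  then show "\<ominus>\<^bsub>P\<^esub> (z \<oplus>\<^bsub>P\<^esub> z') \<in> grading P n" by (simp add: P.minus_add grading_add)
qed

lemma smult_zero: "w \<in> carrier A \<Longrightarrow> w \<odot>\<^bsub>P\<^esub> \<zero>\<^bsub>P\<^esub> = \<zero>\<^bsub>P\<^esub>"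
  using bimodule.smult_r_distr[OF bim, of w "\<zero>\<^bsub>P\<^esub>" "\<zero>\<^bsub>P\<^esub>"] smult_closed[of w "\<zero>\<^bsub>P\<^esub>"]
  by (intro P_zero_eqI) auto

lemma sc_smult_grading: "z \<in> grading P n \<Longrightarrow> sc c \<odot>\<^bsub>P\<^esub> z \<in> grading P n"
proof (rule grading_span[of z n "\<lambda>z. sc c \<odot>\<^bsub>P\<^esub> z \<in> grading P n"])
  show "sc c \<odot>\<^bsub>P\<^esub> \<zero>\<^bsub>P\<^esub> \<in> grading P n" by (simp add: grading_zero smult_zero)
next
  fix x k y p q assume *: "x \<in> gr p" "k \<in> K" "y \<in> gr q" "p + q + \<delta> = n"
  then show "sc c \<odot>\<^bsub>P\<^esub> \<gamma> x k y \<in> grading P n"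
    using gm_grading[OF gr_sc_mult[OF *(1)] *(2,3)] by (simp add: gm_smult gr_closed)
next
  fix z z' assume "z \<in> carrier P" "z' \<in> carrier P"
    "sc c \<odot>\<^bsub>P\<^esub> z \<in> grading P n" "sc c \<odot>\<^bsub>P\<^esub> z' \<in> grading P n"
  then show "sc c \<odot>\<^bsub>P\<^esub> (z \<oplus>\<^bsub>P\<^esub> z') \<in> grading P n"
    using bimodule.smult_r_distr[OF bim] by (simp add: grading_add)
qed

lemma Th_sc:
  assumes "z \<in> carrier P" "k \<in> K" "u \<in> carrier A" "g \<in> carrier A"
  shows "\<Theta> (sc c \<odot>\<^bsub>P\<^esub> z) k u g = c * \<Theta> z k u g"
  using assms lfun_sc[OF formD(1)[OF form_Th[OF assms(1)] assms(2,4)] assms(3)]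
  by (simp add: Th_smult bt_sc sc_comm)

end

text \<open>On forms the two module actions are right multiplication in the first argument and left
  multiplication in the second. An additive map of forms that commutes with these yields a bimodule
  map, and no compatibility with tensor relations has to be checked.\<close>

locale fbim_hom = S: fbim G h \<phi> W \<nu>0 \<nu>1 f B d P K s r \<gamma> \<Theta> \<delta> +
  T: fbim G h \<phi> W \<nu>0 \<nu>1 f B d P' K' s' r' \<gamma>' \<Theta>' \<delta>'
  for G :: "('v, 'e) pre_digraph" and h \<phi> W \<nu>0 \<nu>1 f B d
    and P :: "(('v, 'e) algelt, 'p, ('v, 'e) algelt) bimod" and K :: "'k set" and s r \<gamma> \<Theta> \<delta>
    and P' :: "(('v, 'e) algelt, 'q, ('v, 'e) algelt) bimod" and K' :: "'l set" and s' r' \<gamma>' \<Theta>' \<delta>' +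
  fixes m :: "('k \<Rightarrow> ('v, 'e) algelt \<Rightarrow> ('v, 'e) algelt \<Rightarrow> complex) \<Rightarrow>
    'l \<Rightarrow> ('v, 'e) algelt \<Rightarrow> ('v, 'e) algelt \<Rightarrow> complex"
  assumes m_form: "S.form t \<Longrightarrow> T.form (m t)"
    and m_cong: "k \<in> K' \<Longrightarrow> u \<in> carrier (cell_algebra G W) \<Longrightarrow> g \<in> carrier (cell_algebra G W) \<Longrightarrow>
      (\<And>k u g. k \<in> K \<Longrightarrow> u \<in> carrier (cell_algebra G W) \<Longrightarrow> g \<in> carrier (cell_algebra G W) \<Longrightarrow>
        t k u g = t' k u g) \<Longrightarrow> m t k u g = m t' k u g"
    and m_add: "k \<in> K' \<Longrightarrow> u \<in> carrier (cell_algebra G W) \<Longrightarrow> g \<in> carrier (cell_algebra G W) \<Longrightarrow>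
      m (\<lambda>k u g. t k u g + t' k u g) k u g = m t k u g + m t' k u g"
    and m_l: "k \<in> K' \<Longrightarrow> u \<in> carrier (cell_algebra G W) \<Longrightarrow> g \<in> carrier (cell_algebra G W) \<Longrightarrow>
      w \<in> carrier (cell_algebra G W) \<Longrightarrow>
      m (\<lambda>k u g. t k (u \<otimes>\<^bsub>cell_algebra G W\<^esub> w) g) k u g = m t k (u \<otimes>\<^bsub>cell_algebra G W\<^esub> w) g"
    and m_r: "k \<in> K' \<Longrightarrow> u \<in> carrier (cell_algebra G W) \<Longrightarrow> g \<in> carrier (cell_algebra G W) \<Longrightarrow>
      w \<in> carrier (cell_algebra G W) \<Longrightarrow>
      m (\<lambda>k u g. t k u (w \<otimes>\<^bsub>cell_algebra G W\<^esub> g)) k u g = m t k u (w \<otimes>\<^bsub>cell_algebra G W\<^esub> g)"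
begin

definition mu :: "'p \<Rightarrow> 'q" where
  "mu z = T.Rz (m (\<Theta> z))"

lemma mu_closed: "mu z \<in> carrier P'"
  unfolding mu_def by (rule T.Rz_closed)

lemma Th_mu:
  "z \<in> carrier P \<Longrightarrow> k \<in> K' \<Longrightarrow> u \<in> carrier S.A \<Longrightarrow> g \<in> carrier S.A \<Longrightarrow> \<Theta>' (mu z) k u g = m (\<Theta> z) k u g"
  unfolding mu_def by (rule T.Th_Rz[OF m_form[OF S.form_Th]])

lemma mu_eqI:
  assumes "z \<in> carrier P" "z' \<in> carrier P'"
    "\<And>k u g. k \<in> K' \<Longrightarrow> u \<in> carrier S.A \<Longrightarrow> g \<in> carrier S.A \<Longrightarrow> \<Theta>' z' k u g = m (\<Theta> z) k u g"
  shows "mu z = z'"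
  by (rule T.Th_inj[OF mu_closed assms(2)]) (simp add: Th_mu assms)

lemma mu_add:
  assumes "z \<in> carrier P" "z' \<in> carrier P"
  shows "mu (z \<oplus>\<^bsub>P\<^esub> z') = mu z \<oplus>\<^bsub>P'\<^esub> mu z'"
proof (rule mu_eqI)
  fix k u g assume k: "k \<in> K'" "u \<in> carrier S.A" "g \<in> carrier S.A"
  have "m (\<Theta> (z \<oplus>\<^bsub>P\<^esub> z')) k u g = m (\<lambda>k u g. \<Theta> z k u g + \<Theta> z' k u g) k u g"
    by (rule m_cong[OF k]) (simp add: S.Th_add assms)
  then show "\<Theta>' (mu z \<oplus>\<^bsub>P'\<^esub> mu z') k u g = m (\<Theta> (z \<oplus>\<^bsub>P\<^esub> z')) k u g"
    using k assms by (simp add: T.Th_add mu_closed Th_mu m_add)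
qed (use assms mu_closed in auto)

lemma mu_zero: "mu \<zero>\<^bsub>P\<^esub> = \<zero>\<^bsub>P'\<^esub>"
  using mu_add[of "\<zero>\<^bsub>P\<^esub>" "\<zero>\<^bsub>P\<^esub>"] by (intro T.P_zero_eqI mu_closed) simp

lemma mu_hom: "mu \<in> bimod_hom S.A S.A P P'"
  unfolding bimod_hom_def
proof (intro CollectI conjI ballI funcsetI)
  show "bimodule S.A S.A P" "bimodule S.A S.A P'" by (rule S.bim, rule T.bim)
next
  fix w z assume wz: "w \<in> carrier S.A" "z \<in> carrier P"
  show "mu (w \<odot>\<^bsub>P\<^esub> z) = w \<odot>\<^bsub>P'\<^esub> mu z"
  proof (rule mu_eqI)
    fix k u g assume k: "k \<in> K'" "u \<in> carrier S.A" "g \<in> carrier S.A"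
    have "m (\<Theta> (w \<odot>\<^bsub>P\<^esub> z)) k u g = m (\<lambda>k u g. \<Theta> z k (u \<otimes>\<^bsub>S.A\<^esub> S.bt w) g) k u g"
      by (rule m_cong[OF k]) (simp add: S.Th_smult wz)
    then show "\<Theta>' (w \<odot>\<^bsub>P'\<^esub> mu z) k u g = m (\<Theta> (w \<odot>\<^bsub>P\<^esub> z)) k u g"
      using k wz by (simp add: T.Th_smult mu_closed Th_mu m_l)
  qed (use wz S.smult_closed T.smult_closed mu_closed in auto)
next
  fix w z assume wz: "w \<in> carrier S.A" "z \<in> carrier P"
  show "mu (z \<odot>r\<^bsub>P\<^esub> w) = mu z \<odot>r\<^bsub>P'\<^esub> w"
  proof (rule mu_eqI)
    fix k u g assume k: "k \<in> K'" "u \<in> carrier S.A" "g \<in> carrier S.A"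
    have "m (\<Theta> (z \<odot>r\<^bsub>P\<^esub> w)) k u g = m (\<lambda>k u g. \<Theta> z k u (S.sg w \<otimes>\<^bsub>S.A\<^esub> g)) k u g"
      by (rule m_cong[OF k]) (simp add: S.Th_rsmult wz)
    then show "\<Theta>' (mu z \<odot>r\<^bsub>P'\<^esub> w) k u g = m (\<Theta> (z \<odot>r\<^bsub>P\<^esub> w)) k u g"
      using k wz by (simp add: T.Th_rsmult mu_closed Th_mu m_r)
  qed (use wz S.rsmult_closed T.rsmult_closed mu_closed in auto)
qed (simp_all add: mu_closed mu_add)

lemma mu_grading:
  assumes z: "z \<in> grading P n"
    and g: "\<And>x k y p q. x \<in> S.gr p \<Longrightarrow> k \<in> K \<Longrightarrow> y \<in> S.gr q \<Longrightarrow> p + q + \<delta> = n \<Longrightarrow>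
      mu (\<gamma> x k y) \<in> grading P' n'"
  shows "mu z \<in> grading P' n'"
  using z
proof (rule S.grading_span)
  show "mu \<zero>\<^bsub>P\<^esub> \<in> grading P' n'" by (simp add: mu_zero T.grading_zero)
  show "mu (z \<oplus>\<^bsub>P\<^esub> z') \<in> grading P' n'"
    if "z \<in> carrier P" "z' \<in> carrier P" "mu z \<in> grading P' n'" "mu z' \<in> grading P' n'" for z z'
    using that by (simp add: mu_add T.grading_add)
qed (rule g)

end

context frob
begin

lemma rev_simps [simp]: "tail (reverse_graph G) = head G" "head (reverse_graph G) = tail G"
  "verts (reverse_graph G) = verts G" "arcs (reverse_graph G) = arcs G"
  by (simp_all add: reverse_graph_def)

lemma rev_fin_digraph: "fin_digraph (reverse_graph G)"
  by unfold_locales (auto simp: head_in_verts tail_in_verts)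

lemma frob_arc_G: "frob_arc G h \<phi> W \<nu>0 \<nu>1 f B d G"
  by (intro frob_arc.intro frob_axioms arc_tens.intro arc_tens_axioms.intro cell_alg_axioms fin_digraph_axioms refl)

lemma frob_arc_R: "frob_arc G h \<phi> W \<nu>0 \<nu>1 f B d (reverse_graph G)"
  by (intro frob_arc.intro frob_axioms arc_tens.intro arc_tens_axioms.intro cell_alg_axioms rev_fin_digraph)
    simp_all

abbreviation Th1 where "Th1 \<equiv> frob_arc.ThE G W f G"
abbreviation Th2 where "Th2 \<equiv> frob_arc.ThE G W f (reverse_graph G)"
abbreviation tA where "tA \<equiv> tAA G W"
abbreviation t1 where "t1 \<equiv> tAEA G W G"
abbreviation t2 where "t2 \<equiv> tAEA G W (reverse_graph G)"
abbreviation B0 where "B0 \<equiv> AA G W"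
abbreviation B1 where "B1 \<equiv> AEA G W G"
abbreviation B2 where "B2 \<equiv> AEA G W (reverse_graph G)"

lemma fbim0: "fbim G h \<phi> W \<nu>0 \<nu>1 f B d B0 (verts G) (\<lambda>v. v) (\<lambda>v. v) (\<lambda>x v y. tA (x \<cdot> ve v) y) ThA 0"
  by (rule fbim_AA)

lemma fbim1: "fbim G h \<phi> W \<nu>0 \<nu>1 f B d B1 (arcs G) (tail G) (head G) t1 Th1 1"
  by (rule frob_arc.fbim_AEA[OF frob_arc_G])

lemma fbim2: "fbim G h \<phi> W \<nu>0 \<nu>1 f B d B2 (arcs G) (head G) (tail G) t2 Th2 1"
  using frob_arc.fbim_AEA[OF frob_arc_R] by simp

text \<open>Each differential \<open>\<mu>\<^sub>i\<close> is transported from a map of forms: \<open>\<Theta> (\<mu>\<^sub>i z) = m\<^sub>i (\<Theta> z)\<close>.\<close>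

definition m1 where
  "m1 t v u g = (\<Sum>c\<in>arcs G. t c (ae c \<cdot> (ve v \<cdot> u)) (g \<cdot> ve v) - t c (ve v \<cdot> u) (g \<cdot> ve v \<cdot> ae c))"

text \<open>The condition m2 t = 0 is literally the hypothesis \<open>cyc\<close> of
  \<open>derivation_exists\<close> for the family \<open>t\<close>.\<close>

definition m2 where
  "m2 t c u g = (\<Sum>b\<in>arcs G. \<Sum>b'\<in>arcs G. W c b b' * (t b (ae b' \<cdot> u) g + t b' u (g \<cdot> ae b)))"

definition m3 where
  "m3 t a u g = t (tail G a) (ae a \<cdot> u) g - t (head G a) u (g \<cdot> ae a)"

text \<open>With \<open>ae_tail\<close> and \<open>tail_ae\<close> this removes the vertices that
  the cut-down forms insert next to an arc.\<close>

lemma ae_head: "a \<in> arcs G \<Longrightarrow> u \<in> carrier A \<Longrightarrow> ae a \<cdot> (ve (head G a) \<cdot> u) = ae a \<cdot> u"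
  by (simp add: A.m_assoc[symmetric] ae_ve)

lemma ae_tail: "a \<in> arcs G \<Longrightarrow> u \<in> carrier A \<Longrightarrow> u \<cdot> ve (tail G a) \<cdot> ae a = u \<cdot> ae a"
  by (simp add: A.m_assoc ve_ae)

lemma tail_ae: "a \<in> arcs G \<Longrightarrow> u \<in> carrier A \<Longrightarrow> ve (tail G a) \<cdot> (ae a \<cdot> u) = ae a \<cdot> u"
  by (simp add: A.m_assoc[symmetric] ve_ae)

lemma ve_ve_l: "v \<in> verts G \<Longrightarrow> u \<in> carrier A \<Longrightarrow> ve v \<cdot> (ve v \<cdot> u) = ve v \<cdot> u"
  by (simp add: A.m_assoc[symmetric] ve_ve)

lemma ve_ve_r: "v \<in> verts G \<Longrightarrow> u \<in> carrier A \<Longrightarrow> u \<cdot> ve v \<cdot> ve v = u \<cdot> ve v"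
  by (simp add: A.m_assoc ve_ve)

lemma hom1: "fbim_hom G h \<phi> W \<nu>0 \<nu>1 f B d B1 (arcs G) (tail G) (head G) t1 Th1 1
  B0 (verts G) (\<lambda>v. v) (\<lambda>v. v) (\<lambda>x v y. tA (x \<cdot> ve v) y) ThA 0 m1"
proof (intro fbim_hom.intro fbim0 fbim1 fbim_hom_axioms.intro)
  interpret S: fbim G h \<phi> W \<nu>0 \<nu>1 f B d B1 "arcs G" "tail G" "head G" t1 Th1 1 by (rule fbim1)
  interpret T: fbim G h \<phi> W \<nu>0 \<nu>1 f B d B0 "verts G" "\<lambda>v. v" "\<lambda>v. v" "\<lambda>x v y. tA (x \<cdot> ve v) y" ThA 0
    by (rule fbim0)
  fix t assume t: "S.form t"
  show "T.form (m1 t)"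
    unfolding T.form_def
  proof (intro ballI conjI)
    fix v g assume v: "v \<in> verts G" "g \<in> carrier A"
    show "lfun (\<lambda>u. m1 t v u g)" unfolding m1_def
      by (intro lfun_sum lfun_diff lfun_mult_l lfun_mult_l[OF lfun_mult_l] S.formD(1)[OF t]) (use v in auto)
  next
    fix v u assume v: "v \<in> verts G" "u \<in> carrier A"
    show "lfun (m1 t v u)" unfolding m1_def
      by (intro lfun_sum lfun_diff lfun_mult_r lfun_mult_r[OF lfun_mult_r] S.formD(2)[OF t]) (use v in auto)
  next
    fix v u g assume v: "v \<in> verts G" "u \<in> carrier A" "g \<in> carrier A"
    then show "m1 t v (ve v \<cdot> u) g = m1 t v u g" "m1 t v u (g \<cdot> ve v) = m1 t v u g"
      by (simp_all add: m1_def ve_ve_l ve_ve_r)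
  qed
qed (auto simp: m1_def sum.distrib[symmetric] A.m_assoc algebra_simps intro!: sum.cong)

text \<open>A non-zero cell W c b b' ties the tail of \<open>c\<close> to the head of
  \<open>b'\<close> and the head of \<open>c\<close> to the tail of \<open>b\<close>; this gives the
  vertex conditions of the new form.\<close>

lemma hom2: "fbim_hom G h \<phi> W \<nu>0 \<nu>1 f B d B2 (arcs G) (head G) (tail G) t2 Th2 1
  B1 (arcs G) (tail G) (head G) t1 Th1 1 m2"
proof (intro fbim_hom.intro fbim2 fbim1 fbim_hom_axioms.intro)
  interpret S: fbim G h \<phi> W \<nu>0 \<nu>1 f B d B2 "arcs G" "head G" "tail G" t2 Th2 1 by (rule fbim2)
  interpret T: fbim G h \<phi> W \<nu>0 \<nu>1 f B d B1 "arcs G" "tail G" "head G" t1 Th1 1 by (rule fbim1)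
  fix t assume t: "S.form t"
  show "T.form (m2 t)"
    unfolding T.form_def
  proof (intro ballI conjI)
    fix v g assume v: "v \<in> arcs G" "g \<in> carrier A"
    show "lfun (\<lambda>u. m2 t v u g)" unfolding m2_def
      by (intro lfun_sum lfun_const_mult lfun_plus lfun_mult_l[of "\<lambda>u. t _ u g"] S.formD(1)[OF t]) (use v in auto)
  next
    fix v u assume v: "v \<in> arcs G" "u \<in> carrier A"
    show "lfun (m2 t v u)" unfolding m2_def
      by (intro lfun_sum lfun_const_mult lfun_plus lfun_mult_r[of "t _ u"] S.formD(2)[OF t]) (use v in auto)
  next
    fix c u g assume c: "c \<in> arcs G" "u \<in> carrier A" "g \<in> carrier A"
    show "m2 t c (ve (tail G c) \<cdot> u) g = m2 t c u g"
      unfolding m2_def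
    proof (intro sum.cong[OF refl])
      fix b b' assume b: "b \<in> arcs G" "b' \<in> arcs G"
      show "W c b b' * (t b (ae b' \<cdot> (ve (tail G c) \<cdot> u)) g + t b' (ve (tail G c) \<cdot> u) (g \<cdot> ae b))
        = W c b b' * (t b (ae b' \<cdot> u) g + t b' u (g \<cdot> ae b))"
      proof (cases "W c b b' = 0")
        case False
        then have "tail G c = head G b'" using W_triD(6) by metis
        then show ?thesis using b c by (simp add: ae_head S.formD(3)[OF t])
      qed simp
    qed
    show "m2 t c u (g \<cdot> ve (head G c)) = m2 t c u g"
      unfolding m2_def
    proof (intro sum.cong[OF refl])
      fix b b' assume b: "b \<in> arcs G" "b' \<in> arcs G"
      show "W c b b' * (t b (ae b' \<cdot> u) (g \<cdot> ve (head G c)) + t b' u (g \<cdot> ve (head G c) \<cdot> ae b))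
        = W c b b' * (t b (ae b' \<cdot> u) g + t b' u (g \<cdot> ae b))"
      proof (cases "W c b b' = 0")
        case False
        then have "head G c = tail G b" using W_triD(4) by metis
        then show ?thesis using b c by (simp add: ae_tail S.formD(4)[OF t])
      qed simp
    qed
  qed
qed (auto simp: m2_def sum.distrib[symmetric] A.m_assoc algebra_simps intro!: sum.cong)

lemma hom3: "fbim_hom G h \<phi> W \<nu>0 \<nu>1 f B d B0 (verts G) (\<lambda>v. v) (\<lambda>v. v) (\<lambda>x v y. tA (x \<cdot> ve v) y) ThA 0
  B2 (arcs G) (head G) (tail G) t2 Th2 1 m3"
proof (intro fbim_hom.intro fbim0 fbim2 fbim_hom_axioms.intro)
  interpret S: fbim G h \<phi> W \<nu>0 \<nu>1 f B d B0 "verts G" "\<lambda>v. v" "\<lambda>v. v" "\<lambda>x v y. tA (x \<cdot> ve v) y" ThA 0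
    by (rule fbim0)
  interpret T: fbim G h \<phi> W \<nu>0 \<nu>1 f B d B2 "arcs G" "head G" "tail G" t2 Th2 1 by (rule fbim2)
  fix t assume t: "S.form t"
  show "T.form (m3 t)"
    unfolding T.form_def
  proof (intro ballI conjI)
    fix a g assume v: "a \<in> arcs G" "g \<in> carrier A"
    show "lfun (\<lambda>u. m3 t a u g)" unfolding m3_def
      by (intro lfun_diff lfun_mult_l[of "\<lambda>u. t _ u g"] S.formD(1)[OF t]) (use v in auto)
  next
    fix a u assume v: "a \<in> arcs G" "u \<in> carrier A"
    show "lfun (m3 t a u)" unfolding m3_def
      by (intro lfun_diff lfun_mult_r[of "t _ u"] S.formD(2)[OF t]) (use v in auto)
  next
    fix a u g assume a: "a \<in> arcs G" "u \<in> carrier A" "g \<in> carrier A"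
    then show "m3 t a (ve (head G a) \<cdot> u) g = m3 t a u g"
      by (simp add: m3_def ae_head S.formD(3)[OF t])
    from a show "m3 t a u (g \<cdot> ve (tail G a)) = m3 t a u g"
      by (simp add: m3_def ae_tail S.formD(4)[OF t])
  qed
qed (simp_all add: m3_def A.m_assoc)

end

text \<open>Extend a basis of J by \<open>w\<close> and take the linear functional that is 1 at
  \<open>w\<close> and 0 on that basis. The index set may be infinite, so this is done by basis
  extension in a general vector space.\<close>

lemma separating_functional:
  fixes J :: "('i \<Rightarrow> complex) set"
  assumes J0: "(\<lambda>_. 0) \<in> J" and Ja: "\<And>x y. x \<in> J \<Longrightarrow> y \<in> J \<Longrightarrow> (\<lambda>i. x i + y i) \<in> J"
    and Js: "\<And>c x. x \<in> J \<Longrightarrow> (\<lambda>i. c * x i) \<in> J" and w: "w \<notin> J"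
  obtains l :: "('i \<Rightarrow> complex) \<Rightarrow> complex" where "\<And>x y. l (\<lambda>i. x i + y i) = l x + l y"
    "\<And>c x. l (\<lambda>i. c * x i) = c * l x" "\<And>x. x \<in> J \<Longrightarrow> l x = 0" "l w \<noteq> 0"
proof -
  define scl :: "complex \<Rightarrow> ('i \<Rightarrow> complex) \<Rightarrow> 'i \<Rightarrow> complex" where "scl c x = (\<lambda>i. c * x i)" for c x
  interpret P: vector_space_pair scl "(*) :: complex \<Rightarrow> complex \<Rightarrow> complex"
    by unfold_locales (auto simp: scl_def fun_eq_iff algebra_simps)
  have sub: "P.vs1.subspace J"
    unfolding P.vs1.subspace_def using J0 Ja Js by (auto simp: scl_def plus_fun_def zero_fun_def)
  obtain D where D: "D \<subseteq> J" "P.vs1.independent D" "J \<subseteq> P.vs1.span D"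
    using P.vs1.maximal_independent_subset[of J] by blast
  have "P.vs1.span D \<subseteq> J" by (rule P.vs1.span_minimal[OF D(1) sub])
  then have wD: "w \<notin> P.vs1.span D" using w by blast
  then have ind: "P.vs1.independent (insert w D)" using D(2) by (rule P.vs1.independent_insertI)
  obtain l where l: "Vector_Spaces.linear scl (*) l" "\<forall>x\<in>insert w D. l x = (if x = w then 1 else 0)"
    using P.linear_independent_extend[OF ind, of "\<lambda>x. if x = w then 1 else 0"] by blast
  interpret l: Vector_Spaces.linear scl "(*) :: complex \<Rightarrow> complex \<Rightarrow> complex" l by (rule l(1))
  have "l x = 0" if "x \<in> D" for x
    using l(2) that D(1) w by auto
  then have "l x = 0" if "x \<in> J" for x
    using P.linear_eq_0_on_span[OF l(1), of D x] that D(3) by blast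
  moreover have "l (\<lambda>i. x i + y i) = l x + l y" for x y
    using l.add[of x y] by (simp add: plus_fun_def)
  moreover have "l (\<lambda>i. c * x i) = c * l x" for c x
    using l.scale[of c x] by (simp add: scl_def)
  ultimately show thesis using l(2) by (intro that[of l]) auto
qed

section \<open>The differentials on pure tensors\<close>

context frob
begin

interpretation P0: fbim G h \<phi> W \<nu>0 \<nu>1 f B d B0 "verts G" "\<lambda>v. v" "\<lambda>v. v" "\<lambda>x v y. tA (x \<cdot> ve v) y" ThA 0
  by (rule fbim0)
interpretation P1: fbim G h \<phi> W \<nu>0 \<nu>1 f B d B1 "arcs G" "tail G" "head G" t1 Th1 1
  by (rule fbim1)
interpretation P2: fbim G h \<phi> W \<nu>0 \<nu>1 f B d B2 "arcs G" "head G" "tail G" t2 Th2 1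
  by (rule fbim2)
interpretation M1: fbim_hom G h \<phi> W \<nu>0 \<nu>1 f B d B1 "arcs G" "tail G" "head G" t1 Th1 1
  B0 "verts G" "\<lambda>v. v" "\<lambda>v. v" "\<lambda>x v y. tA (x \<cdot> ve v) y" ThA 0 m1
  by (rule hom1)
interpretation M2: fbim_hom G h \<phi> W \<nu>0 \<nu>1 f B d B2 "arcs G" "head G" "tail G" t2 Th2 1
  B1 "arcs G" "tail G" "head G" t1 Th1 1 m2
  by (rule hom2)
interpretation M3: fbim_hom G h \<phi> W \<nu>0 \<nu>1 f B d B0 "verts G" "\<lambda>v. v" "\<lambda>v. v" "\<lambda>x v y. tA (x \<cdot> ve v) y" ThA 0
  B2 "arcs G" "head G" "tail G" t2 Th2 1 m3
  by (rule hom3)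

lemma tA_closed: "x \<in> carrier A \<Longrightarrow> y \<in> carrier A \<Longrightarrow> tA x y \<in> carrier B0"
  unfolding AA_eq tAA_eq by (rule TA.pt_closed) (simp_all add: A_R_simps R_A_simps)

lemma tA_add_l: "x \<in> carrier A \<Longrightarrow> x' \<in> carrier A \<Longrightarrow> y \<in> carrier A \<Longrightarrow>
    tA (x \<oplus>\<^bsub>A\<^esub> x') y = tA x y \<oplus>\<^bsub>B0\<^esub> tA x' y"
  unfolding AA_eq tAA_eq using TA.pt_add_l[of x x' y] by (simp add: A_R_simps R_A_simps)

lemma tA_add_r: "x \<in> carrier A \<Longrightarrow> y \<in> carrier A \<Longrightarrow> y' \<in> carrier A \<Longrightarrow>
    tA x (y \<oplus>\<^bsub>A\<^esub> y') = tA x y \<oplus>\<^bsub>B0\<^esub> tA x y'"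
  unfolding AA_eq tAA_eq using TA.pt_add_r[of x y y'] by (simp add: A_R_simps R_A_simps)

lemma tA_zero_l: "y \<in> carrier A \<Longrightarrow> tA \<zero>\<^bsub>A\<^esub> y = \<zero>\<^bsub>B0\<^esub>"
  unfolding AA_eq tAA_eq using TA.pt_zero_l[of y] by (simp add: A_R_simps R_A_simps)

lemma tA_zero_r: "x \<in> carrier A \<Longrightarrow> tA x \<zero>\<^bsub>A\<^esub> = \<zero>\<^bsub>B0\<^esub>"
  unfolding AA_eq tAA_eq using TA.pt_zero_r[of x] by (simp add: A_R_simps R_A_simps)

lemma tA_bal: "x \<in> carrier A \<Longrightarrow> y \<in> carrier A \<Longrightarrow> v \<in> verts G \<Longrightarrow>
    tA x (sc c \<cdot> ve v \<cdot> y) = tA (x \<cdot> (sc c \<cdot> ve v)) y"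
  unfolding tAA_eq using TA.pt_bal[of x "sng v [] c" y]
  by (simp add: A_R_simps R_A_simps vr_simps path_part_single cls_single_Nil)

lemma tA_smult: "w \<in> carrier A \<Longrightarrow> w \<odot>\<^bsub>B0\<^esub> tA x y = tA (w \<cdot> x) y"
  unfolding AA_eq tAA_eq by (simp add: TA.T_smult_pt A_R_simps)

lemma tA_rsmult: "w \<in> carrier A \<Longrightarrow> tA x y \<odot>r\<^bsub>B0\<^esub> w = tA x (y \<cdot> w)"
  unfolding AA_eq tAA_eq by (simp add: TA.T_rsmult_pt R_A_simps)

lemma tA_induct [consumes 1, case_names zero pure add]:
  assumes "z \<in> carrier B0" "Q \<zero>\<^bsub>B0\<^esub>"
    "\<And>x y. x \<in> carrier A \<Longrightarrow> y \<in> carrier A \<Longrightarrow> Q (tA x y)"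
    "\<And>z z'. z \<in> carrier B0 \<Longrightarrow> z' \<in> carrier B0 \<Longrightarrow> Q z \<Longrightarrow> Q z' \<Longrightarrow> Q (z \<oplus>\<^bsub>B0\<^esub> z')"
  shows "Q z"
  using assms(1)
proof (rule P0.span)
  show "Q (tA (x \<cdot> ve k) y)" if "x \<in> carrier A" "k \<in> verts G" "y \<in> carrier A" for x k y
    by (rule assms(3)) (use that in auto)
qed (rule assms(2), rule assms(4))

lemma ThA_tA:
  assumes "x \<in> carrier A" "y \<in> carrier A" "v \<in> verts G" "u \<in> carrier A" "g \<in> carrier A"
  shows "ThA (tA x y) v u g = f (x \<cdot> (ve v \<cdot> u)) * f (g \<cdot> (ve v \<cdot> y))"
  unfolding ThA_def tAA_eq
  by (rule TA.lift_pt[OF balA]) (use assms in \<open>simp_all add: A_R_simps R_A_simps\<close>)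

lemma tA_grading: "x \<in> gr p \<Longrightarrow> y \<in> gr q \<Longrightarrow> tA x y \<in> grading B0 (p + q)"
  unfolding AA_eq tAA_eq
  by (rule TA.pt_grading) (use gr_closed in \<open>auto simp: A_R_simps R_A_simps\<close>)

lemma B0_minus_grading:
  "z \<in> grading B0 n \<Longrightarrow> z' \<in> grading B0 n \<Longrightarrow> z \<ominus>\<^bsub>B0\<^esub> z' \<in> grading B0 n"
  unfolding a_minus_def by (intro P0.grading_add P0.grading_uminus)

lemma B2_minus_grading:
  "z \<in> grading B2 n \<Longrightarrow> z' \<in> grading B2 n \<Longrightarrow> z \<ominus>\<^bsub>B2\<^esub> z' \<in> grading B2 n"
  unfolding a_minus_def by (intro P2.grading_add P2.grading_uminus)

text \<open>It suffices to compare forms. The sum over arcs in \<open>m1\<close> collapses to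
  \<open>a\<close>, and wherever the vertex \<open>v\<close> does not match an end of
  \<open>a\<close> both sides contain a zero factor.\<close>

lemma mu1_t1:
  assumes x: "x \<in> carrier A" and a: "a \<in> arcs G" and y: "y \<in> carrier A"
  shows "M1.mu (t1 x a y) = tA (x \<cdot> ae a) y \<ominus>\<^bsub>B0\<^esub> tA x (ae a \<cdot> y)"
proof (rule M1.mu_eqI)
  show "t1 x a y \<in> carrier B1" using assms by simp
  have c: "tA (x \<cdot> ae a) y \<in> carrier B0" "tA x (ae a \<cdot> y) \<in> carrier B0"
    using assms by (auto intro!: tA_closed)
  then show "tA (x \<cdot> ae a) y \<ominus>\<^bsub>B0\<^esub> tA x (ae a \<cdot> y) \<in> carrier B0" by simp
  fix v u g assume v: "v \<in> verts G" and u: "u \<in> carrier A" and g: "g \<in> carrier A"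
  have z: "f (x \<cdot> \<zero>\<^bsub>A\<^esub>) = 0" "f \<zero>\<^bsub>A\<^esub> = 0" using x lfun_zero[OF f_lfun] by simp_all
  have 1: "ae a \<cdot> (ve v \<cdot> u) = (if v = head G a then ae a \<cdot> u else \<zero>\<^bsub>A\<^esub>)"
    using a v u by (simp add: A.m_assoc[symmetric] ae_ve)
  have 2: "g \<cdot> ve v \<cdot> ae a = (if v = tail G a then g \<cdot> ae a else \<zero>\<^bsub>A\<^esub>)"
    using a v g by (simp add: A.m_assoc ve_ae)
  have 3: "g \<cdot> (ve v \<cdot> (ae a \<cdot> y)) = (if v = tail G a then g \<cdot> (ae a \<cdot> y) else \<zero>\<^bsub>A\<^esub>)"
    using a v g y by (simp add: A.m_assoc[symmetric] ve_ae)
  have 4: "ve w \<cdot> (ve v \<cdot> u) = (if v = w then ve v \<cdot> u else \<zero>\<^bsub>A\<^esub>)" if "w \<in> verts G" for w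
    using that v u by (auto simp: A.m_assoc[symmetric] ve_ve)
  have 5: "g \<cdot> ve v \<cdot> (ve w \<cdot> y) = (if v = w then g \<cdot> (ve v \<cdot> y) else \<zero>\<^bsub>A\<^esub>)" if "w \<in> verts G" for w
  proof -
    have "g \<cdot> ve v \<cdot> (ve w \<cdot> y) = g \<cdot> ((ve v \<cdot> ve w) \<cdot> y)" using that v g y by (simp add: A.m_assoc)
    then show ?thesis using that v g y by (auto simp: ve_ve)
  qed
  have "m1 (Th1 (t1 x a y)) v u g
    = (\<Sum>c\<in>arcs G. if c = a then f (x \<cdot> (ve (tail G a) \<cdot> (ae a \<cdot> (ve v \<cdot> u)))) * f (g \<cdot> ve v \<cdot> (ve (head G a) \<cdot> y))
        - f (x \<cdot> (ve (tail G a) \<cdot> (ve v \<cdot> u))) * f (g \<cdot> ve v \<cdot> ae a \<cdot> (ve (head G a) \<cdot> y)) else 0)"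
    unfolding m1_def by (rule sum.cong[OF refl]) (use assms v u g in \<open>auto simp: P1.Th_gm\<close>)
  also have "\<dots> = f (x \<cdot> (ve (tail G a) \<cdot> (ae a \<cdot> (ve v \<cdot> u)))) * f (g \<cdot> ve v \<cdot> (ve (head G a) \<cdot> y))
        - f (x \<cdot> (ve (tail G a) \<cdot> (ve v \<cdot> u))) * f (g \<cdot> ve v \<cdot> ae a \<cdot> (ve (head G a) \<cdot> y))"
    using a by simp
  also have "\<dots> = f (x \<cdot> (ae a \<cdot> (ve v \<cdot> u))) * f (g \<cdot> (ve v \<cdot> y)) - f (x \<cdot> (ve v \<cdot> u)) * f (g \<cdot> (ve v \<cdot> (ae a \<cdot> y)))"
  proof -
    have e1: "ve (tail G a) \<cdot> (ae a \<cdot> (ve v \<cdot> u)) = ae a \<cdot> (ve v \<cdot> u)"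
      using a v u by (intro tail_ae) auto
    \<comment> \<open>If \<open>v\<close> is not the head of \<open>a\<close>, then a v = 0 and the
      first factor already vanishes.\<close>
    have e2: "f (x \<cdot> (ae a \<cdot> (ve v \<cdot> u))) * f (g \<cdot> ve v \<cdot> (ve (head G a) \<cdot> y))
      = f (x \<cdot> (ae a \<cdot> (ve v \<cdot> u))) * f (g \<cdot> (ve v \<cdot> y))"
      using a 1 5[of "head G a"] z by (cases "v = head G a") simp_all
    have e3: "f (x \<cdot> (ve (tail G a) \<cdot> (ve v \<cdot> u))) * f (g \<cdot> ve v \<cdot> ae a \<cdot> (ve (head G a) \<cdot> y))
      = f (x \<cdot> (ve v \<cdot> u)) * f (g \<cdot> (ve v \<cdot> (ae a \<cdot> y)))"
    proof (cases "v = tail G a")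
      case True
      have "g \<cdot> ae a \<cdot> (ve (head G a) \<cdot> y) = g \<cdot> (ae a \<cdot> y)"
        using a g y by (simp add: A.m_assoc ae_head)
      then show ?thesis using True a 2 3 4[of "tail G a"] by simp
    next
      case False
      then show ?thesis using a 3 4[of "tail G a"] z by simp
    qed
    show ?thesis by (simp only: e1 e2 e3)
  qed
  finally have E: "m1 (Th1 (t1 x a y)) v u g = f (x \<cdot> (ae a \<cdot> (ve v \<cdot> u))) * f (g \<cdot> (ve v \<cdot> y))
    - f (x \<cdot> (ve v \<cdot> u)) * f (g \<cdot> (ve v \<cdot> (ae a \<cdot> y)))" .
  show "ThA (tA (x \<cdot> ae a) y \<ominus>\<^bsub>B0\<^esub> tA x (ae a \<cdot> y)) v u g = m1 (Th1 (t1 x a y)) v u g"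
    unfolding E using assms v u g c by (simp add: P0.Th_minus ThA_tA A.m_assoc)
qed

lemma mu1_ok: "mu1_spec G W M1.mu"
  unfolding mu1_spec_def graded_hom_def
proof (intro conjI CollectI ballI allI M1.mu_hom mu1_t1)
  fix p
  show "M1.mu ` grading B1 p \<subseteq> grading B0 p"
  proof (intro image_subsetI, elim M1.mu_grading)
    fix x a y q s assume *: "x \<in> gr q" "a \<in> arcs G" "y \<in> gr s" "q + s + 1 = p"
    have "tA (x \<cdot> ae a) y \<in> grading B0 (q + 1 + s)" "tA x (ae a \<cdot> y) \<in> grading B0 (q + (1 + s))"
      by (intro tA_grading gr_mult gr_ae *)+
    then show "M1.mu (t1 x a y) \<in> grading B0 p"
      using * gr_closed by (auto simp: mu1_t1 intro!: B0_minus_grading)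
  qed
qed

text \<open>The formula for \<mu>2 has the source arc \<open>a\<close> in front in the cell,
  \<open>m2\<close> has the target arc \<open>c\<close> there. The rotations W a b c = W c a b and W
  a c b = W c b a exchange the two.\<close>

lemma mu2_t2:
  assumes x: "x \<in> carrier A" and a: "a \<in> arcs G" and y: "y \<in> carrier A"
  shows "M2.mu (t2 x a y) = finsum B1 (\<lambda>(b, b'). sc (W a b b') \<odot>\<^bsub>B1\<^esub>
     (t1 (x \<cdot> ae b) b' y \<oplus>\<^bsub>B1\<^esub> t1 x b (ae b' \<cdot> y))) (arcs G \<times> arcs G)" (is "_ = finsum B1 ?t _")
proof (rule M2.mu_eqI)
  show "t2 x a y \<in> carrier B2" using assms by simp
  have tc: "?t i \<in> carrier B1" if "i \<in> arcs G \<times> arcs G" for i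
    using that assms by (auto intro!: P1.smult_closed)
  show "finsum B1 ?t (arcs G \<times> arcs G) \<in> carrier B1" by (rule P1.P_sum_closed[OF tc])
  fix c u g assume c: "c \<in> arcs G" and u: "u \<in> carrier A" and g: "g \<in> carrier A"
  let ?F = "\<lambda>b. W a b c * (f (x \<cdot> (ae b \<cdot> u)) * f (g \<cdot> y))"
  have hd: "head G c \<in> verts G" "tail G c \<in> verts G" using c by auto
  have "Th1 (finsum B1 ?t (arcs G \<times> arcs G)) c u g = (\<Sum>i\<in>arcs G \<times> arcs G. Th1 (?t i) c u g)"
    by (rule P1.Th_finsum) (use tc c u g in auto)
  also have "\<dots> = (\<Sum>b\<in>arcs G. \<Sum>b'\<in>arcs G. W a b b' *
      ((if b' = c then f (x \<cdot> ae b \<cdot> (ve (tail G c) \<cdot> u)) * f (g \<cdot> (ve (head G c) \<cdot> y)) else 0)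
      + (if b = c then f (x \<cdot> (ve (tail G c) \<cdot> u)) * f (g \<cdot> (ve (head G c) \<cdot> (ae b' \<cdot> y))) else 0)))"
    unfolding sum.cartesian_product[symmetric]
    by (simp only: sum.cartesian_product, rule sum.cong[OF refl])
      (use assms c u g in \<open>auto simp: P1.Th_sc P1.Th_add P1.Th_gm\<close>)
  also have "\<dots> = (\<Sum>b\<in>arcs G. W a b c * (f (x \<cdot> ae b \<cdot> (ve (tail G c) \<cdot> u)) * f (g \<cdot> (ve (head G c) \<cdot> y))))
      + (\<Sum>b'\<in>arcs G. W a c b' * (f (x \<cdot> (ve (tail G c) \<cdot> u)) * f (g \<cdot> (ve (head G c) \<cdot> (ae b' \<cdot> y)))))"
  proof -
    have 1: "(\<Sum>b'\<in>arcs G. W a b b' * (if b' = c then f (x \<cdot> ae b \<cdot> (ve (tail G c) \<cdot> u)) * f (g \<cdot> (ve (head G c) \<cdot> y)) else 0))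
      = W a b c * (f (x \<cdot> ae b \<cdot> (ve (tail G c) \<cdot> u)) * f (g \<cdot> (ve (head G c) \<cdot> y)))" for b
      using c by (simp add: if_distrib[of "(*) _"] cong: if_cong)
    have 2: "(\<Sum>b\<in>arcs G. \<Sum>b'\<in>arcs G. W a b b' * (if b = c then f (x \<cdot> (ve (tail G c) \<cdot> u)) * f (g \<cdot> (ve (head G c) \<cdot> (ae b' \<cdot> y))) else 0))
      = (\<Sum>b\<in>arcs G. if b = c then \<Sum>b'\<in>arcs G. W a c b' * (f (x \<cdot> (ve (tail G c) \<cdot> u)) * f (g \<cdot> (ve (head G c) \<cdot> (ae b' \<cdot> y)))) else 0)"
      by (rule sum.cong[OF refl]) auto
    show ?thesis
      using c by (simp only: distrib_left sum.distrib 1 2) simp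
  qed
  also have "\<dots> = (\<Sum>b'\<in>arcs G. W c a b' * (f (x \<cdot> (ve (head G a) \<cdot> (ae b' \<cdot> u))) * f (g \<cdot> (ve (tail G a) \<cdot> y))))
      + (\<Sum>b\<in>arcs G. W c b a * (f (x \<cdot> (ve (head G a) \<cdot> u)) * f (g \<cdot> ae b \<cdot> (ve (tail G a) \<cdot> y))))"
  proof (intro arg_cong2[where f = "(+)"] sum.cong[OF refl])
    fix b assume b: "b \<in> arcs G"
    show "W a b c * (f (x \<cdot> ae b \<cdot> (ve (tail G c) \<cdot> u)) * f (g \<cdot> (ve (head G c) \<cdot> y)))
      = W c a b * (f (x \<cdot> (ve (head G a) \<cdot> (ae b \<cdot> u))) * f (g \<cdot> (ve (tail G a) \<cdot> y)))"
    proof (cases "W a b c = 0")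
      case True
      then show ?thesis using W_cyc[of c a b] by simp
    next
      case False
      note tr = W_triD(4-6)[OF False]
      have "x \<cdot> ae b \<cdot> (ve (tail G c) \<cdot> u) = x \<cdot> (ae b \<cdot> (ve (head G b) \<cdot> u))"
        using x b u hd by (simp add: A.m_assoc tr(2))
      also have "\<dots> = x \<cdot> (ve (head G a) \<cdot> (ae b \<cdot> u))"
        using x b u by (simp add: ae_head tr(1) tail_ae)
      finally show ?thesis using tr W_cyc[of c a b] by simp
    qed
    show "W a c b * (f (x \<cdot> (ve (tail G c) \<cdot> u)) * f (g \<cdot> (ve (head G c) \<cdot> (ae b \<cdot> y))))
      = W c b a * (f (x \<cdot> (ve (head G a) \<cdot> u)) * f (g \<cdot> ae b \<cdot> (ve (tail G a) \<cdot> y)))"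
    proof (cases "W a c b = 0")
      case True
      then show ?thesis using W_cyc[of a c b] by simp
    next
      case False
      note tr = W_triD(4-6)[OF False]
      have "g \<cdot> ae b \<cdot> (ve (tail G a) \<cdot> y) = g \<cdot> (ae b \<cdot> (ve (head G b) \<cdot> y))"
        using g b y a by (simp add: A.m_assoc tr(3))
      also have "\<dots> = g \<cdot> (ve (head G c) \<cdot> (ae b \<cdot> y))"
        using g b y by (simp add: ae_head tr(2) tail_ae)
      finally show ?thesis using tr W_cyc[of a c b] by simp
    qed
  qed
  also have "\<dots> = m2 (Th2 (t2 x a y)) c u g"
  proof -
    have 1: "(\<Sum>b\<in>arcs G. \<Sum>b'\<in>arcs G. W c b b' * (if b = a then f (x \<cdot> (ve (head G a) \<cdot> (ae b' \<cdot> u))) * f (g \<cdot> (ve (tail G a) \<cdot> y)) else 0))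
      = (\<Sum>b\<in>arcs G. if b = a then \<Sum>b'\<in>arcs G. W c a b' * (f (x \<cdot> (ve (head G a) \<cdot> (ae b' \<cdot> u))) * f (g \<cdot> (ve (tail G a) \<cdot> y))) else 0)"
      by (rule sum.cong[OF refl]) auto
    have 2: "(\<Sum>b'\<in>arcs G. W c b b' * (if b' = a then f (x \<cdot> (ve (head G a) \<cdot> u)) * f (g \<cdot> ae b \<cdot> (ve (tail G a) \<cdot> y)) else 0))
      = W c b a * (f (x \<cdot> (ve (head G a) \<cdot> u)) * f (g \<cdot> ae b \<cdot> (ve (tail G a) \<cdot> y)))" for b
      using a by (simp add: if_distrib[of "(*) _"] cong: if_cong)
    have "m2 (Th2 (t2 x a y)) c u g = (\<Sum>b\<in>arcs G. \<Sum>b'\<in>arcs G. W c b b' *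
       ((if b = a then f (x \<cdot> (ve (head G a) \<cdot> (ae b' \<cdot> u))) * f (g \<cdot> (ve (tail G a) \<cdot> y)) else 0)
       + (if b' = a then f (x \<cdot> (ve (head G a) \<cdot> u)) * f (g \<cdot> ae b \<cdot> (ve (tail G a) \<cdot> y)) else 0)))"
      unfolding m2_def
      by (intro sum.cong[OF refl] arg_cong2[where f = "(*)"]) (use assms u g in \<open>simp_all add: P2.Th_gm\<close>)
    then show ?thesis
      using a by (simp only: distrib_left sum.distrib 1 2) simp
  qed
  finally show "Th1 (finsum B1 ?t (arcs G \<times> arcs G)) c u g = m2 (Th2 (t2 x a y)) c u g" .
qed

lemma mu2_ok: "mu2_spec G W M2.mu"
  unfolding mu2_spec_def graded_hom_def
proof (intro conjI CollectI ballI allI mu2_t2 bimod_hom_shift(2) M2.mu_hom)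
  fix p
  show "M2.mu ` grading (shift 1 B2) p \<subseteq> grading B1 p"
  proof (cases "1 \<le> p")
    case True
    have "M2.mu z \<in> grading B1 p" if "z \<in> grading B2 (p - 1)" for z
      using that
    proof (rule M2.mu_grading)
      fix x a y q s assume *: "x \<in> gr q" "a \<in> arcs G" "y \<in> gr s" "q + s + 1 = p - 1"
      have "t1 (x \<cdot> ae b) b' y \<oplus>\<^bsub>B1\<^esub> t1 x b (ae b' \<cdot> y) \<in> grading B1 p"
        if "b \<in> arcs G" "b' \<in> arcs G" for b b'
      proof (rule P1.grading_add)
        have "t1 (x \<cdot> ae b) b' y \<in> grading B1 (q + 1 + s + 1)" "t1 x b (ae b' \<cdot> y) \<in> grading B1 (q + (1 + s) + 1)"
          by (intro P1.gm_grading gr_mult gr_ae * that)+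
        then show "t1 (x \<cdot> ae b) b' y \<in> grading B1 p" "t1 x b (ae b' \<cdot> y) \<in> grading B1 p"
          using * True by (auto simp: ac_simps)
      qed
      then show "M2.mu (t2 x a y) \<in> grading B1 p"
        using * gr_closed by (auto simp: mu2_t2 intro!: P1.grading_finsum P1.sc_smult_grading)
    qed
    then show ?thesis using True by (auto simp: shift_def)
  next
    case False
    then show ?thesis by (simp add: shift_def M2.mu_zero P1.grading_zero)
  qed
qed

lemma mu3_tA:
  assumes x: "x \<in> carrier A" and y: "y \<in> carrier A"
  shows "M3.mu (tA x y) = finsum B2 (\<lambda>a. t2 (x \<cdot> ae a) a y) (arcs G)
    \<ominus>\<^bsub>B2\<^esub> finsum B2 (\<lambda>a. t2 x a (ae a \<cdot> y)) (arcs G)"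
proof (rule M3.mu_eqI)
  show "tA x y \<in> carrier B0" by (rule tA_closed[OF assms])
  have c: "finsum B2 (\<lambda>a. t2 (x \<cdot> ae a) a y) (arcs G) \<in> carrier B2"
    "finsum B2 (\<lambda>a. t2 x a (ae a \<cdot> y)) (arcs G) \<in> carrier B2"
    by (intro P2.P_sum_closed P2.gm_closed; use assms in simp)+
  then show "finsum B2 (\<lambda>a. t2 (x \<cdot> ae a) a y) (arcs G)
    \<ominus>\<^bsub>B2\<^esub> finsum B2 (\<lambda>a. t2 x a (ae a \<cdot> y)) (arcs G) \<in> carrier B2" by simp
  fix a u g assume a: "a \<in> arcs G" and u: "u \<in> carrier A" and g: "g \<in> carrier A"
  have "Th2 (finsum B2 (\<lambda>a. t2 (x \<cdot> ae a) a y) (arcs G)) a u g = (\<Sum>c\<in>arcs G. Th2 (t2 (x \<cdot> ae c) c y) a u g)"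
    by (rule P2.Th_finsum) (use assms a u g in auto)
  also have "\<dots> = (\<Sum>c\<in>arcs G. if c = a then f (x \<cdot> ae a \<cdot> (ve (head G a) \<cdot> u)) * f (g \<cdot> (ve (tail G a) \<cdot> y)) else 0)"
    by (rule sum.cong[OF refl]) (use assms a u g in \<open>auto simp: P2.Th_gm\<close>)
  also have "\<dots> = f (x \<cdot> (ae a \<cdot> u)) * f (g \<cdot> (ve (tail G a) \<cdot> y))"
    using a x u by (simp add: A.m_assoc ae_head)
  finally have 1: "Th2 (finsum B2 (\<lambda>a. t2 (x \<cdot> ae a) a y) (arcs G)) a u g
    = f (x \<cdot> (ae a \<cdot> u)) * f (g \<cdot> (ve (tail G a) \<cdot> y))" .
  have "Th2 (finsum B2 (\<lambda>a. t2 x a (ae a \<cdot> y)) (arcs G)) a u g = (\<Sum>c\<in>arcs G. Th2 (t2 x c (ae c \<cdot> y)) a u g)"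
    by (rule P2.Th_finsum) (use assms a u g in auto)
  also have "\<dots> = (\<Sum>c\<in>arcs G. if c = a then f (x \<cdot> (ve (head G a) \<cdot> u)) * f (g \<cdot> (ve (tail G a) \<cdot> (ae a \<cdot> y))) else 0)"
    by (rule sum.cong[OF refl]) (use assms a u g in \<open>auto simp: P2.Th_gm\<close>)
  also have "\<dots> = f (x \<cdot> (ve (head G a) \<cdot> u)) * f (g \<cdot> (ae a \<cdot> y))"
    using a y by (simp add: tail_ae)
  finally have 2: "Th2 (finsum B2 (\<lambda>a. t2 x a (ae a \<cdot> y)) (arcs G)) a u g
    = f (x \<cdot> (ve (head G a) \<cdot> u)) * f (g \<cdot> (ae a \<cdot> y))" .
  show "Th2 (finsum B2 (\<lambda>a. t2 (x \<cdot> ae a) a y) (arcs G) \<ominus>\<^bsub>B2\<^esub> finsum B2 (\<lambda>a. t2 x a (ae a \<cdot> y)) (arcs G)) a u g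
    = m3 (ThA (tA x y)) a u g"
    unfolding m3_def using assms a u g c
    by (simp add: P2.Th_minus 1 2 ThA_tA tail_ae A.m_assoc ae_head)
qed

lemma mu3_ok: "mu3_spec G W M3.mu"
  unfolding mu3_spec_def graded_hom_def
proof (intro conjI CollectI ballI allI mu3_tA bimod_hom_shift(1) M3.mu_hom)
  fix p
  show "M3.mu ` grading (shift 3 B0) p \<subseteq> grading (shift 1 B2) p"
  proof (cases "3 \<le> p")
    case True
    have "M3.mu z \<in> grading B2 (p - 1)" if "z \<in> grading B0 (p - 3)" for z
      using that
    proof (rule M3.mu_grading)
      fix x v y q s assume *: "x \<in> gr q" "v \<in> verts G" "y \<in> gr s" "q + s + 0 = p - 3"
      have xv: "x \<cdot> ve v \<in> gr (q + 0)" by (intro gr_mult gr_ve *)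
      have "t2 (x \<cdot> ve v \<cdot> ae a) a y \<in> grading B2 (p - 1) \<and> t2 (x \<cdot> ve v) a (ae a \<cdot> y) \<in> grading B2 (p - 1)"
        if "a \<in> arcs G" for a
      proof -
        have "t2 (x \<cdot> ve v \<cdot> ae a) a y \<in> grading B2 (q + 0 + 1 + s + 1)"
          "t2 (x \<cdot> ve v) a (ae a \<cdot> y) \<in> grading B2 (q + 0 + (1 + s) + 1)"
          by (intro P2.gm_grading gr_mult gr_ae gr_ve * that)+
        moreover have "p - 1 = q + s + 2" using * True by simp
        ultimately show ?thesis by (simp add: ac_simps)
      qed
      then show "M3.mu (tA (x \<cdot> ve v) y) \<in> grading B2 (p - 1)"
        using * gr_closed by (auto simp: mu3_tA intro!: P2.grading_finsum B2_minus_grading)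
    qed
    then show ?thesis using True by (auto simp: shift_def)
  next
    case False
    have "\<zero>\<^bsub>shift 1 B2\<^esub> = \<zero>\<^bsub>B2\<^esub>" by (simp add: shift_def)
    then show ?thesis using False by (auto simp: shift_def M3.mu_zero P2.grading_zero)
  qed
qed

text \<open>The form identifies \<open>A\<close> with its dual; the coefficients of the representing
  element in the dual basis are the values of \<open>l\<close> on \<open>B\<close>.\<close>

lemma representing_element:
  assumes "lfun l"
  obtains y where "y \<in> carrier A" "\<And>g. g \<in> carrier A \<Longrightarrow> f (g \<cdot> y) = l g"
proof (rule that[of "finsum A (\<lambda>b. sc (l b) \<cdot> d b) B"])
  show "finsum A (\<lambda>b. sc (l b) \<cdot> d b) B \<in> carrier A" by (auto intro!: A.finsum_closed)
  fix g assume g: "g \<in> carrier A"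
  have "f (g \<cdot> finsum A (\<lambda>b. sc (l b) \<cdot> d b) B) = (\<Sum>b\<in>B. f (g \<cdot> (sc (l b) \<cdot> d b)))"
    by (rule lfun_finsum[OF lfun_mult_l[OF f_lfun g] finite_B]) simp
  also have "\<dots> = (\<Sum>b\<in>B. f (g \<cdot> d b) * l b)"
    by (rule sum.cong[OF refl]) (use g in \<open>simp add: lfun_sc[OF lfun_mult_l[OF f_lfun g]]\<close>)
  also have "\<dots> = l g" by (rule lfun_exp1[OF assms g, symmetric])
  finally show "f (g \<cdot> finsum A (\<lambda>b. sc (l b) \<cdot> d b) B) = l g" .
qed

text \<open>The target \<open>A\<close> is not one of the bimodules of \<open>fbim\<close>, so
  \<mu>0 is given through its pairings. For x \<otimes> y the sum over \<open>b\<close> contracts,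
  and the sum over the vertices then leaves f (g x y).\<close>

definition mu0 where
  "mu0 z = (SOME y. y \<in> carrier A \<and> (\<forall>g\<in>carrier A. f (g \<cdot> y) = (\<Sum>v\<in>verts G. \<Sum>b\<in>B. ThA z v (d b) (g \<cdot> b))))"

lemma f_mu0:
  assumes z: "z \<in> carrier B0"
  shows "mu0 z \<in> carrier A" "\<And>g. g \<in> carrier A \<Longrightarrow> f (g \<cdot> mu0 z) = (\<Sum>v\<in>verts G. \<Sum>b\<in>B. ThA z v (d b) (g \<cdot> b))"
proof -
  have "lfun (\<lambda>g. \<Sum>v\<in>verts G. \<Sum>b\<in>B. ThA z v (d b) (g \<cdot> b))"
    by (intro lfun_sum lfun_mult_r[of "ThA z _ (d _)"] P0.formD(2)[OF P0.form_Th[OF z]]) auto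
  then have "\<exists>y. y \<in> carrier A \<and> (\<forall>g\<in>carrier A. f (g \<cdot> y) = (\<Sum>v\<in>verts G. \<Sum>b\<in>B. ThA z v (d b) (g \<cdot> b)))"
    by (rule representing_element) blast
  then have "mu0 z \<in> carrier A \<and> (\<forall>g\<in>carrier A. f (g \<cdot> mu0 z) = (\<Sum>v\<in>verts G. \<Sum>b\<in>B. ThA z v (d b) (g \<cdot> b)))"
    unfolding mu0_def by (rule someI_ex)
  then show "mu0 z \<in> carrier A"
    "\<And>g. g \<in> carrier A \<Longrightarrow> f (g \<cdot> mu0 z) = (\<Sum>v\<in>verts G. \<Sum>b\<in>B. ThA z v (d b) (g \<cdot> b))" by blast+
qed

lemma f_ve_sum:
  assumes "x \<in> carrier A" "y \<in> carrier A"
  shows "(\<Sum>v\<in>verts G. f (x \<cdot> (ve v \<cdot> y))) = f (x \<cdot> y)"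
proof -
  have l: "lfun (\<lambda>t. f (x \<cdot> (t \<cdot> y)))"
    by (rule lfun_mult_r[OF lfun_mult_l[OF f_lfun]]) (use assms in auto)
  have "(\<Sum>v\<in>verts G. f (x \<cdot> (ve v \<cdot> y))) = f (x \<cdot> (finsum A ve (verts G) \<cdot> y))"
    by (rule lfun_finsum[OF l, symmetric]) auto
  then show ?thesis using assms by (simp add: ve_sum)
qed

lemma mu0_tA:
  assumes x: "x \<in> carrier A" and y: "y \<in> carrier A"
  shows "mu0 (tA x y) = x \<cdot> y"
proof (rule f_eqI_r)
  show "mu0 (tA x y) \<in> carrier A" by (rule f_mu0(1)[OF tA_closed[OF assms]])
  fix g assume g: "g \<in> carrier A"
  have "f (g \<cdot> mu0 (tA x y)) = (\<Sum>v\<in>verts G. \<Sum>b\<in>B. ThA (tA x y) v (d b) (g \<cdot> b))"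
    by (rule f_mu0(2)[OF tA_closed[OF assms] g])
  also have "\<dots> = (\<Sum>v\<in>verts G. f (g \<cdot> x \<cdot> (ve v \<cdot> y)))"
  proof (rule sum.cong[OF refl])
    fix v assume v: "v \<in> verts G"
    have l: "lfun (\<lambda>t. f (g \<cdot> t \<cdot> (ve v \<cdot> y)))"
      by (rule lfun_mult_l[of "\<lambda>t. f (t \<cdot> (ve v \<cdot> y))", OF lfun_mult_r[OF f_lfun] g]) (use v y in auto)
    have "(\<Sum>b\<in>B. ThA (tA x y) v (d b) (g \<cdot> b)) = (\<Sum>b\<in>B. f ((x \<cdot> ve v) \<cdot> d b) * f (g \<cdot> b \<cdot> (ve v \<cdot> y)))"
      by (rule sum.cong[OF refl]) (use assms g v in \<open>simp add: ThA_tA A.m_assoc\<close>)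
    also have "\<dots> = f (g \<cdot> (x \<cdot> ve v) \<cdot> (ve v \<cdot> y))"
      by (rule lfun_exp1[OF l, symmetric]) (use x v in auto)
    also have "g \<cdot> (x \<cdot> ve v) \<cdot> (ve v \<cdot> y) = g \<cdot> x \<cdot> (ve v \<cdot> y)"
      using x y g v by (simp add: A.m_assoc ve_ve_l)
    finally show "(\<Sum>b\<in>B. ThA (tA x y) v (d b) (g \<cdot> b)) = f (g \<cdot> x \<cdot> (ve v \<cdot> y))" .
  qed
  also have "\<dots> = f (g \<cdot> x \<cdot> y)" by (rule f_ve_sum) (use x y g in auto)
  finally show "f (g \<cdot> mu0 (tA x y)) = f (g \<cdot> (x \<cdot> y))"
    using x y g by (simp add: A.m_assoc)
qed (use assms in auto)

lemma mu0_add: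
  assumes "z \<in> carrier B0" "z' \<in> carrier B0"
  shows "mu0 (z \<oplus>\<^bsub>B0\<^esub> z') = mu0 z \<oplus>\<^bsub>A\<^esub> mu0 z'"
proof (rule f_eqI_r)
  fix g assume g: "g \<in> carrier A"
  have "(\<Sum>v\<in>verts G. \<Sum>b\<in>B. ThA (z \<oplus>\<^bsub>B0\<^esub> z') v (d b) (g \<cdot> b))
    = (\<Sum>v\<in>verts G. \<Sum>b\<in>B. ThA z v (d b) (g \<cdot> b) + ThA z' v (d b) (g \<cdot> b))"
    by (intro sum.cong[OF refl]) (use assms g in \<open>simp add: P0.Th_add\<close>)
  then show "f (g \<cdot> mu0 (z \<oplus>\<^bsub>B0\<^esub> z')) = f (g \<cdot> (mu0 z \<oplus>\<^bsub>A\<^esub> mu0 z'))"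
    using assms g by (simp add: f_mu0 lfun_add[OF lfun_mult_l[OF f_lfun g]] sum.distrib)
qed (use assms f_mu0(1) in auto)

lemma mu0_zero: "mu0 \<zero>\<^bsub>B0\<^esub> = \<zero>\<^bsub>A\<^esub>"
  using mu0_tA[of "\<zero>\<^bsub>A\<^esub>" "\<zero>\<^bsub>A\<^esub>"] tA_zero_l[of "\<zero>\<^bsub>A\<^esub>"] by simp

lemma A_A_simps: "carrier (A_A G W) = carrier A" "add (A_A G W) = add A" "zero (A_A G W) = zero A"
  "a \<odot>\<^bsub>A_A G W\<^esub> x = a \<cdot> x" "x \<odot>r\<^bsub>A_A G W\<^esub> a = x \<cdot> a" "grading (A_A G W) = gr"
  by (simp_all add: A_A_def ring_bimod_simps)

lemma mu0_hom: "mu0 \<in> bimod_hom A A B0 (A_A G W)"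
  unfolding bimod_hom_def
proof (intro CollectI conjI ballI funcsetI)
  show "bimodule A A B0" by (rule P0.bim)
  show "bimodule A A (A_A G W)"
    unfolding A_A_def by (rule ring_bimod_bimodule) (auto simp: A_ring)
  fix w z assume w: "w \<in> carrier A" and z: "z \<in> carrier B0"
  from z show "mu0 (w \<odot>\<^bsub>B0\<^esub> z) = w \<odot>\<^bsub>A_A G W\<^esub> mu0 z"
  proof (induction z rule: tA_induct)
    case (add z z')
    then show ?case
      using w bimodule.smult_r_distr[OF P0.bim w] by (simp add: mu0_add A_A_simps A.r_distr f_mu0 P0.smult_closed)
  qed (use w in \<open>simp_all add: P0.smult_zero mu0_zero A_A_simps tA_smult mu0_tA A.m_assoc\<close>)
next
  fix w z assume w: "w \<in> carrier A" and z: "z \<in> carrier B0"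
  from z show "mu0 (z \<odot>r\<^bsub>B0\<^esub> w) = mu0 z \<odot>r\<^bsub>A_A G W\<^esub> w"
  proof (induction z rule: tA_induct)
    case zero
    have "\<zero>\<^bsub>B0\<^esub> \<odot>r\<^bsub>B0\<^esub> w = \<zero>\<^bsub>B0\<^esub>"
      using bimodule.rsmult_l_distr[OF P0.bim, of "\<zero>\<^bsub>B0\<^esub>" "\<zero>\<^bsub>B0\<^esub>" w] P0.rsmult_closed[OF w, of "\<zero>\<^bsub>B0\<^esub>"] w
      by (intro P0.P_zero_eqI) auto
    then show ?case using w by (simp add: mu0_zero A_A_simps)
  next
    case (add z z')
    then show ?case
      using w bimodule.rsmult_l_distr[OF P0.bim _ _ w] by (simp add: mu0_add A_A_simps A.l_distr f_mu0 P0.rsmult_closed)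
  qed (use w in \<open>simp add: A_A_simps tA_rsmult mu0_tA A.m_assoc\<close>)
qed (auto simp: A_A_simps f_mu0 mu0_add)

lemma mu0_ok: "mu0_spec G W mu0"
  unfolding mu0_spec_def graded_hom_def
proof (intro conjI CollectI ballI allI mu0_hom mu0_tA)
  fix p
  have "mu0 z \<in> gr p" if "z \<in> grading B0 p" for z
    using that
  proof (rule P0.grading_span)
    show "mu0 \<zero>\<^bsub>B0\<^esub> \<in> gr p" by (simp add: mu0_zero)
    fix x v y q s assume *: "x \<in> gr q" "v \<in> verts G" "y \<in> gr s" "q + s + 0 = p"
    have "x \<cdot> ve v \<cdot> y \<in> gr (q + 0 + s)" by (intro gr_mult gr_ve *)
    then show "mu0 (tA (x \<cdot> ve v) y) \<in> gr p"
      using * gr_closed by (simp add: mu0_tA)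
  next
    fix z z' assume "z \<in> carrier B0" "z' \<in> carrier B0" "mu0 z \<in> gr p" "mu0 z' \<in> gr p"
    then show "mu0 (z \<oplus>\<^bsub>B0\<^esub> z') \<in> gr p" by (simp add: mu0_add gr_add)
  qed
  then show "mu0 ` grading B0 p \<subseteq> grading (A_A G W) p" by (auto simp: A_A_simps)
qed

section \<open>Exactness\<close>

text \<open>The Casimir element of the Frobenius form. \<open>Th_om\<close> computes its form as f
  (g v u), which shows that the choice of basis is immaterial.\<close>

definition om where "om = finsum B0 (\<lambda>b. tA b (d b)) B"
definition mu4 where "mu4 x = x \<odot>\<^bsub>B0\<^esub> om"

lemma om_closed: "om \<in> carrier B0"
  unfolding om_def by (rule P0.P_sum_closed) (auto intro: tA_closed)

lemma mu4_closed: "x \<in> carrier A \<Longrightarrow> mu4 x \<in> carrier B0"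
  unfolding mu4_def by (rule P0.smult_closed[OF _ om_closed])

lemma Th_om:
  assumes v: "v \<in> verts G" "u \<in> carrier A" "g \<in> carrier A"
  shows "ThA om v u g = f (g \<cdot> (ve v \<cdot> u))"
proof -
  have l: "lfun (\<lambda>y. f (g \<cdot> (ve v \<cdot> y)))"
    by (intro lfun_mult_l[OF lfun_mult_l[OF f_lfun]]) (use v in auto)
  have "ThA om v u g = (\<Sum>b\<in>B. ThA (tA b (d b)) v u g)"
    unfolding om_def by (rule P0.Th_finsum[OF finite_B _ v]) (auto intro: tA_closed)
  also have "\<dots> = (\<Sum>b\<in>B. f (b \<cdot> (ve v \<cdot> u)) * f (g \<cdot> (ve v \<cdot> d b)))"
    by (rule sum.cong[OF refl]) (use v in \<open>simp add: ThA_tA\<close>)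
  also have "\<dots> = f (g \<cdot> (ve v \<cdot> (ve v \<cdot> u)))"
    by (rule lfun_exp2[OF l, symmetric]) (use v in auto)
  finally show ?thesis using v by (simp add: ve_ve_l)
qed

lemma Th_mu4:
  assumes "x \<in> carrier A" "v \<in> verts G" "u \<in> carrier A" "g \<in> carrier A"
  shows "ThA (mu4 x) v u g = f (g \<cdot> (ve v \<cdot> (u \<cdot> bt x)))"
  unfolding mu4_def using assms by (simp add: P0.Th_smult om_closed Th_om)

lemma tw_simps: "carrier (A_twisted G W \<sigma>) = carrier A" "add (A_twisted G W \<sigma>) = add A"
  "zero (A_twisted G W \<sigma>) = zero A" "a \<odot>\<^bsub>A_twisted G W \<sigma>\<^esub> x = a \<cdot> x"
  "x \<odot>r\<^bsub>A_twisted G W \<sigma>\<^esub> a = x \<cdot> \<sigma> a" "grading (A_twisted G W \<sigma>) = gr"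
  by (simp_all add: A_twisted_def ring_bimod_simps)

lemma tw_bim: "bimodule A A (A_twisted G W sg)"
  unfolding A_twisted_def
  by (rule ring_bimod_bimodule) (auto simp: A_ring sg_add sg_mult sg_one)

lemma mu4_add: "x \<in> carrier A \<Longrightarrow> y \<in> carrier A \<Longrightarrow> mu4 (x \<oplus>\<^bsub>A\<^esub> y) = mu4 x \<oplus>\<^bsub>B0\<^esub> mu4 y"
  unfolding mu4_def by (rule bimodule.smult_l_distr[OF P0.bim _ _ om_closed])

lemma mu4_l: "w \<in> carrier A \<Longrightarrow> x \<in> carrier A \<Longrightarrow> mu4 (w \<cdot> x) = w \<odot>\<^bsub>B0\<^esub> mu4 x"
  unfolding mu4_def by (rule bimodule.smult_assoc[OF P0.bim _ _ om_closed])

text \<open>The origin of the twist: right multiplication by \<open>w\<close> puts its preimage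
  under \<beta> in front of \<open>g\<close>; \<open>f\<close> moves this to the end as
  \<open>w\<close>, behind \<beta>(x), where it can be absorbed into the argument of
  \<beta>.\<close>

lemma mu4_r:
  assumes w: "w \<in> carrier A" and x: "x \<in> carrier A"
  shows "mu4 (x \<cdot> sg w) = mu4 x \<odot>r\<^bsub>B0\<^esub> w"
proof (rule P0.Th_inj)
  show "mu4 (x \<cdot> sg w) \<in> carrier B0" "mu4 x \<odot>r\<^bsub>B0\<^esub> w \<in> carrier B0"
    using assms by (auto intro!: mu4_closed P0.rsmult_closed)
  fix v u g assume v: "v \<in> verts G" "u \<in> carrier A" "g \<in> carrier A"
  have "f (sg w \<cdot> (g \<cdot> (ve v \<cdot> (u \<cdot> bt x)))) = f (g \<cdot> (ve v \<cdot> (u \<cdot> bt x)) \<cdot> w)"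
    by (rule f_sg) (use assms v in auto)
  then show "ThA (mu4 (x \<cdot> sg w)) v u g = ThA (mu4 x \<odot>r\<^bsub>B0\<^esub> w) v u g"
    using assms v by (simp add: Th_mu4 P0.Th_rsmult mu4_closed bt_mult A.m_assoc)
qed

lemma mu4_hom: "mu4 \<in> bimod_hom A A (A_twisted G W sg) B0"
  unfolding bimod_hom_def
proof (intro CollectI conjI ballI funcsetI)
  fix m b assume "m \<in> carrier (A_twisted G W sg)" "b \<in> carrier A"
  then show "mu4 (m \<odot>r\<^bsub>A_twisted G W sg\<^esub> b) = mu4 m \<odot>r\<^bsub>B0\<^esub> b"
    unfolding tw_simps by (rule mu4_r[rotated])
qed (simp_all add: tw_bim P0.bim tw_simps mu4_closed mu4_add mu4_l)

lemma smult_grading: "z \<in> grading B0 n \<Longrightarrow> x \<in> gr p \<Longrightarrow> x \<odot>\<^bsub>B0\<^esub> z \<in> grading B0 (p + n)"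
proof (rule P0.grading_span[of z n "\<lambda>z. x \<odot>\<^bsub>B0\<^esub> z \<in> grading B0 (p + n)"])
  assume x: "x \<in> gr p"
  then have xc: "x \<in> carrier A" by (rule gr_closed)
  show "x \<odot>\<^bsub>B0\<^esub> \<zero>\<^bsub>B0\<^esub> \<in> grading B0 (p + n)" using xc by (simp add: P0.smult_zero P0.grading_zero)
  show "x \<odot>\<^bsub>B0\<^esub> tA (y \<cdot> ve v) y' \<in> grading B0 (p + n)"
    if "y \<in> gr q" "v \<in> verts G" "y' \<in> gr q'" "q + q' + 0 = n" for y v y' q q'
  proof -
    have "tA (x \<cdot> (y \<cdot> ve v)) y' \<in> grading B0 (p + (q + 0) + q')"
      by (intro tA_grading gr_mult x that gr_ve)
    then show ?thesis using that xc by (auto simp: tA_smult ac_simps)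
  qed
  show "x \<odot>\<^bsub>B0\<^esub> (z \<oplus>\<^bsub>B0\<^esub> z') \<in> grading B0 (p + n)"
    if "z \<in> carrier B0" "z' \<in> carrier B0" "x \<odot>\<^bsub>B0\<^esub> z \<in> grading B0 (p + n)" "x \<odot>\<^bsub>B0\<^esub> z' \<in> grading B0 (p + n)" for z z'
    using that xc bimodule.smult_r_distr[OF P0.bim xc] by (simp add: P0.grading_add)
qed

lemma om_grading: "om \<in> grading B0 (h - 3)"
  unfolding om_def
proof (rule P0.grading_finsum[OF finite_B])
  fix b assume b: "b \<in> B"
  have "tA b (d b) \<in> grading B0 (dg b + (h - 3 - dg b))"
    by (rule tA_grading[OF dg[OF b] d_gr[OF b]])
  moreover have "dg b + (h - 3 - dg b) = h - 3" using dg_le[OF b] by simp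
  ultimately show "tA b (d b) \<in> grading B0 (h - 3)" by (simp only:)
qed

lemma mu4_ok: "mu4_spec G W h sg B d mu4"
  unfolding mu4_spec_def graded_hom_def
proof (intro conjI CollectI ballI allI bimod_hom_shift(1) mu4_hom)
  fix p
  have z: "mu4 \<zero>\<^bsub>A\<^esub> = \<zero>\<^bsub>B0\<^esub>"
    using mu4_add[of "\<zero>\<^bsub>A\<^esub>" "\<zero>\<^bsub>A\<^esub>"] by (intro P0.P_zero_eqI mu4_closed) auto
  show "mu4 ` grading (shift h (A_twisted G W sg)) p \<subseteq> grading (shift 3 B0) p"
  proof (cases "h \<le> p")
    case True
    \<comment> \<open>The degrees add up: (p - h) + (h - 3) = p - 3, the summand h - 3 being the
      degree of \<open>om\<close>.\<close>
    have "mu4 x \<in> grading B0 (p - 3)" if "x \<in> gr (p - h)" for x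
      using smult_grading[OF om_grading that] True h4 unfolding mu4_def by simp
    then show ?thesis using True h4 by (auto simp: shift_def tw_simps)
  next
    case False
    have "\<zero>\<^bsub>shift 3 B0\<^esub> = \<zero>\<^bsub>B0\<^esub>" by (simp add: shift_def)
    then show ?thesis using False by (auto simp: shift_def tw_simps z P0.grading_zero)
  qed
  fix x show "mu4 x = x \<odot>\<^bsub>B0\<^esub> finsum B0 (\<lambda>b. tA b (d b)) B" by (simp add: mu4_def om_def)
qed

text \<open>The form of \<mu>4(x) at u = 1, summed over the vertices, is f (g \<beta>(x)). This
  determines \<beta>(x) and hence x.\<close>

lemma mu4_inj: "inj_on mu4 (carrier A)"
proof (rule inj_onI)
  fix x x' assume x: "x \<in> carrier A" "x' \<in> carrier A" and eq: "mu4 x = mu4 x'"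
  have s: "f (g \<cdot> bt y) = (\<Sum>v\<in>verts G. ThA (mu4 y) v \<one>\<^bsub>A\<^esub> g)" if "g \<in> carrier A" "y \<in> carrier A" for g y
    using that f_ve_sum[of g "bt y"] by (simp add: Th_mu4)
  have "bt x = bt x'"
    by (rule f_eqI_r) (use x eq s in auto)
  then show "x = x'" using bt_bij x by (auto simp: bij_betw_def inj_on_def)
qed

text \<open>A single form on all of \<open>A\<close> in place of one for each vertex. The components
  are recovered by inserting vertices, and \<open>m3\<close> becomes the commutator in
  \<open>m3_tb\<close>.\<close>

definition tb where "tb z u g = (\<Sum>v\<in>verts G. ThA z v u g)"

lemma ThA_ve_l:
  assumes z: "z \<in> carrier B0" and v: "v \<in> verts G" "w \<in> verts G" "u \<in> carrier A" "g \<in> carrier A"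
  shows "ThA z v (ve w \<cdot> u) g = (if v = w then ThA z v u g else 0)"
proof (cases "v = w")
  case True
  then show ?thesis using P0.formD(3)[OF P0.form_Th[OF z] v(1)] v by simp
next
  case False
  have "ThA z v (ve w \<cdot> u) g = ThA z v (ve v \<cdot> (ve w \<cdot> u)) g"
    using P0.formD(3)[OF P0.form_Th[OF z] v(1)] v by simp
  also have "ve v \<cdot> (ve w \<cdot> u) = \<zero>\<^bsub>A\<^esub>" using v False by (simp add: A.m_assoc[symmetric] ve_ve)
  finally show ?thesis
    using lfun_zero[OF P0.formD(1)[OF P0.form_Th[OF z] v(1,4)]] False by simp
qed

lemma ThA_ve_r:
  assumes z: "z \<in> carrier B0" and v: "v \<in> verts G" "w \<in> verts G" "u \<in> carrier A" "g \<in> carrier A"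
  shows "ThA z v u (g \<cdot> ve w) = (if v = w then ThA z v u g else 0)"
proof (cases "v = w")
  case True
  then show ?thesis using P0.formD(4)[OF P0.form_Th[OF z] v(1)] v by simp
next
  case False
  have "ThA z v u (g \<cdot> ve w) = ThA z v u (g \<cdot> ve w \<cdot> ve v)"
    using P0.formD(4)[OF P0.form_Th[OF z] v(1)] v by simp
  also have "g \<cdot> ve w \<cdot> ve v = \<zero>\<^bsub>A\<^esub>" using v False by (simp add: A.m_assoc ve_ve)
  finally show ?thesis
    using lfun_zero[OF P0.formD(2)[OF P0.form_Th[OF z] v(1,3)]] False by simp
qed

lemma tb_lfun:
  assumes z: "z \<in> carrier B0"
  shows "g \<in> carrier A \<Longrightarrow> lfun (\<lambda>u. tb z u g)" "u \<in> carrier A \<Longrightarrow> lfun (tb z u)"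
  unfolding tb_def
  by (intro lfun_sum P0.formD(1)[OF P0.form_Th[OF z]]; simp)
    (intro lfun_sum P0.formD(2)[OF P0.form_Th[OF z]]; simp)

lemma tb_ve_l:
  "z \<in> carrier B0 \<Longrightarrow> v \<in> verts G \<Longrightarrow> u \<in> carrier A \<Longrightarrow> g \<in> carrier A \<Longrightarrow> tb z (ve v \<cdot> u) g = ThA z v u g"
  unfolding tb_def by (simp add: ThA_ve_l)

lemma tb_ve_r:
  "z \<in> carrier B0 \<Longrightarrow> v \<in> verts G \<Longrightarrow> u \<in> carrier A \<Longrightarrow> g \<in> carrier A \<Longrightarrow> tb z u (g \<cdot> ve v) = ThA z v u g"
  unfolding tb_def by (simp add: ThA_ve_r)

lemma tb_ae_l:
  "z \<in> carrier B0 \<Longrightarrow> a \<in> arcs G \<Longrightarrow> u \<in> carrier A \<Longrightarrow> g \<in> carrier A \<Longrightarrow>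
    tb z (ae a \<cdot> u) g = ThA z (tail G a) (ae a \<cdot> u) g"
  using tb_ve_l[of z "tail G a" "ae a \<cdot> u" g] by (simp add: tail_ae)

lemma tb_ae_r:
  "z \<in> carrier B0 \<Longrightarrow> a \<in> arcs G \<Longrightarrow> u \<in> carrier A \<Longrightarrow> g \<in> carrier A \<Longrightarrow>
    tb z u (g \<cdot> ae a) = ThA z (head G a) u (g \<cdot> ae a)"
  using tb_ve_r[of z "head G a" u "g \<cdot> ae a"] by (simp add: A.m_assoc ae_ve)

lemma m3_tb:
  "z \<in> carrier B0 \<Longrightarrow> a \<in> arcs G \<Longrightarrow> u \<in> carrier A \<Longrightarrow> g \<in> carrier A \<Longrightarrow>
    m3 (ThA z) a u g = tb z (ae a \<cdot> u) g - tb z u (g \<cdot> ae a)"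
  by (simp add: m3_def tb_ae_l tb_ae_r)

lemma exact3: "mu4 ` carrier A = a_kernel B0 B2 M3.mu"
proof
  show "mu4 ` carrier A \<subseteq> a_kernel B0 B2 M3.mu"
  proof
    fix z assume "z \<in> mu4 ` carrier A"
    then obtain x where x: "x \<in> carrier A" "z = mu4 x" by auto
    have "M3.mu z = \<zero>\<^bsub>B2\<^esub>"
    proof (rule M3.mu_eqI)
      fix a u g assume a: "a \<in> arcs G" "u \<in> carrier A" "g \<in> carrier A"
      show "Th2 \<zero>\<^bsub>B2\<^esub> a u g = m3 (ThA z) a u g"
        using a x by (simp add: m3_def Th_mu4 P2.Th_zero A.m_assoc ae_head tail_ae)
    qed (use x mu4_closed in auto)
    then show "z \<in> a_kernel B0 B2 M3.mu" using x mu4_closed by (simp add: a_kernel_def')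
  qed
  show "a_kernel B0 B2 M3.mu \<subseteq> mu4 ` carrier A"
  proof
    fix z assume "z \<in> a_kernel B0 B2 M3.mu"
    then have z: "z \<in> carrier B0" "M3.mu z = \<zero>\<^bsub>B2\<^esub>" by (auto simp: a_kernel_def')
    have comm: "tb z (ae a \<cdot> u) g = tb z u (g \<cdot> ae a)"
      if "a \<in> arcs G" "u \<in> carrier A" "g \<in> carrier A" for a u g
      using M3.Th_mu[OF z(1) that] that z by (simp add: m3_tb P2.Th_zero)
    \<comment> \<open>Commuting with all arcs implies commuting with all of \<open>A\<close>, so the
      form is determined by the functional obtained at u = 1.\<close>
    have full: "tb z (w \<cdot> u) g = tb z u (g \<cdot> w)"
      if "w \<in> carrier A" "u \<in> carrier A" "g \<in> carrier A" for w u g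
      using that
    proof (induction w arbitrary: u g rule: A_induct)
      case zero
      then show ?case using lfun_zero[OF tb_lfun(1)[OF z(1), of g]] lfun_zero[OF tb_lfun(2)[OF z(1), of u]] by simp
    next
      case (vert v c)
      then have "tb z (sc c \<cdot> (ve v \<cdot> u)) g = c * tb z (ve v \<cdot> u) g"
        "tb z u (sc c \<cdot> (g \<cdot> ve v)) = c * tb z u (g \<cdot> ve v)"
        using lfun_sc[OF tb_lfun(1)[OF z(1), of g]] lfun_sc[OF tb_lfun(2)[OF z(1), of u]] by simp_all
      then show ?case using vert z(1) by (simp add: A.m_assoc sc_pull tb_ve_l tb_ve_r)
    next
      case (arc a x)
      then show ?case using arc.IH[of u "g \<cdot> ae a"] comm[of a "x \<cdot> u" g] by (simp add: A.m_assoc)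
    next
      case (add x y)
      then show ?case
        using lfun_add[OF tb_lfun(1)[OF z(1), of g]] lfun_add[OF tb_lfun(2)[OF z(1), of u]]
        by (simp add: A.l_distr A.r_distr)
    qed
    \<comment> \<open>That functional is pairing with \<open>y\<close>. As \<mu>4(x) has the form f
      (g v u \<beta>(x)), the preimage is the inverse image of \<open>y\<close> under
      \<beta>.\<close>
    obtain y where y: "y \<in> carrier A" "\<And>g. g \<in> carrier A \<Longrightarrow> f (g \<cdot> y) = tb z \<one>\<^bsub>A\<^esub> g"
      using representing_element[OF tb_lfun(2)[OF z(1), of "\<one>\<^bsub>A\<^esub>"]] by auto
    have "z = mu4 (sg y)"
    proof (rule P0.Th_inj[OF z(1) mu4_closed])
      fix v u g assume v: "v \<in> verts G" "u \<in> carrier A" "g \<in> carrier A"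
      have "ThA z v u g = tb z (ve v \<cdot> u \<cdot> \<one>\<^bsub>A\<^esub>) g" using v z by (simp add: tb_ve_l)
      also have "\<dots> = f (g \<cdot> (ve v \<cdot> u) \<cdot> y)" using v y full[of "ve v \<cdot> u" "\<one>\<^bsub>A\<^esub>" g] by simp
      finally show "ThA z v u g = ThA (mu4 (sg y)) v u g"
        using v y by (simp add: Th_mu4 A.m_assoc)
    qed (use y in auto)
    then show "z \<in> mu4 ` carrier A" using y by auto
  qed
qed

lemma exact2: "M3.mu ` carrier B0 = a_kernel B2 B1 M2.mu"
proof
  show "M3.mu ` carrier B0 \<subseteq> a_kernel B2 B1 M2.mu"
  proof
    fix Z assume "Z \<in> M3.mu ` carrier B0"
    then obtain z where z: "z \<in> carrier B0" "Z = M3.mu z" by auto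
    have "M2.mu Z = \<zero>\<^bsub>B1\<^esub>"
    proof (rule M2.mu_eqI)
      show "Z \<in> carrier B2" using z M3.mu_closed by simp
      fix c u g assume c: "c \<in> arcs G" "u \<in> carrier A" "g \<in> carrier A"
      have l1: "lfun (\<lambda>x. tb z (x \<cdot> u) g)" and l2: "lfun (\<lambda>x. tb z u (g \<cdot> x))"
        using lfun_mult_r[OF tb_lfun(1)[OF z(1) c(3)] c(2)] lfun_mult_l[OF tb_lfun(2)[OF z(1) c(2)] c(3)] .
      \<comment> \<open>The mixed terms at (b' u, g b) cancel. The remaining ones are the relation
        of \<open>c\<close> inserted in the first and in the second argument.\<close>
      have "m2 (Th2 Z) c u g = (\<Sum>b\<in>arcs G. \<Sum>b'\<in>arcs G.
          W c b b' * tb z (ae b \<cdot> ae b' \<cdot> u) g - W c b b' * tb z u (g \<cdot> (ae b \<cdot> ae b')))"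
        unfolding m2_def
        by (intro sum.cong[OF refl]) (use z c in \<open>simp add: M3.Th_mu m3_tb A.m_assoc algebra_simps\<close>)
      also have "\<dots> = 0"
        using rel_fun[OF l1, of c] rel_fun[OF l2, of c] by (simp add: sum_subtractf)
      finally show "Th1 \<zero>\<^bsub>B1\<^esub> c u g = m2 (Th2 Z) c u g" using c by (simp add: P1.Th_zero)
    qed simp
    then show "Z \<in> a_kernel B2 B1 M2.mu" using z M3.mu_closed by (simp add: a_kernel_def')
  qed
  show "a_kernel B2 B1 M2.mu \<subseteq> M3.mu ` carrier B0"
  proof
    fix Z assume "Z \<in> a_kernel B2 B1 M2.mu"
    then have Z: "Z \<in> carrier B2" "M2.mu Z = \<zero>\<^bsub>B1\<^esub>" by (auto simp: a_kernel_def')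
    note F = P2.formD[OF P2.form_Th[OF Z(1)]]
    have cyc: "(\<Sum>b\<in>arcs G. \<Sum>b'\<in>arcs G. W c b b' * (Th2 Z b (ae b' \<cdot> u) g + Th2 Z b' u (g \<cdot> ae b))) = 0"
      if "c \<in> arcs G" "u \<in> carrier A" "g \<in> carrier A" for c u g
      using M2.Th_mu[OF Z(1) that] that Z(2) by (simp add: m2_def P1.Th_zero)
    obtain \<tau> where \<tau>u: "\<And>g. g \<in> carrier A \<Longrightarrow> lfun (\<lambda>u. \<tau> u g)" and \<tau>g: "\<And>u. u \<in> carrier A \<Longrightarrow> lfun (\<tau> u)"
      and \<tau>: "\<And>a u g. a \<in> arcs G \<Longrightarrow> u \<in> carrier A \<Longrightarrow> g \<in> carrier A \<Longrightarrow>
        \<tau> (ae a \<cdot> u) g = Th2 Z a u g + \<tau> u (g \<cdot> ae a)"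
    proof (rule derivation_exists[of "Th2 Z"], goal_cases)
      case (1 a g)
      show ?case by (rule F(1); fact 1)
    next
      case (2 a u)
      show ?case by (rule F(2); fact 2)
    next
      case (3 a u g)
      show ?case by (rule F(3); fact 3)
    next
      case (4 a u g)
      show ?case by (rule F(4); fact 4)
    next
      case (5 c u g)
      show ?case by (rule cyc; fact 5)
    next
      case (6 \<tau>)
      show ?case by (rule that[OF 6(2-4)])
    qed
    \<comment> \<open>The solution of the Leibniz rule is a form on all of \<open>A\<close>. Cutting
      it with \<open>v\<close> on both sides gives an element of the space of forms.\<close>
    define t where "t v u g = \<tau> (ve v \<cdot> u) (g \<cdot> ve v)" for v u g
    have t: "P0.form t"
      unfolding P0.form_def t_def
    proof (intro ballI conjI)
      fix v g assume "v \<in> verts G" "g \<in> carrier A"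
      then show "lfun (\<lambda>u. \<tau> (ve v \<cdot> u) (g \<cdot> ve v))"
        by (intro lfun_mult_l[of "\<lambda>u. \<tau> u (g \<cdot> ve v)"] \<tau>u) auto
    next
      fix v u assume "v \<in> verts G" "u \<in> carrier A"
      then show "lfun (\<lambda>g. \<tau> (ve v \<cdot> u) (g \<cdot> ve v))"
        by (intro lfun_mult_r[of "\<tau> (ve v \<cdot> u)"] \<tau>g) auto
    qed (simp_all add: ve_ve_l ve_ve_r)
    have "M3.mu (P0.Rz t) = Z"
    proof (rule M3.mu_eqI[OF P0.Rz_closed Z(1)])
      fix a u g assume a: "a \<in> arcs G" "u \<in> carrier A" "g \<in> carrier A"
      have "m3 (ThA (P0.Rz t)) a u g = m3 t a u g"
        by (rule M3.m_cong[OF a]) (rule P0.Th_Rz[OF t])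
      also have "\<dots> = \<tau> (ae a \<cdot> (ve (head G a) \<cdot> u)) (g \<cdot> ve (tail G a))
          - \<tau> (ve (head G a) \<cdot> u) (g \<cdot> ve (tail G a) \<cdot> ae a)"
        using a by (simp add: m3_def t_def tail_ae ae_head ae_tail A.m_assoc ae_ve ve_ae)
      also have "\<dots> = Th2 Z a (ve (head G a) \<cdot> u) (g \<cdot> ve (tail G a))"
        using a by (subst \<tau>) auto
      also have "\<dots> = Th2 Z a u g" using a F(3,4)[OF a(1)] by simp
      finally show "Th2 Z a u g = m3 (ThA (P0.Rz t)) a u g" by simp
    qed
    then show "Z \<in> M3.mu ` carrier B0" using P0.Rz_closed by blast
  qed
qed

text \<open>Four groups of terms appear. Two contain both arcs in the same argument and vanish by
  the relations after rotating \<open>W\<close>; the two mixed groups coincide by cyclic symmetry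
  and have opposite signs.\<close>

lemma mu1_mu2:
  assumes Z: "Z \<in> carrier B2"
  shows "M1.mu (M2.mu Z) = \<zero>\<^bsub>B0\<^esub>"
proof (rule M1.mu_eqI[OF M2.mu_closed])
  note F = P2.formD[OF P2.form_Th[OF Z]]
  fix v u0 g0 assume v: "v \<in> verts G" "u0 \<in> carrier A" "g0 \<in> carrier A"
  define u where "u = ve v \<cdot> u0"
  define g where "g = g0 \<cdot> ve v"
  have ug: "u \<in> carrier A" "g \<in> carrier A" using v by (auto simp: u_def g_def)
  let ?t = "Th2 Z"
  let ?S = "\<lambda>k. \<Sum>c\<in>arcs G. \<Sum>b\<in>arcs G. \<Sum>b'\<in>arcs G. k c b b'"
  have 1: "?S (\<lambda>c b b'. W c b b' * ?t b (ae b' \<cdot> ae c \<cdot> u) g) = 0"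
  proof -
    have "?S (\<lambda>c b b'. W c b b' * ?t b (ae b' \<cdot> ae c \<cdot> u) g)
      = ?S (\<lambda>c b b'. W b b' c * ?t b (ae b' \<cdot> ae c \<cdot> u) g)"
      by (intro sum.cong[OF refl] arg_cong2[where f = "(*)"] W_cyc refl)
    also have "\<dots> = (\<Sum>b\<in>arcs G. \<Sum>b'\<in>arcs G. \<Sum>c\<in>arcs G. W b b' c * ?t b (ae b' \<cdot> ae c \<cdot> u) g)"
      by (rule sum_rot3[symmetric])
    also have "\<dots> = 0"
    proof (rule sum.neutral, rule ballI)
      fix b assume b: "b \<in> arcs G"
      have "lfun (\<lambda>x. ?t b (x \<cdot> u) g)"
        by (rule lfun_mult_r[OF F(1)[OF b ug(2)] ug(1)])
      from rel_fun[OF this, of b] show "(\<Sum>b'\<in>arcs G. \<Sum>c\<in>arcs G. W b b' c * ?t b (ae b' \<cdot> ae c \<cdot> u) g) = 0" by (simp only:)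
    qed
    finally show ?thesis .
  qed
  have 4: "?S (\<lambda>c b b'. W c b b' * ?t b' u (g \<cdot> (ae c \<cdot> ae b))) = 0"
  proof -
    have "?S (\<lambda>c b b'. W c b b' * ?t b' u (g \<cdot> (ae c \<cdot> ae b)))
      = (\<Sum>b'\<in>arcs G. \<Sum>c\<in>arcs G. \<Sum>b\<in>arcs G. W c b b' * ?t b' u (g \<cdot> (ae c \<cdot> ae b)))"
      by (rule sum_rot3)
    also have "\<dots> = (\<Sum>b'\<in>arcs G. \<Sum>c\<in>arcs G. \<Sum>b\<in>arcs G. W b' c b * ?t b' u (g \<cdot> (ae c \<cdot> ae b)))"
      by (intro sum.cong[OF refl] arg_cong2[where f = "(*)"] W_cyc[symmetric] refl)
    also have "\<dots> = 0"
    proof (rule sum.neutral, rule ballI)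
      fix b assume b: "b \<in> arcs G"
      have "lfun (\<lambda>x. ?t b u (g \<cdot> x))"
        by (rule lfun_mult_l[OF F(2)[OF b ug(1)] ug(2)])
      from rel_fun[OF this, of b] show "(\<Sum>c\<in>arcs G. \<Sum>c'\<in>arcs G. W b c c' * ?t b u (g \<cdot> (ae c \<cdot> ae c'))) = 0" by (simp only:)
    qed
    finally show ?thesis .
  qed
  have 23: "?S (\<lambda>c b b'. W c b b' * ?t b' (ae c \<cdot> u) (g \<cdot> ae b))
    = ?S (\<lambda>c b b'. W c b b' * ?t b (ae b' \<cdot> u) (g \<cdot> ae c))"
  proof -
    have "?S (\<lambda>c b b'. W c b b' * ?t b' (ae c \<cdot> u) (g \<cdot> ae b))
      = ?S (\<lambda>c b b'. W b b' c * ?t b' (ae c \<cdot> u) (g \<cdot> ae b))"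
      by (intro sum.cong[OF refl] arg_cong2[where f = "(*)"] W_cyc refl)
    also have "\<dots> = ?S (\<lambda>c b b'. W c b b' * ?t b (ae b' \<cdot> u) (g \<cdot> ae c))"
      by (rule sum_rot3[symmetric])
    finally show ?thesis .
  qed
  have "m1 (Th1 (M2.mu Z)) v u0 g0 = m1 (m2 ?t) v u0 g0"
    by (rule M1.m_cong[OF v]) (rule M2.Th_mu[OF Z])
  also have "\<dots> = ?S (\<lambda>c b b'. W c b b' * ?t b (ae b' \<cdot> ae c \<cdot> u) g)
     + ?S (\<lambda>c b b'. W c b b' * ?t b' (ae c \<cdot> u) (g \<cdot> ae b))
     - ?S (\<lambda>c b b'. W c b b' * ?t b (ae b' \<cdot> u) (g \<cdot> ae c))
     - ?S (\<lambda>c b b'. W c b b' * ?t b' u (g \<cdot> (ae c \<cdot> ae b)))"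
    unfolding m1_def m2_def u_def[symmetric] g_def[symmetric] sum.distrib[symmetric] sum_subtractf[symmetric]
    by (intro sum.cong[OF refl]) (use ug in \<open>simp add: A.m_assoc algebra_simps\<close>)
  also have "\<dots> = 0" by (simp only: 1 23 4) simp
  finally show "ThA \<zero>\<^bsub>B0\<^esub> v u0 g0 = m1 (Th1 (M2.mu Z)) v u0 g0" using v by (simp add: P0.Th_zero)
qed simp

text \<open>A functional that separates an element of the kernel from the image yields a family \<open>T\<close>
  compatible with the relations; the resulting \<open>\<tau>\<close> shows that the functional factors through
  \<open>\<mu>\<^sub>1\<close>, a contradiction.\<close>

lemma exact1: "M2.mu ` carrier B2 = a_kernel B1 B0 M1.mu"
proof
  show "M2.mu ` carrier B2 \<subseteq> a_kernel B1 B0 M1.mu"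
    using mu1_mu2 M2.mu_closed by (auto simp: a_kernel_def')
  show "a_kernel B1 B0 M1.mu \<subseteq> M2.mu ` carrier B2"
  proof (rule subsetI, rule ccontr)
    fix z assume "z \<in> a_kernel B1 B0 M1.mu" and nz: "z \<notin> M2.mu ` carrier B2"
    then have z: "z \<in> carrier B1" "M1.mu z = \<zero>\<^bsub>B0\<^esub>" by (auto simp: a_kernel_def')
    \<comment> \<open>Coordinates: the form of an element, extended by 0, as a function on triples.
      The image of \<mu>2 becomes a subspace of a space of functions, where functionals are
      available.\<close>
    define co where "co z = (\<lambda>(k, u, g). if k \<in> arcs G \<and> u \<in> carrier A \<and> g \<in> carrier A then Th1 z k u g else 0)" for z
    have co_add: "co (z \<oplus>\<^bsub>B1\<^esub> z') = (\<lambda>i. co z i + co z' i)" if "z \<in> carrier B1" "z' \<in> carrier B1" for z z'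
      unfolding co_def using that by (auto simp: P1.Th_add fun_eq_iff)
    have co_sc: "co (sc c \<odot>\<^bsub>B1\<^esub> z) = (\<lambda>i. c * co z i)" if "z \<in> carrier B1" for c z
      unfolding co_def using that by (auto simp: P1.Th_sc fun_eq_iff)
    have co_inj: "z = z'" if "co z = co z'" "z \<in> carrier B1" "z' \<in> carrier B1" for z z'
    proof (rule P1.Th_inj[OF that(2,3)])
      fix k u g assume "k \<in> arcs G" "u \<in> carrier A" "g \<in> carrier A"
      then show "Th1 z k u g = Th1 z' k u g" using fun_cong[OF that(1), of "(k, u, g)"] by (simp add: co_def)
    qed
    let ?J = "(\<lambda>Z. co (M2.mu Z)) ` carrier B2"
    have mh: "M2.mu (sc c \<odot>\<^bsub>B2\<^esub> Z) = sc c \<odot>\<^bsub>B1\<^esub> M2.mu Z" if "Z \<in> carrier B2" for c Z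
      using M2.mu_hom that unfolding bimod_hom_def by simp
    have co0: "co (M2.mu \<zero>\<^bsub>B2\<^esub>) = (\<lambda>_. 0)"
      unfolding co_def M2.mu_zero by (auto simp: P1.Th_zero fun_eq_iff)
    have J0: "(\<lambda>_. 0) \<in> ?J" by (rule image_eqI[where x = "\<zero>\<^bsub>B2\<^esub>"]) (simp_all add: co0)
    have Ja: "(\<lambda>i. x i + y i) \<in> ?J" if "x \<in> ?J" "y \<in> ?J" for x y
    proof -
      obtain Z Z' where "Z \<in> carrier B2" "x = co (M2.mu Z)" "Z' \<in> carrier B2" "y = co (M2.mu Z')"
        using \<open>x \<in> ?J\<close> \<open>y \<in> ?J\<close> by auto
      then show ?thesis
        by (intro image_eqI[of _ _ "Z \<oplus>\<^bsub>B2\<^esub> Z'"]) (simp_all add: M2.mu_add co_add M2.mu_closed)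
    qed
    have Js: "(\<lambda>i. c * x i) \<in> ?J" if "x \<in> ?J" for c x
    proof -
      obtain Z where "Z \<in> carrier B2" "x = co (M2.mu Z)" using \<open>x \<in> ?J\<close> by auto
      then show ?thesis
        by (intro image_eqI[of _ _ "sc c \<odot>\<^bsub>B2\<^esub> Z"]) (simp_all add: mh co_sc M2.mu_closed P2.smult_closed)
    qed
    have nJ: "co z \<notin> ?J"
    proof
      assume "co z \<in> ?J"
      then obtain Z where "Z \<in> carrier B2" "co z = co (M2.mu Z)" by auto
      then show False using co_inj[OF _ z(1) M2.mu_closed] nz by blast
    qed
    obtain l where l: "\<And>x y. l (\<lambda>i. x i + y i) = l x + l y" "\<And>c x. l (\<lambda>i. c * x i) = c * l x"
      "\<And>x. x \<in> ?J \<Longrightarrow> l x = 0" "l (co z) \<noteq> 0"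
    proof (rule separating_functional[where J = ?J and w = "co z"], goal_cases)
      case 1
      show ?case by (rule J0)
    next
      case (2 x y)
      show ?case by (rule Ja; fact 2)
    next
      case (3 c x)
      show ?case by (rule Js; fact 3)
    next
      case 4
      show ?case by (rule nJ)
    next
      case (5 l)
      show ?case by (rule that[OF 5(2-5)])
    qed
    define L where "L z = l (co z)" for z
    have L_add: "L (z \<oplus>\<^bsub>B1\<^esub> z') = L z + L z'" if "z \<in> carrier B1" "z' \<in> carrier B1" for z z'
      unfolding L_def co_add[OF that] by (rule l(1))
    have L_sc: "L (sc c \<odot>\<^bsub>B1\<^esub> z) = c * L z" if "z \<in> carrier B1" for c z
      unfolding L_def co_sc[OF that] by (rule l(2))
    have L_zero: "L \<zero>\<^bsub>B1\<^esub> = 0" using L_add[of "\<zero>\<^bsub>B1\<^esub>" "\<zero>\<^bsub>B1\<^esub>"] by simp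
    have L_mu: "L (M2.mu Z) = 0" if "Z \<in> carrier B2" for Z
      unfolding L_def by (rule l(3)) (use that in blast)
    have L_fin: "L (finsum B1 k S) = (\<Sum>i\<in>S. L (k i))" if "finite S" "\<And>i. i \<in> S \<Longrightarrow> k i \<in> carrier B1"
      for k and S :: "('e \<times> 'e) set"
      using that
    proof (induction S rule: finite_induct)
      case (insert i S)
      then have "finsum B1 k (insert i S) = k i \<oplus>\<^bsub>B1\<^esub> finsum B1 k S"
        by (intro P1.P.finsum_insert) auto
      then show ?case using insert L_add[of "k i" "finsum B1 k S"] P1.P_sum_closed[of S k] by simp
    qed (simp add: L_zero)
    \<comment> \<open>The functional on pure tensors, with the right factor \<open>y\<close> in the
      role of \<open>u\<close> and the left factor \<open>x\<close> in that of \<open>g\<close>.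
      That it kills the image of \<mu>2 is the hypothesis \<open>cyc\<close>.\<close>
    define T where "T a y x = L (t1 x a y)" for a y x
    have Tl: "lfun (\<lambda>y. T a y x)" if "a \<in> arcs G" "x \<in> carrier A" for a x
    proof (rule lfunI)
      fix y y' assume "y \<in> carrier A" "y' \<in> carrier A"
      then show "T a (y \<oplus>\<^bsub>A\<^esub> y') x = T a y x + T a y' x"
        unfolding T_def using that by (simp add: P1.gm_add_r L_add)
    next
      fix c y assume "y \<in> carrier A"
      then show "T a (sc c \<cdot> y) x = c * T a y x"
        unfolding T_def using that P1.gm_sc[of x a y c] P1.gm_smult[of "sc c" x a y] L_sc[of "t1 x a y" c] by simp
    qed
    have Tr: "lfun (T a y)" if "a \<in> arcs G" "y \<in> carrier A" for a y
    proof (rule lfunI)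
      fix x x' assume "x \<in> carrier A" "x' \<in> carrier A"
      then show "T a y (x \<oplus>\<^bsub>A\<^esub> x') = T a y x + T a y x'"
        unfolding T_def using that by (simp add: P1.gm_add_l L_add)
    next
      fix c x assume "x \<in> carrier A"
      then show "T a y (sc c \<cdot> x) = c * T a y x"
        unfolding T_def using that P1.gm_smult[of "sc c" x a y] L_sc[of "t1 x a y" c] by simp
    qed
    have Th: "T a (ve (head G a) \<cdot> y) x = T a y x" "T a y (x \<cdot> ve (tail G a)) = T a y x"
      if "a \<in> arcs G" "y \<in> carrier A" "x \<in> carrier A" for a y x
      unfolding T_def using that by (simp_all add: P1.gm_r P1.gm_s)
    have cyc: "(\<Sum>b\<in>arcs G. \<Sum>b'\<in>arcs G. W c b b' * (T b (ae b' \<cdot> y) x + T b' y (x \<cdot> ae b))) = 0"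
      if c: "c \<in> arcs G" and y: "y \<in> carrier A" and x: "x \<in> carrier A" for c y x
    proof -
      have cl: "t1 (x \<cdot> ae b) b' y \<in> carrier B1" "t1 x b (ae b' \<cdot> y) \<in> carrier B1"
        if "b \<in> arcs G" "b' \<in> arcs G" for b b' using that x y by auto
      have "0 = L (M2.mu (t2 x c y))" using L_mu x c y by simp
      also have "\<dots> = (\<Sum>i\<in>arcs G \<times> arcs G. L (case i of (b, b') \<Rightarrow> sc (W c b b') \<odot>\<^bsub>B1\<^esub>
         (t1 (x \<cdot> ae b) b' y \<oplus>\<^bsub>B1\<^esub> t1 x b (ae b' \<cdot> y))))"
        unfolding mu2_t2[OF x c y] by (rule L_fin) (use cl in \<open>auto intro!: P1.smult_closed\<close>)
      also have "\<dots> = (\<Sum>(b, b')\<in>arcs G \<times> arcs G. W c b b' * (T b (ae b' \<cdot> y) x + T b' y (x \<cdot> ae b)))"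
        by (rule sum.cong[OF refl]) (use cl in \<open>auto simp: L_sc L_add T_def add.commute\<close>)
      finally show ?thesis by (simp add: sum.cartesian_product)
    qed
    obtain \<tau> where \<tau>u: "\<And>g. g \<in> carrier A \<Longrightarrow> lfun (\<lambda>u. \<tau> u g)" and \<tau>g: "\<And>u. u \<in> carrier A \<Longrightarrow> lfun (\<tau> u)"
      and \<tau>: "\<And>a u g. a \<in> arcs G \<Longrightarrow> u \<in> carrier A \<Longrightarrow> g \<in> carrier A \<Longrightarrow>
        \<tau> (ae a \<cdot> u) g = T a u g + \<tau> u (g \<cdot> ae a)"
    proof (rule derivation_exists[of "T"], goal_cases)
      case (1 a g)
      show ?case by (rule Tl; fact 1)
    next
      case (2 a u)
      show ?case by (rule Tr; fact 2)
    next
      case (3 a u g)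
      show ?case by (rule Th(1); fact 3)
    next
      case (4 a u g)
      show ?case by (rule Th(2); fact 4)
    next
      case (5 c u g)
      show ?case by (rule cyc; fact 5)
    next
      case (6 \<tau>)
      show ?case by (rule that[OF 6(2-4)])
    qed
    \<comment> \<open>Cutting \<tau> with the vertices makes it balanced, so it defines a functional
      on A \<otimes> A.\<close>
    have bal: "TA.balanced (\<lambda>x y. \<Sum>v\<in>verts G. \<tau> (ve v \<cdot> y) (x \<cdot> ve v))"
      unfolding TA.balanced_def A_R_simps R_A_simps vr_simps
    proof (intro conjI ballI)
      fix x x' y assume *: "x \<in> carrier A" "x' \<in> carrier A" "y \<in> carrier A"
      then have "\<tau> (ve v \<cdot> y) ((x \<oplus>\<^bsub>A\<^esub> x') \<cdot> ve v) = \<tau> (ve v \<cdot> y) (x \<cdot> ve v) + \<tau> (ve v \<cdot> y) (x' \<cdot> ve v)"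
        if "v \<in> verts G" for v
        using that lfun_add[OF \<tau>g[of "ve v \<cdot> y"], of "x \<cdot> ve v" "x' \<cdot> ve v"] by (simp add: A.l_distr)
      then show "(\<Sum>v\<in>verts G. \<tau> (ve v \<cdot> y) ((x \<oplus>\<^bsub>A\<^esub> x') \<cdot> ve v))
        = (\<Sum>v\<in>verts G. \<tau> (ve v \<cdot> y) (x \<cdot> ve v)) + (\<Sum>v\<in>verts G. \<tau> (ve v \<cdot> y) (x' \<cdot> ve v))"
        by (simp add: sum.distrib)
    next
      fix x y y' assume *: "x \<in> carrier A" "y \<in> carrier A" "y' \<in> carrier A"
      then have "\<tau> (ve v \<cdot> (y \<oplus>\<^bsub>A\<^esub> y')) (x \<cdot> ve v) = \<tau> (ve v \<cdot> y) (x \<cdot> ve v) + \<tau> (ve v \<cdot> y') (x \<cdot> ve v)"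
        if "v \<in> verts G" for v
        using that lfun_add[OF \<tau>u[of "x \<cdot> ve v"], of "ve v \<cdot> y" "ve v \<cdot> y'"] by (simp add: A.r_distr)
      then show "(\<Sum>v\<in>verts G. \<tau> (ve v \<cdot> (y \<oplus>\<^bsub>A\<^esub> y')) (x \<cdot> ve v))
        = (\<Sum>v\<in>verts G. \<tau> (ve v \<cdot> y) (x \<cdot> ve v)) + (\<Sum>v\<in>verts G. \<tau> (ve v \<cdot> y') (x \<cdot> ve v))"
        by (simp add: sum.distrib)
    next
      fix x c y assume *: "x \<in> carrier A" "c \<in> path_part G 0" "y \<in> carrier A"
      have "\<tau> (ve v \<cdot> y) (x \<cdot> cls G W c \<cdot> ve v) = \<tau> (ve v \<cdot> (cls G W c \<cdot> y)) (x \<cdot> ve v)"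
        if v: "v \<in> verts G" for v
      proof -
        let ?c = "Poly_Mapping.lookup c (v, [])"
        have cc: "cls G W c \<in> carrier A" using * by (simp add: path_part_closed)
        have 1: "x \<cdot> cls G W c \<cdot> ve v = sc ?c \<cdot> (x \<cdot> ve v)"
          using * v cc by (simp add: A.m_assoc cls_ve sc_pull)
        have "ve v \<cdot> (cls G W c \<cdot> y) = (ve v \<cdot> cls G W c) \<cdot> y"
          using * v cc by (simp add: A.m_assoc)
        then have 2: "ve v \<cdot> (cls G W c \<cdot> y) = sc ?c \<cdot> (ve v \<cdot> y)"
          using * v by (simp add: cls_ve A.m_assoc)
        show ?thesis
          unfolding 1 2 using * v lfun_sc[OF \<tau>g[of "ve v \<cdot> y"], of "x \<cdot> ve v" ?c]
            lfun_sc[OF \<tau>u[of "x \<cdot> ve v"], of "ve v \<cdot> y" ?c] by simp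
      qed
      then show "(\<Sum>v\<in>verts G. \<tau> (ve v \<cdot> y) (x \<cdot> cls G W c \<cdot> ve v))
        = (\<Sum>v\<in>verts G. \<tau> (ve v \<cdot> (cls G W c \<cdot> y)) (x \<cdot> ve v))" by simp
    qed
    define Mp where "Mp = TA.lift (\<lambda>x y. \<Sum>v\<in>verts G. \<tau> (ve v \<cdot> y) (x \<cdot> ve v))"
    have Mp_tA: "Mp (tA x y) = (\<Sum>v\<in>verts G. \<tau> (ve v \<cdot> y) (x \<cdot> ve v))"
      if "x \<in> carrier A" "y \<in> carrier A" for x y
      unfolding Mp_def tAA_eq by (rule TA.lift_pt[OF bal]) (use that in \<open>simp_all add: A_R_simps R_A_simps\<close>)
    have Mp_add: "Mp (z \<oplus>\<^bsub>B0\<^esub> z') = Mp z + Mp z'" if "z \<in> carrier B0" "z' \<in> carrier B0" for z z'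
      using TA.lift_add[OF bal] that unfolding Mp_def AA_eq by blast
    have Mp_zero: "Mp \<zero>\<^bsub>B0\<^esub> = 0" using Mp_add[of "\<zero>\<^bsub>B0\<^esub>" "\<zero>\<^bsub>B0\<^esub>"] by simp
    have Mp_minus: "Mp (z \<ominus>\<^bsub>B0\<^esub> z') = Mp z - Mp z'" if "z \<in> carrier B0" "z' \<in> carrier B0" for z z'
    proof -
      have "(z \<ominus>\<^bsub>B0\<^esub> z') \<oplus>\<^bsub>B0\<^esub> z' = z" using that by (simp add: a_minus_def P0.P.a_assoc P0.P.l_neg)
      then have "Mp z = Mp (z \<ominus>\<^bsub>B0\<^esub> z') + Mp z'" using Mp_add[of "z \<ominus>\<^bsub>B0\<^esub> z'" z'] that by simp
      then show ?thesis by simp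
    qed
    \<comment> \<open>The Leibniz rule says that \<tau>(a y, x) - \<tau>(y, x a) is the value of the
      functional at x \<otimes> a \<otimes> y, while \<mu>1 takes the difference in the other order;
      hence the sign.\<close>
    have key: "L z = - Mp (M1.mu z)" if "z \<in> carrier B1" for z
      using that
    proof (rule P1.span)
      show "L \<zero>\<^bsub>B1\<^esub> = - Mp (M1.mu \<zero>\<^bsub>B1\<^esub>)" by (simp add: L_zero M1.mu_zero Mp_zero)
    next
      fix x a y assume x: "x \<in> carrier A" and a: "a \<in> arcs G" and y: "y \<in> carrier A"
      have "Mp (tA (x \<cdot> ae a) y) = (\<Sum>v\<in>verts G. if v = head G a then \<tau> (ve v \<cdot> y) (x \<cdot> ae a) else 0)"
        unfolding Mp_tA[OF A.m_closed[OF x ae_closed[OF a]] y]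
        by (rule sum.cong[OF refl]) (use x a y lfun_zero[OF \<tau>g] in \<open>simp add: A.m_assoc ae_ve\<close>)
      then have 1: "Mp (tA (x \<cdot> ae a) y) = \<tau> (ve (head G a) \<cdot> y) (x \<cdot> ae a)" using a by simp
      have "Mp (tA x (ae a \<cdot> y)) = (\<Sum>v\<in>verts G. if v = tail G a then \<tau> (ae a \<cdot> y) (x \<cdot> ve v) else 0)"
        unfolding Mp_tA[OF x A.m_closed[OF ae_closed[OF a] y]]
        by (rule sum.cong[OF refl])
          (use x a y lfun_zero[OF \<tau>u] in \<open>simp add: A.m_assoc[symmetric] ve_ae\<close>)
      then have "Mp (tA x (ae a \<cdot> y)) = \<tau> (ae a \<cdot> (ve (head G a) \<cdot> y)) (x \<cdot> ve (tail G a))"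
        using a y by (simp add: ae_head)
      also have "\<dots> = T a (ve (head G a) \<cdot> y) (x \<cdot> ve (tail G a)) + \<tau> (ve (head G a) \<cdot> y) (x \<cdot> ve (tail G a) \<cdot> ae a)"
        by (rule \<tau>) (use x a y in auto)
      also have "\<dots> = T a y x + \<tau> (ve (head G a) \<cdot> y) (x \<cdot> ae a)"
        using x a y by (simp add: Th ae_tail)
      finally show "L (t1 x a y) = - Mp (M1.mu (t1 x a y))"
        unfolding mu1_t1[OF x a y]
        using x a y by (simp add: Mp_minus tA_closed 1 T_def)
    next
      fix z z' assume "z \<in> carrier B1" "z' \<in> carrier B1" "L z = - Mp (M1.mu z)" "L z' = - Mp (M1.mu z')"
      then show "L (z \<oplus>\<^bsub>B1\<^esub> z') = - Mp (M1.mu (z \<oplus>\<^bsub>B1\<^esub> z'))"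
        by (simp add: L_add M1.mu_add Mp_add M1.mu_closed)
    qed
    have "L z = 0" using key[OF z(1)] z(2) Mp_zero by simp
    then show False using l(4) by (simp add: L_def)
  qed
qed

text \<open>Modulo the image of \<mu>1 the arcs of the right factor can be moved across one at a
  time, so x \<otimes> y is congruent to x y \<otimes> 1. Every \<open>z\<close> is thus congruent
  to \<mu>0(z) \<otimes> 1.\<close>

lemma exact0: "M1.mu ` carrier B1 = a_kernel B0 A mu0"
proof
  show "M1.mu ` carrier B1 \<subseteq> a_kernel B0 A mu0"
  proof
    fix w assume "w \<in> M1.mu ` carrier B1"
    then obtain z where z: "z \<in> carrier B1" "w = M1.mu z" by auto
    from z(1) have "mu0 (M1.mu z) = \<zero>\<^bsub>A\<^esub>"
    proof (rule P1.span)
      show "mu0 (M1.mu \<zero>\<^bsub>B1\<^esub>) = \<zero>\<^bsub>A\<^esub>" by (simp add: M1.mu_zero mu0_zero)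
    next
      fix x a y assume x: "x \<in> carrier A" and a: "a \<in> arcs G" and y: "y \<in> carrier A"
      let ?z = "tA (x \<cdot> ae a) y \<ominus>\<^bsub>B0\<^esub> tA x (ae a \<cdot> y)"
      have c: "tA (x \<cdot> ae a) y \<in> carrier B0" "tA x (ae a \<cdot> y) \<in> carrier B0"
        using x a y by (auto intro!: tA_closed)
      then have "?z \<oplus>\<^bsub>B0\<^esub> tA x (ae a \<cdot> y) = tA (x \<cdot> ae a) y"
        by (simp add: a_minus_def P0.P.a_assoc P0.P.l_neg)
      then have "mu0 ?z \<oplus>\<^bsub>A\<^esub> x \<cdot> (ae a \<cdot> y) = x \<cdot> ae a \<cdot> y"
        using mu0_add[of ?z "tA x (ae a \<cdot> y)"] c x a y by (simp add: mu0_tA)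
      then have "mu0 ?z \<oplus>\<^bsub>A\<^esub> x \<cdot> (ae a \<cdot> y) = \<zero>\<^bsub>A\<^esub> \<oplus>\<^bsub>A\<^esub> x \<cdot> (ae a \<cdot> y)"
        using x a y by (simp add: A.m_assoc)
      then show "mu0 (M1.mu (t1 x a y)) = \<zero>\<^bsub>A\<^esub>"
        unfolding mu1_t1[OF x a y] using x a y c f_mu0(1)[of ?z] by (simp add: A.add.right_cancel)
    next
      fix z z' assume "z \<in> carrier B1" "z' \<in> carrier B1" "mu0 (M1.mu z) = \<zero>\<^bsub>A\<^esub>" "mu0 (M1.mu z') = \<zero>\<^bsub>A\<^esub>"
      then show "mu0 (M1.mu (z \<oplus>\<^bsub>B1\<^esub> z')) = \<zero>\<^bsub>A\<^esub>"
        by (simp add: M1.mu_add mu0_add M1.mu_closed)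
    qed
    then show "w \<in> a_kernel B0 A mu0" using z M1.mu_closed by (simp add: a_kernel_def')
  qed
  have pureA: "\<exists>w\<in>carrier B1. tA x y = M1.mu w \<oplus>\<^bsub>B0\<^esub> tA (x \<cdot> y) \<one>\<^bsub>A\<^esub>"
    if "y \<in> carrier A" "x \<in> carrier A" for x y
    using that
  proof (induction y arbitrary: x rule: A_induct)
    case zero
    then show ?case by (intro bexI[of _ "\<zero>\<^bsub>B1\<^esub>"]) (simp_all add: tA_zero_l tA_zero_r M1.mu_zero)
  next
    case (vert v c)
    then show ?case
      using tA_bal[of x "\<one>\<^bsub>A\<^esub>" v c] tA_closed
      by (intro bexI[of _ "\<zero>\<^bsub>B1\<^esub>"]) (simp_all add: M1.mu_zero)
  next
    \<comment> \<open>Here x \<otimes> a y is x a \<otimes> y minus \<mu>1(x \<otimes> a \<otimes>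
      y); the sign is absorbed by replacing the left factor x by its negative.\<close>
    case (arc a y)
    then obtain w where w: "w \<in> carrier B1" "tA (x \<cdot> ae a) y = M1.mu w \<oplus>\<^bsub>B0\<^esub> tA (x \<cdot> ae a \<cdot> y) \<one>\<^bsub>A\<^esub>"
      by (meson A.m_closed ae_closed)
    let ?a = "tA (x \<cdot> ae a) y" and ?b = "tA x (ae a \<cdot> y)" and ?g = "t1 x a y"
    have c: "?a \<in> carrier B0" "?b \<in> carrier B0" "?g \<in> carrier B1" "tA (x \<cdot> (ae a \<cdot> y)) \<one>\<^bsub>A\<^esub> \<in> carrier B0"
      using arc by (auto intro!: tA_closed)
    have g: "t1 (\<ominus>\<^bsub>A\<^esub> x) a y \<in> carrier B1" using arc by simp
    have z: "M1.mu (t1 (\<ominus>\<^bsub>A\<^esub> x) a y) \<oplus>\<^bsub>B0\<^esub> M1.mu ?g = \<zero>\<^bsub>B0\<^esub>"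
    proof -
      have "M1.mu (t1 (\<ominus>\<^bsub>A\<^esub> x) a y) \<oplus>\<^bsub>B0\<^esub> M1.mu ?g = M1.mu (t1 (\<ominus>\<^bsub>A\<^esub> x) a y \<oplus>\<^bsub>B1\<^esub> ?g)"
        by (rule M1.mu_add[OF g c(3), symmetric])
      also have "t1 (\<ominus>\<^bsub>A\<^esub> x) a y \<oplus>\<^bsub>B1\<^esub> ?g = t1 (\<ominus>\<^bsub>A\<^esub> x \<oplus>\<^bsub>A\<^esub> x) a y"
        by (rule P1.gm_add_l[symmetric]) (use arc in auto)
      also have "\<dots> = \<zero>\<^bsub>B1\<^esub>" using arc by (simp add: A.l_neg P1.gm_zero_l)
      finally show ?thesis by (simp add: M1.mu_zero)
    qed
    have "M1.mu ?g \<oplus>\<^bsub>B0\<^esub> ?b = ?a"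
      using c mu1_t1[of x a y] arc by (simp add: a_minus_def P0.P.a_assoc P0.P.l_neg)
    then have "M1.mu (t1 (\<ominus>\<^bsub>A\<^esub> x) a y) \<oplus>\<^bsub>B0\<^esub> ?a = \<zero>\<^bsub>B0\<^esub> \<oplus>\<^bsub>B0\<^esub> ?b"
      using z c M1.mu_closed P0.P.a_assoc[of "M1.mu (t1 (\<ominus>\<^bsub>A\<^esub> x) a y)" "M1.mu ?g" ?b] by simp
    then have "?b = M1.mu (t1 (\<ominus>\<^bsub>A\<^esub> x) a y) \<oplus>\<^bsub>B0\<^esub> ?a" using c by simp
    also have "\<dots> = M1.mu (t1 (\<ominus>\<^bsub>A\<^esub> x) a y) \<oplus>\<^bsub>B0\<^esub> (M1.mu w \<oplus>\<^bsub>B0\<^esub> tA (x \<cdot> (ae a \<cdot> y)) \<one>\<^bsub>A\<^esub>)"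
      using w arc by (simp add: A.m_assoc)
    also have "\<dots> = M1.mu (t1 (\<ominus>\<^bsub>A\<^esub> x) a y \<oplus>\<^bsub>B1\<^esub> w) \<oplus>\<^bsub>B0\<^esub> tA (x \<cdot> (ae a \<cdot> y)) \<one>\<^bsub>A\<^esub>"
      using w g c M1.mu_closed by (simp add: M1.mu_add P0.P.a_assoc)
    finally show ?case using w g by (intro bexI[of _ "t1 (\<ominus>\<^bsub>A\<^esub> x) a y \<oplus>\<^bsub>B1\<^esub> w"]) simp_all
  next
    case (add y y')
    then obtain w w' where w: "w \<in> carrier B1" "tA x y = M1.mu w \<oplus>\<^bsub>B0\<^esub> tA (x \<cdot> y) \<one>\<^bsub>A\<^esub>"
      "w' \<in> carrier B1" "tA x y' = M1.mu w' \<oplus>\<^bsub>B0\<^esub> tA (x \<cdot> y') \<one>\<^bsub>A\<^esub>" by meson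
    have "tA x (y \<oplus>\<^bsub>A\<^esub> y') = (M1.mu w \<oplus>\<^bsub>B0\<^esub> tA (x \<cdot> y) \<one>\<^bsub>A\<^esub>) \<oplus>\<^bsub>B0\<^esub> (M1.mu w' \<oplus>\<^bsub>B0\<^esub> tA (x \<cdot> y') \<one>\<^bsub>A\<^esub>)"
      using add w by (simp add: tA_add_r)
    also have "\<dots> = (M1.mu w \<oplus>\<^bsub>B0\<^esub> M1.mu w') \<oplus>\<^bsub>B0\<^esub> (tA (x \<cdot> y) \<one>\<^bsub>A\<^esub> \<oplus>\<^bsub>B0\<^esub> tA (x \<cdot> y') \<one>\<^bsub>A\<^esub>)"
      using add tA_closed M1.mu_closed by (simp add: P0.P.a_ac)
    also have "\<dots> = M1.mu (w \<oplus>\<^bsub>B1\<^esub> w') \<oplus>\<^bsub>B0\<^esub> tA (x \<cdot> (y \<oplus>\<^bsub>A\<^esub> y')) \<one>\<^bsub>A\<^esub>"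
      using add w by (simp add: M1.mu_add A.r_distr tA_add_l)
    finally show ?case using w by (intro bexI[of _ "w \<oplus>\<^bsub>B1\<^esub> w'"]) simp_all
  qed
  have all: "\<exists>w\<in>carrier B1. z = M1.mu w \<oplus>\<^bsub>B0\<^esub> tA (mu0 z) \<one>\<^bsub>A\<^esub>" if "z \<in> carrier B0" for z
    using that
  proof (induction z rule: tA_induct)
    case zero
    show ?case by (intro bexI[of _ "\<zero>\<^bsub>B1\<^esub>"]) (simp_all add: M1.mu_zero mu0_zero tA_zero_l)
  next
    case (pure x y)
    then show ?case using pureA[of y x] by (simp add: mu0_tA)
  next
    case (add z z')
    then obtain w w' where w: "w \<in> carrier B1" "z = M1.mu w \<oplus>\<^bsub>B0\<^esub> tA (mu0 z) \<one>\<^bsub>A\<^esub>"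
      "w' \<in> carrier B1" "z' = M1.mu w' \<oplus>\<^bsub>B0\<^esub> tA (mu0 z') \<one>\<^bsub>A\<^esub>" by meson
    let ?t = "tA (mu0 z) \<one>\<^bsub>A\<^esub>" and ?t' = "tA (mu0 z') \<one>\<^bsub>A\<^esub>"
    have t: "?t \<in> carrier B0" "?t' \<in> carrier B0" using add f_mu0(1) by (auto intro!: tA_closed)
    have "z \<oplus>\<^bsub>B0\<^esub> z' = (M1.mu w \<oplus>\<^bsub>B0\<^esub> ?t) \<oplus>\<^bsub>B0\<^esub> (M1.mu w' \<oplus>\<^bsub>B0\<^esub> ?t')"
      using w(2,4) by (rule arg_cong2)
    also have "\<dots> = (M1.mu w \<oplus>\<^bsub>B0\<^esub> M1.mu w') \<oplus>\<^bsub>B0\<^esub> (?t \<oplus>\<^bsub>B0\<^esub> ?t')"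
      using t M1.mu_closed by (simp add: P0.P.a_ac)
    also have "\<dots> = M1.mu (w \<oplus>\<^bsub>B1\<^esub> w') \<oplus>\<^bsub>B0\<^esub> tA (mu0 (z \<oplus>\<^bsub>B0\<^esub> z')) \<one>\<^bsub>A\<^esub>"
      using add w(1,3) f_mu0(1) by (simp add: M1.mu_add mu0_add tA_add_l)
    finally show ?case using w(1,3) by (intro bexI[of _ "w \<oplus>\<^bsub>B1\<^esub> w'"]) simp_all
  qed
  show "a_kernel B0 A mu0 \<subseteq> M1.mu ` carrier B1"
  proof
    fix z assume "z \<in> a_kernel B0 A mu0"
    then have z: "z \<in> carrier B0" "mu0 z = \<zero>\<^bsub>A\<^esub>" by (auto simp: a_kernel_def')
    then obtain w where "w \<in> carrier B1" "z = M1.mu w \<oplus>\<^bsub>B0\<^esub> tA \<zero>\<^bsub>A\<^esub> \<one>\<^bsub>A\<^esub>" using all[of z] by auto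
    then show "z \<in> M1.mu ` carrier B1" using M1.mu_closed by (simp add: tA_zero_l)
  qed
qed

lemma mu0_surj: "mu0 ` carrier B0 = carrier A"
proof
  show "mu0 ` carrier B0 \<subseteq> carrier A" using f_mu0(1) by auto
  show "carrier A \<subseteq> mu0 ` carrier B0"
  proof
    fix x assume "x \<in> carrier A"
    then show "x \<in> mu0 ` carrier B0"
      by (intro image_eqI[of _ _ "tA x \<one>\<^bsub>A\<^esub>"]) (simp_all add: mu0_tA tA_closed)
  qed
qed

section \<open>The kernel of \<mu>3 as a bimodule\<close>

lemma mu4_zero: "mu4 \<zero>\<^bsub>A\<^esub> = \<zero>\<^bsub>B0\<^esub>"
  using mu4_add[of "\<zero>\<^bsub>A\<^esub>" "\<zero>\<^bsub>A\<^esub>"] by (intro P0.P_zero_eqI mu4_closed) auto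

abbreviation K where "K \<equiv> B0\<lparr>carrier := a_kernel B0 B2 M3.mu\<rparr>"

lemma carrier_K: "carrier K = mu4 ` carrier A"
  by (simp add: exact3)

lemma K_simps: "add K = add B0" "zero K = zero B0" "smult K = smult B0" "rsmult K = rsmult B0"
  by simp_all

lemma K_closed: "z \<in> carrier K \<Longrightarrow> z \<in> carrier B0"
  unfolding carrier_K by (auto intro: mu4_closed)

text \<open>By \<open>exact3\<close> the carrier is the image of \<mu>4, so closure under the
  operations follows from the additivity and the two module laws of \<mu>4. The axioms are inherited
  from the ambient bimodule.\<close>

lemma bimodule_K: "bimodule A A K"
proof -
  note b = P0.bim
  note bs = bimodule.smult_l_distr[OF b] bimodule.smult_r_distr[OF b] bimodule.smult_assoc[OF b]
    bimodule.smult_one[OF b] bimodule.rsmult_r_distr[OF b] bimodule.rsmult_l_distr[OF b]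
    bimodule.rsmult_assoc[OF b] bimodule.rsmult_one[OF b] bimodule.smult_rsmult[OF b]
  have ab: "abelian_group K"
  proof (rule abelian_groupI, unfold K_simps)
    fix x y assume "x \<in> carrier K" "y \<in> carrier K"
    then obtain x' y' where "x' \<in> carrier A" "x = mu4 x'" "y' \<in> carrier A" "y = mu4 y'"
      unfolding carrier_K by blast
    then show "x \<oplus>\<^bsub>B0\<^esub> y \<in> carrier K"
      unfolding carrier_K by (intro image_eqI[of _ _ "x' \<oplus>\<^bsub>A\<^esub> y'"]) (simp_all add: mu4_add)
  next
    show "\<zero>\<^bsub>B0\<^esub> \<in> carrier K"
      unfolding carrier_K by (rule image_eqI[of _ _ "\<zero>\<^bsub>A\<^esub>"]) (simp_all add: mu4_zero)
  next
    fix x assume "x \<in> carrier K"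
    then obtain x' where x': "x' \<in> carrier A" "x = mu4 x'" unfolding carrier_K by blast
    have "mu4 (\<ominus>\<^bsub>A\<^esub> x') \<oplus>\<^bsub>B0\<^esub> x = \<zero>\<^bsub>B0\<^esub>"
      using x' mu4_add[of "\<ominus>\<^bsub>A\<^esub> x'" x'] by (simp add: A.l_neg mu4_zero)
    then show "\<exists>y\<in>carrier K. y \<oplus>\<^bsub>B0\<^esub> x = \<zero>\<^bsub>B0\<^esub>"
      unfolding carrier_K using x' by (intro bexI[of _ "mu4 (\<ominus>\<^bsub>A\<^esub> x')"] imageI) simp_all
  qed (rule P0.P.a_assoc P0.P.a_comm P0.P.l_zero; erule K_closed)+
  show ?thesis
  proof (intro bimodule.intro A_ring ab bimodule_axioms.intro; unfold K_simps)
    fix a z assume "a \<in> carrier A" "z \<in> carrier K"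
    then obtain x where "a \<in> carrier A" "x \<in> carrier A" "z = mu4 x"
      unfolding carrier_K by blast
    then show "a \<odot>\<^bsub>B0\<^esub> z \<in> carrier K"
      unfolding carrier_K by (intro image_eqI[of _ _ "a \<cdot> x"]) (simp_all add: mu4_l)
  next
    fix z a assume "z \<in> carrier K" "a \<in> carrier A"
    then obtain x where "a \<in> carrier A" "x \<in> carrier A" "z = mu4 x"
      unfolding carrier_K by blast
    then show "z \<odot>r\<^bsub>B0\<^esub> a \<in> carrier K"
      unfolding carrier_K by (intro image_eqI[of _ _ "x \<cdot> sg a"]) (simp_all add: mu4_r)
  qed (rule bs; (assumption | erule K_closed))+
qed

text \<open>The inverse of \<mu>4 on its image; \<open>mu4_r\<close> is what makes it respect the
  twisted right action.\<close>

lemma kernel_iso: "bimod_iso A A K (A_twisted G W sg)"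
proof -
  define g where "g = inv_into (carrier A) mu4"
  have g: "g (mu4 x) = x" if "x \<in> carrier A" for x
    unfolding g_def by (rule inv_into_f_f[OF mu4_inj that])
  have "g \<in> bimod_hom A A K (A_twisted G W sg)"
    unfolding bimod_hom_def
  proof (intro CollectI conjI ballI funcsetI bimodule_K tw_bim; unfold carrier_K tw_simps K_simps)
    fix z assume "z \<in> mu4 ` carrier A"
    then show "g z \<in> carrier A" using g by auto
  next
    fix z z' assume "z \<in> mu4 ` carrier A" "z' \<in> mu4 ` carrier A"
    then obtain x x' where x: "x \<in> carrier A" "z = mu4 x" "x' \<in> carrier A" "z' = mu4 x'" by blast
    then show "g (z \<oplus>\<^bsub>B0\<^esub> z') = g z \<oplus>\<^bsub>A\<^esub> g z'"
      using g[of "x \<oplus>\<^bsub>A\<^esub> x'"] by (simp add: mu4_add g)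
  next
    fix a z assume a: "a \<in> carrier A" and "z \<in> mu4 ` carrier A"
    then obtain x where x: "x \<in> carrier A" "z = mu4 x" by blast
    then show "g (a \<odot>\<^bsub>B0\<^esub> z) = a \<cdot> g z"
      using a g[of "a \<cdot> x"] by (simp add: mu4_l g)
  next
    fix z a assume "z \<in> mu4 ` carrier A" and a: "a \<in> carrier A"
    then obtain x where x: "x \<in> carrier A" "z = mu4 x" by blast
    then show "g (z \<odot>r\<^bsub>B0\<^esub> a) = g z \<cdot> sg a"
      using a g[of "x \<cdot> sg a"] by (simp add: mu4_r g)
  qed
  moreover have "bij_betw g (carrier K) (carrier (A_twisted G W sg))"
    unfolding carrier_K tw_simps g_def
    by (rule bij_betw_inv_into) (simp add: bij_betw_def mu4_inj)
  ultimately show ?thesis unfolding bimod_iso_def by blast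
qed

lemma resolution:
  "\<exists>\<mu>0 \<mu>1 \<mu>2 \<mu>3 \<mu>4.
    mu0_spec G W \<mu>0 \<and> mu1_spec G W \<mu>1 \<and> mu2_spec G W \<mu>2 \<and> mu3_spec G W \<mu>3 \<and>
    mu4_spec G W h (inv_into (carrier A) bt) B d \<mu>4 \<and>
    bimod_iso A A
      (AA G W\<lparr>carrier := a_kernel (AA G W) (AEA G W (reverse_graph G)) \<mu>3\<rparr>)
      (A_twisted G W (inv_into (carrier A) bt)) \<and>
    inj_on \<mu>4 (carrier A) \<and>
    \<mu>4 ` carrier A = a_kernel (AA G W) (AEA G W (reverse_graph G)) \<mu>3 \<and>
    \<mu>3 ` carrier (AA G W) = a_kernel (AEA G W (reverse_graph G)) (AEA G W G) \<mu>2 \<and>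
    \<mu>2 ` carrier (AEA G W (reverse_graph G)) = a_kernel (AEA G W G) (AA G W) \<mu>1 \<and>
    \<mu>1 ` carrier (AEA G W G) = a_kernel (AA G W) A \<mu>0 \<and>
    \<mu>0 ` carrier (AA G W) = carrier A"
  by (intro exI[of _ mu0] exI[of _ M1.mu] exI[of _ M2.mu] exI[of _ M3.mu] exI[of _ mu4] conjI
      mu0_ok mu1_ok mu2_ok mu3_ok mu4_ok mu4_inj kernel_iso exact3 exact2 exact1 exact0 mu0_surj)

end

section \<open>The graphs\<close>

lemma fin_digraph_digraph_of_mult:
  assumes "finite V"
  shows "fin_digraph (digraph_of_mult V m)"
proof
  have "arcs (digraph_of_mult V m) \<subseteq> (SIGMA u:V. SIGMA v:V. {..<m u v})"
    by (auto simp: digraph_of_mult_def)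
  then show "finite (arcs (digraph_of_mult V m))"
    by (rule finite_subset) (intro finite_SigmaI finite_lessThan assms)
qed (use assms in \<open>auto simp: digraph_of_mult_def\<close>)

text \<open>A vertex permutation that preserves multiplicities lifts to the arcs by keeping the
  index among parallel arcs.\<close>

lemma bij_betw_arcs_digraph_of_mult:
  assumes b: "bij_betw \<nu> V V" and m: "\<And>u v. u \<in> V \<Longrightarrow> v \<in> V \<Longrightarrow> m (\<nu> u) (\<nu> v) = m u v"
  shows "bij_betw (\<lambda>(u, v, k). (\<nu> u, \<nu> v, k)) (arcs (digraph_of_mult V m)) (arcs (digraph_of_mult V m))"
proof (rule bij_betwI')
  fix x y assume "x \<in> arcs (digraph_of_mult V m)" "y \<in> arcs (digraph_of_mult V m)"
  then show "((case x of (u, v, k) \<Rightarrow> (\<nu> u, \<nu> v, k)) = (case y of (u, v, k) \<Rightarrow> (\<nu> u, \<nu> v, k))) = (x = y)"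
    using b by (auto simp: digraph_of_mult_def bij_betw_def inj_on_def)
next
  fix x assume "x \<in> arcs (digraph_of_mult V m)"
  then show "(case x of (u, v, k) \<Rightarrow> (\<nu> u, \<nu> v, k)) \<in> arcs (digraph_of_mult V m)"
    using b m by (auto simp: digraph_of_mult_def bij_betw_def)
next
  fix y assume "y \<in> arcs (digraph_of_mult V m)"
  then obtain u v k where y: "y = (u, v, k)" "u \<in> V" "v \<in> V" "k < m u v"
    by (auto simp: digraph_of_mult_def)
  have "u \<in> \<nu> ` V" using b y(2) by (simp add: bij_betw_def)
  then obtain u' where u: "u' \<in> V" "\<nu> u' = u" by blast
  have "v \<in> \<nu> ` V" using b y(3) by (simp add: bij_betw_def)
  then obtain v' where v: "v' \<in> V" "\<nu> v' = v" by blast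
  have "(u', v', k) \<in> arcs (digraph_of_mult V m)" using y u v m[of u' v'] by (simp add: digraph_of_mult_def)
  then show "\<exists>x\<in>arcs (digraph_of_mult V m). y = (case x of (u, v, k) \<Rightarrow> (\<nu> u, \<nu> v, k))"
    using y u v by (intro bexI[of _ "(u', v', k)"]) simp_all
qed

lemma bij_betw_endo: "finite V \<Longrightarrow> inj_on \<nu> V \<Longrightarrow> \<nu> ` V \<subseteq> V \<Longrightarrow> bij_betw \<nu> V V"
  by (simp add: bij_betw_def endo_inj_surj)

lemma finite_wts: "finite (wts n)"
  by (rule finite_subset[of _ "{..n} \<times> {..n}"]) (auto simp: wts_def)

definition mult_automorphism where
  "mult_automorphism V m \<nu> \<longleftrightarrow> finite V \<and> bij_betw \<nu> V V \<and> (\<forall>u\<in>V. \<forall>v\<in>V. m (\<nu> u) (\<nu> v) = m u v)"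

lemma mult_automorphism_id: "finite V \<Longrightarrow> (\<And>v. \<nu> v = v) \<Longrightarrow> mult_automorphism V m \<nu>"
  by (simp add: mult_automorphism_def bij_betw_def inj_on_def)

lemma A_graph_automorphism:
  fixes n :: nat
  defines "V \<equiv> {Wt p l | p l. (p, l) \<in> wts n}"
    and "m \<equiv> \<lambda>u v. (case (u, v) of (Wt p l, Wt p' l') \<Rightarrow> of_bool (wt_arc (p, l) (p', l')) | _ \<Rightarrow> 0) :: nat"
  shows "mult_automorphism V m (nu_vert (A_ade n))"
proof -
  have V: "V = (\<lambda>(p, l). Wt p l) ` wts n" by (auto simp: V_def)
  then have fin: "finite V" by (simp add: finite_wts)
  have "inj_on (nu_vert (A_ade n)) V"
    by (auto simp: V inj_on_def rot_def wts_def)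
  moreover have "nu_vert (A_ade n) ` V \<subseteq> V"
    by (auto simp: V_def rot_def wts_def)
  ultimately have "bij_betw (nu_vert (A_ade n)) V V" by (rule bij_betw_endo[OF fin])
  moreover have "m (nu_vert (A_ade n) u) (nu_vert (A_ade n) v) = m u v" if "u \<in> V" "v \<in> V" for u v
  proof -
    obtain p l p' l' where *: "u = Wt p l" "v = Wt p' l'" "p + l \<le> n - 3" "p' + l' \<le> n - 3"
      using \<open>u \<in> V\<close> \<open>v \<in> V\<close> by (auto simp: V_def wts_def)
    \<comment> \<open>The third coordinate of a weight. In the triples (p, l, q) the map
      \<open>rot\<close> is the cyclic shift, and each kind of arc moves one unit from one
      coordinate to the cyclically next one.\<close>
    obtain q q' where q: "n - 3 = p + l + q" "n - 3 = p' + l' + q'"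
      using *(3,4) by (meson le_Suc_ex)
    then have "rot n (p, l) = (q, p)" "rot n (p', l') = (q', p')"
      unfolding rot_def Let_def prod.case by simp_all
    moreover from q have "p + l + q = p' + l' + q'" by simp
    then have "wt_arc (q, p) (q', p') \<longleftrightarrow> wt_arc (p, l) (p', l')"
      unfolding wt_arc_def Let_def prod.case by auto
    ultimately show ?thesis using *(1,2) by (simp add: m_def)
  qed
  ultimately show ?thesis using fin by (simp add: mult_automorphism_def)
qed

text \<open>Adding a constant to all colours commutes with the step from c to c + 1 along an arc.
  Injectivity modulo 3 is checked on the three residues.\<close>

lemma colour_graph_automorphism:
  fixes m :: "nat \<Rightarrow> nat \<Rightarrow> nat"
  assumes "finite V" and \<nu>: "\<And>x c. \<nu> (Col x c) = Col x ((c + k) mod 3)"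
  shows "mult_automorphism {Col x c | x c. x \<in> V \<and> c < 3}
    (\<lambda>u v. case (u, v) of (Col x c, Col y d) \<Rightarrow> (if d = (c + 1) mod 3 then m x y else 0) | _ \<Rightarrow> 0) \<nu>"
proof -
  let ?V = "{Col x c | x c. x \<in> V \<and> c < 3}"
  have "?V = (\<lambda>(x, c). Col x c) ` (V \<times> {..<3})" by auto
  then have fin: "finite ?V" using assms(1) by simp
  have inj: "c = d" if "(c + k) mod 3 = (d + k) mod 3" "c < 3" "d < 3" for c d :: nat
  proof -
    have "(c + k mod 3) mod 3 = (d + k mod 3) mod 3" using that(1) by (simp add: mod_simps)
    moreover have "k mod 3 = 0 \<or> k mod 3 = 1 \<or> k mod 3 = 2" by linarith
    moreover have "c = 0 \<or> c = 1 \<or> c = 2" "d = 0 \<or> d = 1 \<or> d = 2" using that by auto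
    ultimately show ?thesis by (elim disjE) simp_all
  qed
  have "inj_on \<nu> ?V"
  proof (rule inj_onI)
    fix u v assume "u \<in> ?V" "v \<in> ?V" and eq: "\<nu> u = \<nu> v"
    then obtain x c y d where u: "u = Col x c" "c < 3" and v: "v = Col y d" "d < 3" by blast
    have "x = y" "(c + k) mod 3 = (d + k) mod 3" using eq unfolding u(1) v(1) \<nu> by simp_all
    then show "u = v" using inj[of c d] u v by simp
  qed
  moreover have "\<nu> ` ?V \<subseteq> ?V" by (auto simp: \<nu>)
  ultimately have "bij_betw \<nu> ?V ?V" by (intro bij_betw_endo[OF fin])
  moreover have "(d + k) mod 3 = ((c + k) mod 3 + 1) mod 3 \<longleftrightarrow> d = (c + 1) mod 3"
    if "c < 3" "d < 3" for c d :: nat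
  proof -
    have "((c + k) mod 3 + 1) mod 3 = ((c + 1) mod 3 + k) mod 3" by (simp add: mod_simps ac_simps)
    then show ?thesis using inj[of d "(c + 1) mod 3"] that by auto
  qed
  ultimately show ?thesis
    unfolding mult_automorphism_def using fin by (auto simp only: mem_Collect_eq \<nu> vertex.case prod.case)
qed

lemma ade_graph_automorphism:
  obtains V m where "ade_graph g = digraph_of_mult V m" "mult_automorphism V m (nu_vert g)"
proof (cases g)
  case (A_ade n)
  show ?thesis by (rule that[OF _ A_graph_automorphism[of n, folded A_ade]]) (simp add: A_ade A_graph_def)
next
  case (D_ade n)
  have "finite {Orb (rot_orbit n x) | x. x \<in> wts n \<and> card (rot_orbit n x) = 3}"
    by (rule finite_subset[of _ "(\<lambda>x. Orb (rot_orbit n x)) ` wts n"]) (auto simp: finite_wts)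
  then show ?thesis
    by (intro that[of "{Orb (rot_orbit n x) | x. x \<in> wts n \<and> card (rot_orbit n x) = 3}
       \<union> (if 3 dvd n then {Fxd 1, Fxd 2, Fxd 3} else {})"] mult_automorphism_id)
      (simp_all add: D_ade D_graph_def)
next
  case (Astar_ade n)
  show ?thesis
    by (rule that[OF _ mult_automorphism_id], simp only: Astar_ade Astar_graph_def ade_graph.simps) (simp_all add: Astar_ade Astar_graph_def)
next
  case (Dstar_ade n)
  show ?thesis
    by (rule that[OF _ colour_graph_automorphism[where k = n]], simp only: Dstar_ade Dstar_graph_def colour_graph_def ade_graph.simps) (simp_all add: Dstar_ade Dstar_graph_def colour_graph_def)
next
  case E8star_ade
  show ?thesis
    by (rule that[OF _ mult_automorphism_id], simp only: E8star_ade E8star_graph_def num_graph_def ade_graph.simps) (simp_all add: E8star_ade E8star_graph_def num_graph_def)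
next
  case E8_ade
  show ?thesis
    by (rule that[OF _ colour_graph_automorphism[where k = 2]], simp only: E8_ade E8_graph_def colour_graph_def ade_graph.simps) (simp_all add: E8_ade E8_graph_def colour_graph_def)
next
  case E12_1_ade
  have "finite {Sub x s | x s. x \<in> {Li, Lj, Lk} \<and> s \<in> {1..3}}"
    by (rule finite_subset[of _ "(\<lambda>(x, s). Sub x s) ` ({Li, Lj, Lk} \<times> {1..3})"]) auto
  then show ?thesis
    by (intro that[of "{Sub x s | x s. x \<in> {Li, Lj, Lk} \<and> s \<in> {1..3}} \<union> {Ltr Lp, Ltr Lq, Ltr Lr}"]
          mult_automorphism_id)
      (simp_all only: E12_1_ade E12_1_graph_def ade_graph.simps nu_vert.simps finite_Un finite.intros)
next
  case E12_2_ade
  have "finite {Sub x s | x s. x \<in> {Lp, Lq, Lr} \<and> s \<in> {1..3}}"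
    by (rule finite_subset[of _ "(\<lambda>(x, s). Sub x s) ` ({Lp, Lq, Lr} \<times> {1..3})"]) auto
  then show ?thesis
    by (intro that[of "{Ltr Li, Ltr Lj, Ltr Lk} \<union> {Sub x s | x s. x \<in> {Lp, Lq, Lr} \<and> s \<in> {1..3}}"]
          mult_automorphism_id)
      (simp_all only: E12_2_ade E12_2_graph_def ade_graph.simps nu_vert.simps finite_Un finite.intros)
next
  case E12_5_ade
  show ?thesis
    by (rule that[OF _ mult_automorphism_id], simp only: E12_5_ade E12_5_graph_def num_graph_def ade_graph.simps) (simp_all add: E12_5_ade E12_5_graph_def num_graph_def)
next
  case E24_ade
  show ?thesis
    by (rule that[OF _ mult_automorphism_id], simp only: E24_ade E24_graph_def num_graph_def ade_graph.simps) (simp_all add: E24_ade E24_graph_def num_graph_def)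
qed

lemma coxeter_ge_4: "su3_ade g \<Longrightarrow> 4 \<le> coxeter g"
  by (cases g) auto

theorem theorem5p1:
  fixes g :: ade and G :: "(vertex, arc) pre_digraph" and h :: nat
    and \<nu>0 :: "vertex \<Rightarrow> vertex" and \<nu>1 :: "arc \<Rightarrow> arc"
    and \<phi> :: "vertex \<Rightarrow> real" and W :: "arc \<Rightarrow> arc \<Rightarrow> arc \<Rightarrow> complex"
    and A :: "(vertex, arc) algelt ring"
    and \<beta> :: "(vertex, arc) algelt \<Rightarrow> (vertex, arc) algelt"
    and f :: "(vertex, arc) algelt \<Rightarrow> complex"
    and B :: "(vertex, arc) algelt set"
    and d :: "(vertex, arc) algelt \<Rightarrow> (vertex, arc) algelt"
  assumes "su3_ade g"
    and "G = ade_graph g" and "h = coxeter g" and "\<nu>0 = nu_vert g" and "\<nu>1 = nu_arc g"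
    and "perron_frobenius G h \<phi>"
    and "cell_system G h \<phi> W"
    and "cell_invariant G \<nu>1 W"
    and "A = cell_algebra G W"
    and "\<beta> = beta G W \<nu>0 \<nu>1"
    and "frobenius_form G W h \<nu>0 \<nu>1 f"
    and "homogeneous_basis G W B"
    and "dual_basis G W f B d"
  shows "\<exists>\<mu>0 \<mu>1 \<mu>2 \<mu>3 \<mu>4.
    mu0_spec G W \<mu>0 \<and> mu1_spec G W \<mu>1 \<and> mu2_spec G W \<mu>2 \<and> mu3_spec G W \<mu>3 \<and>
    mu4_spec G W h (inv_into (carrier A) \<beta>) B d \<mu>4 \<and>
    bimod_iso A A
      (AA G W\<lparr>carrier := a_kernel (AA G W) (AEA G W (reverse_graph G)) \<mu>3\<rparr>)
      (A_twisted G W (inv_into (carrier A) \<beta>)) \<and>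
    inj_on \<mu>4 (carrier A) \<and>
    \<mu>4 ` carrier A = a_kernel (AA G W) (AEA G W (reverse_graph G)) \<mu>3 \<and>
    \<mu>3 ` carrier (AA G W) = a_kernel (AEA G W (reverse_graph G)) (AEA G W G) \<mu>2 \<and>
    \<mu>2 ` carrier (AEA G W (reverse_graph G)) = a_kernel (AEA G W G) (AA G W) \<mu>1 \<and>
    \<mu>1 ` carrier (AEA G W G) = a_kernel (AA G W) A \<mu>0 \<and>
    \<mu>0 ` carrier (AA G W) = carrier A"
proof -
  obtain V m where g: "ade_graph g = digraph_of_mult V m" and aut: "mult_automorphism V m (nu_vert g)"
    by (rule ade_graph_automorphism)
  have G: "verts G = V" "tail G = fst" "head G = fst \<circ> snd"
    unfolding \<open>G = ade_graph g\<close> g by (simp_all add: digraph_of_mult_def)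
  have fin: "fin_digraph G"
    unfolding \<open>G = ade_graph g\<close> g
    by (rule fin_digraph_digraph_of_mult) (use aut in \<open>simp add: mult_automorphism_def\<close>)
  have \<nu>1: "\<nu>1 = (\<lambda>(u, v, k). (\<nu>0 u, \<nu>0 v, k))"
    unfolding \<open>\<nu>0 = nu_vert g\<close> \<open>\<nu>1 = nu_arc g\<close> by (auto simp: fun_eq_iff)
  have bij: "bij_betw \<nu>1 (arcs G) (arcs G)"
    unfolding \<nu>1 unfolding \<open>G = ade_graph g\<close> g \<open>\<nu>0 = nu_vert g\<close>
    by (rule bij_betw_arcs_digraph_of_mult) (use aut in \<open>simp_all add: mult_automorphism_def\<close>)
  have cells: "cells G h \<phi> W"
    by (intro cells.intro cells_axioms.intro fin)
      (use assms(3,6,7) coxeter_ge_4[OF assms(1)] in simp_all)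
  have "cell_nu G W \<nu>0 \<nu>1"
  proof (intro cell_nu.intro cell_alg.intro fin cell_alg_axioms.intro cell_nu_axioms.intro bij)
    show "triangle G a b c" if "W a b c \<noteq> 0" for a b c using cells.W_tri[OF cells that] .
    show "bij_betw \<nu>0 (verts G) (verts G)"
      using aut unfolding G(1) \<open>\<nu>0 = nu_vert g\<close> by (simp add: mult_automorphism_def)
    show "tail G (\<nu>1 a) = \<nu>0 (tail G a)" "head G (\<nu>1 a) = \<nu>0 (head G a)" for a
      by (cases a; simp add: G \<nu>1)+
    show "W a b c = W (\<nu>1 a) (\<nu>1 b) (\<nu>1 c)" if "triangle G a b c" for a b c
      using \<open>cell_invariant G \<nu>1 W\<close> that unfolding cell_invariant_def by blast
  qed
  then have "frob G h \<phi> W \<nu>0 \<nu>1 f B d"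
    by (intro frob.intro frob_axioms.intro cells assms(11-13))
  then show ?thesis
    unfolding \<open>A = cell_algebra G W\<close> \<open>\<beta> = beta G W \<nu>0 \<nu>1\<close> by (rule frob.resolution)
qed

end
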